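(* Let $\Omega\subset\mathbb R^n$, $n\ge3$, be any open set with $\mathcal L^n(\Omega)<\infty$ and $\mathcal H^{n-1}(\partial\Omega)<\infty$. Let $\mu$ be a Borel measure on $\Omega$ with $\mu(\Omega)<\infty$ such that $\mu(B_r(x)\cap\Omega)\le C_\mu r^\alpha$ for all $x\in\Omega$, $r>0$, for some $\alpha\in(n-1,n]$, $C_\mu>0$. (i) Let $1<p<\frac n2$, $1<s<n-1$, $r>1$, and $q=\min\{\frac{p\alpha}{n-2p},\frac{s\alpha}{n-1-s},\frac{r\alpha}{n-1}\}$. Then there exists $C=C(n,p,r,s,\alpha,C_\mu)$ such that $$\|u\|_{L^q(\Omega,\mu)}\le C\Big(\max\{\mu(\Omega)^{\frac n\alpha},\mathcal L^n(\Omega)\}^{\frac\alpha{qn}-\frac{n-2p}{pn}}\|\nabla^2u\|_{L^p(\Omega)}+\max\{\mu(\Omega)^{\frac{n-1}\alpha},\mathcal H^{n-1}(\partial\Omega)\}^{\frac\alpha{q(n-1)}-\frac{n-1-s}{s(n-1)}}\|u\|_{\mathcal V^1L^s(\partial\Omega)}$$ $$+\max\{\mu(\Omega)^{\frac{n-1}\alpha},\mathcal H^{n-1}(\partial\Omega)\}^{\frac\alpha{q(n-1)}-\frac1r}\|u\|_{L^r(\partial\Omega)}\Big)$$ for every $u\in V^2L^p(\Omega)\cap\mathcal V^1L^s(\partial\Omega)\cap C_b(\overline\Omega)$. (ii) Let $\beta>0$, $s>n-1$, and $\gamma=\min\{\frac n{n-2},\beta\}$. Then there exists $C=C(n,\beta,\alpha,C_\mu,\mathcal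 L^n(\Omega),\mathcal H^{n-1}(\partial\Omega),\mu(\Omega))$ such that $$\|u\|_{\exp L^\gamma(\Omega,\mu)}\le C\big(\|\nabla^2u\|_{L^{\frac n2}(\Omega)}+\|u\|_{\mathcal V^1L^s(\partial\Omega)}+\|u\|_{\exp L^\beta(\partial\Omega)}\big)$$ for every $u\in V^2L^{\frac n2}(\Omega)\cap\mathcal V^1L^s(\partial\Omega)\cap C_b(\overline\Omega)$. (iii) Let $p>\frac n2$ and $s>n-1$. Then there exists $C=C(n,p,s)$ such that $$\|u\|_{L^\infty(\Omega)}\le C\big(\mathcal L^n(\Omega)^{\frac2n-\frac1p}\|\nabla^2u\|_{L^p(\Omega)}+\mathcal H^{n-1}(\partial\Omega)^{\frac1{n-1}-\frac1s}\|u\|_{\mathcal V^1L^s(\partial\Omega)}+\|u\|_{L^\infty(\partial\Omega)}\big)$$ for every $u\in V^2L^p(\Omega)\cap\mathcal V^1L^s(\partial\Omega)\cap C_b(\overline\Omega)$.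
   Context: $\mathcal L^n$ is Lebesgue measure, $\mathcal H^{n-1}$ the $(n-1)$-dimensional Hausdorff measure on $\partial\Omega$; spaces without indicated measure use these. $C_b(\overline\Omega)$: continuous functions on $\overline\Omega$ with bounded support; boundary quantities of $u$ refer to its restriction $u_{\partial\Omega}$ to $\partial\Omega$. $V^2X(\Omega)$: twice weakly differentiable $u$ on $\Omega$ with $|\nabla^2u|\in X(\Omega)$, $\nabla^2u$ the matrix of second derivatives. A Borel function $g:\partial\Omega\to\mathbb R$ is a Hajłasz upper gradient of $\varphi:\partial\Omega\to\mathbb R$ if $|\varphi(x)-\varphi(y)|\le|x-y|(g(x)+g(y))$ for $\mathcal H^{n-1}$-a.e. $x,y\in\partial\Omega$. For a rearrangement-invariant space $X(\partial\Omega)$, $\mathcal V^1X(\partial\Omega)$ is the set of $\varphi$ admitting an upper gradient in $X(\partial\Omega)$, with seminorm $\|\varphi\|_{\mathcal V^1X(\partial\Omega)}=\inf\|g\|_{X(\partial\Omega)}$ over all such upper gradients; $u\in\mathcal V^1X(\partial\Omega)$ means $u_{\partial\Omega}$ belongs to it. For a finite measure space $(\mathcal R,m)$ and $\gamma>0$, $\exp L^\gamma(\mathcal R,m)$ is the Orlicz space with Luxemburg norm $\inf\{\lambda>0:\int_{\mathcal R}A(|\phi|/\lambda)dm\le1\}$, $A$ a Young function equivalent to $e^{t^\gamma}-1$ near infinity. *)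

theory Defs
  imports "HOL-Analysis.Analysis"
begin

definition dpartial :: "'a::euclidean_space \<Rightarrow> ('a \<Rightarrow> real) \<Rightarrow> 'a \<Rightarrow> real" where
  "dpartial i f x = (THE d. ((\<lambda>t. f (x + t *\<^sub>R i)) has_real_derivative d) (at 0))"

fun iter_partial :: "'a::euclidean_space list \<Rightarrow> ('a \<Rightarrow> real) \<Rightarrow> 'a \<Rightarrow> real" where
  "iter_partial [] f = f"
| "iter_partial (i # is) f = dpartial i (iter_partial is f)"

definition C_inf :: "('a::euclidean_space \<Rightarrow> real) \<Rightarrow> bool" where
  "C_inf f \<longleftrightarrow> (\<forall>is. set is \<subseteq> Basis \<longrightarrow>
      continuous_on UNIV (iter_partial is f) \<and>
      (\<forall>i\<in>Basis. \<forall>x. (\<lambda>t. iter_partial is f (x + t *\<^sub>R i)) differentiable (at (0::real))))"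

definition test_fun :: "'a::euclidean_space set \<Rightarrow> ('a \<Rightarrow> real) \<Rightarrow> bool" where
  "test_fun \<Omega> \<phi> \<longleftrightarrow> C_inf \<phi> \<and> compact (closure {x. \<phi> x \<noteq> 0}) \<and> closure {x. \<phi> x \<noteq> 0} \<subseteq> \<Omega>"

definition loc_int :: "'a::euclidean_space set \<Rightarrow> ('a \<Rightarrow> real) \<Rightarrow> bool" where
  "loc_int \<Omega> f \<longleftrightarrow> (\<forall>K. compact K \<and> K \<subseteq> \<Omega> \<longrightarrow> f absolutely_integrable_on K)"

definition weak_deriv :: "'a::euclidean_space set \<Rightarrow> ('a \<Rightarrow> real) \<Rightarrow> 'a \<Rightarrow> ('a \<Rightarrow> real) \<Rightarrow> bool" where
  "weak_deriv \<Omega> u i g \<longleftrightarrow> loc_int \<Omega> u \<and> loc_int \<Omega> g \<and>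
     (\<forall>\<phi>. test_fun \<Omega> \<phi> \<longrightarrow>
        integral\<^sup>L (lebesgue_on \<Omega>) (\<lambda>x. u x * dpartial i \<phi> x)
        = - integral\<^sup>L (lebesgue_on \<Omega>) (\<lambda>x. g x * \<phi> x))"

definition weak_hessian :: "'a::euclidean_space set \<Rightarrow> ('a \<Rightarrow> real) \<Rightarrow> ('a \<Rightarrow> 'a \<Rightarrow> 'a \<Rightarrow> real) \<Rightarrow> bool" where
  "weak_hessian \<Omega> u Hs \<longleftrightarrow> (\<exists>G. (\<forall>i\<in>Basis. weak_deriv \<Omega> u i (G i)) \<and>
       (\<forall>i\<in>Basis. \<forall>j\<in>Basis. weak_deriv \<Omega> (G i) j (Hs i j)))"

definition hess_norm :: "('a::euclidean_space \<Rightarrow> 'a \<Rightarrow> 'a \<Rightarrow> real) \<Rightarrow> 'a \<Rightarrow> real" where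
  "hess_norm Hs x = sqrt (\<Sum>i\<in>Basis. \<Sum>j\<in>Basis. (Hs i j x)\<^sup>2)"

definition Cb_closure :: "'a::euclidean_space set \<Rightarrow> ('a \<Rightarrow> real) \<Rightarrow> bool" where
  "Cb_closure \<Omega> u \<longleftrightarrow> continuous_on (closure \<Omega>) u \<and> bounded {x \<in> closure \<Omega>. u x \<noteq> 0}"

definition hausdorff_const :: "real \<Rightarrow> real" where
  "hausdorff_const d = pi powr (d / 2) / Gamma (d / 2 + 1)"

definition hausdorff_pre :: "real \<Rightarrow> real \<Rightarrow> 'a::euclidean_space set \<Rightarrow> ennreal" where
  "hausdorff_pre d \<delta> A =
     (INF C \<in> {C :: nat \<Rightarrow> 'a set. A \<subseteq> (\<Union>i. C i) \<and> (\<forall>i. bounded (C i) \<and> diameter (C i) \<le> \<delta>)}.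
        (\<Sum>i. ennreal (hausdorff_const d * (diameter (C i) / 2) powr d)))"

definition hausdorff :: "real \<Rightarrow> 'a::euclidean_space set \<Rightarrow> ennreal" where
  "hausdorff d A = (SUP \<delta> \<in> {0<..}. hausdorff_pre d \<delta> A)"

definition hausdorff_measure :: "real \<Rightarrow> 'a::euclidean_space set \<Rightarrow> 'a measure" where
  "hausdorff_measure d X = measure_of X (sets (restrict_space borel X)) (hausdorff d)"

definition lp_norm :: "'b measure \<Rightarrow> real \<Rightarrow> ('b \<Rightarrow> real) \<Rightarrow> ennreal" where
  "lp_norm M p f = (let I = (\<integral>\<^sup>+ x. ennreal (\<bar>f x\<bar> powr p) \<partial>M) in
      if I = \<infinity> then \<infinity> else ennreal (enn2real I powr (1 / p)))"

definition linf_norm :: "'b measure \<Rightarrow> ('b \<Rightarrow> real) \<Rightarrow> ennreal" where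
  "linf_norm M f = Inf {c. AE x in M. ennreal \<bar>f x\<bar> \<le> c}"

text \<open>A Young function equivalent to exp(t^g) - 1 near infinity (equal to it when g >= 1).\<close>
definition young_shift :: "real \<Rightarrow> real" where
  "young_shift g = (if g < 1 then ((1 - g) / g) powr (1 / g) else 0)"

definition young_exp :: "real \<Rightarrow> real \<Rightarrow> real" where
  "young_exp g t = exp ((t + young_shift g) powr g) - exp (young_shift g powr g)"

definition orlicz_norm :: "'b measure \<Rightarrow> (real \<Rightarrow> real) \<Rightarrow> ('b \<Rightarrow> real) \<Rightarrow> ennreal" where
  "orlicz_norm M A f =
     (INF l \<in> {l::real. 0 < l \<and> (\<integral>\<^sup>+ x. ennreal (A (\<bar>f x\<bar> / l)) \<partial>M) \<le> 1}. ennreal l)"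

definition expL_norm :: "'b measure \<Rightarrow> real \<Rightarrow> ('b \<Rightarrow> real) \<Rightarrow> ennreal" where
  "expL_norm M g f = orlicz_norm M (young_exp g) f"

definition hajlasz_ug :: "'a::euclidean_space measure \<Rightarrow> ('a \<Rightarrow> real) \<Rightarrow> ('a \<Rightarrow> real) \<Rightarrow> bool" where
  "hajlasz_ug M \<phi> g \<longleftrightarrow> g \<in> borel_measurable M \<and>
     (\<exists>N \<in> null_sets M. \<forall>x \<in> space M - N. \<forall>y \<in> space M - N.
         \<bar>\<phi> x - \<phi> y\<bar> \<le> dist x y * (g x + g y))"

definition V1_norm :: "'a::euclidean_space measure \<Rightarrow> (('a \<Rightarrow> real) \<Rightarrow> ennreal) \<Rightarrow> ('a \<Rightarrow> real) \<Rightarrow> ennreal" where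
  "V1_norm M Xnorm \<phi> = (INF g \<in> {g. hajlasz_ug M \<phi> g}. Xnorm g)"

abbreviation bdry_meas :: "'a::euclidean_space set \<Rightarrow> 'a measure" where
  "bdry_meas \<Omega> \<equiv> hausdorff_measure (real DIM('a) - 1) (frontier \<Omega>)"

definition admissible_domain :: "'a::euclidean_space set \<Rightarrow> bool" where
  "admissible_domain \<Omega> \<longleftrightarrow> open \<Omega> \<and> emeasure lebesgue \<Omega> < \<infinity> \<and>
     emeasure (bdry_meas \<Omega>) (frontier \<Omega>) < \<infinity>"

definition upper_ahlfors :: "'a::euclidean_space set \<Rightarrow> 'a measure \<Rightarrow> real \<Rightarrow> real \<Rightarrow> bool" where
  "upper_ahlfors \<Omega> \<mu> \<alpha> C\<mu> \<longleftrightarrow> sets \<mu> = sets (restrict_space borel \<Omega>) \<and> emeasure \<mu> \<Omega> < \<infinity> \<and>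
     (\<forall>x\<in>\<Omega>. \<forall>r>0. emeasure \<mu> (ball x r \<inter> \<Omega>) \<le> ennreal (C\<mu> * r powr \<alpha>))"

end

(* The estimate rests on a pointwise bound for u at an interior point x. On almost every line through x
the trace of u is attained at the two exit points; integrating the second derivative of the restricted function
along the lines bounds |u x| by three terms: the mean of |u| over the exit points of rays from x, a potential of
order one of the mean of the upper gradient over exit points, and the Riesz potential of order two of |Hess u|.
The line-by-line argument is carried out for mollifications of u on compactly contained subdomains, which are then
exhausted; no regularity of the boundary is needed because the exit points seen from x in a boundary set B fill a
solid angle at most C times the integral of |x-z|^(1-n) over B. All operators involved are hence dominated by
potentials with kernels |x-y|^(-b), and a splitting of the density into small and large values yields their
mapping properties into L^q(mu), which is where the growth condition on mu enters. For the exponential estimate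
the same splitting, taken at dyadic scales, gives tail bounds for the distribution function. *)
theory Submission
 imports Defs
begin

text \<open>In (ii) the constant must not depend on s. Uniformly in s > n-1 an upper gradient is
  only known to lie in L^(n-1) of the boundary, its means over exit points then lie in L^n of the
  domain, and the potential of order one does not map L^n into bounded functions. For this reason
  the gradient enters the pointwise bound only on the last half of each ray before its exit, where
  an elementary inequality makes L^n sufficient. Directions range over the annulus 1/2 <= |th| <= 1
  instead of the sphere, so that polar coordinates and solid angles reduce to Lebesgue measure,
  scaling and Fubini. The gradient at a point of one subdomain is estimated along chords of a
  strictly larger one: the lengths of these chords have a positive lower bound that depends on the
  smaller subdomain only, and the error of mollification, divided by this length, can be made small.
  The larger subdomain is exhausted first, the smaller one second. For the Hessian no limit in the
  scale of mollification is needed, because averaging over balls of any radius increases Riesz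
  potentials by at most a constant factor.\<close>

abbreviation bmb where "bmb \<equiv> borel_measurable borel"

abbreviation nn_lborel :: "('a::euclidean_space => ennreal) => ennreal" (binder "NNI " 10) where
 "nn_lborel f \<equiv> nn_integral lborel f"

section \<open>Hausdorff measure as a Borel measure\<close>

lemma tendsto_suminf_tail_ennreal:
 fixes f :: "nat => ennreal"
 assumes fin: "(\<Sum>k. f k) ~= \<infinity>"
 shows "(%k. \<Sum>j. f (j + k)) \<longlonglongrightarrow> 0"
proof -
 define r where "r k = enn2real (f k)" for k
 have "f k < \<infinity>" for k
  using ennreal_suminf_lessD[of f \<infinity> k] fin by (simp add: less_top)
 then have f: "f k = ennreal (r k)" for k by (simp add: r_def)
 have r0: "0 <= r k" for k by (simp add: r_def)
 have sm: "summable r"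
  using fin by (intro summable_suminf_not_top) (auto simp: r0 f[symmetric])
 have "(%k. suminf r - (\<Sum>i<k. r i)) \<longlonglongrightarrow> suminf r - suminf r"
  by (intro tendsto_diff tendsto_const summable_LIMSEQ sm)
 then have "(%k. ennreal (suminf r - (\<Sum>i<k. r i))) \<longlonglongrightarrow> ennreal 0"
  by (intro tendsto_ennrealI) simp
 moreover have "(\<Sum>j. f (j + k)) = ennreal (suminf r - (\<Sum>i<k. r i))" for k
  unfolding f suminf_minus_initial_segment[OF sm, of k, symmetric]
  by (rule suminf_ennreal2) (use r0 sm in \<open>auto simp: summable_iff_shift\<close>)
 ultimately show ?thesis by simp
qed

text \<open>Caratheodory's criterion. The part of \<open>T - F\<close> close to \<open>F\<close> is
  cut into rings by the distance to \<open>F\<close>. Rings of equal parity are at positive distance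
  from each other, so the sum over all rings is at most \<open>2 * ph T\<close>; hence the tail of
  this sum, which bounds what \<open>D k\<close> misses of \<open>T - F\<close>, tends to 0.\<close>

lemma caratheodory_closed_metric:
 fixes ph :: "'a::metric_space set => ennreal"
 assumes mono: "!!A B. A \<subseteq> B ==> ph A <= ph B"
  and empty: "ph {} = 0"
  and sub: "!!A :: nat => 'a set. ph (\<Union>i. A i) <= (\<Sum>i. ph (A i))"
  and metric: "!!A B e. 0 < e ==> (!!x y. x \<in> A ==> y \<in> B ==> e <= dist x y) ==> ph A + ph B <= ph (A \<union> B)"
  and F: "closed F"
 shows "ph (T \<inter> F) + ph (T - F) = ph T"
proof (rule antisym)
 have sub2: "ph (A \<union> B) <= ph A + ph B" for A B
  using sub[of "binaryset A B"] by (simp add: UN_binaryset_eq suminf_binaryset_eq[of ph, OF empty])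
 show "ph T <= ph (T \<inter> F) + ph (T - F)"
  using sub2[of "T \<inter> F" "T - F"] by (metis Un_Diff_Int Un_commute)
 show "ph (T \<inter> F) + ph (T - F) <= ph T"
 proof (cases "F = {} \<or> ph T = \<infinity>")
  case True
  then show ?thesis by (auto simp: empty)
 next
  case False
  then have ne: "F ~= {}" and fin: "ph T < \<infinity>" by (auto simp: less_top)
  define D where "D k = {x \<in> T. 1 / real (k+1) <= infdist x F}" for k
  define R where "R k = {x \<in> T. 1 / real (k+2) <= infdist x F & infdist x F < 1 / real (k+1)}" for k
  have sep: "1 / real (k+2) - 1 / real (j+1) <= dist x y" if "x \<in> R k" "y \<in> R j" for x y k j
   using that infdist_triangle[of x F y] by (auto simp: R_def)
  have par: "(\<Sum>k<N. ph (R (2*k+p))) <= ph (\<Union>k<N. R (2*k+p))" for N p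
  proof (induction N)
   case 0 then show ?case by (simp add: empty)
  next
   case (Suc N)
   have "ph (\<Union>k<N. R (2*k+p)) + ph (R (2*N+p)) <= ph ((\<Union>k<N. R (2*k+p)) \<union> R (2*N+p))"
   \<comment> \<open>The gap used below starts with \<open>1 / real (2*N+p)\<close>. At
     \<open>N = 0\<close> this may be a division by zero, with value 0, but then the left union is
     empty.\<close>
   proof (cases "N = 0")
    case False
    show ?thesis
    proof (rule metric)
     show "0 < 1 / real (2*N+p) - 1 / real (2*N+p+1)"
      using False by (simp add: frac_less2)
    next
     fix x y assume "x \<in> (\<Union>k<N. R (2 * k + p))" "y \<in> R (2 * N + p)"
     then obtain k where k: "k < N" "x \<in> R (2*k+p)" by auto
     have "1 / real (2*N+p) <= 1 / real (2*k+p+2)" using k by (intro divide_left_mono) auto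
     with sep[OF k(2) \<open>y \<in> R (2 * N + p)\<close>]
     show "1 / real (2*N+p) - 1 / real (2*N+p+1) <= dist x y" by simp
    qed
   qed (simp add: empty)
   also have "(\<Union>k<N. R (2*k+p)) \<union> R (2*N+p) = (\<Union>k<Suc N. R (2*k+p))"
    by (auto simp: less_Suc_eq)
   finally show ?case using Suc by (simp add: add_right_mono order.trans[OF add_right_mono])
  qed
  have parT: "(\<Sum>k<N. ph (R (2*k+p))) <= ph T" for N p
   by (rule order.trans[OF par mono]) (auto simp: R_def)
  have "(\<Sum>k<2*N. ph (R k)) = (\<Sum>k<N. ph (R (2*k+0))) + (\<Sum>k<N. ph (R (2*k+1)))" for N
   by (induction N) (auto simp: algebra_simps)
  then have "(\<Sum>k<2*N. ph (R k)) <= ph T + ph T" for N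
   using add_mono[OF parT[where p = 0] parT[where p = 1]] by metis
  moreover have "(\<Sum>k<N. ph (R k)) <= (\<Sum>k<2*N. ph (R k))" for N
   by (intro sum_mono2) auto
  ultimately have "(\<Sum>k<N. ph (R k)) <= ph T + ph T" for N
   using order.trans by blast
  then have "(\<Sum>k. ph (R k)) <= ph T + ph T"
   by (intro suminf_le_const) auto
  then have sumfin: "(\<Sum>k. ph (R k)) ~= \<infinity>"
   using fin by (metis ennreal_add_eq_top infinity_ennreal_def less_irrefl top.extremum_uniqueI)
  have tail: "(%k. \<Sum>j. ph (R (j + k))) \<longlonglongrightarrow> 0"
   by (rule tendsto_suminf_tail_ennreal) (use sumfin in auto)
  have main: "ph (T \<inter> F) + ph (T - F) <= ph T + (\<Sum>j. ph (R (j + k)))" for k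
  proof -
   have cover: "T - F \<subseteq> D k \<union> (\<Union>j. R (j + k))"
   proof
    fix x assume x: "x \<in> T - F"
    then have pos: "infdist x F > 0" using F ne by (simp add: infdist_pos_not_in_closed)
    show "x \<in> D k \<union> (\<Union>j. R (j + k))"
    proof (cases "x \<in> D k")
     case False
     with x have lt: "infdist x F < 1 / real (k+1)" by (auto simp: D_def)
     obtain m where m: "1 / real (Suc m) < infdist x F" using pos nat_approx_posE by blast
     define l where "l = (LEAST l. 1 / real (l+1) <= infdist x F)"
     have l: "1 / real (l+1) <= infdist x F" unfolding l_def
      by (rule LeastI[of _ m]) (use m in simp)
     have "l > k"
     proof (rule ccontr)
      assume "\<not> k < l"
      then have "1 / real (k+1) <= 1 / real (l+1)" by (intro divide_left_mono) auto
      with l lt show False by simp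
     qed
     then have "infdist x F < 1 / real ((l-1)+1)"
      using not_less_Least[of "l-1" "%l. 1 / real (l+1) <= infdist x F"] unfolding l_def[symmetric] by simp
     then have "x \<in> R ((l-1-k) + k)" using l \<open>l > k\<close> x by (auto simp: R_def)
     then show ?thesis by blast
    qed simp
   qed
   have "ph (T - F) <= ph (D k) + (\<Sum>j. ph (R (j + k)))"
    by (rule order.trans[OF mono[OF cover]], rule order.trans[OF sub2], rule add_left_mono, rule sub)
   then have "ph (T \<inter> F) + ph (T - F) <= (ph (T \<inter> F) + ph (D k)) + (\<Sum>j. ph (R (j + k)))"
    by (simp add: add.assoc add_left_mono)
   also have "ph (T \<inter> F) + ph (D k) <= ph (T \<inter> F \<union> D k)"
   proof (rule metric)
    show "0 < 1 / real (k+1)" by simp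
    fix x y assume "x \<in> T \<inter> F" "y \<in> D k"
    then show "1 / real (k+1) <= dist x y"
     using infdist_le[of x F y] by (auto simp: D_def dist_commute)
   qed
   also have "... <= ph T" by (rule mono) (auto simp: D_def)
   finally show ?thesis by (simp add: add_right_mono)
  qed
  have "(%k. ph T + (\<Sum>j. ph (R (j + k)))) \<longlonglongrightarrow> ph T + 0"
   by (intro tendsto_add tendsto_const tail)
  then show ?thesis
   using main by (intro LIMSEQ_le_const[of _ "ph T"]) (auto)
 qed
qed

lemma hausdorff_pre_mono: "A \<subseteq> B ==> hausdorff_pre d de A <= hausdorff_pre d de B"
 unfolding hausdorff_pre_def by (rule INF_superset_mono) auto

lemma hausdorff_pre_antimono: "de <= de' ==> hausdorff_pre d de' A <= hausdorff_pre d de A"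
 unfolding hausdorff_pre_def by (rule INF_superset_mono) (auto intro: order.trans)

lemma hausdorff_pre_empty: "0 < de ==> hausdorff_pre d de {} = 0"
proof -
 assume "0 < de"
 then have "hausdorff_pre d de ({}::'a set) <= (\<Sum>i::nat. ennreal (hausdorff_const d * (diameter ({}::'a set) / 2) powr d))"
  unfolding hausdorff_pre_def by (intro INF_lower2[of "%_. {}"]) auto
 then show ?thesis by simp
qed

lemma hausdorff_pre_close:
 assumes "hausdorff_pre d de A < \<infinity>" "0 < e"
 obtains C :: "nat => 'a::euclidean_space set" where "A \<subseteq> (\<Union>i. C i)"
  "!!i. bounded (C i)" "!!i. diameter (C i) <= de"
  "(\<Sum>i. ennreal (hausdorff_const d * (diameter (C i) / 2) powr d)) <= hausdorff_pre d de A + ennreal e"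
proof -
 have "hausdorff_pre d de A < hausdorff_pre d de A + ennreal e"
  using assms by (simp add: ennreal_less_top less_top)
 then obtain C where "C \<in> {C :: nat => 'a set. A \<subseteq> (\<Union>i. C i) & (ALL i. bounded (C i) & diameter (C i) <= de)}"
  "(\<Sum>i. ennreal (hausdorff_const d * (diameter (C i) / 2) powr d)) < hausdorff_pre d de A + ennreal e"
  by (subst (asm) (1) hausdorff_pre_def) (auto simp: INF_less_iff)
 then show ?thesis by (intro that[of C]) auto
qed

lemma hausdorff_pre_subadditive:
 fixes A :: "nat => 'a::euclidean_space set"
 shows "hausdorff_pre d de (\<Union>i. A i) <= (\<Sum>i. hausdorff_pre d de (A i))"
proof (cases "(\<Sum>i. hausdorff_pre d de (A i)) = \<infinity>")
 case False
 then have fin: "hausdorff_pre d de (A i) < \<infinity>" for i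
  using ennreal_suminf_lessD[of "%i. hausdorff_pre d de (A i)" \<infinity> i] by (simp add: less_top)
 show ?thesis
 proof (rule ennreal_le_epsilon)
  fix e :: real assume e: "0 < e"
  have "ALL i. EX C :: nat => 'a set. A i \<subseteq> (\<Union>j. C j) & (ALL j. bounded (C j) & diameter (C j) <= de) &
   (\<Sum>j. ennreal (hausdorff_const d * (diameter (C j) / 2) powr d)) <= hausdorff_pre d de (A i) + ennreal (e * (1/2)^Suc i)"
  proof
   fix i
   have "0 < e * (1/2)^Suc i" using e by simp
   from hausdorff_pre_close[OF fin[of i] this] show "EX C :: nat => 'a set. A i \<subseteq> (\<Union>j. C j) & (ALL j. bounded (C j) & diameter (C j) <= de) &
   (\<Sum>j. ennreal (hausdorff_const d * (diameter (C j) / 2) powr d)) <= hausdorff_pre d de (A i) + ennreal (e * (1/2)^Suc i)"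
    by metis
  qed
  from choice[OF this] obtain C :: "nat => nat => 'a set" where C: "!!i. A i \<subseteq> (\<Union>j. C i j)"
   "!!i j. bounded (C i j)" "!!i j. diameter (C i j) <= de"
   "!!i. (\<Sum>j. ennreal (hausdorff_const d * (diameter (C i j) / 2) powr d)) <= hausdorff_pre d de (A i) + ennreal (e * (1/2)^Suc i)"
   by blast
  define D where "D k = (case prod_decode k of (i,j) => C i j)" for k
  have "hausdorff_pre d de (\<Union>i. A i) <= (\<Sum>k. ennreal (hausdorff_const d * (diameter (D k) / 2) powr d))"
   unfolding hausdorff_pre_def
  proof (rule INF_lower, safe)
   fix x i assume "x \<in> A i"
   with C(1) obtain j where "x \<in> C i j" by blast
   then have "x \<in> D (prod_encode (i,j))" by (simp add: D_def)
   then show "x \<in> (\<Union>k. D k)" by blast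
  qed (auto simp: D_def C split: prod.splits)
  also have "(\<Sum>k. ennreal (hausdorff_const d * (diameter (D k) / 2) powr d)) =
    (\<Sum>k. (%(i,j). ennreal (hausdorff_const d * (diameter (C i j) / 2) powr d)) (prod_decode k))"
   by (simp add: D_def case_prod_beta)
  also have "... = (\<Sum>i. \<Sum>j. ennreal (hausdorff_const d * (diameter (C i j) / 2) powr d))"
   by (rule suminf_ennreal_2dimen) simp
  also have "... <= (\<Sum>i. hausdorff_pre d de (A i) + ennreal (e * (1/2)^Suc i))"
   by (intro suminf_le C(4)) auto
  also have "... = (\<Sum>i. hausdorff_pre d de (A i)) + (\<Sum>i. ennreal (e * (1/2)^Suc i))"
   by (rule suminf_add[symmetric]) auto
  also have "(\<Sum>i. ennreal (e * (1/2)^Suc i)) = ennreal e"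
   using sums_mult[OF power_half_series, of e] e by (intro suminf_ennreal_eq) auto
  finally show "hausdorff_pre d de (\<Union>i. A i) <= (\<Sum>i. hausdorff_pre d de (A i)) + ennreal e" .
 qed
qed simp

lemma hausdorff_pre_le: "0 < de ==> hausdorff_pre d de A <= hausdorff d A"
 unfolding hausdorff_def by (rule SUP_upper) simp

lemma hausdorff_mono: "A \<subseteq> B ==> hausdorff d A <= hausdorff d B"
 unfolding hausdorff_def by (intro SUP_mono') (simp add: hausdorff_pre_mono)

lemma hausdorff_empty: "hausdorff d {} = 0"
 unfolding hausdorff_def by (simp add: hausdorff_pre_empty)

lemma hausdorff_subadditive: "hausdorff d (\<Union>i. A i) <= (\<Sum>i. hausdorff d (A i))"
 unfolding hausdorff_def[of d "\<Union>i. A i"]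
proof (rule SUP_least)
 fix de :: real assume "de \<in> {0<..}"
 then show "hausdorff_pre d de (\<Union>i. A i) <= (\<Sum>i. hausdorff d (A i))"
  by (intro order.trans[OF hausdorff_pre_subadditive] suminf_le hausdorff_pre_le) auto
qed

text \<open>A covering set of diameter at most \<open>de < e\<close> cannot meet both
  \<open>A\<close> and \<open>B\<close>. One cover therefore splits into two when the sets that miss
  \<open>A\<close>, respectively \<open>B\<close>, are replaced by the empty set, whose term is 0
  because \<open>0 powr d\<close> is 0.\<close>

lemma hausdorff_pre_metric:
 fixes A B :: "'a::euclidean_space set"
 assumes de: "0 < de" "de < e" and sep: "!!x y. x \<in> A ==> y \<in> B ==> e <= dist x y"
 shows "hausdorff_pre d de A + hausdorff_pre d de B <= hausdorff_pre d de (A \<union> B)"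
 unfolding hausdorff_pre_def[of d de "A \<union> B"]
proof (rule INF_greatest, clarify)
 fix C :: "nat => 'a set"
 assume C: "A \<union> B \<subseteq> (\<Union>i. C i)" "ALL i. bounded (C i) & diameter (C i) <= de"
 let ?f = "%S::'a set. ennreal (hausdorff_const d * (diameter S / 2) powr d)"
 define CA where "CA i = (if C i \<inter> A = {} then {} else C i)" for i
 define CB where "CB i = (if C i \<inter> B = {} then {} else C i)" for i
 have disj: "C i \<inter> A = {} \<or> C i \<inter> B = {}" for i
 proof (rule ccontr)
  assume "\<not> ?thesis"
  then obtain x y where xy: "x \<in> C i" "x \<in> A" "y \<in> C i" "y \<in> B" by auto
  then have "dist x y <= diameter (C i)" using C by (intro diameter_bounded_bound) auto
  with sep[OF xy(2,4)] C(2) de show False by (meson order.strict_trans1 order.trans not_le)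
 qed
 have "hausdorff_pre d de A <= (\<Sum>i. ?f (CA i))" unfolding hausdorff_pre_def
  by (rule INF_lower) (use C de in \<open>auto simp: CA_def, blast?\<close>)
 moreover have "hausdorff_pre d de B <= (\<Sum>i. ?f (CB i))" unfolding hausdorff_pre_def
  by (rule INF_lower) (use C de in \<open>auto simp: CB_def, blast?\<close>)
 ultimately have "hausdorff_pre d de A + hausdorff_pre d de B <= (\<Sum>i. ?f (CA i)) + (\<Sum>i. ?f (CB i))"
  by (rule add_mono)
 also have "... = (\<Sum>i. ?f (CA i) + ?f (CB i))" by (rule suminf_add) auto
 also have "... <= (\<Sum>i. ?f (C i))"
  using disj by (intro suminf_le) (auto simp: CA_def CB_def)
 finally show "hausdorff_pre d de A + hausdorff_pre d de B <= (\<Sum>i. ?f (C i))" .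
qed

lemma hausdorff_metric:
 fixes A B :: "'a::euclidean_space set"
 assumes e: "0 < e" and sep: "!!x y. x \<in> A ==> y \<in> B ==> e <= dist x y"
 shows "hausdorff d A + hausdorff d B <= hausdorff d (A \<union> B)"
proof -
 have "hausdorff_pre d de A + hausdorff_pre d de' B <= hausdorff d (A \<union> B)" if "0 < de" "0 < de'" for de de'
 proof -
  define m where "m = min (min de de') (e/2)"
  have m: "0 < m" "m < e" "m <= de" "m <= de'" using that e by (auto simp: m_def)
  have "hausdorff_pre d de A + hausdorff_pre d de' B <= hausdorff_pre d m A + hausdorff_pre d m B"
   by (intro add_mono hausdorff_pre_antimono m)
  also have "... <= hausdorff_pre d m (A \<union> B)" by (rule hausdorff_pre_metric[OF m(1,2) sep])
  finally show ?thesis using hausdorff_pre_le[OF m(1)] by (rule order.trans)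
 qed
 then have "(SUP de'\<in>{0<..}. hausdorff_pre d de A + hausdorff_pre d de' B) <= hausdorff d (A \<union> B)" if "0 < de" for de
  using that by (intro SUP_least) auto
 then have "hausdorff_pre d de A + hausdorff d B <= hausdorff d (A \<union> B)" if "0 < de" for de
  using that by (simp add: hausdorff_def[of d B] ennreal_SUP_add_right)
 then have "(SUP de\<in>{0<..}. hausdorff_pre d de A + hausdorff d B) <= hausdorff d (A \<union> B)"
  by (intro SUP_least) auto
 then show ?thesis
  by (simp add: hausdorff_def[of d A] ennreal_SUP_add_left)
qed

text \<open>\<open>measure_of\<close> takes the value 0 everywhere unless its set function is a
  measure on the sigma-algebra, so this fact gives content to every boundary norm of the statement.
  The Caratheodory-measurable sets form a sigma-algebra, so that testing closed sets
  suffices.\<close>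

lemma measure_space_hausdorff:
 "measure_space UNIV (sets borel) (hausdorff d :: 'a::euclidean_space set => ennreal)"
proof -
 let ?L = "lambda_system UNIV (Pow UNIV) (hausdorff d :: 'a set => ennreal)"
 have oms: "outer_measure_space (Pow UNIV) (hausdorff d :: 'a set => ennreal)"
  unfolding outer_measure_space_def positive_def increasing_def countably_subadditive_def
  by (auto simp: hausdorff_empty hausdorff_mono hausdorff_subadditive)
 have ms: "measure_space UNIV ?L (hausdorff d)"
  by (rule sigma_algebra.caratheodory_lemma[OF sigma_algebra_Pow oms])
 then have sa: "sigma_algebra UNIV ?L" by (simp add: measure_space_def)
 have "F \<in> ?L" if "closed F" for F :: "'a set"
 proof -
  have "hausdorff d (T \<inter> F) + hausdorff d (T - F) = hausdorff d T" for T :: "'a set"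
   by (rule caratheodory_closed_metric)
    (auto intro: hausdorff_mono hausdorff_subadditive hausdorff_metric that simp: hausdorff_empty)
  then show ?thesis
   unfolding lambda_system_def by (auto simp: Int_commute Diff_eq)
 qed
 then have "sigma_sets UNIV {F :: 'a set. closed F} \<subseteq> ?L"
  by (intro sigma_algebra.sigma_sets_subset[OF sa]) auto
 then have "sets (borel :: 'a measure) \<subseteq> ?L"
  by (simp add: borel_eq_closed)
 then show ?thesis
  by (intro measure_down[OF ms]) (metis sets.sigma_algebra_axioms space_borel)
qed

lemma space_hausdorff_measure [simp]: "space (hausdorff_measure d X) = X"
 unfolding hausdorff_measure_def by (rule space_measure_of) (use sets.sets_into_space[of _ "restrict_space borel X"] in \<open>auto simp: space_restrict_space\<close>)

lemma sets_hausdorff_measure [simp]: "sets (hausdorff_measure d X) = sets (restrict_space borel X)"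
 unfolding hausdorff_measure_def
 using sets.sigma_sets_eq[of "restrict_space borel X"] sets.space_closed[of "restrict_space borel X"]
 by (subst sets_measure_of) (auto simp: space_restrict_space)

lemma emeasure_hausdorff_measure:
 fixes X :: "'a::euclidean_space set"
 assumes X: "X \<in> sets borel" and A: "A \<in> sets borel" "A \<subseteq> X"
 shows "emeasure (hausdorff_measure d X) A = hausdorff d A"
proof (rule emeasure_measure_of)
 show "hausdorff_measure d X = measure_of X (sets (restrict_space borel X)) (hausdorff d)"
  by (rule hausdorff_measure_def)
 show "sets (restrict_space borel X) \<subseteq> Pow X"
  using sets.space_closed[of "restrict_space borel X"] by (simp add: space_restrict_space)
 show "A \<in> sets (hausdorff_measure d X)"
  using A X by (auto simp: sets_restrict_space image_iff)
 show "positive (sets (hausdorff_measure d X)) (hausdorff d)"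
  by (simp add: positive_def hausdorff_empty)
 have "sets (restrict_space borel X) \<subseteq> sets borel"
  using X by (auto simp: sets_restrict_space)
 moreover have "countably_additive (sets borel) (hausdorff d :: 'a set => ennreal)"
  using measure_space_hausdorff[where 'a='a, of d] by (simp add: measure_space_def)
 ultimately show "countably_additive (sets (hausdorff_measure d X)) (hausdorff d)"
  by (auto simp: countably_additive_def subset_iff)
qed

text \<open>The boundary measure pushed forward to the whole space: integrands may then be Borel
  functions on the whole space, and Fubini against measures on the interior avoids restricted
  sigma-algebras.\<close>

definition hmeas :: "real => 'a::euclidean_space set => 'a measure" where
 "hmeas d X = distr (hausdorff_measure d X) borel (%x. x)"

lemma measurable_id_hausdorff: "(%x. x) \<in> measurable (hausdorff_measure d X) borel"
 by (subst measurable_cong_sets[OF sets_hausdorff_measure refl]) (rule measurable_restrict_space1, simp)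

abbreviation bdm :: "'a::euclidean_space set => 'a measure" where
 "bdm Om \<equiv> hmeas (real DIM('a) - 1) (frontier Om)"

lemma sets_hmeas [simp, measurable_cong]: "sets (hmeas d X) = sets borel"
 and space_hmeas [simp]: "space (hmeas d X) = UNIV"
 by (simp_all add: hmeas_def)

lemma emeasure_hmeas:
 assumes "X \<in> sets borel" "A \<in> sets borel"
 shows "emeasure (hmeas d X) A = hausdorff d (A \<inter> X)"
 unfolding hmeas_def using assms by (subst emeasure_distr) (auto simp: emeasure_hausdorff_measure measurable_id_hausdorff)

lemma nn_integral_hmeas:
 "f \<in> bmb ==> (\<integral>\<^sup>+x. f x \<partial>hmeas d X) = (\<integral>\<^sup>+x. f x \<partial>hausdorff_measure d X)"
 unfolding hmeas_def by (subst nn_integral_distr) (auto simp: measurable_id_hausdorff)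

section \<open>Riesz kernels against measures of controlled growth\<close>

definition rker :: "real => 'a::euclidean_space => 'a => ennreal" where
 "rker b x y = ennreal (dist x y powr (-b))"

lemma rker_commute: "rker b x y = rker b y x"
 by (simp add: rker_def dist_commute)

lemma rker_measurable [measurable (raw)]:
 "f \<in> borel_measurable M ==> g \<in> borel_measurable M ==> (%z. rker b (f z) (g z)) \<in> borel_measurable M"
 unfolding rker_def
 by (intro measurable_compose[OF _ measurable_ennreal] powr_real_measurable borel_measurable_dist borel_measurable_const)

lemma sets_borel_ball [measurable]: "ball (x::'a::euclidean_space) r \<in> sets borel"
 by simp

lemma powr_power_commute: "0 < x ==> (x ^ k) powr s = (x powr s) ^ (k::nat)" for x :: real
 by (induction k) (auto simp: powr_mult)

lemma ennreal_le_suminf: "f k <= (\<Sum>k. f k)" for f :: "nat => ennreal"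
 using sum_le_suminf[of f "{k}"] by simp

lemma dyadic_below:
 fixes t R :: real assumes "0 < t" "t < R"
 shows "EX k::nat. R * (1/2)^(Suc k) <= t & t < R * (1/2)^k"
proof -
 have R: "0 < R" using assms by simp
 obtain m where m: "(1/2::real)^m < t / R"
  using real_arch_pow_inv[of "t/R" "1/2"] assms R by auto
 define k where "k = (LEAST k. R * (1/2)^k <= t)"
 have k: "R * (1/2)^k <= t" unfolding k_def
  by (rule LeastI[of _ m]) (use m R in \<open>simp add: field_simps\<close>)
 then have "k ~= 0" using assms by (intro notI) auto
 moreover have "t < R * (1/2)^(k-1)"
  using not_less_Least[of "k-1" "%k. R * (1/2)^k <= t"] \<open>k ~= 0\<close> unfolding k_def[symmetric] by auto
 ultimately show ?thesis using k by (intro exI[of _ "k-1"]) auto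
qed

lemma dyadic_above:
 fixes t R :: real assumes "0 < R" "R <= t"
 shows "EX k::nat. R * 2^k <= t & t < R * 2^(Suc k)"
proof -
 obtain m where m: "t / R < 2^m"
  using real_arch_pow[of 2 "t/R"] by auto
 define k where "k = (LEAST k. t < R * 2^k)"
 have k: "t < R * 2^k" unfolding k_def
  by (rule LeastI[of _ m]) (use m assms in \<open>simp add: field_simps\<close>)
 then have "k ~= 0" using assms by (intro notI) auto
 moreover have "R * 2^(k-1) <= t"
  using not_less_Least[of "k-1" "%k. t < R * 2^k"] \<open>k ~= 0\<close> unfolding k_def[symmetric] by auto
 ultimately show ?thesis using k by (intro exI[of _ "k-1"]) auto
qed

text \<open>Unlike in \<open>upper_ahlfors\<close>, centres range over the whole space and the
  measure lives on all Borel sets, since kernels will be centred at boundary points and at arbitrary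
  points of integration.\<close>

definition ahlfors :: "'a::euclidean_space measure => real => real => bool" where
 "ahlfors M a C \<longleftrightarrow> sets M = sets borel & 0 < C & 0 < a &
   (ALL x r. 0 < r --> emeasure M (ball x r) <= ennreal (C * r powr a))"

lemma ahlforsD:
 assumes "ahlfors M a C"
 shows "sets M = sets borel" "space M = UNIV" "0 < C" "0 < a"
  "0 < r ==> emeasure M (ball x r) <= ennreal (C * r powr a)"
 using assms sets_eq_imp_space_eq[of M borel] by (auto simp: ahlfors_def)

lemma ahlfors_measurable:
 "ahlfors M a C ==> f \<in> bmb ==> f \<in> borel_measurable M"
 unfolding ahlfors_def using measurable_cong_sets by blast

lemma ahlfors_lborel:
 "ahlfors (lborel :: 'a::euclidean_space measure) DIM('a) (unit_ball_vol DIM('a))"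
 unfolding ahlfors_def by (auto simp: emeasure_ball powr_realpow)

text \<open>The sums of the geometric series over dyadic shells inside a ball, and for
  \<open>far_const\<close> outside of it. The former blows up like \<open>1 / (a - b)\<close> as
  \<open>b\<close> approaches \<open>a\<close>; the exponential estimate depends on this
  rate.\<close>

definition near_const :: "real => real => real" where
 "near_const a b = 2 powr b / (1 - (1/2) powr (a-b))"

definition far_const :: "real => real => real" where
 "far_const a b = 2 powr a / (1 - (1/2) powr (b-a))"

lemma half_powr_less_1: "0 < s ==> (1/2) powr s < (1::real)"
 using powr_less_mono2[of s "1/2" 1] by simp

lemma near_const_pos: "b < a ==> 0 < near_const a b"
 unfolding near_const_def using half_powr_less_1[of "a-b"] by simp

lemma far_const_pos: "a < b ==> 0 < far_const a b"
 unfolding far_const_def using half_powr_less_1[of "b-a"] by simp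

text \<open>On the shell of outer radius \<open>R * (1/2)^k\<close> the kernel is at most its value
  at half that radius, and the growth condition controls the ball containing the shell. Consecutive
  terms have the ratio \<open>(1/2) powr (a-b) < 1\<close>.\<close>

lemma rker_near:
 assumes M: "ahlfors M a C" and b: "0 <= b" "b < a" and R: "0 < R"
 shows "(\<integral>\<^sup>+x. rker b x y * indicator (ball y R) x \<partial>M) <= ennreal (C * near_const a b * R powr (a-b))"
proof -
 note C = ahlforsD(3)[OF M]
 define c where "c k = (R * (1/2)^Suc k) powr (-b)" for k :: nat
 have "rker b x y * indicator (ball y R) x <= (\<Sum>k. ennreal (c k) * indicator (ball y (R * (1/2)^k)) x)" (is "?l <= ?r") for x
 \<comment> \<open>On the diagonal the kernel is 0, because \<open>0 powr (-b)\<close> is 0; the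
   shells cover the points with \<open>x ~= y\<close> only.\<close>
 proof (cases "x = y \<or> R <= dist x y")
  case True then show ?thesis by (auto simp: rker_def indicator_def dist_commute)
 next
  case False
  then obtain k where k: "R * (1/2)^(Suc k) <= dist x y" "dist x y < R * (1/2)^k"
   using dyadic_below[of "dist x y" R] by auto
  have "rker b x y <= ennreal (c k)" unfolding rker_def c_def
   by (intro ennreal_leI powr_mono2') (use k b R in auto)
  then have "?l <= ennreal (c k) * indicator (ball y (R * (1/2)^k)) x"
   using k by (auto simp: indicator_def dist_commute)
  also have "... <= ?r"
   by (rule ennreal_le_suminf)
  finally show ?thesis .
 qed
 then have "(\<integral>\<^sup>+x. rker b x y * indicator (ball y R) x \<partial>M) <= (\<integral>\<^sup>+x. (\<Sum>k. ennreal (c k) * indicator (ball y (R * (1/2)^k)) x) \<partial>M)"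
  by (intro nn_integral_mono)
 also have "... = (\<Sum>k. ennreal (c k) * emeasure M (ball y (R * (1/2)^k)))"
  by (subst nn_integral_suminf) (auto intro!: ahlfors_measurable[OF M] borel_measurable_times_ennreal borel_measurable_indicator nn_integral_cmult_indicator suminf_cong simp: ahlforsD(1)[OF M])
 also have "... <= (\<Sum>k. ennreal (c k) * ennreal (C * (R * (1/2)^k) powr a))"
  using R by (intro suminf_le mult_left_mono ahlforsD(5)[OF M]) auto
 also have "... = (\<Sum>k. ennreal (C * 2 powr b * R powr (a-b) * ((1/2) powr (a-b))^k))"
 proof (rule suminf_cong)
  fix k
  have "c k = R powr (-b) * 2 powr b * ((1/2) powr (-b))^k"
   using R by (simp add: c_def powr_mult powr_power_commute powr_minus powr_divide field_simps)
  moreover have "(R * (1/2)^k) powr a = R powr a * ((1/2) powr a)^k"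
   using R by (simp add: powr_mult powr_power_commute)
  moreover have "R powr (a-b) = R powr a * R powr (-b)" "(1/2::real) powr (a-b) = (1/2) powr a * (1/2) powr (-b)"
   by (simp_all add: powr_add[symmetric])
  ultimately show "ennreal (c k) * ennreal (C * (R * (1/2)^k) powr a) = ennreal (C * 2 powr b * R powr (a-b) * ((1/2) powr (a-b))^k)"
   using C by (simp add: ennreal_mult'[symmetric] power_mult_distrib mult_ac)
 qed
 also have "... = ennreal (C * near_const a b * R powr (a-b))"
  unfolding near_const_def
  using sums_mult[OF geometric_sums[of "(1/2) powr (a-b)"], of "C * 2 powr b * R powr (a-b)"] half_powr_less_1[of "a-b"] b C
  by (intro suminf_ennreal_eq) (auto simp: mult_ac)
 finally show ?thesis .
qed

lemma rker_far:
 assumes M: "ahlfors M a C" and b: "a < b" and R: "0 < R"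
 shows "(\<integral>\<^sup>+x. rker b x y * indicator (- ball y R) x \<partial>M) <= ennreal (C * far_const a b * R powr (a-b))"
proof -
 note C = ahlforsD(3,4)[OF M]
 define c where "c k = (R * 2^k) powr (-b)" for k :: nat
 have "rker b x y * indicator (- ball y R) x <= (\<Sum>k. ennreal (c k) * indicator (ball y (R * 2^Suc k)) x)" (is "?l <= ?r") for x
 proof (cases "dist x y < R")
  case True then show ?thesis by (auto simp: rker_def indicator_def dist_commute)
 next
  case False
  then obtain k where k: "R * 2^k <= dist x y" "dist x y < R * 2^Suc k"
   using dyadic_above[of R "dist x y"] R by auto
  have "rker b x y <= ennreal (c k)" unfolding rker_def c_def
   by (intro ennreal_leI powr_mono2') (use k b R C in auto)
  then have "?l <= ennreal (c k) * indicator (ball y (R * 2^Suc k)) x"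
   using k by (auto simp: indicator_def dist_commute)
  also have "... <= ?r"
   by (rule ennreal_le_suminf)
  finally show ?thesis .
 qed
 then have "(\<integral>\<^sup>+x. rker b x y * indicator (- ball y R) x \<partial>M) <= (\<integral>\<^sup>+x. (\<Sum>k. ennreal (c k) * indicator (ball y (R * 2^Suc k)) x) \<partial>M)"
  by (intro nn_integral_mono)
 also have "... = (\<Sum>k. ennreal (c k) * emeasure M (ball y (R * 2^Suc k)))"
  by (subst nn_integral_suminf) (auto intro!: ahlfors_measurable[OF M] borel_measurable_times_ennreal borel_measurable_indicator nn_integral_cmult_indicator suminf_cong simp: ahlforsD(1)[OF M])
 also have "... <= (\<Sum>k. ennreal (c k) * ennreal (C * (R * 2^Suc k) powr a))"
  using R by (intro suminf_le mult_left_mono ahlforsD(5)[OF M]) auto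
 also have "... = (\<Sum>k. ennreal (C * 2 powr a * R powr (a-b) * ((1/2) powr (b-a))^k))"
 proof (rule suminf_cong)
  fix k
  have "c k = R powr (-b) * (2 powr (-b))^k"
   using R by (simp add: c_def powr_mult powr_power_commute)
  moreover have "(R * 2^Suc k) powr a = R powr a * 2 powr a * (2 powr a)^k"
   using R by (simp add: powr_mult powr_power_commute)
  moreover have "R powr (a-b) = R powr a * R powr (-b)" "(1/2::real) powr (b-a) = 2 powr a * 2 powr (-b)"
   by (simp_all add: powr_add[symmetric] powr_divide powr_minus_divide[symmetric])
  ultimately show "ennreal (c k) * ennreal (C * (R * 2^Suc k) powr a) = ennreal (C * 2 powr a * R powr (a-b) * ((1/2) powr (b-a))^k)"
   using C by (simp add: ennreal_mult'[symmetric] power_mult_distrib mult_ac)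
 qed
 also have "... = ennreal (C * far_const a b * R powr (a-b))"
  unfolding far_const_def
  using sums_mult[OF geometric_sums[of "(1/2) powr (b-a)"], of "C * 2 powr a * R powr (a-b)"] half_powr_less_1[of "b-a"] b C
  by (intro suminf_ennreal_eq) (auto simp: mult_ac)
 finally show ?thesis .
qed

definition set_const :: "real => real => real => real" where
 "set_const a b C = C * near_const a b + 1"

text \<open>Up to constants a ball about \<open>y\<close> is the worst set of given measure. With
  \<open>R powr a\<close> equal to the measure of \<open>E\<close>, the part in
  \<open>ball y R\<close> is estimated by the whole ball, and off this ball the kernel is at most
  \<open>R powr (-b)\<close>; both contributions have the same power of the measure. Null sets are
  treated apart to keep \<open>R\<close> positive.\<close>

lemma rker_set:
 assumes M: "ahlfors M a C" and b: "0 <= b" "b < a" and E: "E \<in> sets borel" "emeasure M E < \<infinity>"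
 shows "(\<integral>\<^sup>+x. rker b x y * indicator E x \<partial>M) <= ennreal (set_const a b C * measure M E powr (1-b/a))"
proof (cases "measure M E = 0")
 case True
 from True E have "emeasure M E = 0" by (simp add: emeasure_eq_ennreal_measure less_top)
 then have AE: "AE x in M. x \<notin> E" using E by (intro AE_not_in) (auto simp: null_sets_def ahlforsD(1)[OF M])
 have "(%x. rker b x y * indicator E x) \<in> borel_measurable M"
  using E(1) by (intro ahlfors_measurable[OF M] borel_measurable_times_ennreal borel_measurable_indicator rker_measurable) auto
 moreover have "AE x in M. rker b x y * indicator E x = 0"
  using AE by eventually_elim simp
 ultimately have "(\<integral>\<^sup>+x. rker b x y * indicator E x \<partial>M) = 0"
  by (subst nn_integral_0_iff_AE)
 then show ?thesis by simp
next
 case False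
 define m where "m = measure M E"
 have m: "0 < m" using False by (simp add: m_def zero_less_measure_iff)
 have eM: "emeasure M E = ennreal m" using E by (simp add: m_def emeasure_eq_ennreal_measure less_top)
 note C = ahlforsD(3,4)[OF M]
 define R where "R = m powr (1/a)"
 have R: "0 < R" using m by (simp add: R_def)
 have "rker b x y * indicator E x <= rker b x y * indicator (ball y R) x + ennreal (R powr (-b)) * indicator E x" for x
 proof (cases "dist x y < R")
  case False
  then have "rker b x y <= ennreal (R powr (-b))" unfolding rker_def using R b
   by (intro ennreal_leI powr_mono2') auto
  then show ?thesis using False by (auto simp: indicator_def)
 qed (auto simp: indicator_def dist_commute)
 then have "(\<integral>\<^sup>+x. rker b x y * indicator E x \<partial>M) <= (\<integral>\<^sup>+x. rker b x y * indicator (ball y R) x + ennreal (R powr (-b)) * indicator E x \<partial>M)"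
  by (intro nn_integral_mono)
 also have "... = (\<integral>\<^sup>+x. rker b x y * indicator (ball y R) x \<partial>M) + ennreal (R powr (-b)) * emeasure M E"
 proof (subst nn_integral_add)
  have EM: "E \<in> sets M" using E(1) by (simp add: ahlforsD(1)[OF M])
  show "(%x. rker b x y * indicator (ball y R) x) \<in> borel_measurable M"
   by (intro ahlfors_measurable[OF M] borel_measurable_times_ennreal borel_measurable_indicator rker_measurable) auto
  show "(%x. ennreal (R powr (-b)) * indicator E x) \<in> borel_measurable M"
   using EM by (intro borel_measurable_times_ennreal borel_measurable_indicator) auto
  show "(\<integral>\<^sup>+x. rker b x y * indicator (ball y R) x \<partial>M) + (\<integral>\<^sup>+x. ennreal (R powr (-b)) * indicator E x \<partial>M)
   = (\<integral>\<^sup>+x. rker b x y * indicator (ball y R) x \<partial>M) + ennreal (R powr (-b)) * emeasure M E"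
   by (simp only: nn_integral_cmult_indicator[OF EM])
 qed
 also have "... <= ennreal (C * near_const a b * R powr (a-b)) + ennreal (R powr (-b)) * ennreal m"
  unfolding eM by (intro add_mono rker_near[OF M b R]) auto
 also have "R powr (a-b) = m powr (1-b/a)"
 proof -
  have "1/a*(a-b) = 1-b/a" using C by (simp add: diff_divide_distrib)
  then show ?thesis unfolding R_def powr_powr by simp
 qed
 also have "ennreal (R powr (-b)) * ennreal m = ennreal (m powr (1-b/a))"
 proof -
  have "R powr (-b) * m = m powr (-b/a) * m powr 1" unfolding R_def powr_powr using m by simp
  also have "... = m powr (1-b/a)" unfolding powr_add[symmetric] by simp
  finally show ?thesis using m by (simp add: ennreal_mult'[symmetric])
 qed
 also have "ennreal (C * near_const a b * m powr (1-b/a)) + ennreal (m powr (1-b/a)) = ennreal (set_const a b C * m powr (1-b/a))"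
  using C near_const_pos[OF b(2)] by (subst ennreal_plus[symmetric]) (auto simp: set_const_def distrib_right)
 finally show ?thesis unfolding m_def .
qed

text \<open>By symmetry let \<open>y\<close> be nearer to \<open>x\<close> than to \<open>z\<close>.
  Within half of \<open>dist x z\<close> of \<open>x\<close> the other factor is bounded by a power
  of that distance. Beyond it the product is at most the kernel of exponent \<open>2*b\<close> at
  \<open>x\<close>, which is integrable at infinity because \<open>2*b\<close> exceeds the
  dimension.\<close>

lemma rker_compose:
 fixes x z :: "'a::euclidean_space" and b :: real
 assumes b: "DIM('a) / 2 < b" "b < DIM('a)" and xz: "x ~= z"
 defines "V \<equiv> unit_ball_vol DIM('a)"
 shows "(NNI y. rker b x y * rker b y z) <=
  ennreal (2 * V * (near_const DIM('a) b + far_const DIM('a) (2*b)) * 2 powr (2*b - DIM('a))) * rker (2*b - DIM('a)) x z"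
proof -
 let ?n = "real DIM('a)"
 define d where "d = dist x z / 2"
 have d: "0 < d" using xz by (simp add: d_def)
 have b0: "0 <= b" using b by simp
 have nf: "0 <= V" "0 < near_const ?n b" "0 < far_const ?n (2*b)"
  using near_const_pos[of b ?n] far_const_pos[of ?n "2*b"] b by (auto simp: V_def)
 let ?f = "%w y. ennreal (d powr (-b)) * (rker b y w * indicator (ball w d) y) + rker (2*b) y w * indicator (- ball w d) y"
 have half: "rker b x y * rker b y z <= ?f x y" if "dist x y <= dist y z" "dist x z = 2*d" for x y z :: 'a
 proof -
  have tri: "2*d <= dist x y + dist y z" using that dist_triangle[of x z y] by (simp add: dist_commute)
  show ?thesis
  proof (cases "dist x y < d")
   case True
   then have "rker b y z <= ennreal (d powr (-b))" unfolding rker_def using d b0 tri by (intro ennreal_leI powr_mono2') auto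
   then have "rker b x y * rker b y z <= rker b x y * ennreal (d powr (-b))" by (intro mult_left_mono) auto
   then show ?thesis using True by (simp add: rker_commute mult_ac)
  next
   case False
   then have "rker b y z <= rker b x y" unfolding rker_def using d b0 that by (intro ennreal_leI powr_mono2') auto
   then have "rker b x y * rker b y z <= rker b x y * rker b x y" by (intro mult_left_mono) auto
   also have "... = rker (2*b) y x" using False d
    by (simp add: rker_def ennreal_mult'[symmetric] powr_add[symmetric] dist_commute)
   finally show ?thesis using False by simp
  qed
 qed
 have fin: "(NNI y. ?f w y) <= ennreal (V * (near_const ?n b + far_const ?n (2*b)) * d powr (?n - 2*b))" for w :: 'a
 proof -
  have "(NNI y. ?f w y) = ennreal (d powr (-b)) * (NNI y. rker b y w * indicator (ball w d) y)
    + (NNI y. rker (2*b) y w * indicator (- ball w d) y)"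
   by (subst nn_integral_add) (simp_all add: nn_integral_cmult)
  also have "... <= ennreal (d powr (-b)) * ennreal (V * near_const ?n b * d powr (?n - b)) + ennreal (V * far_const ?n (2*b) * d powr (?n - 2*b))"
   unfolding V_def using b d
   by (intro add_mono mult_left_mono rker_near[OF ahlfors_lborel] rker_far[OF ahlfors_lborel]) auto
  also have "ennreal (d powr (-b)) * ennreal (V * near_const ?n b * d powr (?n - b)) = ennreal (V * near_const ?n b * d powr (?n - 2*b))"
  proof -
   have "d powr (-b) * d powr (?n - b) = d powr (?n-2*b)" by (simp add: powr_add[symmetric])
   then have "d powr (-b) * (V * near_const ?n b * d powr (?n - b)) = V * near_const ?n b * d powr (?n - 2*b)"
    by (metis mult.assoc mult.commute)
   then show ?thesis by (metis ennreal_mult' powr_ge_zero)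
  qed
  also have "ennreal (V * near_const ?n b * d powr (?n - 2*b)) + ennreal (V * far_const ?n (2*b) * d powr (?n - 2*b))
    = ennreal (V * near_const ?n b * d powr (?n - 2*b) + V * far_const ?n (2*b) * d powr (?n - 2*b))"
   using nf by (intro ennreal_plus[symmetric]) auto
  finally show ?thesis by (simp only: distrib_left distrib_right)
 qed
 have "rker b x y * rker b y z <= ?f x y + ?f z y" for y
 proof (cases "dist x y <= dist y z")
  case True then show ?thesis using half[of x y z] by (simp add: d_def add_increasing2)
 next
  case False
  then have "rker b z y * rker b y x <= ?f z y" by (intro half) (auto simp: d_def dist_commute)
  then have "rker b x y * rker b y z <= ?f z y" by (simp only: rker_commute mult.commute)
  then show ?thesis by (rule add_increasing[rotated]) simp
 qed
 then have "(NNI y. rker b x y * rker b y z) <= (NNI y. ?f x y + ?f z y)"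
  by (intro nn_integral_mono)
 also have "... = (NNI y. ?f x y) + (NNI y. ?f z y)"
  by (intro nn_integral_add) auto
 also have "... <= ennreal (V * (near_const ?n b + far_const ?n (2*b)) * d powr (?n - 2*b)) + ennreal (V * (near_const ?n b + far_const ?n (2*b)) * d powr (?n - 2*b))"
  by (intro add_mono fin)
 also have "... = ennreal (2 * V * (near_const ?n b + far_const ?n (2*b)) * 2 powr (2*b - ?n)) * rker (2*b - ?n) x z"
 proof -
  have "d powr (?n - 2*b) = 2 powr (2*b - ?n) * dist x z powr (-(2*b - ?n))"
  proof -
   have "(dist x z / 2) powr (- s) = 2 powr s * dist x z powr (- s)" for s :: real
    by (simp add: powr_divide powr_minus_divide)
   from this[of "2*b - ?n"] show ?thesis by (simp add: d_def)
  qed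
  define K where "K = V * (near_const ?n b + far_const ?n (2*b))"
  have K: "0 <= K" using nf by (simp add: K_def)
  have "ennreal (K * d powr (?n - 2*b)) + ennreal (K * d powr (?n - 2*b)) = ennreal (2 * K * d powr (?n - 2*b))"
   using K by (subst ennreal_plus[symmetric]) auto
  also have "... = ennreal (2 * K * 2 powr (2*b - ?n)) * rker (2*b - ?n) x z"
   unfolding \<open>d powr (?n - 2*b) = _\<close> rker_def using K by (subst ennreal_mult'[symmetric]) (auto simp: mult.assoc)
  finally show ?thesis by (simp only: K_def mult.assoc)
 qed
 finally show ?thesis .
qed

text \<open>The constant is uniform in the radius. If \<open>de\<close> is at most half of
  \<open>dist x z\<close>, the kernel is bounded on the ball by a multiple of its value at the
  centre. Otherwise the ball lies in the ball of radius \<open>3*de\<close> about \<open>x\<close>,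
  and \<open>de\<close> exceeds half of the distance.\<close>

lemma rker_average:
 fixes x z :: "'a::euclidean_space" and b :: real
 assumes b: "0 <= b" "b < DIM('a)" and xz: "x ~= z" and de: "0 < de"
 defines "V \<equiv> unit_ball_vol DIM('a)"
 shows "(NNI y. rker b x y * indicator (ball z de) y) <=
  ennreal (2 powr b * V * (1 + near_const DIM('a) b * 3 powr (DIM('a) - b)) * de ^ DIM('a)) * rker b x z"
proof -
 let ?n = "real DIM('a)"
 have nc: "0 < near_const ?n b" using b by (intro near_const_pos)
 have rk: "2 powr b * dist x z powr (-b) = (dist x z / 2) powr (-b)"
  using xz by (simp add: powr_divide powr_minus_divide)
 show ?thesis
 proof (cases "2 * de <= dist x z")
  case True
  have "rker b x y * indicator (ball z de) y <= ennreal ((dist x z / 2) powr (-b)) * indicator (ball z de) y" for y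
  proof (cases "dist z y < de")
   case y: True
   have "dist x z / 2 <= dist x y" using dist_triangle[of x z y] y True by (simp add: dist_commute)
   then have "rker b x y <= ennreal ((dist x z / 2) powr (-b))" unfolding rker_def using xz b
    by (intro ennreal_leI powr_mono2') auto
   then show ?thesis using y by simp
  qed simp
  then have "(NNI y. rker b x y * indicator (ball z de) y) <= (NNI y. ennreal ((dist x z / 2) powr (-b)) * indicator (ball z de) y)"
   by (intro nn_integral_mono)
  also have "... = ennreal (2 powr b * V * 1 * de ^ DIM('a)) * rker b x z"
   unfolding rk[symmetric] using de
   by (subst nn_integral_cmult_indicator) (simp_all add: emeasure_ball V_def rker_def ennreal_mult'[symmetric] mult_ac)
  also have "... <= ennreal (2 powr b * V * (1 + near_const DIM('a) b * 3 powr (DIM('a) - b)) * de ^ DIM('a)) * rker b x z"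
   using nc de by (intro mult_right_mono ennreal_leI mult_left_mono) (auto simp: V_def)
  finally show ?thesis .
 next
  case False
  have "(NNI y. rker b x y * indicator (ball z de) y) <= (NNI y. rker b y x * indicator (ball x (3*de)) y)"
  proof (intro nn_integral_mono)
   fix y
   have "dist x y < 3*de" if "dist z y < de"
    using dist_triangle[of x y z] False that by simp
   then show "rker b x y * indicator (ball z de) y <= rker b y x * indicator (ball x (3*de)) y"
    by (auto simp: indicator_def rker_commute)
  qed
  also have "... <= ennreal (V * near_const ?n b * (3*de) powr (?n - b))"
   unfolding V_def using b de by (intro rker_near[OF ahlfors_lborel]) auto
  also have "(3*de) powr (?n-b) = 3 powr (?n-b) * de^DIM('a) * de powr (-b)"
  proof -
   have "de powr (?n-b) = de powr ?n * de powr (-b)" by (simp add: powr_add[symmetric])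
   then show ?thesis using de by (simp add: powr_mult powr_realpow)
  qed
  also have "ennreal (V * near_const ?n b * (3 powr (?n-b) * de^DIM('a) * de powr (-b))) <=
    ennreal (V * near_const ?n b * (3 powr (?n-b) * de^DIM('a) * (2 powr b * dist x z powr (-b))))"
   unfolding rk using nc de xz b False by (intro ennreal_leI mult_left_mono powr_mono2') (auto simp: V_def)
  also have "... = ennreal (2 powr b * V * (near_const ?n b * 3 powr (?n - b)) * de ^ DIM('a)) * rker b x z"
   using nc de by (simp add: rker_def ennreal_mult'[symmetric] V_def mult_ac)
  also have "... <= ennreal (2 powr b * V * (1 + near_const ?n b * 3 powr (?n - b)) * de ^ DIM('a)) * rker b x z"
   using nc de by (intro mult_right_mono ennreal_leI mult_left_mono) (auto simp: V_def)
  finally show ?thesis .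
 qed
qed

section \<open>Strong type bounds from the splitting into small and large values\<close>

lemma nn_integral_powr_interval:
 fixes m w :: real assumes "0 < m" "0 <= w"
 shows "(NNI t. ennreal (t powr (m-1)) * indicator {0<..<w} t) = ennreal (w powr m / m)"
proof -
 have "((%t. t powr (m-1)) has_integral (w powr (m-1+1) / (m-1+1))) {0..w}"
  by (rule has_integral_powr_from_0) (use assms in auto)
 then have "((%t. if t \<in> {0..w} then t powr (m-1) else 0) has_integral (w powr m / m)) UNIV"
  by (simp only: has_integral_restrict_UNIV) simp
 moreover have "(%t. if t \<in> {0..w} then t powr (m-1) else 0) = (%t. t powr (m-1) * indicator {0..w} t)"
  by (auto simp: fun_eq_iff indicator_def)
 ultimately have "((%t. t powr (m-1) * indicator {0..w} t) has_integral (w powr m / m)) UNIV" by simp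
 then have "(NNI t. ennreal (t powr (m-1) * indicator {0..w} t)) = ennreal (w powr m / m)"
  by (intro nn_integral_has_integral_lborel) auto
 also have "(NNI t. ennreal (t powr (m-1) * indicator {0..w} t)) = (NNI t. ennreal (t powr (m-1)) * indicator {0<..<w} t)"
 proof (rule nn_integral_cong_AE)
  have "AE t in lborel. t ~= 0 & t ~= w"
   using AE_lborel_singleton[of 0] AE_lborel_singleton[of w] by eventually_elim simp
  then show "AE t in lborel. ennreal (t powr (m-1) * indicator {0..w} t) = ennreal (t powr (m-1)) * indicator {0<..<w} t"
   by eventually_elim (auto simp: indicator_def)
 qed
 finally show ?thesis .
qed

definition interp_const :: "real => real => real => real => real => real" where
 "interp_const a p th c A = (2*c) powr (a*(th+p-1)/th) * (a*(th+p-1)) * (A/c) powr a / (p-1)"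

text \<open>A Marcinkiewicz argument. Where \<open>v > 2 * c * l powr th\<close> the remainder
  \<open>R l\<close> is at least \<open>c * l powr th\<close>, so \<open>weak\<close> bounds the
  measure of this set by the power \<open>a\<close> of the tail integral \<open>G l\<close>.
  Chebyshev's bound \<open>G l <= l powr (1-p)\<close> replaces all but one factor
  \<open>G l\<close>, and the last one, integrated over \<open>l\<close>, becomes the integral of
  \<open>g powr p\<close> by Fubini. The exponent \<open>m = a*(th+p-1)\<close> is the one that
  leaves the weight \<open>l powr (p-2)\<close>.\<close>

lemma interpolation:
 fixes M :: "'x measure" and N :: "'y measure" and g :: "'y => real"
 assumes fM: "finite_measure M" and sN: "sigma_finite_measure N"
  and v [measurable]: "v \<in> borel_measurable M" and v0: "!!x. 0 <= v x"
  and g [measurable]: "g \<in> borel_measurable N" and g0: "!!y. 0 <= g y"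
  and par: "1 <= a" "1 < p" "0 < th" "0 < c" "0 <= A"
  and gp: "(\<integral>\<^sup>+y. ennreal (g y powr p) \<partial>N) <= 1"
  and split: "!!l x. 0 < l ==> x \<in> space M ==> ennreal (v x) <= ennreal (c * l powr th) + R l x"
  and R [measurable]: "!!l. R l \<in> borel_measurable M"
  and weak: "!!l E. 0 < l ==> E \<in> sets M ==> (\<integral>\<^sup>+x. R l x * indicator E x \<partial>M) <=
   ennreal (A * measure M E powr (1-1/a)) * (\<integral>\<^sup>+y. ennreal (g y) * indicator {y. l < g y} y \<partial>N)"
 shows "(\<integral>\<^sup>+x. ennreal (v x powr (a*(th+p-1)/th)) \<partial>M) <= ennreal (interp_const a p th c A)"
proof -
 interpret M: finite_measure M by (rule fM)
 interpret N: sigma_finite_measure N by (rule sN)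
 interpret P1: pair_sigma_finite M lborel ..
 interpret P2: pair_sigma_finite N lborel ..
 define m where "m = a*(th+p-1)"
 define q where "q = m / th"
 have m: "0 < m" using par by (simp add: m_def)
 have q: "0 < q" using m par by (simp add: q_def)
 define G where "G l = (\<integral>\<^sup>+y. ennreal (g y) * indicator {y. l < g y} y \<partial>N)" for l
 have G: "G l <= ennreal (l powr (1-p))" if "0 < l" for l
 proof -
  have "G l <= (\<integral>\<^sup>+y. ennreal (l powr (1-p)) * ennreal (g y powr p) \<partial>N)" unfolding G_def
  proof (intro nn_integral_mono)
   fix y
   have "g y <= l powr (1-p) * g y powr p" if "l < g y"
   proof -
    have "g y = g y powr (1-p) * g y powr p" using that \<open>0 < l\<close> by (simp add: powr_add[symmetric])
    also have "... <= l powr (1-p) * g y powr p"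
     using that \<open>0 < l\<close> par by (intro mult_right_mono powr_mono2') auto
    finally show ?thesis .
   qed
   then show "ennreal (g y) * indicator {y. l < g y} y <= ennreal (l powr (1-p)) * ennreal (g y powr p)"
    by (auto simp: indicator_def ennreal_mult'[symmetric] intro!: ennreal_leI)
  qed
  also have "... = ennreal (l powr (1-p)) * (\<integral>\<^sup>+y. ennreal (g y powr p) \<partial>N)"
   by (rule nn_integral_cmult) measurable
  also have "... <= ennreal (l powr (1-p)) * 1" by (intro mult_left_mono gp) auto
  finally show ?thesis by simp
 qed
 define E where "E l = {x \<in> space M. 2 * c * l powr th < v x}" for l
 have E [measurable]: "E l \<in> sets M" for l unfolding E_def by measurable
 have level: "emeasure M (E l) * ennreal (l powr (m-1)) <= ennreal ((A/c) powr a * l powr (p-2)) * G l" if l: "0 < l" for l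
 proof (cases "measure M (E l) = 0")
  case True
  then show ?thesis by (simp add: M.emeasure_eq_measure)
 next
  case False
  define e where "e = measure M (E l)"
  have e: "0 < e" using False by (simp add: e_def zero_less_measure_iff)
  have "G l < \<infinity>" using G[OF l] by (simp add: le_less_trans)
  then obtain ga where ga: "G l = ennreal ga" "0 <= ga" by (cases "G l") auto
  have gal: "ga <= l powr (1-p)" using G[OF l] ga by (simp add: ennreal_le_iff)
  define s where "s = c * l powr th"
  have s: "0 < s" using par l by (simp add: s_def)
  have "ennreal (s * e) = (\<integral>\<^sup>+x. ennreal s * indicator (E l) x \<partial>M)"
   using s by (simp add: nn_integral_cmult_indicator e_def M.emeasure_eq_measure ennreal_mult')
  also have "... <= (\<integral>\<^sup>+x. R l x * indicator (E l) x \<partial>M)"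
  proof (intro nn_integral_mono)
   fix x assume x: "x \<in> space M"
   show "ennreal s * indicator (E l) x <= R l x * indicator (E l) x"
   proof (cases "x \<in> E l")
    case True
    then have "ennreal s + ennreal s <= ennreal (v x)"
     using s by (simp add: E_def s_def ennreal_plus[symmetric] del: ennreal_plus)
    also have "... <= ennreal s + R l x" using split[OF l x] by (simp add: s_def)
    finally show ?thesis using True by simp
   qed simp
  qed
  also have "... <= ennreal (A * e powr (1-1/a)) * ennreal ga"
   using weak[OF l E[of l]] unfolding G_def[symmetric] ga e_def .
  also have "... = ennreal (A * e powr (1-1/a) * ga)" using par ga by (simp add: ennreal_mult')
  finally have "s * e <= A * e powr (1-1/a) * ga"
   using par ga by (subst (asm) ennreal_le_iff) auto
  \<comment> \<open>Moving a power of \<open>e\<close> to the left side requires \<open>e\<close> to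
    be positive and finite, hence the finiteness of \<open>M\<close>.\<close>
  moreover have "e = e powr (1-1/a) * e powr (1/a)" using e by (simp add: powr_add[symmetric])
  ultimately have "e powr (1-1/a) * (s * e powr (1/a)) <= e powr (1-1/a) * (A * ga)"
   by (metis mult.assoc mult.left_commute)
  then have "s * e powr (1/a) <= A * ga" using e by (subst (asm) mult_le_cancel_left_pos) auto
  then have "e powr (1/a) <= A * ga / s" using s by (simp add: field_simps)
  then have "(e powr (1/a)) powr a <= (A * ga / s) powr a" using par by (intro powr_mono2) auto
  then have "e <= (A/c * ga * l powr (-th)) powr a"
   using par e l by (simp add: powr_powr s_def powr_minus_divide field_simps)
  also have "... = (A/c) powr a * ga powr a * l powr (-th*a)"
   using par ga by (simp only: powr_mult powr_powr)
  also have "ga powr a <= ga * l powr ((1-p)*(a-1))"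
  proof (cases "ga = 0")
   case False
   then have "ga powr a = ga powr 1 * ga powr (a-1)" using ga by (subst powr_add[symmetric]) simp
   also have "... <= ga * (l powr (1-p)) powr (a-1)"
    using ga gal False par by (intro mult_mono powr_mono2) auto
   finally show ?thesis by (simp add: powr_powr)
  qed simp
  finally have "e <= (A/c) powr a * (ga * l powr ((1-p)*(a-1))) * l powr (-th*a)"
   by (simp add: mult_left_mono mult_right_mono)
  then have "e * l powr (m-1) <= (A/c) powr a * (ga * l powr ((1-p)*(a-1))) * l powr (-th*a) * l powr (m-1)"
   by (intro mult_right_mono) auto
  also have "... = (A/c) powr a * ga * (l powr ((1-p)*(a-1)) * l powr (-th*a) * l powr (m-1))"
   by (simp add: mult_ac)
  also have "l powr ((1-p)*(a-1)) * l powr (-th*a) * l powr (m-1) = l powr (p-2)"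
   unfolding powr_add[symmetric] by (rule arg_cong[where f="%s. l powr s"]) (simp add: m_def algebra_simps)
  finally have "ennreal (e * l powr (m-1)) <= ennreal ((A/c) powr a * ga * l powr (p-2))" by (rule ennreal_leI)
  then show ?thesis using e ga by (simp add: e_def M.emeasure_eq_measure ennreal_mult'[symmetric] mult_ac)
 qed
 \<comment> \<open>The layer cake formula in the splitting level \<open>l\<close> instead of the
   height of \<open>v\<close>: the substitution \<open>2 * c * l powr th\<close> for the height
   turns the exponent \<open>q\<close> into \<open>m = q * th\<close>.\<close>
 have cake: "ennreal (v x powr q) = ennreal ((2*c) powr q * m) * (NNI l. (if 0 < l & 2 * c * l powr th < v x then ennreal (l powr (m-1)) else 0))" for x
 proof -
  define w where "w = (v x / (2*c)) powr (1/th)"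
  have "2 * c * l powr th < v x \<longleftrightarrow> l < w" if l: "0 < l" for l
  proof
   assume "2 * c * l powr th < v x"
   then have "l powr th < v x / (2*c)" using par by (simp add: field_simps)
   then have "(l powr th) powr (1/th) < w" unfolding w_def using par by (intro powr_less_mono2) auto
   then show "l < w" using par l by (simp add: powr_powr)
  next
   assume "l < w"
   then have "l powr th < w powr th" using par l by (intro powr_less_mono2) auto
   also have "w powr th = v x / (2*c)" using par v0[of x] by (simp add: w_def powr_powr)
   finally show "2 * c * l powr th < v x" using par by (simp add: field_simps)
  qed
  then have "(NNI l. (if 0 < l & 2 * c * l powr th < v x then ennreal (l powr (m-1)) else 0))
   = (NNI l. ennreal (l powr (m-1)) * indicator {0<..<w} l)"
   by (intro nn_integral_cong) (auto simp: indicator_def)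
  moreover have "w powr m = v x powr q / (2*c) powr q"
   using par v0[of x] by (simp add: w_def powr_powr q_def powr_divide)
  moreover have "0 <= w" by (simp add: w_def)
  ultimately show ?thesis using m par by (simp add: nn_integral_powr_interval ennreal_mult'[symmetric])
 qed
 have "(\<integral>\<^sup>+x. ennreal (v x powr q) \<partial>M) = ennreal ((2*c) powr q * m) *
   (\<integral>\<^sup>+x. \<integral>\<^sup>+l. (if 0 < l & 2 * c * l powr th < v x then ennreal (l powr (m-1)) else 0) \<partial>lborel \<partial>M)"
  unfolding cake by (rule nn_integral_cmult) measurable
 also have "(\<integral>\<^sup>+x. \<integral>\<^sup>+l. (if 0 < l & 2 * c * l powr th < v x then ennreal (l powr (m-1)) else 0) \<partial>lborel \<partial>M)
   = (NNI l. \<integral>\<^sup>+x. (if 0 < l & 2 * c * l powr th < v x then ennreal (l powr (m-1)) else 0) \<partial>M)"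
  by (rule P1.Fubini'[symmetric]) measurable
 also have "... = (NNI l. indicator {0<..} l * (emeasure M (E l) * ennreal (l powr (m-1))))"
 proof (rule nn_integral_cong)
  fix l :: real
  show "(\<integral>\<^sup>+x. (if 0 < l & 2 * c * l powr th < v x then ennreal (l powr (m-1)) else 0) \<partial>M)
   = indicator {0<..} l * (emeasure M (E l) * ennreal (l powr (m-1)))"
  proof (cases "0 < l")
   case True
   then have "(\<integral>\<^sup>+x. (if 0 < l & 2 * c * l powr th < v x then ennreal (l powr (m-1)) else 0) \<partial>M)
    = (\<integral>\<^sup>+x. ennreal (l powr (m-1)) * indicator (E l) x \<partial>M)"
    by (intro nn_integral_cong) (auto simp: E_def indicator_def)
   also have "... = ennreal (l powr (m-1)) * emeasure M (E l)"
    by (rule nn_integral_cmult_indicator) measurable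
   finally show ?thesis using True by (simp add: mult.commute)
  qed simp
 qed
 also have "... <= (NNI l. indicator {0<..} l * (ennreal ((A/c) powr a * l powr (p-2)) * G l))"
  using level by (intro nn_integral_mono) (auto simp: indicator_def)
 also have "... = (NNI l. \<integral>\<^sup>+y. ennreal ((A/c) powr a) * (if 0 < l & l < g y then ennreal (l powr (p-1-1)) * ennreal (g y) else 0) \<partial>N)"
 proof (rule nn_integral_cong)
  fix l :: real
  show "indicator {0<..} l * (ennreal ((A/c) powr a * l powr (p-2)) * G l) =
   (\<integral>\<^sup>+y. ennreal ((A/c) powr a) * (if 0 < l & l < g y then ennreal (l powr (p-1-1)) * ennreal (g y) else 0) \<partial>N)"
  proof (cases "0 < l")
   case True
   have "(\<integral>\<^sup>+y. ennreal ((A/c) powr a) * (if 0 < l & l < g y then ennreal (l powr (p-1-1)) * ennreal (g y) else 0) \<partial>N)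
    = (\<integral>\<^sup>+y. ennreal ((A/c) powr a * l powr (p-2)) * (ennreal (g y) * indicator {y. l < g y} y) \<partial>N)"
    using True by (intro nn_integral_cong) (auto simp: indicator_def ennreal_mult' mult_ac)
   also have "... = ennreal ((A/c) powr a * l powr (p-2)) * G l"
    unfolding G_def by (rule nn_integral_cmult) measurable
   finally show ?thesis using True by simp
  qed simp
 qed
 also have "... = (\<integral>\<^sup>+y. \<integral>\<^sup>+l. ennreal ((A/c) powr a) * (if 0 < l & l < g y then ennreal (l powr (p-1-1)) * ennreal (g y) else 0) \<partial>lborel \<partial>N)"
  by (rule P2.Fubini') measurable
 also have "... = (\<integral>\<^sup>+y. ennreal ((A/c) powr a / (p-1)) * ennreal (g y powr p) \<partial>N)"
 proof (rule nn_integral_cong)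
  fix y
  have "(NNI l. ennreal ((A/c) powr a) * (if 0 < l & l < g y then ennreal (l powr (p-1-1)) * ennreal (g y) else 0))
   = (NNI l. ennreal ((A/c) powr a * g y) * (ennreal (l powr (p-1-1)) * indicator {0<..<g y} l))"
   by (intro nn_integral_cong) (simp add: ennreal_mult' g0 mult_ac indicator_def)
  also have "... = ennreal ((A/c) powr a * g y) * ennreal (g y powr (p-1) / (p-1))"
   using nn_integral_powr_interval[of "p-1" "g y"] par g0 by (subst nn_integral_cmult) simp_all
  also have "... = ennreal ((A/c) powr a / (p-1)) * ennreal (g y powr p)"
  proof -
   have "g y * g y powr (p-1) = g y powr p"
    using g0[of y] by (cases "g y = 0") (simp_all add: powr_mult_base)
   then have "(A/c) powr a * g y * (g y powr (p-1) / (p-1)) = (A/c) powr a / (p-1) * g y powr p"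
    by (metis (no_types, opaque_lifting) mult.assoc times_divide_eq_left times_divide_eq_right)
   then show ?thesis using par g0 by (simp add: ennreal_mult'[symmetric] mult.assoc)
  qed
  finally show "(NNI l. ennreal ((A/c) powr a) * (if 0 < l & l < g y then ennreal (l powr (p-1-1)) * ennreal (g y) else 0))
   = ennreal ((A/c) powr a / (p-1)) * ennreal (g y powr p)" .
 qed
 also have "... = ennreal ((A/c) powr a / (p-1)) * (\<integral>\<^sup>+y. ennreal (g y powr p) \<partial>N)"
  by (rule nn_integral_cmult) measurable
 also have "... <= ennreal ((A/c) powr a / (p-1)) * 1" by (intro mult_left_mono gp) auto
 finally have "(\<integral>\<^sup>+x. ennreal (v x powr q) \<partial>M) <= ennreal ((2*c) powr q * m) * ennreal ((A/c) powr a / (p-1))"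
  by (simp add: mult_left_mono)
 then show ?thesis using m par
  by (simp add: interp_const_def q_def m_def ennreal_mult'[symmetric])
qed

text \<open>Young's inequality with crude constants, by comparing \<open>y\<close> with
  \<open>x powr (p-1)\<close>. The loss is the factor 2 in \<open>nn_holder_le\<close>.\<close>

lemma times_le_powr_add:
 fixes x y p p' :: real
 assumes "0 <= x" "0 <= y" "1 < p" "p' = p / (p-1)"
 shows "x * y <= x powr p + y powr p'"
proof (cases "x = 0 \<or> y = 0")
 case False
 then have pos: "0 < x" "0 < y" using assms by auto
 show ?thesis
 proof (cases "y <= x powr (p-1)")
  case True
  then have "x * y <= x * x powr (p-1)" using pos by simp
  also have "... = x powr p" using pos by (simp add: powr_mult_base)
  finally show ?thesis by (rule order.trans) simp
 next
  case False
  then have "(x powr (p-1)) powr (1/(p-1)) <= y powr (1/(p-1))" using assms by (intro powr_mono2) auto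
  then have "x <= y powr (1/(p-1))" using assms pos by (simp add: powr_powr)
  then have "x * y <= y powr (1/(p-1)) * y" using pos by simp
  also have "... = y powr (1 + 1/(p-1))" using pos by (simp add: powr_add mult.commute)
  also have "1 + 1/(p-1) = p'" using assms by (simp add: field_simps)
  finally show ?thesis by (rule order.trans) simp
 qed
qed auto

lemma nn_holder_le:
 fixes f k :: "'x => real"
 assumes p: "1 < p" "p' = p / (p-1)" and S: "0 < S"
  and [measurable]: "f \<in> borel_measurable M" "k \<in> borel_measurable M"
  and pos: "!!x. 0 <= f x" "!!x. 0 <= k x"
  and f: "(\<integral>\<^sup>+x. ennreal (f x powr p) \<partial>M) <= 1"
  and k: "(\<integral>\<^sup>+x. ennreal (k x powr p') \<partial>M) <= ennreal S"
 shows "(\<integral>\<^sup>+x. ennreal (k x * f x) \<partial>M) <= ennreal (2 * S powr (1/p'))"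
proof -
 define s where "s = S powr (1/p')"
 have p': "0 < p'" using p by simp
 have s: "0 < s" "s powr p' = S" using S p' by (auto simp: s_def powr_powr)
 have "k x * f x <= s * (f x powr p + k x powr p' / S)" for x
 proof -
  have "k x * f x = s * (f x * (k x / s))" using s by simp
  also have "... <= s * (f x powr p + (k x / s) powr p')"
   using pos p s by (intro mult_left_mono times_le_powr_add) auto
  also have "(k x / s) powr p' = k x powr p' / S" using s pos by (simp add: powr_divide)
  finally show ?thesis .
 qed
 then have "(\<integral>\<^sup>+x. ennreal (k x * f x) \<partial>M) <= (\<integral>\<^sup>+x. ennreal (s * (f x powr p + k x powr p' / S)) \<partial>M)"
  by (intro nn_integral_mono ennreal_leI)
 also have "... = (\<integral>\<^sup>+x. ennreal s * (ennreal (f x powr p) + ennreal (1/S) * ennreal (k x powr p')) \<partial>M)"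
  using s S by (intro nn_integral_cong) (simp add: ennreal_mult'[symmetric] ennreal_plus[symmetric] del: ennreal_plus)
 also have "... = ennreal s * ((\<integral>\<^sup>+x. ennreal (f x powr p) \<partial>M) + ennreal (1/S) * (\<integral>\<^sup>+x. ennreal (k x powr p') \<partial>M))"
  by (simp add: nn_integral_cmult nn_integral_add)
 also have "... <= ennreal s * (1 + ennreal (1/S) * ennreal S)"
  by (intro mult_left_mono add_mono f k) auto
 also have "... = ennreal (2 * s)"
 proof -
  have "ennreal (1/S) * ennreal S = 1" using S by (simp add: ennreal_mult'[symmetric])
  moreover have "ennreal s * ennreal 2 = ennreal (2 * s)" using s by (subst ennreal_mult'[symmetric]) (auto simp: mult.commute)
  ultimately show ?thesis by simp
 qed
 finally show ?thesis by (simp add: s_def)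
qed

text \<open>Hedberg's splitting. Inside the ball of radius \<open>R = l powr (-p/n)\<close> the
  density is at most \<open>l\<close>. Outside, Hoelder's inequality applies with the normalisation
  \<open>gp\<close>, where \<open>k * p < n\<close> makes the power of the kernel integrable at
  infinity. This radius gives both parts the same power of \<open>l\<close>.\<close>

lemma riesz_small_values:
 fixes g :: "'a::euclidean_space => real" and k p :: real
 assumes kp: "0 < k" "k < DIM('a)" "1 < p" "k * p < DIM('a)"
  and g [measurable]: "g \<in> bmb" and g0: "!!y. 0 <= g y"
  and gp: "(NNI y. ennreal (g y powr p)) <= 1" and l: "0 < l"
 defines "n \<equiv> real DIM('a)" and "V \<equiv> unit_ball_vol (real DIM('a))"
 shows "(NNI y. rker (n-k) x y * (ennreal (g y) * indicator {y. g y <= l} y)) <=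
  ennreal ((V * near_const n (n-k) + 2 * (V * far_const n ((n-k)*(p/(p-1)))) powr (1/(p/(p-1)))) * l powr (1-k*p/n))"
proof -
 define p' where "p' = p/(p-1)"
 define R where "R = l powr (-p/n)"
 have n: "0 < n" by (simp add: n_def)
 have V: "0 < V" by (simp add: V_def)
 have p': "0 < p'" using kp by (simp add: p'_def)
 have R: "0 < R" using l by (simp add: R_def)
 have b: "0 <= n-k" "n-k < n" using kp by (auto simp: n_def)
 have bp': "n < (n-k)*p'"
 proof -
  have "n*(p-1) < (n-k)*p" using kp by (simp add: n_def algebra_simps)
  then show ?thesis using kp by (simp add: p'_def pos_less_divide_eq)
 qed
 have nc: "0 < near_const n (n-k)" using b by (intro near_const_pos)
 have fc: "0 < far_const n ((n-k)*p')" using bp' by (intro far_const_pos)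
 have "(NNI y. rker (n-k) x y * (ennreal (g y) * indicator {y. g y <= l} y)) <=
   (NNI y. ennreal l * (rker (n-k) y x * indicator (ball x R) y) + rker (n-k) y x * indicator (- ball x R) y * ennreal (g y))"
 proof (intro nn_integral_mono)
  fix y
  show "rker (n-k) x y * (ennreal (g y) * indicator {y. g y <= l} y) <=
   ennreal l * (rker (n-k) y x * indicator (ball x R) y) + rker (n-k) y x * indicator (- ball x R) y * ennreal (g y)"
  proof (cases "y \<in> ball x R")
   case True
   have "ennreal (g y) * indicator {y. g y <= l} y <= ennreal l" by (auto simp: indicator_def intro: ennreal_leI)
   then have "rker (n-k) x y * (ennreal (g y) * indicator {y. g y <= l} y) <= rker (n-k) x y * ennreal l"
    by (rule mult_left_mono) simp
   then show ?thesis using True by (simp add: rker_commute[of _ y x] mult.commute)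
  next
   case False
   then show ?thesis by (auto simp: rker_commute[of _ y x] indicator_def)
  qed
 qed
 also have "... = ennreal l * (NNI y. rker (n-k) y x * indicator (ball x R) y)
   + (NNI y. rker (n-k) y x * indicator (- ball x R) y * ennreal (g y))"
  by (subst nn_integral_add) (simp_all add: nn_integral_cmult)
 also have "... <= ennreal l * ennreal (V * near_const n (n-k) * R powr (n-(n-k)))
   + ennreal (2 * (V * far_const n ((n-k)*p') * R powr (n-(n-k)*p')) powr (1/p'))"
 proof (intro add_mono mult_left_mono)
  show "(NNI y. rker (n-k) y x * indicator (ball x R) y) <= ennreal (V * near_const n (n-k) * R powr (n-(n-k)))"
   unfolding n_def V_def by (rule rker_near[OF ahlfors_lborel]) (use R b in \<open>auto simp: n_def\<close>)
  have "(NNI y. rker (n-k) y x * indicator (- ball x R) y * ennreal (g y))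
   = (NNI y. ennreal ((dist y x powr (-(n-k)) * indicator (- ball x R) y) * g y))"
   by (intro nn_integral_cong) (auto simp: rker_def indicator_def ennreal_mult')
  also have "... <= ennreal (2 * (V * far_const n ((n-k)*p') * R powr (n-(n-k)*p')) powr (1/p'))"
  proof (rule nn_holder_le[OF \<open>1 < p\<close> p'_def])
   show "(NNI y. ennreal ((dist y x powr (-(n-k)) * indicator (- ball x R) y) powr p')) <= ennreal (V * far_const n ((n-k)*p') * R powr (n-(n-k)*p'))"
   proof -
    have "(NNI y. ennreal ((dist y x powr (-(n-k)) * indicator (- ball x R) y) powr p'))
     = (NNI y. rker ((n-k)*p') y x * indicator (- ball x R) y)"
    proof (intro nn_integral_cong)
     fix y
     have "(dist y x powr (-(n-k))) powr p' = dist y x powr (-((n-k)*p'))"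
      by (simp only: powr_powr mult_minus_left)
     then show "ennreal ((dist y x powr (-(n-k)) * indicator (- ball x R) y) powr p') = rker ((n-k)*p') y x * indicator (- ball x R) y"
      by (auto simp: rker_def indicator_def simp del: minus_diff_eq)
    qed
    also have "... <= ennreal (V * far_const n ((n-k)*p') * R powr (n-(n-k)*p'))"
     unfolding n_def V_def by (rule rker_far[OF ahlfors_lborel]) (use R bp' in \<open>auto simp: n_def\<close>)
    finally show ?thesis .
   qed
  qed (use V fc R g0 gp in auto)
  finally show "(NNI y. rker (n-k) y x * indicator (- ball x R) y * ennreal (g y))
   <= ennreal (2 * (V * far_const n ((n-k)*p') * R powr (n-(n-k)*p')) powr (1/p'))" .
 qed simp
 also have "... = ennreal (V * near_const n (n-k) * l powr (1-k*p/n)) + ennreal (2 * (V * far_const n ((n-k)*p')) powr (1/p') * l powr (1-k*p/n))"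
 proof (rule arg_cong2[where f="(+)"])
  have "l * R powr (n-(n-k)) = l powr 1 * l powr ((-p/n)*k)" unfolding R_def powr_powr using l by simp
  also have "... = l powr (1-k*p/n)" unfolding powr_add[symmetric] by (simp add: mult.commute)
  finally have "l * (V * near_const n (n-k) * R powr (n-(n-k))) = V * near_const n (n-k) * l powr (1-k*p/n)"
   by (metis mult.assoc mult.commute)
  then show "ennreal l * ennreal (V * near_const n (n-k) * R powr (n-(n-k))) = ennreal (V * near_const n (n-k) * l powr (1-k*p/n))"
   using l by (metis ennreal_mult' less_imp_le)
  have e1: "-p/n * (n-(n-k)*p') * (1/p') = -(p/p') + p*(n-k)/n" using n p' by (simp add: field_simps)
  have "p/p' = p-1" using kp by (simp add: p'_def)
  then have "-(p/p') + p*(n-k)/n = 1-p+p*(n-k)/n" by simp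
  also have "... = 1-k*p/n" using n by (simp add: field_simps)
  finally have ex: "-p/n * (n-(n-k)*p') * (1/p') = 1-k*p/n" unfolding e1 .
  have "(V * far_const n ((n-k)*p') * R powr (n-(n-k)*p')) powr (1/p') = (V * far_const n ((n-k)*p')) powr (1/p') * l powr (1-k*p/n)"
   unfolding R_def powr_mult powr_powr ex ..
  then show "ennreal (2 * (V * far_const n ((n-k)*p') * R powr (n-(n-k)*p')) powr (1/p')) = ennreal (2 * (V * far_const n ((n-k)*p')) powr (1/p') * l powr (1-k*p/n))"
   by simp
 qed
 also have "... = ennreal (V * near_const n (n-k) * l powr (1-k*p/n) + 2 * (V * far_const n ((n-k)*p')) powr (1/p') * l powr (1-k*p/n))"
  using V nc by (intro ennreal_plus[symmetric]) auto
 finally show ?thesis by (simp only: p'_def distrib_right)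
qed

text \<open>Fubini and \<open>rker_set\<close> yield the hypothesis \<open>weak\<close> of
  \<open>interpolation\<close> with \<open>a = al/b\<close>. The growth of \<open>M\<close> enters
  here; \<open>N\<close> stays general in order to serve volume and boundary densities
  alike.\<close>

lemma nn_integral_rker_swap:
 fixes M N :: "'a::euclidean_space measure"
 assumes M: "ahlfors M al C" "finite_measure M" and N: "sigma_finite_measure N" "sets N = sets borel"
  and b: "0 <= b" "b < al"
  and E: "E \<in> sets M" and f: "f \<in> bmb"
 shows "(\<integral>\<^sup>+x. (\<integral>\<^sup>+y. rker b x y * f y \<partial>N) * indicator E x \<partial>M) <=
  ennreal (set_const al b C * measure M E powr (1-b/al)) * (\<integral>\<^sup>+y. f y \<partial>N)"
proof -
 interpret M: finite_measure M by (rule M(2))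
 interpret N: sigma_finite_measure N by (rule N(1))
 interpret P: pair_sigma_finite M N ..
 note [measurable_cong] = N(2) ahlforsD(1)[OF M(1)]
 have E' [measurable]: "E \<in> sets borel" using E ahlforsD(1)[OF M(1)] by simp
 note f[measurable]
 have "(\<integral>\<^sup>+x. (\<integral>\<^sup>+y. rker b x y * f y \<partial>N) * indicator E x \<partial>M) = (\<integral>\<^sup>+x. \<integral>\<^sup>+y. f y * (rker b x y * indicator E x) \<partial>N \<partial>M)"
  by (subst nn_integral_multc[symmetric]) (auto intro!: nn_integral_cong simp: mult_ac)
 also have "... = (\<integral>\<^sup>+y. \<integral>\<^sup>+x. f y * (rker b x y * indicator E x) \<partial>M \<partial>N)"
  by (rule P.Fubini'[symmetric]) measurable
 also have "... = (\<integral>\<^sup>+y. f y * (\<integral>\<^sup>+x. rker b x y * indicator E x \<partial>M) \<partial>N)"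
  by (intro nn_integral_cong nn_integral_cmult) measurable
 also have "... <= (\<integral>\<^sup>+y. f y * ennreal (set_const al b C * measure M E powr (1-b/al)) \<partial>N)"
  by (intro nn_integral_mono mult_left_mono rker_set[OF M(1) b E']) (auto simp: M.emeasure_eq_measure)
 also have "... = (\<integral>\<^sup>+y. f y \<partial>N) * ennreal (set_const al b C * measure M E powr (1-b/al))"
  by (rule nn_integral_multc) measurable
 finally show ?thesis by (simp add: mult.commute)
qed

lemma set_const_pos: "b < a ==> 0 < C ==> 0 < set_const a b C"
 unfolding set_const_def using near_const_pos[of b a] by (simp add: add_pos_pos)

lemma riesz_strong:
 fixes k p al C :: real
 assumes kp: "0 < k" "k < DIM('a::euclidean_space)" "1 < p" "k * p < DIM('a)"
  and al: "DIM('a) - k < al" and C: "0 < C"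
 shows "EX K>0. ALL (M :: 'a measure) g v. ahlfors M al C --> finite_measure M -->
   g \<in> bmb --> (ALL y. 0 <= g y) --> (NNI y. ennreal (g y powr p)) <= 1 -->
   v \<in> borel_measurable M --> (ALL x. 0 <= v x) -->
   (ALL x. ennreal (v x) <= (NNI y. rker (DIM('a) - k) x y * ennreal (g y))) -->
   (\<integral>\<^sup>+x. ennreal (v x powr (p * al / (DIM('a) - k * p))) \<partial>M) <= ennreal K"
proof -
 define n where "n = real DIM('a)"
 define V where "V = unit_ball_vol (real DIM('a))"
 define b where "b = n - k"
 define th where "th = 1 - k*p/n"
 define c where "c = V * near_const n b + 2 * (V * far_const n (b*(p/(p-1)))) powr (1/(p/(p-1)))"
 define A where "A = set_const al b C"
 have n: "0 < n" by (simp add: n_def)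
 have b: "0 < b" "b < al" "b < n" using kp al by (auto simp: b_def n_def)
 have th: "0 < th" using kp by (simp add: th_def n_def)
 have V: "0 < V" by (simp add: V_def)
 have c: "0 < c" unfolding c_def using V near_const_pos[of b n] b by (intro add_pos_nonneg) auto
 have A: "0 < A" using b C by (simp add: A_def set_const_pos)
 \<comment> \<open>The exponent that \<open>interpolation\<close> returns is the Sobolev exponent of
   a potential of order \<open>k\<close> with respect to a measure of dimension
   \<open>al\<close>.\<close>
 have q: "al/b*(th+p-1)/th = p*al/(n-k*p)"
 proof -
  have "th*n = n-k*p" using n by (simp add: th_def field_simps)
  moreover have "(th+p-1)*n = p*b" using n by (simp add: th_def b_def field_simps)
  ultimately have "al/b*((th+p-1)*n)/(th*n) = al/b*(p*b)/(n-k*p)" by simp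
  then show ?thesis using n b by simp
 qed
 show ?thesis
 proof (intro exI[of _ "1 + interp_const (al/b) p th c A"] conjI allI impI)
  have "0 <= interp_const (al/b) p th c A" unfolding interp_const_def using b th kp c A by simp
  then show "0 < 1 + interp_const (al/b) p th c A" by simp
  fix M :: "'a measure" and g v :: "'a => real"
  assume M: "ahlfors M al C" "finite_measure M"
   and g [measurable]: "g \<in> bmb" and g0: "ALL y. 0 <= g y"
   and gp: "(NNI y. ennreal (g y powr p)) <= 1"
   and v: "v \<in> borel_measurable M" "ALL x. 0 <= v x"
   and vle: "ALL x. ennreal (v x) <= (NNI y. rker (DIM('a) - k) x y * ennreal (g y))"
  note [measurable_cong] = ahlforsD(1)[OF M(1)]
  let ?R = "%l x. \<integral>\<^sup>+y. rker b x y * (ennreal (g y) * indicator {y. l < g y} y) \<partial>lborel"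
  have "(\<integral>\<^sup>+x. ennreal (v x powr (al/b*(th+p-1)/th)) \<partial>M) <= ennreal (interp_const (al/b) p th c A)"
  proof (rule interpolation[where N = lborel and g = g and R = ?R])
   show "sigma_finite_measure (lborel :: 'a measure)" by unfold_locales
   show "?R l \<in> borel_measurable M" for l by measurable
   fix l :: real assume l: "0 < l"
   show "ennreal (v x) <= ennreal (c * l powr th) + ?R l x" for x
   proof -
    have "ennreal (v x) <= (NNI y. rker b x y * ennreal (g y))" using vle by (simp add: b_def n_def)
    also have "... = (NNI y. rker b x y * (ennreal (g y) * indicator {y. g y <= l} y) + rker b x y * (ennreal (g y) * indicator {y. l < g y} y))"
     by (intro nn_integral_cong) (auto simp: indicator_def)
    also have "... = (NNI y. rker b x y * (ennreal (g y) * indicator {y. g y <= l} y)) + ?R l x"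
     by (rule nn_integral_add) measurable
    also have "... <= ennreal (c * l powr th) + ?R l x"
     unfolding c_def th_def b_def n_def V_def
     by (intro add_right_mono riesz_small_values) (use kp g0 gp l in auto)
    finally show ?thesis .
   qed
   fix E assume E: "E \<in> sets M"
   show "(\<integral>\<^sup>+x. ?R l x * indicator E x \<partial>M) <= ennreal (A * measure M E powr (1 - 1/(al/b))) *
      (NNI y. ennreal (g y) * indicator {y. l < g y} y)"
    using nn_integral_rker_swap[OF M, of lborel b E "%y. ennreal (g y) * indicator {y. l < g y} y"] b E
    by (simp add: A_def lborel.sigma_finite_measure_axioms)
  qed (use M g0 gp v b th kp c A in auto)
  also have "... <= ennreal (1 + interp_const (al/b) p th c A)" by (intro ennreal_leI) simp
  finally show "(\<integral>\<^sup>+x. ennreal (v x powr (p * al / (DIM('a) - k * p))) \<partial>M) <= ennreal (1 + interp_const (al/b) p th c A)"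
   unfolding q by (simp add: n_def)
 qed
qed

section \<open>Compactly supported smooth kernels\<close>

definition expinv :: "real poly => real => real" where
 "expinv P t = (if 0 < t then poly P (1/t) * exp (-(1/t)) else 0)"

lemma expinv_limit: "((%t. poly P (1/t) * exp (-(1/t))) \<longlongrightarrow> 0) (at_right (0::real))"
proof -
 have "((%s. \<Sum>i\<le>degree P. coeff P i * (s ^ i / exp s)) \<longlongrightarrow> (\<Sum>i\<le>degree P. coeff P i * 0)) at_top"
  by (intro tendsto_sum tendsto_mult tendsto_const tendsto_power_div_exp_0)
 also have "(%s. \<Sum>i\<le>degree P. coeff P i * (s ^ i / exp s)) = (%s. poly P s * exp (-s))"
  by (simp add: poly_altdef sum_distrib_right exp_minus divide_inverse mult.assoc)
 finally have "((%s. poly P s * exp (-s)) \<longlongrightarrow> 0) at_top" by simp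
 then show ?thesis
  by (simp add: filterlim_at_top_to_right inverse_eq_divide)
qed

text \<open>For positive \<open>t\<close> the chain rule gives the polynomial
  \<open>x^2 * (P - P')\<close> in \<open>x = 1/t\<close>, and at 0 the exponential beats every
  polynomial. The polynomial is a parameter so that the family is closed under differentiation and
  no formula for higher derivatives is needed.\<close>

lemma expinv_deriv: "(expinv P has_real_derivative expinv ([:0,0,1:] * (P - pderiv P)) t) (at t)"
proof -
 consider "0 < t" | "t < 0" | "t = 0" by linarith
 then show ?thesis
 proof cases
  case 1
  have "((%t. poly P (1/t) * exp (-(1/t))) has_real_derivative expinv ([:0,0,1:] * (P - pderiv P)) t) (at t)"
   using 1 by (auto intro!: derivative_eq_intros simp: expinv_def field_simps power2_eq_square)
  then show ?thesis
   by (rule has_field_derivative_transform_within_open[of _ _ _ "{0<..}"]) (use 1 in \<open>auto simp: expinv_def\<close>)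
 next
  case 2
  have "((%t::real. 0) has_real_derivative expinv ([:0,0,1:] * (P - pderiv P)) t) (at t)"
   using 2 by (auto simp: expinv_def)
  then show ?thesis
   by (rule has_field_derivative_transform_within_open[of _ _ _ "{..<0}"]) (use 2 in \<open>auto simp: expinv_def\<close>)
 next
  case 3
  have "((%h. expinv P h / h) \<longlongrightarrow> 0) (at_right 0)"
  proof (rule Lim_transform_eventually[OF expinv_limit[of "[:0,1:] * P"]])
   show "\<forall>\<^sub>F h in at_right 0. poly ([:0, 1:] * P) (1/h) * exp (-(1/h)) = expinv P h / h"
    by (auto simp: eventually_at_filter expinv_def)
  qed
  moreover have "((%h. expinv P h / h) \<longlongrightarrow> 0) (at_left 0)"
   by (rule Lim_transform_eventually[OF tendsto_const[of 0]]) (auto simp: eventually_at_filter expinv_def)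
  ultimately have "((%h. expinv P h / h) \<longlongrightarrow> 0) (at 0)"
   by (simp add: filterlim_at_split)
  then show ?thesis using 3 by (simp add: has_field_derivative_iff expinv_def)
 qed
qed

text \<open>Sums are included because the product rule leads out of the set of single products. For
  positive \<open>a\<close> all members vanish when \<open>1/a <= |t|\<close>, so differentiation
  does not enlarge the support.\<close>

inductive_set bump_span :: "real => (real => real) set" for a :: real where
 base: "(%t. expinv P (1 + a*t) * expinv Q (1 - a*t)) \<in> bump_span a"
| add: "f \<in> bump_span a ==> g \<in> bump_span a ==> (%t. f t + g t) \<in> bump_span a"

lemma expinv_smult: "expinv (smult c P) t = c * expinv P t"
 by (simp add: expinv_def)

lemma bump_span_deriv: "f \<in> bump_span a ==> EX f':bump_span a. ALL t. (f has_real_derivative f' t) (at t)"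
proof (induction rule: bump_span.induct)
 case (base P Q)
 let ?D = "%P. [:0,0,1:] * (P - pderiv P)"
 have D: "((%t. expinv P (1 + a*t) * expinv Q (1 - a*t)) has_real_derivative
  (expinv (smult a (?D P)) (1 + a*t) * expinv Q (1 - a*t) + expinv P (1 + a*t) * expinv (smult (-a) (?D Q)) (1 - a*t))) (at t)" for t
  unfolding expinv_smult
  by (auto intro!: derivative_eq_intros DERIV_chain'[OF _ expinv_deriv] simp: algebra_simps)
 have "(%t. expinv (smult a (?D P)) (1 + a*t) * expinv Q (1 - a*t) + expinv P (1 + a*t) * expinv (smult (-a) (?D Q)) (1 - a*t)) \<in> bump_span a"
  by (intro bump_span.add bump_span.base)
 then show ?case using D by (intro bexI[where x = "%t. expinv (smult a (?D P)) (1 + a*t) * expinv Q (1 - a*t) + expinv P (1 + a*t) * expinv (smult (-a) (?D Q)) (1 - a*t)"] allI) assumption+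
next
 case (add f g)
 then obtain f' g' where "f' \<in> bump_span a" "g' \<in> bump_span a"
  "!!t. (f has_real_derivative f' t) (at t)" "!!t. (g has_real_derivative g' t) (at t)" by blast
 then show ?case by (intro bexI[of _ "%t. f' t + g' t"]) (auto intro: bump_span.add derivative_intros)
qed

lemma bump_span_support: "f \<in> bump_span a ==> 0 < a ==> 1/a <= \<bar>t\<bar> ==> f t = 0"
 by (induction rule: bump_span.induct) (auto simp: expinv_def field_simps abs_if split: if_splits)

text \<open>Iterating one choice of derivatives in \<open>bump_span\<close> yields all derivatives
  as one sequence. It is applied with \<open>a\<close> the dimension: a product over the coordinates
  is then supported in the unit ball, because the l1 norm dominates the Euclidean norm.\<close>

lemma bump_exists:
 fixes a :: real assumes a: "0 < a"
 shows "EX F :: nat => real => real. (ALL k t. (F k has_real_derivative F (Suc k) t) (at t)) &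
  (ALL k t. 1/a <= \<bar>t\<bar> --> F k t = 0) & (ALL t. 0 <= F 0 t) & 0 < F 0 0"
proof -
 have "EX d. ALL f:bump_span a. d f \<in> bump_span a & (ALL t. (f has_real_derivative d f t) (at t))"
  by (rule bchoice) (use bump_span_deriv[of _ a] in blast)
 then obtain d where d: "!!f. f \<in> bump_span a ==> d f \<in> bump_span a"
  "!!f t. f \<in> bump_span a ==> (f has_real_derivative d f t) (at t)"
  by blast
 define f where "f t = expinv 1 (1 + a*t) * expinv 1 (1 - a*t)" for t
 have f: "f \<in> bump_span a" unfolding f_def by (rule bump_span.base)
 define F where "F k = (d ^^ k) f" for k
 have F: "F k \<in> bump_span a" for k by (induction k) (auto simp: F_def f d)
 show ?thesis
 proof (intro exI[of _ F] conjI allI impI)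
  show "(F k has_real_derivative F (Suc k) t) (at t)" for k t using d(2)[OF F[of k]] by (simp add: F_def)
  show "F k t = 0" if "1/a <= \<bar>t\<bar>" for k t by (rule bump_span_support[OF F a that])
  show "0 <= F 0 t" "0 < F 0 0" for t by (auto simp: F_def f_def expinv_def)
 qed
qed

locale bump =
 fixes F :: "nat => real => real" and dummy :: "'a::euclidean_space itself"
 assumes F_deriv: "(F k has_real_derivative F (Suc k) t) (at t)"
  and F_supp: "1 / DIM('a) <= \<bar>t\<bar> ==> F k t = 0"
  and F_nonneg: "0 <= F 0 t" and F_pos: "0 < F 0 0"
begin

definition pF :: "('a => nat) => 'a => real" where
 "pF ka v = (\<Prod>i\<in>Basis. F (ka i) (v \<bullet> i))"

lemma F_cont: "continuous_on UNIV (F k)"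
 using F_deriv by (intro continuous_at_imp_continuous_on ballI) (rule DERIV_isCont)

lemma pF_cont: "continuous_on UNIV (pF ka)"
 unfolding pF_def
 by (intro continuous_on_prod continuous_on_compose2[OF F_cont] continuous_intros) auto

lemma pF_measurable [measurable]: "pF ka \<in> bmb"
 by (rule borel_measurable_continuous_onI[OF pF_cont])

lemma pF_supp: "1 <= norm v ==> pF ka v = 0"
proof -
 assume v: "1 <= norm v"
 have "EX i:Basis. 1 / DIM('a) <= \<bar>v \<bullet> i\<bar>"
 proof (rule ccontr)
  assume "\<not> ?thesis"
  then have "(\<Sum>i\<in>Basis. \<bar>v \<bullet> i\<bar>) < (\<Sum>i\<in>(Basis::'a set). 1 / DIM('a))"
   by (intro sum_strict_mono) auto
  then show False using norm_le_l1[of v] v by simp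
 qed
 then have "EX i:Basis. F (ka i) (v \<bullet> i) = 0" using F_supp by blast
 then show ?thesis unfolding pF_def by (intro prod_zero) auto
qed

lemma pF_nonneg: "0 <= pF (%_. 0) v"
 unfolding pF_def by (intro prod_nonneg) (auto simp: F_nonneg)

lemma pF_bound: "EX B>0. ALL v. \<bar>pF ka v\<bar> <= B"
proof -
 have "compact (pF ka ` cball 0 1)"
  by (intro compact_continuous_image continuous_on_subset[OF pF_cont]) auto
 then have "bounded (pF ka ` cball 0 1)" by (rule compact_imp_bounded)
 then obtain B where B: "0 < B" "!!v. v \<in> cball 0 1 ==> \<bar>pF ka v\<bar> <= B"
  unfolding bounded_pos by auto
 have "\<bar>pF ka v\<bar> <= B" for v
  using B pF_supp[of v ka] by (cases "norm v <= 1") auto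
 then show ?thesis using B by blast
qed

lemma pF_deriv:
 "((%t. pF ka (v + t *\<^sub>R th)) has_real_derivative (\<Sum>i\<in>Basis. (th \<bullet> i) * pF (ka(i := Suc (ka i))) (v + t *\<^sub>R th))) (at t)"
proof -
 have "((%t. \<Prod>i\<in>Basis. F (ka i) (v \<bullet> i + t * (th \<bullet> i))) has_real_derivative
   (\<Sum>i\<in>Basis. (F (Suc (ka i)) (v \<bullet> i + t * (th \<bullet> i)) * (th \<bullet> i)) * (\<Prod>j\<in>Basis - {i}. F (ka j) (v \<bullet> j + t * (th \<bullet> j))))) (at t)"
  by (rule has_field_derivative_prod) (auto intro!: derivative_eq_intros DERIV_chain'[OF _ F_deriv])
 also have "(\<Sum>i\<in>Basis. (F (Suc (ka i)) (v \<bullet> i + t * (th \<bullet> i)) * (th \<bullet> i)) * (\<Prod>j\<in>Basis - {i}. F (ka j) (v \<bullet> j + t * (th \<bullet> j))))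
  = (\<Sum>i\<in>Basis. (th \<bullet> i) * pF (ka(i := Suc (ka i))) (v + t *\<^sub>R th))"
 proof (rule sum.cong)
  fix i :: 'a assume i: "i \<in> Basis"
  have "pF (ka(i := Suc (ka i))) (v + t *\<^sub>R th) = F (Suc (ka i)) ((v + t *\<^sub>R th) \<bullet> i) * (\<Prod>j\<in>Basis-{i}. F (ka j) ((v + t *\<^sub>R th) \<bullet> j))"
   unfolding pF_def by (subst prod.remove[OF finite_Basis i]) auto
  then show "(F (Suc (ka i)) (v \<bullet> i + t * (th \<bullet> i)) * (th \<bullet> i)) * (\<Prod>j\<in>Basis - {i}. F (ka j) (v \<bullet> j + t * (th \<bullet> j)))
   = (th \<bullet> i) * pF (ka(i := Suc (ka i))) (v + t *\<^sub>R th)"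
   by (simp add: inner_add_left)
 qed simp
 finally show ?thesis by (simp add: pF_def inner_add_left)
qed

text \<open>Test functions centred at \<open>x\<close>; differentiating raises the multi-index.\<close>

definition bf :: "real => real => 'a => ('a => nat) => 'a => real" where
 "bf c de x ka z = c * pF ka ((x - z) /\<^sub>R de)"

lemma bf_deriv:
 assumes i: "i \<in> Basis"
 shows "((%t. bf c de x ka (z + t *\<^sub>R i)) has_real_derivative bf (-c/de) de x (ka(i := Suc (ka i))) z) (at 0)"
proof -
 have eq: "(x - (z + t *\<^sub>R i)) /\<^sub>R de = (x - z) /\<^sub>R de + t *\<^sub>R (- (i /\<^sub>R de))" for t
  by (simp add: algebra_simps)
 have "((%t. c * pF ka ((x - z) /\<^sub>R de + t *\<^sub>R (- (i /\<^sub>R de)))) has_real_derivative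
   c * (\<Sum>j\<in>Basis. (- (i /\<^sub>R de) \<bullet> j) * pF (ka(j := Suc (ka j))) ((x - z) /\<^sub>R de + 0 *\<^sub>R (- (i /\<^sub>R de))))) (at 0)"
  by (intro DERIV_cmult pF_deriv)
 also have "(\<Sum>j\<in>Basis. (- (i /\<^sub>R de) \<bullet> j) * pF (ka(j := Suc (ka j))) ((x - z) /\<^sub>R de + 0 *\<^sub>R (- (i /\<^sub>R de))))
   = (\<Sum>j\<in>{i}. (- (i /\<^sub>R de) \<bullet> j) * pF (ka(j := Suc (ka j))) ((x - z) /\<^sub>R de))"
  using i by (intro sum.mono_neutral_cong_right) (auto simp: inner_not_same_Basis)
 finally show ?thesis unfolding bf_def eq using i by (simp add: field_simps inverse_eq_divide)
qed

lemma dpartial_bf: "i \<in> Basis ==> dpartial i (bf c de x ka) = bf (-c/de) de x (ka(i := Suc (ka i)))"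
 unfolding dpartial_def by (rule ext) (rule the_equality, erule bf_deriv, erule (1) DERIV_unique[OF _ bf_deriv])

text \<open>\<open>C_inf\<close> speaks of all iterated partial derivatives. These are again of the
  form \<open>bf\<close>, so that one step of differentiation settles every order; the coefficient
  is a parameter of \<open>bf\<close> in order to absorb the factors \<open>-1/de\<close>.\<close>

lemma iter_partial_bf: "set is \<subseteq> Basis ==> EX c' ka'. iter_partial is (bf c de x ka) = bf c' de x ka'"
proof (induction "is")
 case Nil
 show ?case unfolding iter_partial.simps by blast
next
 case (Cons i "is")
 then obtain c' ka' where "iter_partial is (bf c de x ka) = bf c' de x ka'" by auto
 then have "iter_partial (i # is) (bf c de x ka) = bf (-c'/de) de x (ka'(i := Suc (ka' i)))"
  using Cons.prems by (simp only: iter_partial.simps dpartial_bf set_simps) (simp add: dpartial_bf)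
 then show ?case by blast
qed

lemma bf_cont: "continuous_on UNIV (bf c de x ka)"
 unfolding bf_def by (intro continuous_intros continuous_on_compose2[OF pF_cont]) auto

lemma C_inf_bf: "C_inf (bf c de x ka)"
 unfolding C_inf_def
proof (intro allI impI)
 fix "is" :: "'a list" assume "set is \<subseteq> Basis"
 then obtain c' ka' where eq: "iter_partial is (bf c de x ka) = bf c' de x ka'" using iter_partial_bf by blast
 show "continuous_on UNIV (iter_partial is (bf c de x ka)) &
  (ALL i:Basis. ALL xa. (%t. iter_partial is (bf c de x ka) (xa + t *\<^sub>R i)) differentiable (at (0::real)))"
  unfolding eq real_differentiable_def using bf_deriv bf_cont by blast
qed

lemma bf_supp: "0 < de ==> de <= dist x z ==> bf c de x ka z = 0"
proof -
 assume "0 < de" "de <= dist x z"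
 then have "1 <= norm ((x - z) /\<^sub>R de)" unfolding norm_scaleR dist_norm by (simp add: field_simps)
 then show ?thesis by (simp add: bf_def pF_supp)
qed

lemma test_fun_bf:
 assumes "0 < de" "cball x de \<subseteq> Om"
 shows "test_fun Om (bf c de x ka)"
proof -
 have "{z. bf c de x ka z ~= 0} \<subseteq> cball x de" using bf_supp[OF assms(1)] by (force simp: not_le)
 then have "closure {z. bf c de x ka z ~= 0} \<subseteq> cball x de" by (simp add: closure_minimal)
 then show ?thesis unfolding test_fun_def using C_inf_bf assms
  by (auto intro: bounded_subset simp: compact_eq_bounded_closed)
qed

end

section \<open>Mollification of functions with a weak Hessian\<close>

lemma nn_integral_lborel_scale:
 fixes f :: "'a::euclidean_space => ennreal"
 assumes [measurable]: "f \<in> bmb" and c: "c ~= 0"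
 shows "(NNI z. f z) = ennreal (\<bar>c\<bar> ^ DIM('a)) * (NNI z. f (t + c *\<^sub>R z))"
proof -
 have "(NNI z. f z) = (\<integral>\<^sup>+z. f z \<partial>density (distr lborel borel (%x. t + c *\<^sub>R x)) (%_. ennreal (\<bar>c\<bar> ^ DIM('a))))"
  using lborel_affine[OF c, of t] by simp
 also have "... = ennreal (\<bar>c\<bar> ^ DIM('a)) * (NNI z. f (t + c *\<^sub>R z))"
  by (subst nn_integral_density) (auto simp: nn_integral_distr nn_integral_cmult)
 finally show ?thesis .
qed

text \<open>By the mean value theorem the difference quotients are at most \<open>B'\<close>, so
  \<open>B'\<close> times the integrable \<open>U\<close> dominates.\<close>

lemma DERIV_integral_bounded:
 fixes Ph Ph' :: "real => 'x => real"
 assumes U: "integrable M U"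
  and D: "!!t z. ((%t. Ph t z) has_real_derivative Ph' t z) (at t)"
  and m [measurable]: "!!t. Ph t \<in> borel_measurable M" "!!t. Ph' t \<in> borel_measurable M"
  and B: "!!t z. \<bar>Ph t z\<bar> <= B" "!!t z. \<bar>Ph' t z\<bar> <= B'"
 shows "((%t. \<integral>z. U z * Ph t z \<partial>M) has_real_derivative (\<integral>z. U z * Ph' t z \<partial>M)) (at t)"
proof -
 have U' [measurable]: "U \<in> borel_measurable M" using U by auto
 have int: "integrable M (%z. U z * Ph t z)" for t
 proof (rule Bochner_Integration.integrable_bound[of M "%z. B * \<bar>U z\<bar>"])
  show "AE z in M. norm (U z * Ph t z) <= norm (B * \<bar>U z\<bar>)"
  proof (intro AE_I2)
   fix z
   have "\<bar>U z\<bar> * \<bar>Ph t z\<bar> <= \<bar>U z\<bar> * \<bar>B\<bar>" using B(1)[of t z] by (intro mult_left_mono) auto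
   then show "norm (U z * Ph t z) <= norm (B * \<bar>U z\<bar>)" by (simp add: abs_mult mult.commute)
  qed
 qed (use U in auto)
 show ?thesis
  unfolding DERIV_def tendsto_at_iff_sequentially comp_def
 proof (intro allI impI)
  fix X :: "nat => real" assume X: "ALL i. X i \<in> UNIV - {0}" "X \<longlonglongrightarrow> 0"
  have "(%i. \<integral>z. U z * ((Ph (t + X i) z - Ph t z) / X i) \<partial>M) \<longlonglongrightarrow> (\<integral>z. U z * Ph' t z \<partial>M)"
  proof (rule integral_dominated_convergence[where w = "%z. \<bar>U z\<bar> * B'"])
   show "AE z in M. (%i. U z * ((Ph (t + X i) z - Ph t z) / X i)) \<longlonglongrightarrow> U z * Ph' t z"
   proof (intro AE_I2 tendsto_mult tendsto_const)
    fix z show "(%i. (Ph (t + X i) z - Ph t z) / X i) \<longlonglongrightarrow> Ph' t z"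
     by (rule D[of z t, unfolded DERIV_def tendsto_at_iff_sequentially comp_def, rule_format, OF X(1)[rule_format] X(2)])
   qed
   show "AE z in M. norm (U z * ((Ph (t + X i) z - Ph t z) / X i)) <= \<bar>U z\<bar> * B'" for i
   proof (intro AE_I2)
    fix z
    have "\<bar>Ph (t + X i) z - Ph t z\<bar> <= B' * \<bar>X i\<bar>"
     using field_differentiable_bound[of UNIV "%t. Ph t z" "%t. Ph' t z" B' "t + X i" t, OF convex_UNIV D] B(2) by simp
    then have "\<bar>(Ph (t + X i) z - Ph t z) / X i\<bar> <= B'" using X by (simp add: field_simps)
    then show "norm (U z * ((Ph (t + X i) z - Ph t z) / X i)) <= \<bar>U z\<bar> * B'"
     unfolding real_norm_def abs_mult by (rule mult_left_mono) simp
   qed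
  qed (use U in auto)
  also have "(%i. \<integral>z. U z * ((Ph (t + X i) z - Ph t z) / X i) \<partial>M)
   = (%i. ((\<integral>z. U z * Ph (t + X i) z \<partial>M) - (\<integral>z. U z * Ph t z \<partial>M)) / X i)"
  proof
   fix i
   have "(\<integral>z. U z * Ph (t + X i) z \<partial>M) - (\<integral>z. U z * Ph t z \<partial>M) = (\<integral>z. U z * Ph (t + X i) z - U z * Ph t z \<partial>M)"
    by (rule Bochner_Integration.integral_diff[symmetric]) (rule int)+
   then show "(\<integral>z. U z * ((Ph (t + X i) z - Ph t z) / X i) \<partial>M)
    = ((\<integral>z. U z * Ph (t + X i) z \<partial>M) - (\<integral>z. U z * Ph t z \<partial>M)) / X i"
    by (simp add: right_diff_distrib)
  qed
  finally show "(%i. ((\<integral>z. U z * Ph (t + X i) z \<partial>M) - (\<integral>z. U z * Ph t z \<partial>M)) / X i) \<longlonglongrightarrow> (\<integral>z. U z * Ph' t z \<partial>M)" .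
 qed
qed

context bump
begin

definition moll :: "real => ('a => real) => ('a => nat) => 'a => real" where
 "moll de U ka x = (\<integral>z. U z * pF ka ((x - z) /\<^sub>R de) \<partial>lborel)"

lemma moll_integrable:
 assumes "integrable lborel U"
 shows "integrable lborel (%z. U z * pF ka ((x - z) /\<^sub>R de))"
proof -
 obtain B where B: "0 < B" "!!v. \<bar>pF ka v\<bar> <= B" using pF_bound by blast
 have [measurable]: "U \<in> bmb" using assms by auto
 show ?thesis
 proof (rule Bochner_Integration.integrable_bound[of _ "%z. B * U z"])
  show "AE z in lborel. norm (U z * pF ka ((x - z) /\<^sub>R de)) <= norm (B * U z)"
   using B by (intro AE_I2) (simp add: abs_mult mult.commute[of B] mult_left_mono)
 qed (use assms in auto)
qed

lemma moll_deriv: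
 assumes U: "integrable lborel U"
 shows "((%t. moll de U ka (x + t *\<^sub>R th)) has_real_derivative
  (\<Sum>i\<in>Basis. (th \<bullet> i) / de * moll de U (ka(i := Suc (ka i))) (x + t *\<^sub>R th))) (at t)"
proof -
 have eq: "(x + t *\<^sub>R th - z) /\<^sub>R de = (x - z) /\<^sub>R de + t *\<^sub>R (th /\<^sub>R de)" for t z
  by (simp add: algebra_simps)
 let ?D = "%t z. \<Sum>i\<in>Basis. (th \<bullet> i) / de * pF (ka(i := Suc (ka i))) ((x + t *\<^sub>R th - z) /\<^sub>R de)"
 obtain B where B: "0 < B" "!!v. \<bar>pF ka v\<bar> <= B" using pF_bound by blast
 have "ALL i. EX B. ALL v. \<bar>pF (ka(i := Suc (ka i))) v\<bar> <= B" using pF_bound by blast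
 then obtain b where b: "!!i v. \<bar>pF (ka(i := Suc (ka i))) v\<bar> <= b i" by metis
 have "((%t. \<integral>z. U z * pF ka ((x + t *\<^sub>R th - z) /\<^sub>R de) \<partial>lborel) has_real_derivative
   (\<integral>z. U z * ?D t z \<partial>lborel)) (at t)"
 proof (rule DERIV_integral_bounded[OF U])
  show "((%t. pF ka ((x + t *\<^sub>R th - z) /\<^sub>R de)) has_real_derivative ?D t z) (at t)" for t z
   using pF_deriv[of ka "(x - z) /\<^sub>R de" "th /\<^sub>R de" t] unfolding eq by (simp add: field_simps inverse_eq_divide)
  show "\<bar>pF ka ((x + t *\<^sub>R th - z) /\<^sub>R de)\<bar> <= B" for t z by (rule B)
  show "\<bar>?D t z\<bar> <= (\<Sum>i\<in>Basis. \<bar>(th \<bullet> i) / de\<bar> * b i)" for t z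
   by (rule order.trans[OF sum_abs]) (auto simp: abs_mult intro!: sum_mono mult_left_mono divide_right_mono b)
 qed measurable
 also have "(\<integral>z. U z * ?D t z \<partial>lborel) = (\<integral>z. (\<Sum>i\<in>Basis. (th \<bullet> i) / de * (U z * pF (ka(i := Suc (ka i))) ((x + t *\<^sub>R th - z) /\<^sub>R de))) \<partial>lborel)"
  by (simp add: sum_distrib_left mult_ac)
 also have "... = (\<Sum>i\<in>Basis. (th \<bullet> i) / de * moll de U (ka(i := Suc (ka i))) (x + t *\<^sub>R th))"
  unfolding moll_def
  by (subst Bochner_Integration.integral_sum) (auto intro!: integrable_mult_right moll_integrable[OF U])
 finally show ?thesis unfolding moll_def .
qed

lemma moll_cont:
 assumes U: "integrable lborel U"
 shows "continuous_on UNIV (moll de U ka)"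
proof (rule continuous_at_imp_continuous_on, intro ballI)
 fix x :: 'a
 obtain B where B: "0 < B" "!!v. \<bar>pF ka v\<bar> <= B" using pF_bound by blast
 have [measurable]: "U \<in> bmb" using U by auto
 show "isCont (moll de U ka) x"
  unfolding continuous_at_sequentially comp_def
 proof (intro allI impI)
  fix X :: "nat => 'a" assume X: "X \<longlonglongrightarrow> x"
  show "(%n. moll de U ka (X n)) \<longlonglongrightarrow> moll de U ka x"
   unfolding moll_def
  proof (rule integral_dominated_convergence[where w = "%z. \<bar>U z\<bar> * B"])
   show "AE z in lborel. (%i. U z * pF ka ((X i - z) /\<^sub>R de)) \<longlonglongrightarrow> U z * pF ka ((x - z) /\<^sub>R de)"
    by (intro AE_I2 tendsto_mult tendsto_const continuous_on_tendsto_compose[OF pF_cont] tendsto_intros X) auto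
   show "AE z in lborel. norm (U z * pF ka ((X i - z) /\<^sub>R de)) <= \<bar>U z\<bar> * B" for i
    by (intro AE_I2) (auto simp: abs_mult intro!: mult_left_mono B)
  qed (use U in auto)
 qed
qed

definition mass :: real where "mass = (\<integral>v. pF (%_. 0) v \<partial>lborel)"

lemma pF_integrable: "integrable lborel (pF ka)"
proof -
 obtain B where B: "0 < B" "!!v. \<bar>pF ka v\<bar> <= B" using pF_bound by blast
 have "integrable lborel (%v::'a. indicator (cball 0 1) v * B)"
  using emeasure_bounded_finite[of "cball (0::'a) 1"] by (intro integrable_mult_left integrable_real_indicator) auto
 then show ?thesis
  by (rule Bochner_Integration.integrable_bound)
   (use B pF_supp[of _ ka] in \<open>auto simp: indicator_def not_le\<close>)
qed

lemma mass_pos: "0 < mass"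
proof -
 have c: "isCont (pF (%_. 0)) 0" using pF_cont continuous_on_eq_continuous_at by blast
 have p: "0 < pF (%_. 0) 0" unfolding pF_def by (intro prod_pos) (auto simp: F_pos)
 have "\<forall>\<^sub>F v in at 0. pF (%_. 0) v > 0" using c p unfolding isCont_def by (rule order_tendstoD)
 then obtain d where d: "0 < d" "!!v. v ~= 0 ==> dist v 0 < d ==> pF (%_. 0) v > 0"
  unfolding eventually_at by auto
 have "\<not> (AE v in lborel. pF (%_. 0) v = 0)"
 proof
  assume "AE v in lborel. pF (%_. 0) v = 0"
  note A = this
  have imp: "v \<notin> ball 0 d" if "pF (%_. 0) v = 0" for v :: 'a
   using d(2)[of v] p that by (cases "v = 0") (auto simp: dist_commute)
  have "AE v in lborel. v \<notin> ball (0::'a) d"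
   by (rule eventually_mono[OF A], rule imp)
  then have "ball (0::'a) d \<in> null_sets lborel" by (subst AE_iff_null_sets) auto
  then have "emeasure lborel (ball (0::'a) d) = 0" by auto
  then show False using d(1) unit_ball_vol_pos[of "real DIM('a)"] by (simp add: emeasure_ball)
 qed
 then have "mass ~= 0" unfolding mass_def
  using integral_nonneg_eq_0_iff_AE[OF pF_integrable, of "%_. 0"] pF_nonneg by simp
 moreover have "0 <= mass" unfolding mass_def by (intro integral_nonneg_AE AE_I2 pF_nonneg)
 ultimately show ?thesis by simp
qed

lemma pF_scale_integral:
 assumes "0 < de"
 shows "(\<integral>z. pF (%_. 0) ((y - z) /\<^sub>R de) \<partial>lborel) = de ^ DIM('a) * mass"
proof -
 have "ennreal mass = (NNI v. ennreal (pF (%_. 0) v))"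
  unfolding mass_def by (rule nn_integral_eq_integral[symmetric, OF pF_integrable]) (auto simp: pF_nonneg)
 also have "... = ennreal (\<bar>-1/de\<bar> ^ DIM('a)) * (NNI z. ennreal (pF (%_. 0) (y /\<^sub>R de + (-1/de) *\<^sub>R z)))"
  using assms by (intro nn_integral_lborel_scale) auto
 also have "(%z. y /\<^sub>R de + (-1/de) *\<^sub>R z) = (%z. (y - z) /\<^sub>R de)"
  by (auto simp: algebra_simps divide_inverse)
 finally have e: "ennreal mass = ennreal (1/de ^ DIM('a)) * (NNI z. ennreal (pF (%_. 0) ((y - z) /\<^sub>R de)))"
  using assms by (simp add: power_one_over divide_inverse power_inverse)
 have "ennreal (de ^ DIM('a) * mass) = ennreal (de ^ DIM('a)) * (ennreal (1/de ^ DIM('a)) * (NNI z. ennreal (pF (%_. 0) ((y - z) /\<^sub>R de))))"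
  unfolding e[symmetric] using assms mass_pos by (simp add: ennreal_mult')
 also have "... = (NNI z. ennreal (pF (%_. 0) ((y - z) /\<^sub>R de)))"
  unfolding mult.assoc[symmetric] using assms by (simp add: ennreal_mult'[symmetric])
 finally have e2: "(NNI z. ennreal (pF (%_. 0) ((y - z) /\<^sub>R de))) = ennreal (de ^ DIM('a) * mass)" by (rule sym)
 have "(\<integral>z. pF (%_. 0) ((y - z) /\<^sub>R de) \<partial>lborel) = enn2real (NNI z. ennreal (pF (%_. 0) ((y - z) /\<^sub>R de)))"
  by (rule integral_eq_nn_integral) (auto simp: pF_nonneg)
 then show ?thesis using assms mass_pos unfolding e2 by simp
qed

end

lemma Cb_closure_bounded:
 assumes "Cb_closure Om u"
 shows "EX B>0. ALL x:closure Om. \<bar>u x\<bar> <= B"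
proof -
 let ?S = "closure {x \<in> closure Om. u x ~= 0}"
 have S: "?S \<subseteq> closure Om" by (intro closure_minimal) auto
 have "compact (u ` ?S)"
  using assms S unfolding Cb_closure_def
  by (intro compact_continuous_image) (auto intro: continuous_on_subset simp: compact_eq_bounded_closed)
 then have "bounded (u ` ?S)" by (rule compact_imp_bounded)
 then obtain B where B: "0 < B" "!!x. x \<in> ?S ==> \<bar>u x\<bar> <= B" unfolding bounded_pos by auto
 have "\<bar>u x\<bar> <= B" if "x \<in> closure Om" for x
  using B closure_subset[of "{x \<in> closure Om. u x ~= 0}"] that by (cases "u x = 0") auto
 then show ?thesis using B by blast
qed

lemma Cb_closure_integrable:
 assumes "open Om" "emeasure lborel Om < \<infinity>" "Cb_closure Om u"
 shows "integrable lborel (%x. indicator Om x * u x)"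
proof -
 obtain B where B: "0 < B" "!!x. x \<in> closure Om ==> \<bar>u x\<bar> <= B" using Cb_closure_bounded[OF assms(3)] by blast
 have "continuous_on Om u" using assms(3) closure_subset unfolding Cb_closure_def by (blast intro: continuous_on_subset)
 then have m: "(%x. indicator Om x *\<^sub>R u x) \<in> bmb"
  using assms(1) by (intro borel_measurable_continuous_on_indicator) auto
 have "integrable lborel (%x. indicator Om x * B)"
  using assms by (intro integrable_mult_left integrable_real_indicator) auto
 then show ?thesis
  by (rule Bochner_Integration.integrable_bound)
   (use m B closure_subset in \<open>auto simp: indicator_def intro!: AE_I2\<close>)
qed

text \<open>Cauchy-Schwarz over pairs of indices; the right factor is the Frobenius norm, as in
  \<open>hess_norm\<close>. The transposed order of indices is the one in which
  \<open>moll_hessian\<close> returns the second derivatives.\<close>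

lemma sum_sum_mult_le_norm:
 fixes th :: "'a::euclidean_space" and a :: "'a => 'a => real"
 shows "\<bar>\<Sum>i\<in>Basis. \<Sum>j\<in>Basis. (th \<bullet> i) * (th \<bullet> j) * a j i\<bar> <= (norm th)\<^sup>2 * sqrt (\<Sum>i\<in>Basis. \<Sum>j\<in>Basis. (a i j)\<^sup>2)"
proof -
 have "(\<Sum>p\<in>Basis\<times>Basis. ((th \<bullet> fst p) * (th \<bullet> snd p)) * a (snd p) (fst p))\<^sup>2
   <= (\<Sum>p\<in>Basis\<times>Basis. ((th \<bullet> fst p) * (th \<bullet> snd p))\<^sup>2) * (\<Sum>p\<in>Basis\<times>Basis. (a (snd p) (fst p))\<^sup>2)"
  by (rule Cauchy_Schwarz_ineq_sum)
 also have "(\<Sum>p\<in>Basis\<times>Basis. ((th \<bullet> fst p) * (th \<bullet> snd p))\<^sup>2) = ((norm th)\<^sup>2)\<^sup>2"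
 proof -
  have "(norm th)\<^sup>2 = (\<Sum>i\<in>Basis. (th \<bullet> i)\<^sup>2)"
   by (subst power2_norm_eq_inner, subst euclidean_inner) (simp add: power2_eq_square)
  then show ?thesis
   by (simp add: sum.cartesian_product' power_mult_distrib power2_eq_square[of "sum _ _"] sum_product)
 qed
 also have "(\<Sum>p\<in>Basis\<times>Basis. (a (snd p) (fst p))\<^sup>2) = (\<Sum>i\<in>Basis. \<Sum>j\<in>Basis. (a i j)\<^sup>2)"
  by (simp only: sum.cartesian_product' fst_conv snd_conv) (rule sum.swap)
 also have "(\<Sum>p\<in>Basis\<times>Basis. ((th \<bullet> fst p) * (th \<bullet> snd p)) * a (snd p) (fst p)) = (\<Sum>i\<in>Basis. \<Sum>j\<in>Basis. (th \<bullet> i) * (th \<bullet> j) * a j i)"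
  by (subst sum.cartesian_product') simp
 finally have "sqrt ((\<Sum>i\<in>Basis. \<Sum>j\<in>Basis. (th \<bullet> i) * (th \<bullet> j) * a j i)\<^sup>2) <= sqrt (((norm th)\<^sup>2)\<^sup>2 * (\<Sum>i\<in>Basis. \<Sum>j\<in>Basis. (a i j)\<^sup>2))"
  by (rule real_sqrt_le_mono)
 then show ?thesis by (simp only: real_sqrt_mult real_sqrt_abs abs_power2)
qed

text \<open>An interface that hides the convolution from the estimates along lines: \<open>D\<close>
  acts as gradient and \<open>H th\<close> as second derivative in direction \<open>th\<close>. The
  two bounds are claimed only where the closed ball lies in the domain, because the function that is
  mollified is \<open>u\<close> cut off to the domain.\<close>

definition mollified ::
 "'a::euclidean_space set => ('a => real) => ('a => real) => real => real => ('a => real) => ('a => 'a) => ('a => 'a => real) => bool" where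
 "mollified Om u h K de w D H \<longleftrightarrow>
   continuous_on UNIV w & continuous_on UNIV D & (ALL th. continuous_on UNIV (H th)) &
   (ALL x th t. ((%t. w (x + t *\<^sub>R th)) has_real_derivative D (x + t *\<^sub>R th) \<bullet> th) (at t)) &
   (ALL x th t. ((%t. D (x + t *\<^sub>R th) \<bullet> th) has_real_derivative H th (x + t *\<^sub>R th)) (at t)) &
   (ALL y th. cball y de \<subseteq> Om --> ennreal \<bar>H th y\<bar> <=
    ennreal (K * (norm th)\<^sup>2 / de ^ DIM('a)) * (NNI z. ennreal (h z) * indicator (ball y de) z)) &
   (ALL y e. cball y de \<subseteq> Om --> (ALL z:ball y de. \<bar>u z - u y\<bar> <= e) --> \<bar>w y - u y\<bar> <= e)"

context bump
begin

text \<open>The derivatives fall on the kernel, and two integrations by parts, first against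
  \<open>G j\<close> and then against \<open>Hs j i\<close>, move them to the weak Hessian. The
  minus signs of the two steps cancel, and the two factors \<open>-1/de\<close> make
  \<open>1/de^2\<close>.\<close>

lemma moll_hessian:
 fixes Om :: "'a set" and u :: "'a => real" and Hs :: "'a => 'a => 'a => real"
 assumes Om: "open Om" and U: "integrable lborel (%x. indicator Om x * u x)"
  and H: "weak_hessian Om u Hs" and de: "0 < de" and y: "cball y de \<subseteq> Om" and ij: "i \<in> Basis" "j \<in> Basis"
 shows "moll de (%x. indicator Om x * u x) ((%_. 0)(i := Suc 0, j := Suc (((%_. 0)(i := Suc 0)) j))) y / de\<^sup>2
  = (\<integral>z. Hs j i z * pF (%_. 0) ((y - z) /\<^sub>R de) \<partial>lebesgue_on Om)"
proof -
 obtain G where G: "!!i. i \<in> Basis ==> weak_deriv Om u i (G i)"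
  "!!i j. i \<in> Basis ==> j \<in> Basis ==> weak_deriv Om (G i) j (Hs i j)"
  using H unfolding weak_hessian_def by blast
 let ?ph = "bf 1 de y (%_. 0)"
 let ?k = "(%_. 0)(i := Suc 0, j := Suc (((%_. 0)(i := Suc 0)) j)) :: 'a => nat"
 have d1: "dpartial i ?ph = bf (-1/de) de y ((%_. 0)(i := Suc 0))" using ij by (simp add: dpartial_bf)
 have d2: "dpartial j (dpartial i ?ph) = bf (1/de\<^sup>2) de y ?k"
  unfolding d1 using ij by (subst dpartial_bf) (auto simp: power2_eq_square)
 have "(\<integral>z. u z * dpartial j (dpartial i ?ph) z \<partial>lebesgue_on Om) = - (\<integral>z. G j z * dpartial i ?ph z \<partial>lebesgue_on Om)"
  using G(1)[OF ij(2)] test_fun_bf[OF de y] unfolding weak_deriv_def d1 by blast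
 also have "... = (\<integral>z. Hs j i z * ?ph z \<partial>lebesgue_on Om)"
  using G(2)[OF ij(2,1)] test_fun_bf[OF de y] unfolding weak_deriv_def by simp
 finally have 1: "(\<integral>z. u z * bf (1/de\<^sup>2) de y ?k z \<partial>lebesgue_on Om) = (\<integral>z. Hs j i z * ?ph z \<partial>lebesgue_on Om)"
  unfolding d2 .
 have [measurable]: "(%x. indicator Om x * u x) \<in> bmb" using U by auto
 have "(\<integral>z. u z * bf (1/de\<^sup>2) de y ?k z \<partial>lebesgue_on Om) = (\<integral>z. indicator Om z *\<^sub>R (u z * bf (1/de\<^sup>2) de y ?k z) \<partial>lebesgue)"
  using Om by (intro integral_restrict_space) auto
 also have "... = (\<integral>z. (1/de\<^sup>2) * ((indicator Om z * u z) * pF ?k ((y - z) /\<^sub>R de)) \<partial>lebesgue)"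
  by (simp add: bf_def mult_ac)
 also have "... = (\<integral>z. (1/de\<^sup>2) * ((indicator Om z * u z) * pF ?k ((y - z) /\<^sub>R de)) \<partial>lborel)"
  by (rule integral_completion) measurable
 also have "... = moll de (%x. indicator Om x * u x) ?k y / de\<^sup>2"
  unfolding moll_def by simp
 finally have 2: "(\<integral>z. u z * bf (1/de\<^sup>2) de y ?k z \<partial>lebesgue_on Om) = moll de (%x. indicator Om x * u x) ?k y / de\<^sup>2" .
 have 3: "(\<integral>z. Hs j i z * ?ph z \<partial>lebesgue_on Om) = (\<integral>z. Hs j i z * pF (%_. 0) ((y - z) /\<^sub>R de) \<partial>lebesgue_on Om)"
  by (simp add: bf_def)
 show ?thesis by (rule trans[OF trans[OF 2[symmetric] 1] 3])
qed

lemma moll_hessian_bound: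
 fixes Om :: "'a set" and u :: "'a => real" and Hs :: "'a => 'a => 'a => real"
 assumes Om: "open Om" and U: "integrable lborel (%x. indicator Om x * u x)"
  and H: "weak_hessian Om u Hs" and de: "0 < de" and y: "cball y de \<subseteq> Om"
  and h [measurable]: "h \<in> bmb" and h0: "!!z. 0 <= h z"
  and hH: "AE z in lebesgue. z \<in> Om --> hess_norm Hs z <= h z"
  and B: "!!v. \<bar>pF (%_. 0) v\<bar> <= B"
 shows "ennreal \<bar>\<Sum>i\<in>Basis. \<Sum>j\<in>Basis. (th \<bullet> i) * (th \<bullet> j) * (\<integral>z. Hs j i z * pF (%_. 0) ((y - z) /\<^sub>R de) \<partial>lebesgue_on Om)\<bar>
  <= ennreal ((norm th)\<^sup>2 * B) * (NNI z. ennreal (h z) * indicator (ball y de) z)"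
proof -
 let ?ph = "%z. pF (%_. 0) ((y - z) /\<^sub>R de)"
 have ph0: "?ph z = 0" if "z \<notin> ball y de" for z
  using bf_supp[OF de, of y z 1 "%_. 0"] that by (simp add: bf_def)
 have B0: "0 <= B" using B[of 0] by (meson abs_ge_zero order.trans)
 \<comment> \<open>Only local integrability of the Hessian is available. As the kernel vanishes off
   the ball, the integrand may be cut off to the compact set \<open>cball y de\<close> inside the
   domain.\<close>
 have int: "integrable (lebesgue_on Om) (%z. Hs j i z * ?ph z)" if ij: "i \<in> Basis" "j \<in> Basis" for i j
 proof -
  have "loc_int Om (Hs j i)" using H ij unfolding weak_hessian_def weak_deriv_def by blast
  then have K: "integrable lebesgue (%z. indicator (cball y de) z *\<^sub>R Hs j i z)"
   using y unfolding loc_int_def set_integrable_def by auto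
  have mK [measurable]: "(%z. indicator (cball y de) z *\<^sub>R Hs j i z) \<in> borel_measurable lebesgue" using K by auto
  have mph: "?ph \<in> borel_measurable lebesgue" by (rule measurable_completion) measurable
  have "integrable lebesgue (%z. (indicator (cball y de) z *\<^sub>R Hs j i z) * ?ph z)"
  proof (rule Bochner_Integration.integrable_bound[of _ "%z. B * (indicator (cball y de) z *\<^sub>R Hs j i z)"])
   show "AE z in lebesgue. norm ((indicator (cball y de) z *\<^sub>R Hs j i z) * ?ph z) <= norm (B * (indicator (cball y de) z *\<^sub>R Hs j i z))"
    using B B0 by (intro AE_I2) (simp add: abs_mult mult.commute[of B] mult_left_mono)
   show "(%z. (indicator (cball y de) z *\<^sub>R Hs j i z) * ?ph z) \<in> borel_measurable lebesgue"
    by (intro borel_measurable_times mK mph)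
  qed (use K in auto)
  also have "(%z. (indicator (cball y de) z *\<^sub>R Hs j i z) * ?ph z) = (%z. indicator Om z *\<^sub>R (Hs j i z * ?ph z))"
  proof
   fix z show "(indicator (cball y de) z *\<^sub>R Hs j i z) * ?ph z = indicator Om z *\<^sub>R (Hs j i z * ?ph z)"
    using subsetD[OF y, of z] ph0[of z] by (cases "z \<in> ball y de") (auto simp: indicator_def)
  qed
  finally show ?thesis using Om by (subst integrable_restrict_space) auto
 qed
 let ?f = "%z. \<Sum>i\<in>Basis. \<Sum>j\<in>Basis. (th \<bullet> i) * (th \<bullet> j) * (Hs j i z * ?ph z)"
 have "(\<Sum>i\<in>Basis. \<Sum>j\<in>Basis. (th \<bullet> i) * (th \<bullet> j) * (\<integral>z. Hs j i z * ?ph z \<partial>lebesgue_on Om)) = (\<integral>z. ?f z \<partial>lebesgue_on Om)"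
  using int by (simp add: Bochner_Integration.integral_sum)
 moreover have "ennreal (norm (\<integral>z. ?f z \<partial>lebesgue_on Om)) <= (\<integral>\<^sup>+z. ennreal (norm (?f z)) \<partial>lebesgue_on Om)"
  using int by (intro integral_norm_bound_ennreal) auto
 moreover have "(\<integral>\<^sup>+z. ennreal (norm (?f z)) \<partial>lebesgue_on Om) = (\<integral>\<^sup>+z. ennreal (norm (?f z)) * indicator Om z \<partial>lebesgue)"
  using Om by (intro nn_integral_restrict_space) auto
 moreover have "... <= (\<integral>\<^sup>+z. ennreal ((norm th)\<^sup>2 * B) * (ennreal (h z) * indicator (ball y de) z) \<partial>lebesgue)"
 proof (rule nn_integral_mono_AE)
  show "AE z in lebesgue. ennreal (norm (?f z)) * indicator Om z <= ennreal ((norm th)\<^sup>2 * B) * (ennreal (h z) * indicator (ball y de) z)"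
   using hH
  proof (rule eventually_mono)
   fix z assume z: "z \<in> Om --> hess_norm Hs z <= h z"
   have f: "?f z = (\<Sum>i\<in>Basis. \<Sum>j\<in>Basis. (th \<bullet> i) * (th \<bullet> j) * Hs j i z) * ?ph z"
    by (simp add: sum_distrib_right mult.assoc)
   show "ennreal (norm (?f z)) * indicator Om z <= ennreal ((norm th)\<^sup>2 * B) * (ennreal (h z) * indicator (ball y de) z)"
   proof (cases "z \<in> ball y de")
    case False then show ?thesis unfolding f by (simp add: ph0)
   next
    case True
    then have "z \<in> Om" using y by auto
    have "norm (?f z) <= ((norm th)\<^sup>2 * hess_norm Hs z) * B"
     unfolding f hess_norm_def real_norm_def abs_mult
     by (intro mult_mono sum_sum_mult_le_norm B) (auto intro!: mult_nonneg_nonneg sum_nonneg)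
    also have "... <= ((norm th)\<^sup>2 * h z) * B"
     using z \<open>z \<in> Om\<close> B0 by (intro mult_right_mono mult_left_mono) auto
    finally have "ennreal (norm (?f z)) <= ennreal (((norm th)\<^sup>2 * B) * h z)" by (intro ennreal_leI) (simp add: mult_ac)
    then show ?thesis using True \<open>z \<in> Om\<close> B0 h0 by (simp add: ennreal_mult')
   qed
  qed
 qed
 moreover have "... = (NNI z. ennreal ((norm th)\<^sup>2 * B) * (ennreal (h z) * indicator (ball y de) z))"
  by (rule nn_integral_completion) measurable
 moreover have "... = ennreal ((norm th)\<^sup>2 * B) * (NNI z. ennreal (h z) * indicator (ball y de) z)"
  by (rule nn_integral_cmult) measurable
 ultimately show ?thesis by simp
qed

lemma mollified_exists:
 fixes Om :: "'a set" and u :: "'a => real" and Hs :: "'a => 'a => 'a => real"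
 assumes Om: "open Om" "emeasure lborel Om < \<infinity>" and u: "Cb_closure Om u"
  and H: "weak_hessian Om u Hs" and de: "0 < de"
  and h: "h \<in> bmb" and h0: "!!z. 0 <= h z"
  and hH: "AE z in lebesgue. z \<in> Om --> hess_norm Hs z <= h z"
  and B: "!!v. \<bar>pF (%_. 0) v\<bar> <= B"
 shows "EX w D H. mollified Om u h (B / mass) de w D H"
proof -
 let ?U = "%x. indicator Om x * u x"
 have U: "integrable lborel ?U" by (rule Cb_closure_integrable[OF Om u])
 define C where "C = 1 / (de ^ DIM('a) * mass)"
 have C: "0 < C" using de mass_pos by (simp add: C_def)
 define e where "e i = (%_. 0 :: nat)(i := Suc 0)" for i :: 'a
 define ee where "ee i j = (e i)(j := Suc (e i j))" for i j :: 'a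
 define w where "w x = C * moll de ?U (%_. 0) x" for x
 define D where "D x = (\<Sum>i\<in>Basis. (C / de * moll de ?U (e i) x) *\<^sub>R i)" for x
 define H2 where "H2 th x = (\<Sum>i\<in>Basis. \<Sum>j\<in>Basis. C * ((th \<bullet> i) / de * ((th \<bullet> j) / de * moll de ?U (ee i j) x)))" for th x
 have Dth: "D x \<bullet> th = (\<Sum>i\<in>Basis. C * ((th \<bullet> i) / de * moll de ?U (e i) x))" for x th
  unfolding D_def inner_sum_left by (intro sum.cong) (auto simp: inner_commute mult_ac)
 have "mollified Om u h (B / mass) de w D H2"
  unfolding mollified_def
 proof (intro conjI allI impI)
  show "continuous_on UNIV w" unfolding w_def by (intro continuous_intros moll_cont U)
  show "continuous_on UNIV D" unfolding D_def by (intro continuous_intros moll_cont U)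
  show "continuous_on UNIV (H2 th)" for th unfolding H2_def by (intro continuous_intros moll_cont U)
  fix x th :: 'a and t :: real
  have "((%t. w (x + t *\<^sub>R th)) has_real_derivative C * (\<Sum>i\<in>Basis. (th \<bullet> i) / de * moll de ?U (e i) (x + t *\<^sub>R th))) (at t)"
   unfolding w_def e_def by (intro DERIV_cmult moll_deriv[OF U, where ka = "%_. 0"])
  then show "((%t. w (x + t *\<^sub>R th)) has_real_derivative D (x + t *\<^sub>R th) \<bullet> th) (at t)"
   by (simp add: Dth sum_distrib_left)
  have "((%t. D (x + t *\<^sub>R th) \<bullet> th) has_real_derivative
   (\<Sum>i\<in>Basis. C * ((th \<bullet> i) / de * (\<Sum>j\<in>Basis. (th \<bullet> j) / de * moll de ?U (ee i j) (x + t *\<^sub>R th))))) (at t)"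
   unfolding Dth ee_def by (intro DERIV_sum DERIV_cmult moll_deriv[OF U])
  then show "((%t. D (x + t *\<^sub>R th) \<bullet> th) has_real_derivative H2 th (x + t *\<^sub>R th)) (at t)"
   by (simp add: H2_def sum_distrib_left)
 next
  fix y th assume y: "cball y de \<subseteq> Om"
  let ?I = "%i j. \<integral>z. Hs j i z * pF (%_. 0) ((y - z) /\<^sub>R de) \<partial>lebesgue_on Om"
  have I: "moll de ?U (ee i j) y / de\<^sup>2 = ?I i j" if "i \<in> Basis" "j \<in> Basis" for i j
   unfolding ee_def e_def by (rule moll_hessian[OF Om(1) U H de y that])
  have "H2 th y = (\<Sum>i\<in>Basis. \<Sum>j\<in>Basis. C * ((th \<bullet> i) * (th \<bullet> j) * ?I i j))"
   unfolding H2_def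
  proof (intro sum.cong refl)
   fix i j :: 'a assume "i \<in> Basis" "j \<in> Basis"
   then show "C * ((th \<bullet> i) / de * ((th \<bullet> j) / de * moll de ?U (ee i j) y)) = C * ((th \<bullet> i) * (th \<bullet> j) * ?I i j)"
    by (simp add: I[symmetric] power2_eq_square)
  qed
  also have "... = C * (\<Sum>i\<in>Basis. \<Sum>j\<in>Basis. (th \<bullet> i) * (th \<bullet> j) * ?I i j)"
   by (simp add: sum_distrib_left)
  finally have "ennreal \<bar>H2 th y\<bar> = ennreal C * ennreal \<bar>\<Sum>i\<in>Basis. \<Sum>j\<in>Basis. (th \<bullet> i) * (th \<bullet> j) * ?I i j\<bar>"
   using C by (simp add: abs_mult ennreal_mult')
  also have "... <= ennreal C * (ennreal ((norm th)\<^sup>2 * B) * (NNI z. ennreal (h z) * indicator (ball y de) z))"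
   by (intro mult_left_mono moll_hessian_bound[OF Om(1) U H de y h h0 hH B]) auto
  also have "... = ennreal (C * ((norm th)\<^sup>2 * B)) * (NNI z. ennreal (h z) * indicator (ball y de) z)"
   using C by (simp only: ennreal_mult' less_imp_le mult.assoc)
  also have "C * ((norm th)\<^sup>2 * B) = B / mass * (norm th)\<^sup>2 / de ^ DIM('a)"
   by (simp add: C_def mult.commute)
  finally show "ennreal \<bar>H2 th y\<bar> <= ennreal (B / mass * (norm th)\<^sup>2 / de ^ DIM('a)) * (NNI z. ennreal (h z) * indicator (ball y de) z)" .
 next
  fix y :: 'a and e :: real assume y: "cball y de \<subseteq> Om" and e: "ALL z:ball y de. \<bar>u z - u y\<bar> <= e"
  let ?ph = "%z. pF (%_. 0) ((y - z) /\<^sub>R de)"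
  have ph0: "?ph z = 0" if "z \<notin> ball y de" for z
   using bf_supp[OF de, of y z 1 "%_. 0"] that by (simp add: bf_def)
  have m: "(\<integral>z. ?ph z \<partial>lborel) = de ^ DIM('a) * mass" by (rule pF_scale_integral[OF de])
  then have int: "integrable lborel ?ph"
   using de mass_pos not_integrable_integral_eq[of lborel ?ph] by fastforce
  have i1: "integrable lborel (%z. ?U z * ?ph z)" by (rule moll_integrable[OF U])
  have C1: "C * (de ^ DIM('a) * mass) = 1" using de mass_pos by (simp add: C_def)
  have i2: "(\<integral>z. u y * ?ph z \<partial>lborel) = u y * (de ^ DIM('a) * mass)" by (simp only: integral_mult_right_zero m)
  have "w y - u y = C * ((\<integral>z. ?U z * ?ph z \<partial>lborel) - (\<integral>z. u y * ?ph z \<partial>lborel))"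
   unfolding i2 w_def moll_def by (simp add: right_diff_distrib mult.left_commute[of C "u y"] C1)
  also have "(\<integral>z. ?U z * ?ph z \<partial>lborel) - (\<integral>z. u y * ?ph z \<partial>lborel) = (\<integral>z. ?U z * ?ph z - u y * ?ph z \<partial>lborel)"
   by (intro Bochner_Integration.integral_diff[symmetric] i1 integrable_mult_right int)
  finally have "\<bar>w y - u y\<bar> = C * \<bar>\<integral>z. ?U z * ?ph z - u y * ?ph z \<partial>lborel\<bar>" using C by (simp add: abs_mult)
  also have "\<bar>\<integral>z. ?U z * ?ph z - u y * ?ph z \<partial>lborel\<bar> <= (\<integral>z. e * ?ph z \<partial>lborel)"
  proof (rule order.trans[OF integral_abs_bound], rule integral_mono)
   show "integrable lborel (%z. \<bar>?U z * ?ph z - u y * ?ph z\<bar>)"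
    by (intro integrable_abs Bochner_Integration.integrable_diff i1 integrable_mult_right int)
   show "integrable lborel (%z. e * ?ph z)" by (intro integrable_mult_right int)
   fix z
   show "\<bar>?U z * ?ph z - u y * ?ph z\<bar> <= e * ?ph z"
   proof (cases "z \<in> ball y de")
    case True
    then have "?U z = u z" using subsetD[OF y, of z] by simp
    moreover have "\<bar>u z - u y\<bar> * ?ph z <= e * ?ph z" using e True by (intro mult_right_mono pF_nonneg) auto
    ultimately show ?thesis by (simp only: left_diff_distrib[symmetric] abs_mult abs_of_nonneg[OF pF_nonneg])
   qed (simp add: ph0)
  qed
  also have "(\<integral>z. e * ?ph z \<partial>lborel) = e * (de ^ DIM('a) * mass)" by (simp add: m)
  finally show "\<bar>w y - u y\<bar> <= e" using C de mass_pos by (simp add: C_def mult_left_mono field_simps)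
 qed
 then show ?thesis by blast
qed

end

text \<open>The bump is fixed before domain, function and scale, so the constant depends on the
  dimension only.\<close>

lemma mollification:
 "EX K>0. ALL (Om :: 'a::euclidean_space set) u Hs h de. open Om --> emeasure lborel Om < \<infinity> --> Cb_closure Om u -->
   weak_hessian Om u Hs --> h \<in> bmb --> (ALL z. 0 <= h z) -->
   (AE z in lebesgue. z \<in> Om --> hess_norm Hs z <= h z) --> 0 < de --> (EX w D H. mollified Om u h K de w D H)"
proof -
 obtain F :: "nat => real => real" where F: "!!k t. (F k has_real_derivative F (Suc k) t) (at t)"
  "!!k t. 1 / DIM('a) <= \<bar>t\<bar> ==> F k t = 0" "!!t. 0 <= F 0 t" "0 < F 0 0"
  using bump_exists[of "DIM('a)"] by auto
 interpret bump F "TYPE('a)" by unfold_locales (fact F)+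
 obtain B where B: "0 < B" "!!v. \<bar>pF (%_. 0) v\<bar> <= B" using pF_bound by blast
 show ?thesis
 proof (intro exI[of _ "B / mass"] conjI allI impI)
  show "0 < B / mass" using B mass_pos by simp
 qed (rule mollified_exists[OF _ _ _ _ _ _ _ _ B(2)], auto)
qed

section \<open>Rays, exit times and polar coordinates\<close>

definition exits :: "'a::euclidean_space set => 'a => 'a => bool" where
 "exits U x th \<longleftrightarrow> (EX t>=0. x + t *\<^sub>R th \<notin> U)"

text \<open>Measured in the ray parameter, not in length. On rays that never exit it is the infimum
  of the empty set, an unspecified constant, so its use is guarded by \<open>exits\<close>.\<close>

definition exit_time :: "'a::euclidean_space set => 'a => 'a => real" where
 "exit_time U x th = Inf {t. 0 <= t & x + t *\<^sub>R th \<notin> U}"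

definition hit :: "'a::euclidean_space set => 'a => 'a => 'a" where
 "hit U x th = x + exit_time U x th *\<^sub>R th"

text \<open>Bounding the length of a direction from both sides keeps the ray parameter within a
  factor 2 of the distance travelled.\<close>

definition annulus :: "'a::euclidean_space set" where
 "annulus = {th. 1/2 <= norm th & norm th <= 1}"

abbreviation iann where "iann \<equiv> indicator annulus"

abbreviation in_shell where
 "in_shell U x th t \<equiv> exit_time U x th / 2 < t & t < exit_time U x th"

lemma bdd_below_exit: "bdd_below {t. 0 <= t & x + t *\<^sub>R th \<notin> U}"
 by (rule bdd_belowI[of _ 0]) simp

lemma exit_time_le: "0 <= t ==> x + t *\<^sub>R th \<notin> U ==> exit_time U x th <= t"
 unfolding exit_time_def by (rule cInf_lower[OF _ bdd_below_exit]) simp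

lemma exit_time_inside: "0 <= t ==> t < exit_time U x th ==> x + t *\<^sub>R th \<in> U"
 using exit_time_le[of t x th U] by linarith

lemma exit_time_greatest:
 assumes "exits U x th" "!!t. 0 <= t ==> x + t *\<^sub>R th \<notin> U ==> a <= t"
 shows "a <= exit_time U x th"
 unfolding exit_time_def
proof (rule cInf_greatest)
 show "{t. 0 <= t & x + t *\<^sub>R th \<notin> U} ~= {}" using assms(1) by (simp add: exits_def)
qed (use assms(2) in simp)

lemma exit_time_nonneg: "exits U x th ==> 0 <= exit_time U x th"
 by (rule exit_time_greatest)

lemma hit_notin:
 assumes "open U" "exits U x th"
 shows "hit U x th \<notin> U"
proof -
 let ?S = "{t. 0 <= t & x + t *\<^sub>R th \<notin> U}"
 have "?S = {0..} \<inter> (%t. x + t *\<^sub>R th) -` (-U)" by auto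
 moreover have "closed ((%t. x + t *\<^sub>R th) -` (-U))"
  using assms by (intro closed_vimage continuous_intros) auto
 ultimately have "closed ?S" by auto
 then have "Inf ?S \<in> ?S"
  using assms(2) by (intro closed_contains_Inf bdd_below_exit) (auto simp: exits_def)
 then show ?thesis by (simp add: hit_def exit_time_def)
qed

lemma exit_time_pos:
 assumes "open U" "x \<in> U" "exits U x th"
 shows "0 < exit_time U x th"
 using hit_notin[OF assms(1,3)] exit_time_nonneg[OF assms(3)] assms(2)
 by (cases "exit_time U x th = 0") (auto simp: hit_def)

lemma hit_frontier:
 assumes "open U" "x \<in> U" "exits U x th"
 shows "hit U x th \<in> frontier U"
proof -
 let ?e = "exit_time U x th"
 have e: "0 < ?e" by (rule exit_time_pos[OF assms])
 have "(%k. x + (?e * (1 - 1 / real (Suc k))) *\<^sub>R th) \<longlonglongrightarrow> x + (?e * (1 - 0)) *\<^sub>R th"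
  by (intro tendsto_intros LIMSEQ_Suc lim_1_over_n)
 moreover have "x + (?e * (1 - 1 / real (Suc k))) *\<^sub>R th \<in> U" for k
  using e by (intro exit_time_inside) (auto simp: field_simps)
 ultimately have "hit U x th \<in> closure U"
  unfolding closure_sequential hit_def by (intro exI[of _ "%k. x + (?e * (1 - 1 / real (Suc k))) *\<^sub>R th"]) auto
 then show ?thesis using hit_notin[OF assms(1,3)] assms(1) by (simp add: frontier_def interior_open)
qed

lemma exits_bounded:
 assumes "bounded U" "th ~= 0"
 shows "exits U x th"
proof -
 obtain B where B: "!!y. y \<in> U ==> norm y <= B" using assms(1) by (auto simp: bounded_iff)
 define t where "t = (\<bar>B\<bar> + norm x + 1) / norm th"
 have "norm (t *\<^sub>R th) = \<bar>B\<bar> + norm x + 1" using assms(2) by (simp add: t_def)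
 then have "norm (x + t *\<^sub>R th) > B" using norm_triangle_ineq4[of "x + t *\<^sub>R th" x] by auto
 then have "x + t *\<^sub>R th \<notin> U" using B by force
 moreover have "0 <= t" by (simp add: t_def)
 ultimately show ?thesis unfolding exits_def by blast
qed

lemma exit_time_mono:
 assumes "U \<subseteq> V" "exits V x th"
 shows "exits U x th" "exit_time U x th <= exit_time V x th"
proof -
 show "exits U x th" using assms unfolding exits_def by blast
 show "exit_time U x th <= exit_time V x th"
  by (rule exit_time_greatest[OF assms(2)]) (use assms in \<open>auto intro: exit_time_le\<close>)
qed

text \<open>The source of measurability for exit times: leaving \<open>U\<close> by time
  \<open>a\<close> is the projection of a closed set along the compact interval
  \<open>{0..a}\<close>, hence a closed condition on starting point and direction jointly.\<close>

lemma closed_exits_before: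
 assumes "open (U :: 'a::euclidean_space set)"
 shows "closed {p. EX s. s \<in> {0..a} & (s, p) \<in> {(s, p). fst p + s *\<^sub>R snd p \<in> - U}}"
proof (rule closed_compact_projection)
 have "{(s::real, p::'a \<times> 'a). fst p + s *\<^sub>R snd p \<in> - U} = (%q. fst (snd q) + fst q *\<^sub>R snd (snd q)) -` (- U)" by auto
 moreover have "closed ((%q::real \<times> 'a \<times> 'a. fst (snd q) + fst q *\<^sub>R snd (snd q)) -` (- U))"
  using assms by (intro closed_vimage continuous_intros) auto
 ultimately show "closed {(s::real, p::'a \<times> 'a). fst p + s *\<^sub>R snd p \<in> - U}" by simp
qed auto

lemma sets_exits:
 assumes "open (U :: 'a::euclidean_space set)"
 shows "{p. exits U (fst p) (snd p)} \<in> sets borel"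
proof -
 have "{p. exits U (fst p) (snd p)} = (\<Union>k::nat. {p. EX s. s \<in> {0..real k} & (s, p) \<in> {(s, p). fst p + s *\<^sub>R snd p \<in> - U}})"
 proof (intro set_eqI iffI)
  fix p assume "p \<in> {p. exits U (fst p) (snd p)}"
  then obtain t where t: "0 <= t" "fst p + t *\<^sub>R snd p \<notin> U" by (auto simp: exits_def)
  obtain k :: nat where "t <= real k" using real_arch_simple by blast
  then show "p \<in> (\<Union>k::nat. {p. EX s. s \<in> {0..real k} & (s, p) \<in> {(s, p). fst p + s *\<^sub>R snd p \<in> - U}})"
   using t by (intro UN_I[of k]) auto
 next
  fix p assume "p \<in> (\<Union>k::nat. {p. EX s. s \<in> {0..real k} & (s, p) \<in> {(s, p). fst p + s *\<^sub>R snd p \<in> - U}})"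
  then obtain s where "0 <= s" "fst p + s *\<^sub>R snd p \<notin> U" by auto
  then show "p \<in> {p. exits U (fst p) (snd p)}" unfolding exits_def by blast
 qed
 then show ?thesis using closed_exits_before[OF assms] by auto
qed

lemma exit_time_borel:
 assumes "open (U :: 'a::euclidean_space set)"
 shows "(%p. exit_time U (fst p) (snd p)) \<in> bmb"
 unfolding borel_measurable_iff_le
proof
 fix a :: real
 let ?A = "{p. EX s. s \<in> {0..a} & (s, p) \<in> {(s, p). fst p + s *\<^sub>R snd p \<in> - U}}"
 let ?E = "{p. exits U (fst p) (snd p)}"
 have "exit_time U (fst p) (snd p) <= a \<longleftrightarrow> p \<in> ?A" if "p \<in> ?E" for p
 proof
  assume "exit_time U (fst p) (snd p) <= a"
  then show "p \<in> ?A" using hit_notin[OF assms, of "fst p" "snd p"] exit_time_nonneg[of U "fst p" "snd p"] that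
   by (auto simp: hit_def)
 next
  assume "p \<in> ?A"
  then show "exit_time U (fst p) (snd p) <= a" using exit_time_le[of _ "fst p" "snd p" U] by fastforce
 qed
 \<comment> \<open>On the pairs that never exit, the exit time is one constant, so a sublevel set
   contains all of them or none.\<close>
 moreover have "exit_time U (fst p) (snd p) = Inf {}" if "p \<notin> ?E" for p
  using that unfolding exits_def exit_time_def by (intro arg_cong[where f=Inf]) auto
 ultimately have "exit_time U (fst p) (snd p) <= a \<longleftrightarrow> p \<in> (?E \<inter> ?A) \<union> (- ?E \<inter> {p. (Inf {} :: real) <= a})" for p
  by (cases "p \<in> ?E") simp_all
 then have "{p \<in> space borel. exit_time U (fst p) (snd p) <= a} = (?E \<inter> ?A) \<union> (- ?E \<inter> {p. (Inf {} :: real) <= a})"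
  by (intro set_eqI) simp
 moreover have "{p :: 'a \<times> 'a. (Inf {} :: real) <= a} \<in> sets borel" by simp
 ultimately show "{p \<in> space borel. exit_time U (fst p) (snd p) <= a} \<in> sets borel"
  using sets_exits[OF assms] closed_exits_before[OF assms, of a] by (auto intro!: sets.Un sets.Int)
qed

lemma exit_time_measurable:
 assumes "open (U :: 'a::euclidean_space set)"
  "f \<in> borel_measurable M" "g \<in> borel_measurable M"
 shows "(%z. exit_time U (f z) (g z)) \<in> borel_measurable M"
  "{z \<in> space M. exits U (f z) (g z)} \<in> sets M"
  "(%z. hit U (f z) (g z)) \<in> borel_measurable M"
proof -
 have p: "(%z. (f z, g z)) \<in> borel_measurable M" using assms by (intro borel_measurable_Pair)
 show e: "(%z. exit_time U (f z) (g z)) \<in> borel_measurable M"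
  using measurable_compose[OF p exit_time_borel[OF assms(1)]] by simp
 show "{z \<in> space M. exits U (f z) (g z)} \<in> sets M"
 proof -
  have "{z \<in> space M. exits U (f z) (g z)} = (%z. (f z, g z)) -` {p. exits U (fst p) (snd p)} \<inter> space M" by auto
  then show ?thesis using measurable_sets[OF p sets_exits[OF assms(1)]] by simp
 qed
 show "(%z. hit U (f z) (g z)) \<in> borel_measurable M"
  unfolding hit_def using e assms(2,3) by (intro borel_measurable_add borel_measurable_scaleR)
qed

lemma sets_annulus [measurable]: "annulus \<in> sets borel"
 unfolding annulus_def by measurable

lemma emeasure_annulus: "emeasure lborel (annulus :: 'a::euclidean_space set) <= ennreal (unit_ball_vol DIM('a))"
proof -
 have "emeasure lborel (annulus :: 'a set) <= emeasure lborel (cball (0::'a) 1)"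
  by (intro emeasure_mono) (auto simp: annulus_def)
 then show ?thesis by (simp add: emeasure_cball)
qed

lemma nn_integral_annulus_uminus:
 fixes f :: "'a::euclidean_space => ennreal"
 assumes "f \<in> bmb"
 shows "(NNI th. f (-th) * iann th) = (NNI th. f th * iann th)"
proof -
 have "(NNI th. f th * iann th) = ennreal (\<bar>-1\<bar> ^ DIM('a)) * (NNI th. f (0 + (-1) *\<^sub>R th) * iann (0 + (-1) *\<^sub>R th))"
  using assms by (intro nn_integral_lborel_scale) auto
 also have "... = (NNI th. f (-th) * iann th)"
  by (simp add: annulus_def indicator_def)
 finally show ?thesis by simp
qed

text \<open>Polar coordinates by Fubini: for fixed \<open>t\<close> the substitution
  \<open>y = x + t * th\<close> costs \<open>t powr (-n)\<close>. A given \<open>y\<close> is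
  reached for \<open>t\<close> between \<open>dist x y\<close> and \<open>2 * dist x y\<close>, an
  interval of length \<open>dist x y\<close> on which \<open>t powr (j-n)\<close> is largest at the
  left end.\<close>

lemma polar_annulus:
 fixes f :: "'a::euclidean_space => ennreal" and j :: real
 assumes f [measurable]: "f \<in> bmb" and j: "j <= DIM('a)"
 shows "(NNI th. (NNI t. f (x + t *\<^sub>R th) * ennreal (t powr j) * indicator {0<..} t) * iann th)
  <= (NNI y. f y * rker (real DIM('a) - 1 - j) x y)"
proof -
 let ?n = "real DIM('a)"
 have "(NNI th. (NNI t. f (x + t *\<^sub>R th) * ennreal (t powr j) * indicator {0<..} t) * iann th)
  = (NNI th. (NNI t. f (x + t *\<^sub>R th) * ennreal (t powr j) * indicator {0<..} t * iann th))"
  by (intro nn_integral_cong nn_integral_multc[symmetric]) measurable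
 also have "... = (NNI t. (NNI th. f (x + t *\<^sub>R th) * ennreal (t powr j) * indicator {0<..} t * iann th))"
  by (rule lborel_pair.Fubini') measurable
 also have "... = (NNI t. (NNI y. f y * (if dist x y <= t & t <= 2 * dist x y & 0 < t then ennreal (t powr (j - ?n)) else 0)))"
 proof (rule nn_integral_cong)
  fix t :: real
  show "(NNI th. f (x + t *\<^sub>R th) * ennreal (t powr j) * indicator {0<..} t * iann th)
   = (NNI y. f y * (if dist x y <= t & t <= 2 * dist x y & 0 < t then ennreal (t powr (j - ?n)) else 0))"
  proof (cases "0 < t")
   case True
   have "(NNI y. f y * ennreal (t powr (j - ?n)) * (if dist x y <= t & t <= 2 * dist x y then 1 else 0))
    = ennreal (\<bar>t\<bar> ^ DIM('a)) * (NNI th. f (x + t *\<^sub>R th) * ennreal (t powr (j - ?n)) * (if dist x (x + t *\<^sub>R th) <= t & t <= 2 * dist x (x + t *\<^sub>R th) then 1 else 0))"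
    using True by (intro nn_integral_lborel_scale) auto
   also have "... = (NNI th. ennreal (\<bar>t\<bar> ^ DIM('a)) * (f (x + t *\<^sub>R th) * ennreal (t powr (j - ?n)) * (if dist x (x + t *\<^sub>R th) <= t & t <= 2 * dist x (x + t *\<^sub>R th) then 1 else 0)))"
    by (rule nn_integral_cmult[symmetric]) measurable
   also have "... = (NNI th. f (x + t *\<^sub>R th) * ennreal (t powr j) * indicator {0<..} t * iann th)"
   proof (rule nn_integral_cong)
    fix th :: 'a
    have "t ^ DIM('a) * t powr (j - ?n) = t powr j"
     using True by (simp add: powr_realpow[symmetric] powr_add[symmetric])
    then have "ennreal (t ^ DIM('a)) * ennreal (t powr (j - ?n)) = ennreal (t powr j)"
     using True by (simp add: ennreal_mult'[symmetric])
    moreover have "(dist x (x + t *\<^sub>R th) <= t & t <= 2 * dist x (x + t *\<^sub>R th)) \<longleftrightarrow> th \<in> annulus"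
     using True by (auto simp: annulus_def dist_norm)
    moreover have "ennreal (\<bar>t\<bar> ^ DIM('a)) * (f (x + t *\<^sub>R th) * ennreal (t powr (j - ?n)) * c)
     = f (x + t *\<^sub>R th) * (ennreal (\<bar>t\<bar> ^ DIM('a)) * ennreal (t powr (j - ?n))) * c" for c
     by (simp only: mult_ac)
    ultimately show "ennreal (\<bar>t\<bar> ^ DIM('a)) * (f (x + t *\<^sub>R th) * ennreal (t powr (j - ?n)) * (if dist x (x + t *\<^sub>R th) <= t & t <= 2 * dist x (x + t *\<^sub>R th) then 1 else 0))
     = f (x + t *\<^sub>R th) * ennreal (t powr j) * indicator {0<..} t * iann th"
     using True by simp
   qed
   finally have "(NNI th. f (x + t *\<^sub>R th) * ennreal (t powr j) * indicator {0<..} t * iann th)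
    = (NNI y. f y * ennreal (t powr (j - ?n)) * (if dist x y <= t & t <= 2 * dist x y then 1 else 0))" by (rule sym)
   also have "... = (NNI y. f y * (if dist x y <= t & t <= 2 * dist x y & 0 < t then ennreal (t powr (j - ?n)) else 0))"
    using True by (intro nn_integral_cong) simp
   finally show ?thesis .
  qed simp
 qed
 also have "... = (NNI y. (NNI t. f y * (if dist x y <= t & t <= 2 * dist x y & 0 < t then ennreal (t powr (j - ?n)) else 0)))"
  by (rule lborel_pair.Fubini') measurable
 also have "... <= (NNI y. f y * rker (?n - 1 - j) x y)"
 proof (rule nn_integral_mono)
  fix y
  have "(NNI t. f y * (if dist x y <= t & t <= 2 * dist x y & 0 < t then ennreal (t powr (j - ?n)) else 0))
   <= (NNI t. f y * ennreal (dist x y powr (j - ?n)) * indicator {dist x y..2 * dist x y} t)"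
  proof (rule nn_integral_mono)
   fix t
   show "f y * (if dist x y <= t & t <= 2 * dist x y & 0 < t then ennreal (t powr (j - ?n)) else 0)
    <= f y * ennreal (dist x y powr (j - ?n)) * indicator {dist x y..2 * dist x y} t"
   proof (cases "t \<in> {dist x y..2 * dist x y} & 0 < t")
    case True
    then have "x ~= y" by auto
    then have "t powr (j - ?n) <= dist x y powr (j - ?n)" using True j by (intro powr_mono2') auto
    then show ?thesis using True by (simp add: mult_left_mono ennreal_leI)
   qed (auto simp: indicator_def)
  qed
  also have "... = f y * ennreal (dist x y powr (j - ?n)) * ennreal (dist x y)"
   by (subst nn_integral_cmult_indicator) auto
  also have "... = f y * rker (?n - 1 - j) x y"
  proof -
   have "dist x y powr (j - ?n) * dist x y = dist x y powr (-(?n - 1 - j))" if "x ~= y"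
    using that powr_add[of "dist x y" "j - ?n" 1] by (simp add: algebra_simps)
   then show ?thesis by (cases "x = y") (simp_all add: rker_def mult.assoc ennreal_mult'[symmetric])
  qed
  finally show "(NNI t. f y * (if dist x y <= t & t <= 2 * dist x y & 0 < t then ennreal (t powr (j - ?n)) else 0))
   <= f y * rker (?n - 1 - j) x y" .
 qed
 finally show ?thesis .
qed

text \<open>All dilates of the set of non-exiting directions, translated by \<open>x\<close>, stay
  in the domain, while their volume grows like \<open>t^n\<close>. Finite volume of the domain
  forces the set to be null; the domain itself may be unbounded.\<close>

lemma AE_exits:
 fixes Om :: "'a::euclidean_space set"
 assumes Om: "open Om" "emeasure lborel Om < \<infinity>"
 shows "AE th in lborel. th \<in> annulus --> exits Om x th"
proof -
 let ?N = "{th \<in> space lborel. \<not> exits Om x th}"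
 have "{th \<in> space lborel. exits Om x th} \<in> sets lborel"
  using Om by (intro exit_time_measurable) auto
 then have N: "?N \<in> sets lborel" by (subst sets.sets_Collect_neg) auto
 have le: "ennreal (t ^ DIM('a)) * emeasure lborel ?N <= emeasure lborel Om" if "0 < t" for t :: real
 proof -
  have "ennreal (t ^ DIM('a)) * emeasure lborel ?N = ennreal (\<bar>t\<bar> ^ DIM('a)) * (NNI th. indicator ?N th)"
   using N that by simp
  also have "... <= ennreal (\<bar>t\<bar> ^ DIM('a)) * (NNI th. indicator Om (x + t *\<^sub>R th))"
   using that by (intro mult_left_mono nn_integral_mono) (auto simp: indicator_def exits_def)
  also have "... = (NNI y. indicator Om y)"
   using Om that by (intro nn_integral_lborel_scale[symmetric]) auto
  finally show ?thesis using Om by simp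
 qed
 have "emeasure lborel ?N = 0"
 proof (rule ccontr)
  assume N0: "emeasure lborel ?N ~= 0"
  obtain L where L: "emeasure lborel Om = ennreal L" "0 <= L" using Om(2) by (cases "emeasure lborel Om") auto
  have "emeasure lborel ?N < \<infinity>" using le[of 1] Om by (simp add: le_less_trans)
  then obtain c where c: "emeasure lborel ?N = ennreal c" "0 <= c" by (cases "emeasure lborel ?N") auto
  have c0: "0 < c" using N0 c by (cases "c = 0") auto
  define t where "t = max 1 ((L + 1) / c)"
  have t: "1 <= t" "L + 1 <= t * c" using c0 by (auto simp: t_def max_def field_simps)
  have "ennreal (t ^ DIM('a) * c) <= ennreal L" using le[of t] t c L by (simp add: ennreal_mult')
  then have "t ^ DIM('a) * c <= L" using L by (simp add: ennreal_le_iff)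
  moreover have "t ^ 1 <= t ^ DIM('a)" using t by (intro power_increasing) auto
  then have "t * c <= t ^ DIM('a) * c" using c0 by (intro mult_right_mono) auto
  ultimately show False using t by linarith
 qed
 then have "AE th in lborel. \<not> (\<not> exits Om x th)" using N by (intro AE_I[OF _ _ N]) auto
 then show ?thesis by (rule eventually_mono) simp
qed

section \<open>The solid angle of boundary sets\<close>

lemma tube_cover:
 fixes x :: "'a::euclidean_space" and D :: "'a set"
 assumes s: "0 < s" and D: "bounded D" "!!z. z \<in> D ==> s <= dist x z" and ka: "0 < ka" "diameter D <= ka * s"
 shows "EX W:sets borel. {th\<in>annulus. EX t>=0. x + t *\<^sub>R th \<in> D} \<subseteq> W &
  emeasure lborel W <= ennreal (3 * 2 ^ DIM('a) * unit_ball_vol DIM('a) * ka ^ (DIM('a) - 1))"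
proof (cases "D = {} \<or> 1 < ka")
 case True
 then show ?thesis
 proof
  assume "D = {}" then show ?thesis by (intro bexI[of _ "{}"]) auto
 next
  assume ka1: "1 < ka"
  have "(1::real) * 1 * unit_ball_vol DIM('a) * 1 <= 3 * 2 ^ DIM('a) * unit_ball_vol DIM('a) * ka ^ (DIM('a) - 1)"
   using ka1 by (intro mult_mono one_le_power) auto
  then have "emeasure lborel (annulus :: 'a set) <= ennreal (3 * 2 ^ DIM('a) * unit_ball_vol DIM('a) * ka ^ (DIM('a) - 1))"
   by (intro order.trans[OF emeasure_annulus] ennreal_leI) simp
  then show ?thesis by (intro bexI[of _ annulus]) auto
 qed
next
 case False
 then obtain z0 where z0: "z0 \<in> D" and ka1: "ka <= 1" by auto
 define e where "e = z0 - x"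
 define L where "L = norm e"
 have L: "0 < L" using D(2)[OF z0] s by (auto simp: L_def e_def dist_norm norm_minus_commute)
 define N where "N = nat \<lfloor>2/ka\<rfloor>"
 \<comment> \<open>A direction that reaches \<open>D\<close> at parameter \<open>t\<close> is within
   \<open>ka\<close> of \<open>(1/t) * e\<close>, a point on a segment of length at most 2 from the
   origin. About \<open>2/ka\<close> balls of radius \<open>2*ka\<close> cover all such directions.
   Because lengths vary in the annulus they fill a tube, of volume of order \<open>ka^(n-1)\<close>,
   instead of a spherical cap.\<close>
 define W where "W = (\<Union>j\<le>N. cball ((real j * ka / L) *\<^sub>R e) (2 * ka))"
 have sub: "{th\<in>annulus. EX t>=0. x + t *\<^sub>R th \<in> D} \<subseteq> W"
 proof safe
  fix th t assume th: "th \<in> annulus" and t: "0 <= t" "x + t *\<^sub>R th \<in> D"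
  have nth: "norm th <= 1" using th by (simp add: annulus_def)
  have "s <= t * norm th" using D(2)[OF t(2)] t(1) by (simp add: dist_norm)
  also have "... <= t" using nth t(1) by (simp add: mult_left_le)
  finally have st: "s <= t" .
  then have t0: "0 < t" using s by simp
  have "dist (x + t *\<^sub>R th) z0 <= ka * s"
   using diameter_bounded_bound[OF D(1) t(2) z0] ka(2) by simp
  also have "... <= ka * t" using st ka by simp
  finally have "norm (t *\<^sub>R th - e) <= ka * t" by (simp add: dist_norm e_def algebra_simps)
  moreover have "t *\<^sub>R th - e = t *\<^sub>R (th - (1/t) *\<^sub>R e)" using t0 by (simp add: algebra_simps)
  ultimately have near: "norm (th - (1/t) *\<^sub>R e) <= ka" using t0 by (simp add: mult.commute)
  have "norm ((1/t) *\<^sub>R e) <= norm th + norm (th - (1/t) *\<^sub>R e)" by (metis norm_minus_commute norm_triangle_sub)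
  then have ta: "L / t <= 2" using near nth ka1 t0 by (simp add: L_def)
  define j where "j = nat \<lfloor>L / t / ka\<rfloor>"
  have jf: "real j = of_int \<lfloor>L / t / ka\<rfloor>" using L t0 ka by (simp add: j_def)
  have j: "\<bar>L/t/ka - real j\<bar> <= 1" unfolding jf by linarith
  have jN: "j <= N" unfolding j_def N_def using ta ka by (intro nat_mono floor_mono divide_right_mono) auto
  have "(1/t) *\<^sub>R e - (real j * ka / L) *\<^sub>R e = (1/t - real j * ka / L) *\<^sub>R e" by (simp add: scaleR_diff_left)
  then have "norm ((1/t) *\<^sub>R e - (real j * ka / L) *\<^sub>R e) = \<bar>1/t - real j * ka / L\<bar> * L" by (simp add: L_def)
  also have "... = \<bar>(1/t - real j * ka / L) * L\<bar>" using L by (simp add: abs_mult)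
  also have "(1/t - real j * ka / L) * L = ka * (L/t/ka - real j)" using L ka by (simp add: algebra_simps)
  also have "\<bar>ka * (L/t/ka - real j)\<bar> <= ka * 1" unfolding abs_mult using ka j by (intro mult_mono) auto
  finally have "norm (th - (real j * ka / L) *\<^sub>R e) <= 2 * ka"
   using near norm_triangle_ineq[of "th - (1/t) *\<^sub>R e" "(1/t) *\<^sub>R e - (real j * ka / L) *\<^sub>R e"] by simp
  then show "th \<in> W" unfolding W_def using jN by (intro UN_I[of j]) (auto simp: dist_norm norm_minus_commute)
 qed
 have "emeasure lborel W <= (\<Sum>j\<le>N. emeasure lborel (cball ((real j * ka / L) *\<^sub>R e) (2 * ka)))"
  unfolding W_def by (intro emeasure_subadditive_finite) auto
 also have "... = ennreal (real (N + 1) * (unit_ball_vol DIM('a) * (2 * ka) ^ DIM('a)))"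
  using ka by (simp add: emeasure_cball ennreal_mult' ennreal_of_nat_eq_real_of_nat del: of_nat_Suc)
 also have "... <= ennreal (3 * 2 ^ DIM('a) * unit_ball_vol DIM('a) * ka ^ (DIM('a) - 1))"
 proof (rule ennreal_leI)
  have "real N <= 2/ka" unfolding N_def using ka by simp
  moreover have "1 <= 1/ka" using ka ka1 by simp
  ultimately have "real (N + 1) <= 3/ka" by simp
  then have "real (N + 1) * (unit_ball_vol DIM('a) * (2 * ka) ^ DIM('a)) <= 3/ka * (unit_ball_vol DIM('a) * (2 * ka) ^ DIM('a))"
   using ka by (intro mult_right_mono) auto
  also have "ka ^ DIM('a) = ka * ka ^ (DIM('a) - 1)" by (metis DIM_positive power_eq_if not_gr_zero)
  then have "3/ka * (unit_ball_vol DIM('a) * (2 * ka) ^ DIM('a)) = 3 * 2 ^ DIM('a) * unit_ball_vol DIM('a) * ka ^ (DIM('a) - 1)"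
   using ka by (simp add: power_mult_distrib)
  finally show "real (N + 1) * (unit_ball_vol DIM('a) * (2 * ka) ^ DIM('a)) <= 3 * 2 ^ DIM('a) * unit_ball_vol DIM('a) * ka ^ (DIM('a) - 1)" .
 qed
 finally show ?thesis using sub by (intro bexI[of _ W]) (auto simp: W_def)
qed

text \<open>The power of 2 and \<open>hausdorff_const\<close> undo the normalisation of the
  Hausdorff measure, which is built from half the diameter.\<close>

definition tube_const :: "nat => real" where
 "tube_const n = 3 * 2 ^ n * unit_ball_vol n * 2 powr (real n - 1) / hausdorff_const (real n - 1)"

lemma hausdorff_const_pos: "0 <= d ==> 0 < hausdorff_const d"
 unfolding hausdorff_const_def by (intro divide_pos_pos Gamma_real_pos) auto

lemma tube_const_pos: "1 <= n ==> 0 < tube_const n"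
 unfolding tube_const_def by (intro divide_pos_pos mult_pos_pos hausdorff_const_pos) auto

text \<open>The directions that hit a set of diameter \<open>r\<close> at distance at least
  \<open>s\<close> have volume of order \<open>(r/s)^(n-1)\<close>, with the same power of
  \<open>r\<close> as in the Hausdorff sum. Summing over a cover gives the bound, with no area
  formula involved.\<close>

lemma tube_hausdorff:
 fixes x :: "'a::euclidean_space"
 assumes n: "2 <= DIM('a)" and \<Theta>: "\<Theta> \<in> sets borel" "\<Theta> \<subseteq> annulus" and s: "0 < s"
  and S: "!!z. z \<in> S ==> s <= dist x z" and hits: "!!th. th \<in> \<Theta> ==> EX t>=0. x + t *\<^sub>R th \<in> S"
 shows "emeasure lborel \<Theta> <= ennreal (tube_const DIM('a) * s powr (-(real DIM('a) - 1))) * hausdorff (real DIM('a) - 1) S"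
proof -
 let ?d = "real DIM('a) - 1"
 let ?V = "unit_ball_vol DIM('a)"
 define c where "c = tube_const DIM('a) * s powr (-?d)"
 have c: "0 < c" using n s by (simp add: c_def tube_const_pos)
 have hc: "0 < hausdorff_const ?d" using n by (intro hausdorff_const_pos) auto
 define K where "K = 3 * 2 ^ DIM('a) * ?V"
 have K: "0 < K" by (simp add: K_def)
 \<comment> \<open>The mesh 1 is arbitrary, since \<open>tube_cover\<close> applies to sets of every
   diameter.\<close>
 have main: "emeasure lborel \<Theta> <= ennreal c * hausdorff_pre ?d 1 S"
 proof (cases "hausdorff_pre ?d 1 S = \<infinity>")
  case True then show ?thesis using c by (simp add: ennreal_mult_top)
 next
  case False
  show ?thesis
  proof (rule ennreal_le_epsilon)
   fix e' :: real assume "0 < e'"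
   \<comment> \<open>The error occurs twice: once with the factor \<open>c\<close>, from the nearly
     optimal cover, and once alone, from the covering sets of diameter 0.\<close>
   define e where "e = e' / (c + 1)"
   have "(c + 1) * e = e'" using c by (simp add: e_def)
   moreover have "0 < e" using \<open>0 < e'\<close> c by (simp add: e_def)
   ultimately have e: "0 < e" "c * e + e = e'" by (simp_all only: distrib_right mult_1)
   obtain C where C: "S \<subseteq> (\<Union>i. C i)" "!!i. bounded (C i)"
    "(\<Sum>i. ennreal (hausdorff_const ?d * (diameter (C i) / 2) powr ?d)) <= hausdorff_pre ?d 1 S + ennreal e"
   proof -
    have "hausdorff_pre ?d 1 S < \<infinity>" using False by (simp add: less_top)
    from hausdorff_pre_close[OF this e(1), of thesis] show ?thesis using that by simp
   qed
   define D where "D i = C i \<inter> {z. s <= dist x z}" for i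
   have D: "bounded (D i)" "diameter (D i) <= diameter (C i)" "0 <= diameter (C i)" for i
    using C(2)[of i] by (auto simp: D_def intro: diameter_subset bounded_subset diameter_ge_0)
   let ?b = "%i. ennreal c * ennreal (hausdorff_const ?d * (diameter (C i) / 2) powr ?d) + ennreal (e * (1/2)^Suc i)"
   have "ALL i. EX W. W \<in> sets borel & {th\<in>annulus. EX t>=0. x + t *\<^sub>R th \<in> D i} \<subseteq> W & emeasure lborel W <= ?b i"
   proof
    fix i
    let ?r = "diameter (C i)"
    define ei where "ei = e * (1/2)^Suc i"
    have ei: "0 < ei" using e by (simp add: ei_def)
    \<comment> \<open>A covering set of diameter 0 adds nothing to the Hausdorff sum, yet
      \<open>tube_cover\<close> needs a positive \<open>ka\<close>. It is taken so small that the
      tube costs at most \<open>ei\<close>.\<close>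
    define ka where "ka = (if ?r = 0 then min 1 (ei / K) else ?r / s)"
    have ka0: "0 < ka" using D(3)[of i] s K ei by (auto simp: ka_def)
    have ka: "0 < ka" "diameter (D i) <= ka * s"
    proof -
     show "diameter (D i) <= ka * s"
     proof (cases "?r = 0")
      case True
      then have "diameter (D i) <= 0" using D(2)[of i] by simp
      also have "0 <= ka * s" using ka0 s by simp
      finally show ?thesis .
     qed (use D(2)[of i] s in \<open>simp add: ka_def\<close>)
    qed (rule ka0)
    have Ds: "s <= dist x z" if "z \<in> D i" for z using that by (simp add: D_def)
    obtain W where W: "W \<in> sets borel" "{th\<in>annulus. EX t>=0. x + t *\<^sub>R th \<in> D i} \<subseteq> W"
     "emeasure lborel W <= ennreal (K * ka ^ (DIM('a) - 1))"
     using tube_cover[OF s D(1)[of i] Ds ka] unfolding K_def by blast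
    have kp: "ka ^ (DIM('a) - 1) = ka powr ?d"
     using ka(1) n powr_realpow[of ka "DIM('a) - 1"] by (simp add: of_nat_diff)
    have "K * ka ^ (DIM('a) - 1) <= c * (hausdorff_const ?d * (?r / 2) powr ?d) + ei"
    proof (cases "?r = 0")
     case True
     have "ka ^ (DIM('a) - 1) <= ka ^ 1" using ka True n by (intro power_decreasing) (auto simp: ka_def)
     also have "... <= ei / K" using True by (simp add: ka_def)
     finally show ?thesis using K True by (simp add: field_simps)
    next
     case False
     have "K * ka ^ (DIM('a) - 1) = K * (?r powr ?d * s powr (-?d))"
     proof -
      have "ka = ?r / s" using False by (simp add: ka_def)
      then have "ka powr ?d = ?r powr ?d / s powr ?d" by (simp only: powr_divide)
      then have "ka powr ?d = ?r powr ?d * s powr (-?d)" by (simp only: powr_minus divide_inverse)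
      then show ?thesis by (simp only: kp)
     qed
     also have "?r powr ?d = 2 powr ?d * (?r / 2) powr ?d" by (simp add: powr_divide)
     also have "K * (2 powr ?d * (?r / 2) powr ?d * s powr (-?d)) = c * (hausdorff_const ?d * (?r / 2) powr ?d)"
      using hc by (simp add: c_def K_def tube_const_def)
     finally show ?thesis using ei by simp
    qed
    then have "ennreal (K * ka ^ (DIM('a) - 1)) <= ennreal (c * (hausdorff_const ?d * (?r / 2) powr ?d) + ei)" by (rule ennreal_leI)
    also have "... = ?b i"
    proof -
     have "ennreal (c * X + ei) = ennreal c * ennreal X + ennreal ei" if "0 <= X" for X
      using c ei that by (simp add: ennreal_mult')
     then show ?thesis unfolding ei_def[symmetric] using hc by simp
    qed
    finally show "EX W. W \<in> sets borel & {th\<in>annulus. EX t>=0. x + t *\<^sub>R th \<in> D i} \<subseteq> W & emeasure lborel W <= ?b i"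
     using W by (intro exI[of _ W]) auto
   qed
   from choice[OF this] obtain W where W: "!!i. W i \<in> sets borel"
    "!!i. {th\<in>annulus. EX t>=0. x + t *\<^sub>R th \<in> D i} \<subseteq> W i" "!!i. emeasure lborel (W i) <= ?b i" by blast
   have "\<Theta> \<subseteq> (\<Union>i. W i)"
   proof
    fix th assume th: "th \<in> \<Theta>"
    then obtain t where t: "0 <= t" "x + t *\<^sub>R th \<in> S" using hits by blast
    then obtain i where "x + t *\<^sub>R th \<in> C i" using C(1) by blast
    then have "x + t *\<^sub>R th \<in> D i" using S[OF t(2)] by (simp add: D_def)
    then have "th \<in> W i" using W(2)[of i] t(1) th \<Theta>(2) by blast
    then show "th \<in> (\<Union>i. W i)" by blast
   qed
   then have "emeasure lborel \<Theta> <= emeasure lborel (\<Union>i. W i)" using W(1) by (intro emeasure_mono) auto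
   also have "... <= (\<Sum>i. emeasure lborel (W i))" using W(1) by (intro emeasure_subadditive_countably) auto
   also have "... <= (\<Sum>i. ?b i)" by (intro suminf_le W(3)) auto
   also have "... = (\<Sum>i. ennreal c * ennreal (hausdorff_const ?d * (diameter (C i) / 2) powr ?d)) + (\<Sum>i. ennreal (e * (1/2)^Suc i))"
    by (rule suminf_add[symmetric]) auto
   also have "(\<Sum>i. ennreal (e * (1/2)^Suc i)) = ennreal e"
    using sums_mult[OF power_half_series, of e] e by (intro suminf_ennreal_eq) auto
   also have "(\<Sum>i. ennreal c * ennreal (hausdorff_const ?d * (diameter (C i) / 2) powr ?d))
     = ennreal c * (\<Sum>i. ennreal (hausdorff_const ?d * (diameter (C i) / 2) powr ?d))" by simp
   also have "... <= ennreal c * (hausdorff_pre ?d 1 S + ennreal e)" by (intro mult_left_mono C(3)) auto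
   also have "ennreal c * (hausdorff_pre ?d 1 S + ennreal e) + ennreal e = ennreal c * hausdorff_pre ?d 1 S + ennreal e'"
    using c e by (simp add: distrib_left add.assoc ennreal_mult'[symmetric] ennreal_plus[symmetric] del: ennreal_plus)
   finally show "emeasure lborel \<Theta> <= ennreal c * hausdorff_pre ?d 1 S + ennreal e'" by (simp add: add_right_mono)
  qed
 qed
 also have "... <= ennreal c * hausdorff ?d S" by (intro mult_left_mono hausdorff_pre_le) auto
 finally show ?thesis by (simp add: c_def)
qed

definition proj_const :: "nat => real" where
 "proj_const n = tube_const n * 2 powr (real n - 1)"

lemma proj_const_pos: "1 <= n ==> 0 < proj_const n"
 by (simp add: proj_const_def tube_const_pos)

lemma hit_borel:
 assumes "open (Om :: 'a::euclidean_space set)"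
 shows "(%th. hit Om x th) \<in> bmb" "{th. exits Om x th} \<in> sets borel"
proof -
 have id: "(%th::'a. th) \<in> bmb" by (rule measurable_ident_sets) (rule refl)
 show "(%th. hit Om x th) \<in> bmb"
  by (rule exit_time_measurable(3)[OF assms borel_measurable_const id])
 show "{th. exits Om x th} \<in> sets borel"
  using exit_time_measurable(2)[OF assms borel_measurable_const id, of x] by simp
qed

lemma sets_hit:
 assumes "open (Om :: 'a::euclidean_space set)" "B \<in> sets borel"
 shows "{th \<in> annulus. exits Om x th & hit Om x th \<in> B} \<in> sets borel"
proof -
 have "{th \<in> annulus. exits Om x th & hit Om x th \<in> B} = annulus \<inter> {th. exits Om x th} \<inter> (hit Om x -` B \<inter> space borel)"
  by auto
 also have "... \<in> sets borel"
  by (intro sets.Int sets_annulus hit_borel[OF assms(1)] measurable_sets[OF hit_borel(1)[OF assms(1)] assms(2)])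
 finally show ?thesis .
qed

lemma projection_dyadic:
 fixes x :: "'a::euclidean_space"
 assumes n: "2 <= DIM('a)" and Om: "open Om" "x \<in> Om" and B: "B \<in> sets borel"
  and s: "0 < s" and Bs: "!!z. z \<in> B ==> s <= dist x z & dist x z <= 2 * s"
 shows "emeasure lborel {th \<in> annulus. exits Om x th & hit Om x th \<in> B} <=
  ennreal (proj_const DIM('a)) * (\<integral>\<^sup>+z. rker (real DIM('a) - 1) x z * indicator B z \<partial>bdm Om)"
proof -
 let ?d = "real DIM('a) - 1"
 let ?H = "hmeas ?d (frontier Om)"
 let ?\<Theta> = "{th \<in> annulus. exits Om x th & hit Om x th \<in> B}"
 have \<Theta>: "?\<Theta> \<in> sets borel" by (rule sets_hit[OF Om(1) B])
 have "emeasure lborel ?\<Theta> <= ennreal (tube_const DIM('a) * s powr (-?d)) * hausdorff ?d (B \<inter> frontier Om)"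
 proof (rule tube_hausdorff[OF n \<Theta> _ s])
  fix th assume th: "th \<in> ?\<Theta>"
  show "EX t>=0. x + t *\<^sub>R th \<in> B \<inter> frontier Om"
  proof (intro exI conjI)
   show "0 <= exit_time Om x th" using th exit_time_nonneg by blast
   have "hit Om x th \<in> B \<inter> frontier Om" using th hit_frontier[OF Om, of th] by simp
   then show "x + exit_time Om x th *\<^sub>R th \<in> B \<inter> frontier Om" by (simp only: hit_def)
  qed
 next
  show "?\<Theta> \<subseteq> annulus" by blast
  show "s <= dist x z" if "z \<in> B \<inter> frontier Om" for z using Bs[of z] that by simp
 qed
 also have "hausdorff ?d (B \<inter> frontier Om) = emeasure ?H B" using B by (subst emeasure_hmeas) auto
 also have "ennreal (tube_const DIM('a) * s powr (-?d)) * emeasure ?H B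
  = ennreal (proj_const DIM('a)) * (\<integral>\<^sup>+z. ennreal ((2 * s) powr (-?d)) * indicator B z \<partial>?H)"
 proof -
  have "tube_const DIM('a) * s powr (-?d) = proj_const DIM('a) * (2 * s) powr (-?d)"
  proof -
   have two: "(2::real) powr ?d * 2 powr (-?d) = 1" by (simp add: powr_add[symmetric])
   have "proj_const DIM('a) * (2 * s) powr (-?d) = tube_const DIM('a) * s powr (-?d) * (2 powr ?d * 2 powr (-?d))"
    by (simp only: proj_const_def powr_mult mult_ac)
   then show ?thesis by (simp only: two mult_1_right)
  qed
  then have "ennreal (tube_const DIM('a) * s powr (-?d)) = ennreal (proj_const DIM('a)) * ennreal ((2 * s) powr (-?d))"
   by (simp add: ennreal_mult'')
  then show ?thesis using B by (simp add: nn_integral_cmult_indicator mult.assoc)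
 qed
 also have "... <= ennreal (proj_const DIM('a)) * (\<integral>\<^sup>+z. rker ?d x z * indicator B z \<partial>?H)"
 proof (intro mult_left_mono nn_integral_mono)
  fix z
  show "ennreal ((2 * s) powr (-?d)) * indicator B z <= rker ?d x z * indicator B z"
  proof (cases "z \<in> B")
   case True
   then have "(2 * s) powr (-?d) <= dist x z powr (-?d)" using Bs[OF True] s n by (intro powr_mono2') auto
   then show ?thesis using True by (simp add: rker_def ennreal_leI)
  qed simp
 qed simp
 finally show ?thesis .
qed

text \<open>On a dyadic shell about \<open>x\<close> the power of the distance in
  \<open>tube_hausdorff\<close> is comparable to the kernel; summing over all integer scales brings
  in the kernel itself. The centre lies in no shell, but an exit point never equals
  \<open>x\<close>, since \<open>x\<close> is in the open set.\<close>

lemma projection: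
 fixes x :: "'a::euclidean_space"
 assumes n: "2 <= DIM('a)" and Om: "open Om" "x \<in> Om" and B: "B \<in> sets borel"
 shows "emeasure lborel {th \<in> annulus. exits Om x th & hit Om x th \<in> B} <=
  ennreal (proj_const DIM('a)) * (\<integral>\<^sup>+z. rker (real DIM('a) - 1) x z * indicator B z \<partial>bdm Om)"
proof -
 let ?d = "real DIM('a) - 1"
 let ?H = "hmeas ?d (frontier Om)"
 let ?T = "%B. {th \<in> annulus. exits Om x th & hit Om x th \<in> B}"
 define A where "A k = {z \<in> B. 2 powr real_of_int k <= dist x z & dist x z < 2 powr (real_of_int k + 1)}" for k
 have A [measurable]: "A k \<in> sets borel" for k
 proof -
  have "A k = B \<inter> {z \<in> space borel. 2 powr real_of_int k <= dist x z & dist x z < 2 powr (real_of_int k + 1)}" by (auto simp: A_def)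
  also have "... \<in> sets borel" by (intro sets.Int B) measurable
  finally show ?thesis .
 qed
 have disj: "disjoint_family (%i. A (int_decode i))"
  unfolding disjoint_family_on_def
 proof (intro ballI impI)
  fix i j :: nat assume "i ~= j"
  then have ne: "int_decode i ~= int_decode j" by (simp add: inj_eq[OF inj_int_decode])
  have no: "A k \<inter> A l = {}" if "k < l" for k l
  proof -
   have "(2::real) powr (real_of_int k + 1) <= 2 powr real_of_int l" using that by (intro powr_mono) auto
   then have "\<not> (2 powr real_of_int l <= d & d < 2 powr (real_of_int k + 1))" for d by linarith
   then show ?thesis unfolding A_def by blast
  qed
  show "A (int_decode i) \<inter> A (int_decode j) = {}"
   using ne no[of "int_decode i" "int_decode j"] no[of "int_decode j" "int_decode i"] by (metis Int_commute linorder_neqE)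
 qed
 have cov: "EX i. z \<in> A (int_decode i)" if "z \<in> B" "z ~= x" for z
 proof -
  have d: "0 < dist x z" using that by simp
  define k where "k = \<lfloor>log 2 (dist x z)\<rfloor>"
  have "2 powr real_of_int k <= 2 powr log 2 (dist x z)" "2 powr log 2 (dist x z) < 2 powr (real_of_int k + 1)"
   unfolding k_def by (intro powr_mono powr_less_mono; linarith)+
  then have "z \<in> A k" using d that by (simp add: A_def)
  then show ?thesis by (intro exI[of _ "int_encode k"]) simp
 qed
 have hitne: "hit Om x th ~= x" if "exits Om x th" for th using hit_notin[OF Om(1) that] Om(2) by metis
 have T: "?T (A k) \<in> sets borel" for k by (rule sets_hit[OF Om(1) A])
 have "?T B \<subseteq> (\<Union>i. ?T (A (int_decode i)))" using cov hitne by blast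
 then have "emeasure lborel (?T B) <= emeasure lborel (\<Union>i. ?T (A (int_decode i)))"
  using T by (intro emeasure_mono) auto
 also have "... <= (\<Sum>i. emeasure lborel (?T (A (int_decode i))))" using T by (intro emeasure_subadditive_countably) auto
 also have "... <= (\<Sum>i. ennreal (proj_const DIM('a)) * (\<integral>\<^sup>+z. rker ?d x z * indicator (A (int_decode i)) z \<partial>?H))"
 proof (intro suminf_le)
  fix i
  show "emeasure lborel (?T (A (int_decode i))) <= ennreal (proj_const DIM('a)) * (\<integral>\<^sup>+z. rker ?d x z * indicator (A (int_decode i)) z \<partial>?H)"
   by (rule projection_dyadic[OF n Om A, where s = "2 powr real_of_int (int_decode i)"])
    (auto simp: A_def powr_add mult.commute)
 qed auto
 also have "... = ennreal (proj_const DIM('a)) * (\<Sum>i. \<integral>\<^sup>+z. rker ?d x z * indicator (A (int_decode i)) z \<partial>?H)" by simp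
 also have "(\<Sum>i. \<integral>\<^sup>+z. rker ?d x z * indicator (A (int_decode i)) z \<partial>?H) = (\<integral>\<^sup>+z. (\<Sum>i. rker ?d x z * indicator (A (int_decode i)) z) \<partial>?H)"
  by (rule nn_integral_suminf[symmetric]) measurable
 also have "... = (\<integral>\<^sup>+z. rker ?d x z * indicator (\<Union>i. A (int_decode i)) z \<partial>?H)"
  by (simp add: suminf_indicator[OF disj])
 also have "... <= (\<integral>\<^sup>+z. rker ?d x z * indicator B z \<partial>?H)"
  by (intro nn_integral_mono mult_left_mono) (auto simp: A_def indicator_def)
 finally show ?thesis by (simp add: mult_left_mono)
qed

section \<open>Means over exit points as an operator\<close>

definition hitT :: "'a::euclidean_space set => ('a => ennreal) => 'a => ennreal" where
 "hitT Om f x = (NNI th. (if exits Om x th then f (hit Om x th) else 0) * iann th)"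

lemma hit_integrand_measurable:
 fixes f :: "'a::euclidean_space => ennreal"
 assumes Om: "open Om" and f: "f \<in> bmb"
  and [measurable]: "g \<in> borel_measurable M" "k \<in> borel_measurable M"
 shows "(%z. if exits Om (g z) (k z) then f (hit Om (g z) (k z)) else 0) \<in> borel_measurable M"
 using exit_time_measurable(2,3)[OF Om, of g M k] f
 by (intro measurable_If measurable_const measurable_compose[OF _ f]) (auto simp: pred_def)

lemma hitT_measurable:
 fixes f :: "'a::euclidean_space => ennreal"
 assumes Om: "open Om" and f: "f \<in> bmb"
 shows "hitT Om f \<in> bmb"
proof -
 have "(%p. if exits Om (fst p) (snd p) then f (hit Om (fst p) (snd p)) else 0) \<in> borel_measurable (borel \<Otimes>\<^sub>M lborel)"
  by (rule hit_integrand_measurable[OF Om f]) measurable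
 moreover have "(%p. iann (snd p :: 'a) :: ennreal) \<in> borel_measurable ((borel :: 'a measure) \<Otimes>\<^sub>M lborel)"
  by measurable
 ultimately have "(%p. (if exits Om (fst p) (snd p) then f (hit Om (fst p) (snd p)) else 0) * iann (snd p)) \<in> borel_measurable (borel \<Otimes>\<^sub>M lborel)"
  by (rule borel_measurable_times_ennreal)
 then have "(%x. \<integral>\<^sup>+th. (if exits Om x th then f (hit Om x th) else 0) * iann th \<partial>lborel) \<in> bmb"
  by (intro lborel.borel_measurable_nn_integral) (simp add: case_prod_beta')
 then show ?thesis by (simp add: hitT_def[abs_def])
qed

text \<open>\<open>projection\<close> is the case of indicators; linearity and monotone limits do
  the rest. From here on the operator is controlled by a potential of the boundary density.\<close>

lemma hitT_le:
 fixes f :: "'a::euclidean_space => ennreal"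
 assumes n: "2 <= DIM('a)" and Om: "open Om" "x \<in> Om" and f: "f \<in> bmb"
 shows "hitT Om f x <= ennreal (proj_const DIM('a)) * (\<integral>\<^sup>+z. rker (real DIM('a) - 1) x z * f z \<partial>bdm Om)"
proof -
 let ?d = "real DIM('a) - 1"
 let ?H = "hmeas ?d (frontier Om)"
 have m: "(%th. (if exits Om x th then f (hit Om x th) else 0) * iann th) \<in> bmb"
  if "f \<in> bmb" for f :: "'a => ennreal"
  by (intro borel_measurable_times_ennreal hit_integrand_measurable[OF Om(1) that]) auto
 show ?thesis using f
 proof (induction rule: borel_measurable_induct)
  case (cong f g)
  then show ?case by simp
 next
  case (set A)
  have "hitT Om (indicator A) x = (NNI th. indicator {th \<in> annulus. exits Om x th & hit Om x th \<in> A} th)"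
   unfolding hitT_def by (intro nn_integral_cong) (auto simp: indicator_def)
  also have "... = emeasure lborel {th \<in> annulus. exits Om x th & hit Om x th \<in> A}"
   using sets_hit[OF Om(1) set, of x] by (intro nn_integral_indicator) simp
  finally show ?case using projection[OF n Om set] by simp
 next
  case (mult u c)
  have "hitT Om (%z. c * u z) x = (NNI th. c * ((if exits Om x th then u (hit Om x th) else 0) * iann th))"
   unfolding hitT_def by (intro nn_integral_cong) (auto simp: mult.assoc)
  also have "... = c * hitT Om u x" unfolding hitT_def by (rule nn_integral_cmult) (use m[OF mult(2)] in simp)
  also have "... <= c * (ennreal (proj_const DIM('a)) * (\<integral>\<^sup>+z. rker ?d x z * u z \<partial>?H))" by (intro mult_left_mono mult.IH) auto
  also have "... = ennreal (proj_const DIM('a)) * (\<integral>\<^sup>+z. c * (rker ?d x z * u z) \<partial>?H)"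
   using mult(2) by (subst nn_integral_cmult) (auto simp: mult_ac)
  finally show ?case by (simp add: mult_ac)
 next
  case (add u v)
  have "hitT Om (%z. v z + u z) x = (NNI th. (if exits Om x th then v (hit Om x th) else 0) * iann th + (if exits Om x th then u (hit Om x th) else 0) * iann th)"
   unfolding hitT_def by (intro nn_integral_cong) (auto simp: distrib_right)
  also have "... = hitT Om v x + hitT Om u x" unfolding hitT_def
   by (rule nn_integral_add) (use m[OF add.hyps(1)] m[OF add.hyps(3)] in simp_all)
  also have "... <= ennreal (proj_const DIM('a)) * (\<integral>\<^sup>+z. rker ?d x z * v z \<partial>?H) + ennreal (proj_const DIM('a)) * (\<integral>\<^sup>+z. rker ?d x z * u z \<partial>?H)"
   by (intro add_mono add.IH)
  also have "... = ennreal (proj_const DIM('a)) * (\<integral>\<^sup>+z. rker ?d x z * v z + rker ?d x z * u z \<partial>?H)"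
   using add.hyps(1,3) by (subst nn_integral_add) (auto simp: distrib_left)
  finally show ?case by (simp add: distrib_left)
 next
  case (seq U)
  have "hitT Om (Sup (range U)) x = (NNI th. (SUP i. (if exits Om x th then U i (hit Om x th) else 0) * iann th))"
   unfolding hitT_def by (intro nn_integral_cong) (auto simp: indicator_def image_image)
  also have "... = (SUP i. hitT Om (U i) x)" unfolding hitT_def
  proof (rule nn_integral_monotone_convergence_SUP)
   show "incseq (%i th. (if exits Om x th then U i (hit Om x th) else 0) * iann th)"
    using seq(3) by (auto simp: incseq_def le_fun_def indicator_def)
  qed (use m[OF seq(1)] in simp)
  also have "... <= (SUP i. ennreal (proj_const DIM('a)) * (\<integral>\<^sup>+z. rker ?d x z * U i z \<partial>?H))"
   by (intro SUP_mono' seq.IH)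
  also have "... <= ennreal (proj_const DIM('a)) * (\<integral>\<^sup>+z. rker ?d x z * Sup (range U) z \<partial>?H)"
   by (intro SUP_least mult_left_mono nn_integral_mono) (auto intro!: SUP_upper simp: image_image)
  finally show ?case .
 qed
qed

lemma hitT_mono: "(!!z. f z <= g z) ==> hitT Om f x <= hitT Om g x"
 unfolding hitT_def by (intro nn_integral_mono mult_right_mono) auto

lemma hitT_add:
 assumes Om: "open Om" and f: "f \<in> bmb" "g \<in> bmb"
 shows "hitT Om (%z. f z + g z) x = hitT Om f x + hitT Om g x"
proof -
 have "hitT Om (%z. f z + g z) x = (NNI th. (if exits Om x th then f (hit Om x th) else 0) * iann th + (if exits Om x th then g (hit Om x th) else 0) * iann th)"
  unfolding hitT_def by (intro nn_integral_cong) (auto simp: distrib_right)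
 also have "... = hitT Om f x + hitT Om g x" unfolding hitT_def
  by (intro nn_integral_add borel_measurable_times_ennreal hit_integrand_measurable[OF Om] f) auto
 finally show ?thesis .
qed

lemma hitT_bounded:
 assumes "!!z. f z <= ennreal c" "0 <= c"
 shows "hitT Om (f :: 'a::euclidean_space => ennreal) x <= ennreal (unit_ball_vol DIM('a) * c)"
proof -
 have "hitT Om f x <= (NNI th. ennreal c * indicator (annulus :: 'a set) th)"
  unfolding hitT_def using assms by (intro nn_integral_mono mult_right_mono) auto
 also have "... = ennreal c * emeasure lborel (annulus :: 'a set)"
  by (rule nn_integral_cmult_indicator) auto
 also have "... <= ennreal c * ennreal (unit_ball_vol DIM('a))" by (intro mult_left_mono emeasure_annulus) auto
 finally show ?thesis using assms by (simp add: ennreal_mult'[symmetric] mult.commute)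
qed

text \<open>By \<open>hitT_le\<close> the operator sends the indicator of a null set to 0. Thus
  almost every ray misses the exceptional set in the definition of an upper gradient.\<close>

lemma hit_null_AE:
 fixes x :: "'a::euclidean_space"
 assumes n: "2 <= DIM('a)" and Om: "open Om" "x \<in> Om" and N: "N \<in> null_sets (bdm Om)"
 shows "AE th in lborel. th \<in> annulus --> exits Om x th --> hit Om x th \<notin> N"
proof -
 have NB: "N \<in> sets borel" using N by auto
 have "hitT Om (indicator N) x <= ennreal (proj_const DIM('a)) * (\<integral>\<^sup>+z. rker (real DIM('a) - 1) x z * indicator N z \<partial>bdm Om)"
  using NB by (intro hitT_le n Om) auto
 also have "(\<integral>\<^sup>+z. rker (real DIM('a) - 1) x z * indicator N z \<partial>bdm Om) = 0"
  using nn_integral_null_set[OF N] by simp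
 finally have "hitT Om (indicator N) x = 0" by simp
 then have "AE th in lborel. (if exits Om x th then indicator N (hit Om x th) else 0) * iann th = (0::ennreal)"
  unfolding hitT_def using NB
  by (subst (asm) nn_integral_0_iff_AE) (auto intro!: borel_measurable_times_ennreal hit_integrand_measurable[OF Om(1)])
 then show ?thesis by (rule eventually_mono) (auto split: if_splits)
qed

section \<open>One-dimensional estimates along a line\<close>

lemma FTC_abs_le:
 fixes F f :: "real => real"
 assumes ab: "a <= b" and D: "!!t. (F has_real_derivative f t) (at t)" and c: "continuous_on UNIV f"
 shows "ennreal \<bar>F b - F a\<bar> <= (NNI t. ennreal \<bar>f t\<bar> * indicator {a..b} t)"
proof -
 have isc: "isCont f t" for t using c continuous_on_eq_continuous_at[OF open_UNIV, of f] by blast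
 have i: "has_bochner_integral lborel (%t. f t * indicator {a..b} t) (F b - F a)"
  by (rule has_bochner_integral_FTC_Icc_real[OF ab D isc])
 have "ennreal (norm (F b - F a)) <= (NNI t. ennreal (norm (f t * indicator {a..b} t)))"
  unfolding has_bochner_integral_integral_eq[OF i, symmetric]
  by (rule integral_norm_bound_ennreal[OF integrable.intros[OF i]])
 also have "... = (NNI t. ennreal \<bar>f t\<bar> * indicator {a..b} t)"
  by (intro nn_integral_cong) (auto simp: indicator_def)
 finally show ?thesis by simp
qed

text \<open>By the mean value theorem some point has exactly the slope of the chord; from there to 0
  the slope changes by at most the integral of \<open>|w''|\<close>. Only values of
  \<open>w\<close>, not of its derivative, are taken at the ends.\<close>

lemma slope_line_estimate:
 fixes w w' w'' :: "real => real"
 assumes D1: "!!t. (w has_real_derivative w' t) (at t)" and D2: "!!t. (w' has_real_derivative w'' t) (at t)"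
  and c: "continuous_on UNIV w''" and ab: "0 < a" "0 < b"
 shows "ennreal \<bar>w' 0\<bar> <= ennreal (\<bar>w b - w (-a)\<bar> / (a + b)) + (NNI t. ennreal \<bar>w'' t\<bar> * indicator {-a..b} t)"
proof -
 obtain \<xi> where \<xi>: "-a < \<xi>" "\<xi> < b" "w b - w (-a) = (b - (-a)) * w' \<xi>"
  using MVT2[of "-a" b w w'] D1 ab by auto
 have S: "w b - w (-a) = (a + b) * w' \<xi>" using \<xi>(3) by (simp add: add.commute)
 from S have "\<bar>w b - w (-a)\<bar> = (a + b) * \<bar>w' \<xi>\<bar>" using ab by (simp add: abs_mult)
 then have E: "\<bar>w' \<xi>\<bar> = \<bar>w b - w (-a)\<bar> / (a + b)" using ab by simp
 have I: "ennreal \<bar>w' 0 - w' \<xi>\<bar> <= (NNI t. ennreal \<bar>w'' t\<bar> * indicator {-a..b} t)"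
 proof (cases "\<xi> <= 0")
  case True
  have "ennreal \<bar>w' 0 - w' \<xi>\<bar> <= (NNI t. ennreal \<bar>w'' t\<bar> * indicator {\<xi>..0} t)" by (rule FTC_abs_le[OF True D2 c])
  also have "... <= (NNI t. ennreal \<bar>w'' t\<bar> * indicator {-a..b} t)"
   using \<xi> ab by (intro nn_integral_mono mult_left_mono) (auto simp: indicator_def)
  finally show ?thesis .
 next
  case False
  have "ennreal \<bar>w' \<xi> - w' 0\<bar> <= (NNI t. ennreal \<bar>w'' t\<bar> * indicator {0..\<xi>} t)" using False by (intro FTC_abs_le D2 c) auto
  also have "... <= (NNI t. ennreal \<bar>w'' t\<bar> * indicator {-a..b} t)"
   using \<xi> ab by (intro nn_integral_mono mult_left_mono) (auto simp: indicator_def)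
  finally show ?thesis by (simp add: abs_minus_commute)
 qed
 have "ennreal \<bar>w' 0\<bar> <= ennreal (\<bar>w' \<xi>\<bar> + \<bar>w' 0 - w' \<xi>\<bar>)" by (intro ennreal_leI) linarith
 also have "... = ennreal \<bar>w' \<xi>\<bar> + ennreal \<bar>w' 0 - w' \<xi>\<bar>" by simp
 also have "... <= ennreal \<bar>w' \<xi>\<bar> + (NNI t. ennreal \<bar>w'' t\<bar> * indicator {-a..b} t)"
  by (rule add_left_mono[OF I])
 finally show ?thesis unfolding E .
qed

text \<open>From \<open>(t * w' - w)' = t * w''\<close>; the weight \<open>t\<close> is what later
  produces a potential of order two. The term \<open>t * w' t\<close> is not controlled at a single
  \<open>t\<close>, so \<open>t\<close> is averaged over the second half of the interval. In the
  factor 3 the averaging accounts for 2 and the passage from \<open>w t\<close> to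
  \<open>w r\<close> for 1.\<close>

lemma value_line_estimate:
 fixes w w' w'' :: "real => real"
 assumes D1: "!!t. (w has_real_derivative w' t) (at t)" and D2: "!!t. (w' has_real_derivative w'' t) (at t)"
  and c: "continuous_on UNIV w''" and r: "0 < r"
 shows "ennreal \<bar>w 0\<bar> <= ennreal \<bar>w r\<bar> + 3 * (NNI t. ennreal \<bar>w' t\<bar> * indicator {r/2..r} t)
   + (NNI t. ennreal (t * \<bar>w'' t\<bar>) * indicator {0..r} t)"
proof -
 let ?I1 = "\<integral>\<^sup>+t. ennreal \<bar>w' t\<bar> * indicator {r/2..r} t \<partial>lborel"
 let ?I2 = "\<integral>\<^sup>+t. ennreal (t * \<bar>w'' t\<bar>) * indicator {0..r} t \<partial>lborel"
 have c': "continuous_on UNIV w'" using D2 by (intro continuous_at_imp_continuous_on ballI) (rule DERIV_isCont)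
 then have [measurable]: "w' \<in> bmb" by (rule borel_measurable_continuous_onI)
 have pt: "ennreal \<bar>w 0\<bar> <= (ennreal \<bar>w r\<bar> + ?I1 + ?I2) + ennreal r * ennreal \<bar>w' t\<bar>" if t: "t \<in> {r/2..r}" for t
 proof -
  have t0: "0 <= t" "t <= r" "r/2 <= t" using t r by auto
  have "((%ta. ta * w' ta - w ta) has_real_derivative ta * w'' ta) (at ta)" for ta
   by (auto intro!: derivative_eq_intros D1 D2)
  then have "ennreal \<bar>(t * w' t - w t) - (0 * w' 0 - w 0)\<bar> <= (NNI ta. ennreal \<bar>ta * w'' ta\<bar> * indicator {0..t} ta)"
   by (intro FTC_abs_le[OF t0(1)] continuous_intros c)
  also have "... <= ?I2" using t0 by (intro nn_integral_mono) (auto simp: indicator_def abs_mult)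
  finally have a: "ennreal \<bar>t * w' t - w t + w 0\<bar> <= ?I2" by simp
  have "ennreal \<bar>w r - w t\<bar> <= (NNI ta. ennreal \<bar>w' ta\<bar> * indicator {t..r} ta)"
   by (rule FTC_abs_le[OF t0(2) D1 c'])
  also have "... <= ?I1" using t0 by (intro nn_integral_mono) (auto simp: indicator_def)
  finally have b: "ennreal \<bar>w r - w t\<bar> <= ?I1" .
  have "\<bar>w 0\<bar> <= \<bar>w r\<bar> + \<bar>w r - w t\<bar> + \<bar>t * w' t - w t + w 0\<bar> + r * \<bar>w' t\<bar>"
  proof -
   have "w 0 = w r - (w r - w t) + (t * w' t - w t + w 0) - t * w' t" by simp
   moreover have "\<bar>t * w' t\<bar> <= r * \<bar>w' t\<bar>" unfolding abs_mult using t0 by (intro mult_right_mono) auto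
   ultimately show ?thesis by linarith
  qed
  then have "ennreal \<bar>w 0\<bar> <= ennreal (\<bar>w r\<bar> + \<bar>w r - w t\<bar> + \<bar>t * w' t - w t + w 0\<bar> + r * \<bar>w' t\<bar>)" by (rule ennreal_leI)
  also have "... = ennreal \<bar>w r\<bar> + ennreal \<bar>w r - w t\<bar> + ennreal \<bar>t * w' t - w t + w 0\<bar> + ennreal r * ennreal \<bar>w' t\<bar>"
   using r by (simp add: ennreal_mult')
  also have "... <= (ennreal \<bar>w r\<bar> + ?I1 + ?I2) + ennreal r * ennreal \<bar>w' t\<bar>"
   by (intro add_mono a b order.refl)
  finally show ?thesis .
 qed
 have "ennreal (r/2) * ennreal \<bar>w 0\<bar> = (NNI t. ennreal \<bar>w 0\<bar> * indicator {r/2..r} t)"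
  using r by (subst nn_integral_cmult_indicator) (auto simp: mult.commute)
 also have "... <= (NNI t. (ennreal \<bar>w r\<bar> + ?I1 + ?I2) * indicator {r/2..r} t + ennreal r * (ennreal \<bar>w' t\<bar> * indicator {r/2..r} t))"
  using pt by (intro nn_integral_mono) (simp add: indicator_def)
 also have "... = (ennreal \<bar>w r\<bar> + ?I1 + ?I2) * ennreal (r/2) + ennreal r * ?I1"
 proof (subst nn_integral_add)
  have "(NNI t. (ennreal \<bar>w r\<bar> + ?I1 + ?I2) * indicator {r/2..r} t) = (ennreal \<bar>w r\<bar> + ?I1 + ?I2) * emeasure lborel {r/2..r}"
   by (rule nn_integral_cmult_indicator) simp
  also have "emeasure lborel {r/2..r} = ennreal (r/2)" using r by simp
  moreover have "(NNI t. ennreal r * (ennreal \<bar>w' t\<bar> * indicator {r/2..r} t)) = ennreal r * ?I1"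
   by (rule nn_integral_cmult) measurable
  ultimately show "(NNI t. (ennreal \<bar>w r\<bar> + ?I1 + ?I2) * indicator {r/2..r} t) + (NNI t. ennreal r * (ennreal \<bar>w' t\<bar> * indicator {r/2..r} t))
   = (ennreal \<bar>w r\<bar> + ?I1 + ?I2) * ennreal (r/2) + ennreal r * ?I1" by simp
 qed measurable
 also have "... = ennreal (r/2) * (ennreal \<bar>w r\<bar> + ?I1 + ?I2 + 2 * ?I1)"
 proof -
  have "ennreal r = ennreal (r/2) * ennreal 2" using r by (subst ennreal_mult'[symmetric]) auto
  then have r2: "ennreal r = ennreal (r/2) * 2" by simp
  have "ennreal (r/2) * (X + 2 * Y) = X * ennreal (r/2) + ennreal (r/2) * 2 * Y" for X Y
   by (simp only: distrib_left mult.assoc mult.commute[of X])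
  then show ?thesis by (simp only: r2)
 qed
 finally have "ennreal \<bar>w 0\<bar> <= ennreal \<bar>w r\<bar> + ?I1 + ?I2 + 2 * ?I1"
  using r ennreal_mult_le_mult_iff[of "ennreal (r/2)"] by (simp add: ennreal_eq_0_iff)
 also have "... = ennreal \<bar>w r\<bar> + (?I1 + 2 * ?I1) + ?I2" by (simp add: ac_simps)
 also have "?I1 + 2 * ?I1 = 3 * ?I1"
 proof -
  have "(1 + 2) * ?I1 = ?I1 + 2 * ?I1" by (simp only: distrib_right mult_1_left)
  moreover have "(1 + 2 :: ennreal) = 3" by simp
  ultimately show ?thesis by simp
 qed
 finally show ?thesis .
qed

text \<open>The ball of radius 1/4 about 3/4 of the unit vector along \<open>v\<close> lies in the
  annulus, and on it the integrand is at least half of \<open>norm v\<close>. This recovers a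
  gradient from its directional derivatives.\<close>

lemma norm_le_annulus_integral:
 fixes v :: "'a::euclidean_space"
 shows "ennreal (norm v * (unit_ball_vol DIM('a) / (2 * 4 ^ DIM('a)))) <= (NNI th. ennreal \<bar>v \<bullet> th\<bar> * iann th)"
proof (cases "v = 0")
 case False
 define e where "e = v /\<^sub>R norm v"
 have e: "norm e = 1" using False by (simp add: e_def)
 have v: "v = norm v *\<^sub>R e" using False by (simp add: e_def)
 have in_ball: "th \<in> annulus & norm v / 2 <= \<bar>v \<bullet> th\<bar>" if "th \<in> ball ((3/4) *\<^sub>R e) (1/4)" for th
 proof -
  have d: "norm (th - (3/4) *\<^sub>R e) < 1/4" using that by (simp add: dist_norm norm_minus_commute)
  have "norm th <= norm ((3/4) *\<^sub>R e) + norm (th - (3/4) *\<^sub>R e)" by (metis norm_triangle_sub)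
  moreover have "norm ((3/4) *\<^sub>R e) <= norm th + norm (th - (3/4) *\<^sub>R e)" by (metis norm_minus_commute norm_triangle_sub)
  ultimately have "th \<in> annulus" using d e by (simp add: annulus_def)
  have "e \<bullet> th = 3/4 * (e \<bullet> e) + e \<bullet> (th - (3/4) *\<^sub>R e)" by (simp add: inner_diff_right)
  moreover have "\<bar>e \<bullet> (th - (3/4) *\<^sub>R e)\<bar> <= 1/4" using Cauchy_Schwarz_ineq2[of e "th - (3/4) *\<^sub>R e"] d e by simp
  moreover have "e \<bullet> e = 1" using e by (simp add: dot_square_norm)
  ultimately have "1/2 <= e \<bullet> th" by linarith
  then have "norm v * (1/2) <= norm v * (e \<bullet> th)" by (intro mult_left_mono) auto
  also have "norm v * (e \<bullet> th) = v \<bullet> th" by (subst (2) v) simp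
  finally show ?thesis using \<open>th \<in> annulus\<close> by simp
 qed
 have "ennreal (norm v * (unit_ball_vol DIM('a) / (2 * 4 ^ DIM('a)))) = (NNI th. ennreal (norm v / 2) * indicator (ball ((3/4) *\<^sub>R e) (1/4)) th)"
  by (subst nn_integral_cmult_indicator) (auto simp: emeasure_ball ennreal_mult'[symmetric] power_one_over field_simps)
 also have "... <= (NNI th. ennreal \<bar>v \<bullet> th\<bar> * iann th)"
 proof (rule nn_integral_mono)
  fix th
  show "ennreal (norm v / 2) * indicator (ball ((3/4) *\<^sub>R e) (1/4)) th <= ennreal \<bar>v \<bullet> th\<bar> * iann th"
   using in_ball[of th] by (cases "th \<in> ball ((3/4) *\<^sub>R e) (1/4)") (auto intro!: ennreal_leI)
 qed
 finally show ?thesis .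
qed simp

section \<open>Exhaustion by subdomains\<close>

definition inner_part :: "'a::euclidean_space set => nat => 'a set" where
 "inner_part Om m = {y \<in> Om. norm y < real (Suc m) & 1 / real (Suc m) < infdist y (- Om)}"

lemma inner_part_open: "open Om ==> open (inner_part Om m)"
proof -
 assume "open Om"
 moreover have "open {y :: 'a. norm y < real (Suc m)}" by (intro open_Collect_less continuous_intros)
 moreover have "open {y. 1 / real (Suc m) < infdist y (- Om)}" by (intro open_Collect_less continuous_intros)
 ultimately have "open (Om \<inter> {y. norm y < real (Suc m)} \<inter> {y. 1 / real (Suc m) < infdist y (- Om)})" by (intro open_Int)
 moreover have "inner_part Om m = Om \<inter> {y. norm y < real (Suc m)} \<inter> {y. 1 / real (Suc m) < infdist y (- Om)}"
  by (auto simp: inner_part_def)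
 ultimately show ?thesis by simp
qed

lemma inner_part_subset: "inner_part Om m \<subseteq> Om"
 by (auto simp: inner_part_def)

lemma inner_part_bounded: "bounded (inner_part Om m)"
 unfolding bounded_iff inner_part_def by (intro exI[of _ "real (Suc m)"]) auto

lemma inner_part_mono: "m <= k ==> inner_part Om m \<subseteq> inner_part Om k"
proof
 fix y assume "m <= k" "y \<in> inner_part Om m"
 moreover from \<open>m <= k\<close> have "1 / real (Suc k) <= 1 / real (Suc m)" by (intro divide_left_mono) auto
 ultimately show "y \<in> inner_part Om k" by (auto simp: inner_part_def)
qed

lemma cball_subset_infdist:
 assumes "1 / real (Suc m) <= infdist y (- Om)" "de < 1 / real (Suc m)"
 shows "cball y de \<subseteq> Om"
proof
 fix z assume "z \<in> cball y de"
 then show "z \<in> Om" using infdist_le[of z "- Om" y] assms by (cases "z \<in> Om") auto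
qed

lemma inner_part_exits: "th \<in> annulus ==> exits (inner_part Om m) x th"
 by (intro exits_bounded inner_part_bounded) (auto simp: annulus_def)

lemma annulus_uminus: "-th \<in> annulus \<longleftrightarrow> th \<in> annulus"
 by (simp add: annulus_def)

text \<open>The strict distance bound of \<open>inner_part\<close> becomes a non-strict one on the
  closure, hence also at the exit point. Mollification at any scale below
  \<open>1 / real (Suc m)\<close> is therefore legitimate on the whole closed segment.\<close>

lemma inner_part_segment:
 assumes Om: "open Om" and x: "x \<in> inner_part Om m" and th: "th \<in> annulus"
  and t: "0 <= t" "t <= exit_time (inner_part Om m) x th"
 shows "1 / real (Suc m) <= infdist (x + t *\<^sub>R th) (- Om)"
proof -
 let ?U = "inner_part Om m"
 have "x + t *\<^sub>R th \<in> closure ?U"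
 proof (cases "t < exit_time ?U x th")
  case True
  then show ?thesis using exit_time_inside[OF t(1) True] closure_subset by blast
 next
  case False
  then have "x + t *\<^sub>R th = hit ?U x th" using t by (simp add: hit_def)
  then show ?thesis using hit_frontier[OF inner_part_open[OF Om] x inner_part_exits[OF th]] by (simp add: frontier_def)
 qed
 moreover have "closure ?U \<subseteq> {y. 1 / real (Suc m) <= infdist y (- Om)}"
 proof (rule closure_minimal)
  show "closed {y. 1 / real (Suc m) <= infdist y (- Om)}" by (intro closed_Collect_le continuous_intros)
 qed (auto simp: inner_part_def)
 ultimately show ?thesis by blast
qed

text \<open>Along a ray the point moves with speed at least 1/2, while two points of the subdomain
  are at distance less than \<open>2 * real (Suc m)\<close>.\<close>

lemma exit_time_inner_le:
 assumes "th \<in> annulus" "x \<in> inner_part Om m" "open Om"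
 shows "exit_time (inner_part Om m) x th <= 4 * real (Suc m)"
proof (rule ccontr)
 define T where "T = 4 * real (Suc m)"
 assume "\<not> ?thesis"
 then have "x + T *\<^sub>R th \<in> inner_part Om m" by (intro exit_time_inside) (auto simp: T_def)
 then have "norm (x + T *\<^sub>R th) + norm x < real (Suc m) + real (Suc m)" using assms by (intro add_strict_mono) (auto simp: inner_part_def)
 moreover have "norm (T *\<^sub>R th) <= norm (x + T *\<^sub>R th) + norm x" using norm_triangle_ineq4[of "x + T *\<^sub>R th" x] by simp
 ultimately have "norm (T *\<^sub>R th) < real (Suc m) + real (Suc m)" by (rule le_less_trans[rotated])
 moreover have "real (Suc m) + real (Suc m) = T * (1/2)" by (simp add: T_def)
 moreover have "T * (1/2) <= T * norm th" using assms(1) by (intro mult_left_mono) (auto simp: annulus_def T_def)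
 moreover have "norm (T *\<^sub>R th) = T * norm th" by (simp add: T_def)
 ultimately show False by (metis not_le)
qed

text \<open>The lower bound is the room between subdomain \<open>m\<close> and the next one, and so
  does not depend on \<open>k\<close>. It keeps the denominators of slope quotients away from 0
  uniformly in the larger subdomain.\<close>

lemma exit_time_gap:
 assumes Om: "open Om" and y: "y \<in> inner_part Om m" and k: "Suc m <= k" and th: "th \<in> annulus"
 shows "1 / real (Suc m) - 1 / real (Suc (Suc m)) <= exit_time (inner_part Om k) y th"
proof (rule exit_time_greatest[OF inner_part_exits[OF th]], rule ccontr)
 fix t assume t: "0 <= t" "y + t *\<^sub>R th \<notin> inner_part Om k" and lt: "\<not> 1 / real (Suc m) - 1 / real (Suc (Suc m)) <= t"
 have n: "norm (t *\<^sub>R th) <= t" using th t by (simp add: annulus_def mult_left_le)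
 have sk: "1 / real (Suc k) <= 1 / real (Suc (Suc m))" using k by (intro divide_left_mono) auto
 have g1: "1 / real (Suc m) <= (1::real)" by simp
 have "infdist y (- Om) <= infdist (y + t *\<^sub>R th) (- Om) + dist y (y + t *\<^sub>R th)" by (rule infdist_triangle)
 then have "1 / real (Suc k) < infdist (y + t *\<^sub>R th) (- Om)" using y n lt sk by (simp add: inner_part_def dist_norm)
 moreover from this have "y + t *\<^sub>R th \<in> Om"
  by (metis Compl_iff infdist_zero less_asym divide_pos_pos of_nat_0_less_iff zero_less_Suc zero_less_one)
 moreover have "norm (y + t *\<^sub>R th) < real (Suc k)"
 proof -
  have "norm (y + t *\<^sub>R th) <= norm y + t" using norm_triangle_ineq[of y "t *\<^sub>R th"] n by simp
  also have "... < real (Suc m) + 1"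
  proof -
   have "0 < 1 / real (Suc (Suc m))" by simp
   then have "t < 1" using lt g1 by linarith
   then show ?thesis using y by (simp add: inner_part_def)
  qed
  also have "... <= real (Suc k)" using k by simp
  finally show ?thesis .
 qed
 ultimately show False using t(2) by (simp add: inner_part_def)
qed

lemma inner_part_compact:
 assumes Om: "open Om" "Om ~= UNIV" and K: "compact K" "K \<subseteq> Om"
 shows "EX m. K \<subseteq> inner_part Om m"
proof (cases "K = {}")
 case False
 have "continuous_on K (%y. infdist y (- Om))" by (intro continuous_intros)
 from continuous_attains_inf[OF K(1) False this] obtain y0 where y0: "y0 \<in> K" "!!y. y \<in> K ==> infdist y0 (- Om) <= infdist y (- Om)" by blast
 have pos: "0 < infdist y0 (- Om)"
  using y0 K Om by (intro infdist_pos_not_in_closed) auto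
 obtain B where B: "!!y. y \<in> K ==> norm y <= B" using compact_imp_bounded[OF K(1)] unfolding bounded_iff by blast
 obtain m1 where m1: "1 / real (Suc m1) < infdist y0 (- Om)" using pos nat_approx_posE by blast
 obtain m2 :: nat where m2: "B < real m2" using reals_Archimedean2 by blast
 define m where "m = max m1 m2"
 have "1 / real (Suc m) <= 1 / real (Suc m1)" by (intro divide_left_mono) (auto simp: m_def)
 moreover have "B < real (Suc m)" using m2 by (simp add: m_def)
 ultimately have "K \<subseteq> inner_part Om m" using B y0(2) m1 K(2) unfolding inner_part_def by force
 then show ?thesis by blast
qed simp

text \<open>An initial piece of the ray strictly before the exit is compact, hence contained in all
  late subdomains, so these cannot be left earlier than that piece ends.\<close>

lemma exit_time_inner_tendsto:
 assumes Om: "open Om" "Om ~= UNIV" and x: "x \<in> Om" and ex: "exits Om x th"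
 shows "(%m. exit_time (inner_part Om m) x th) \<longlonglongrightarrow> exit_time Om x th"
proof (rule LIMSEQ_I)
 let ?e = "exit_time Om x th"
 fix r :: real assume r: "0 < r"
 have e: "0 < ?e" by (rule exit_time_pos[OF Om(1) x ex])
 define t where "t = max 0 (?e - r/2)"
 have t: "0 <= t" "t < ?e" "?e - r < t" using r e by (auto simp: t_def)
 have "(%s. x + s *\<^sub>R th) ` {0..t} \<subseteq> Om" using exit_time_inside[of _ Om x th] t by force
 moreover have "compact ((%s. x + s *\<^sub>R th) ` {0..t})" by (intro compact_continuous_image continuous_intros) auto
 ultimately obtain M where M: "(%s. x + s *\<^sub>R th) ` {0..t} \<subseteq> inner_part Om M" using inner_part_compact[OF Om] by blast
 have "\<bar>exit_time (inner_part Om m) x th - ?e\<bar> < r" if m: "M <= m" for m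
 proof -
  have le: "exit_time (inner_part Om m) x th <= ?e" and ex': "exits (inner_part Om m) x th"
   using exit_time_mono[OF inner_part_subset ex] by auto
  have "t <= exit_time (inner_part Om m) x th"
  proof (rule exit_time_greatest[OF ex'], rule ccontr)
   fix s assume s: "0 <= s" "x + s *\<^sub>R th \<notin> inner_part Om m" "\<not> t <= s"
   then have "x + s *\<^sub>R th \<in> (%s. x + s *\<^sub>R th) ` {0..t}" by (intro imageI) simp
   then show False using M inner_part_mono[OF m, of Om] s(2) by blast
  qed
  then show ?thesis using le t by simp
 qed
 then show "EX no. ALL m>=no. norm (exit_time (inner_part Om m) x th - ?e) < r" by auto
qed

section \<open>Riesz potentials of averages and their composition\<close>

definition pot :: "real => ('a::euclidean_space => real) => 'a => ennreal" where
 "pot b h x = (NNI z. rker b x z * ennreal (h z))"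

lemma rker_pair [measurable]: "(%p. rker b (fst p) (snd p)) \<in> borel_measurable ((borel :: 'a::euclidean_space measure) \<Otimes>\<^sub>M borel)"
 by measurable

lemma pot_measurable [measurable]:
 assumes [measurable]: "h \<in> bmb"
 shows "pot b h \<in> bmb"
 unfolding pot_def by measurable

definition avgh :: "real => ('a::euclidean_space => real) => 'a => ennreal" where
 "avgh de h y = ennreal (1 / de ^ DIM('a)) * (NNI z. ennreal (h z) * indicator (ball y de) z)"

lemma avgh_eq: "avgh de h (y::'a::euclidean_space) = ennreal (1 / de ^ DIM('a)) * (NNI z. (if dist y z < de then ennreal (h z) else 0))"
 unfolding avgh_def by (intro arg_cong2[where f="(*)"] nn_integral_cong refl) (auto simp: indicator_def)

lemma avgh_measurable [measurable]:
 assumes [measurable]: "h \<in> bmb"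
 shows "avgh de h \<in> bmb"
 unfolding avgh_eq[abs_def] by measurable

definition avg_const :: "nat => real => real" where
 "avg_const n b = 2 powr b * unit_ball_vol n * (1 + near_const n b * 3 powr (real n - b))"

lemma avg_const_nonneg: "b < real n ==> 0 <= avg_const n b"
 unfolding avg_const_def using near_const_pos[of b "real n"] by (intro mult_nonneg_nonneg add_nonneg_nonneg) auto

text \<open>Fubini moves the average from the density onto the kernel, where
  \<open>rker_average\<close> applies with a constant independent of \<open>de\<close>.\<close>

lemma pot_avgh:
 fixes h :: "'a::euclidean_space => real" and b :: real
 assumes [measurable]: "h \<in> bmb" and b: "0 <= b" "b < DIM('a)" and de: "0 < de"
 shows "(NNI y. avgh de h y * rker b x y) <= ennreal (avg_const DIM('a) b) * pot b h x"
proof -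
 have "(NNI y. avgh de h y * rker b x y) = (NNI y. (NNI z. ennreal (1 / de ^ DIM('a)) * ((if dist y z < de then ennreal (h z) else 0) * rker b x y)))"
  unfolding avgh_eq
 proof (rule nn_integral_cong)
  fix y
  have "(NNI z. ennreal (1 / de ^ DIM('a)) * ((if dist y z < de then ennreal (h z) else 0) * rker b x y))
   = ennreal (1 / de ^ DIM('a)) * (NNI z. (if dist y z < de then ennreal (h z) else 0) * rker b x y)"
   by (rule nn_integral_cmult) measurable
  also have "(NNI z. (if dist y z < de then ennreal (h z) else 0) * rker b x y) = (NNI z. (if dist y z < de then ennreal (h z) else 0)) * rker b x y"
   by (rule nn_integral_multc) measurable
  finally show "ennreal (1 / de ^ DIM('a)) * (NNI z. (if dist y z < de then ennreal (h z) else 0)) * rker b x y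
   = (NNI z. ennreal (1 / de ^ DIM('a)) * ((if dist y z < de then ennreal (h z) else 0) * rker b x y))"
   by (simp only: mult.assoc)
 qed
 also have "... = (NNI z. (NNI y. ennreal (1 / de ^ DIM('a)) * ((if dist y z < de then ennreal (h z) else 0) * rker b x y)))"
  by (rule lborel_pair.Fubini') measurable
 also have "... <= (NNI z. ennreal (avg_const DIM('a) b) * (rker b x z * ennreal (h z)))"
 proof (rule nn_integral_mono_AE)
  have "AE z in lborel. z ~= x" by (rule AE_lborel_singleton)
  then show "AE z in lborel. (NNI y. ennreal (1 / de ^ DIM('a)) * ((if dist y z < de then ennreal (h z) else 0) * rker b x y))
   <= ennreal (avg_const DIM('a) b) * (rker b x z * ennreal (h z))"
  proof (rule eventually_mono)
   fix z assume z: "z ~= x"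
   have "(NNI y. ennreal (1 / de ^ DIM('a)) * ((if dist y z < de then ennreal (h z) else 0) * rker b x y))
    = (NNI y. (ennreal (1 / de ^ DIM('a)) * ennreal (h z)) * (rker b x y * indicator (ball z de) y))"
    by (intro nn_integral_cong) (auto simp: indicator_def dist_commute mult_ac)
   also have "... = (ennreal (1 / de ^ DIM('a)) * ennreal (h z)) * (NNI y. rker b x y * indicator (ball z de) y)"
    by (rule nn_integral_cmult) measurable
   also have "... <= (ennreal (1 / de ^ DIM('a)) * ennreal (h z)) * (ennreal (avg_const DIM('a) b * de ^ DIM('a)) * rker b x z)"
    unfolding avg_const_def using z b de by (intro mult_left_mono rker_average) auto
   also have "... = (ennreal (1 / de ^ DIM('a)) * ennreal (avg_const DIM('a) b * de ^ DIM('a))) * (rker b x z * ennreal (h z))"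
    by (simp only: mult_ac)
   also have "ennreal (1 / de ^ DIM('a)) * ennreal (avg_const DIM('a) b * de ^ DIM('a)) = ennreal (avg_const DIM('a) b)"
    using de by (subst ennreal_mult'[symmetric]) auto
   finally show "(NNI y. ennreal (1 / de ^ DIM('a)) * ((if dist y z < de then ennreal (h z) else 0) * rker b x y))
    <= ennreal (avg_const DIM('a) b) * (rker b x z * ennreal (h z))" .
  qed
 qed
 also have "... = ennreal (avg_const DIM('a) b) * pot b h x"
  unfolding pot_def by (rule nn_integral_cmult) measurable
 finally show ?thesis .
qed

definition comp_const :: "nat => real" where
 "comp_const n = 2 * unit_ball_vol n * (near_const n (real n - 1) + far_const n (2 * (real n - 1))) * 2 powr (real n - 2)"

lemma comp_const_nonneg: "3 <= n ==> 0 <= comp_const n"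
 unfolding comp_const_def using near_const_pos[of "real n - 1" "real n"] far_const_pos[of "real n" "2 * (real n - 1)"]
 by (intro mult_nonneg_nonneg add_nonneg_nonneg) auto

text \<open>The index of \<open>pot\<close> is the exponent of the kernel, so the order is the
  dimension minus the index: order one applied twice gives order two. Integrability of the composed
  kernel at infinity requires \<open>2 * (n-1) > n\<close>, that is, dimension at least 3.\<close>

lemma pot_pot:
 fixes h :: "'a::euclidean_space => real"
 assumes n: "3 <= DIM('a)" and [measurable]: "h \<in> bmb"
 shows "(NNI y. pot (real DIM('a) - 1) h y * rker (real DIM('a) - 1) x y) <= ennreal (comp_const DIM('a)) * pot (real DIM('a) - 2) h x"
proof -
 let ?b = "real DIM('a) - 1"
 have "(NNI y. pot ?b h y * rker ?b x y) = (NNI y. (NNI z. (rker ?b y z * ennreal (h z)) * rker ?b x y))"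
  unfolding pot_def by (intro nn_integral_cong nn_integral_multc[symmetric]) measurable
 also have "... = (NNI z. (NNI y. (rker ?b y z * ennreal (h z)) * rker ?b x y))"
  by (rule lborel_pair.Fubini') measurable
 also have "... <= (NNI z. ennreal (comp_const DIM('a)) * (rker (real DIM('a) - 2) x z * ennreal (h z)))"
 proof (rule nn_integral_mono_AE)
  have "AE z in lborel. z ~= x" by (rule AE_lborel_singleton)
  then show "AE z in lborel. (NNI y. (rker ?b y z * ennreal (h z)) * rker ?b x y) <= ennreal (comp_const DIM('a)) * (rker (real DIM('a) - 2) x z * ennreal (h z))"
  proof (rule eventually_mono)
   fix z assume z: "z ~= x"
   have e: "2 * ?b - real DIM('a) = real DIM('a) - 2" by simp
   have "(NNI y. (rker ?b y z * ennreal (h z)) * rker ?b x y) = (NNI y. ennreal (h z) * (rker ?b x y * rker ?b y z))"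
    by (intro nn_integral_cong) (simp only: mult_ac)
   also have "... = ennreal (h z) * (NNI y. rker ?b x y * rker ?b y z)"
    by (rule nn_integral_cmult) measurable
   also have "... <= ennreal (h z) * (ennreal (comp_const DIM('a)) * rker (real DIM('a) - 2) x z)"
    using rker_compose[of ?b x z] z n unfolding e comp_const_def by (intro mult_left_mono) auto
   finally show "(NNI y. (rker ?b y z * ennreal (h z)) * rker ?b x y) <= ennreal (comp_const DIM('a)) * (rker (real DIM('a) - 2) x z * ennreal (h z))"
    by (simp only: mult_ac)
  qed
 qed
 also have "... = ennreal (comp_const DIM('a)) * pot (real DIM('a) - 2) h x"
  unfolding pot_def by (rule nn_integral_cmult) measurable
 finally show ?thesis .
qed

section \<open>Gradient and value of a mollification\<close>

lemma mollified_second_derivative: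
 assumes m: "mollified Om u h K de w D H" and K: "0 <= K" and de: "0 < de" "cball y de \<subseteq> Om" and th: "norm th <= 1"
 shows "ennreal \<bar>H th y\<bar> <= ennreal K * avgh de h y"
proof -
 let ?n = "DIM('a::euclidean_space)"
 have "ennreal \<bar>H th y\<bar> <= ennreal (K * (norm th)\<^sup>2 / de ^ DIM('a)) * (NNI z. ennreal (h z) * indicator (ball y de) z)"
  using m de(2) unfolding mollified_def by blast
 also have "... <= ennreal (K * (1 / de ^ DIM('a))) * (NNI z. ennreal (h z) * indicator (ball y de) z)"
 proof (intro mult_right_mono ennreal_leI)
  have "(norm th)\<^sup>2 <= 1" using th by (simp add: power_le_one)
  then have "K * (norm th)\<^sup>2 <= K * 1" using K by (rule mult_left_mono)
  then show "K * (norm th)\<^sup>2 / de ^ DIM('a) <= K * (1 / de ^ DIM('a))" using de by (simp add: divide_right_mono)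
 qed simp
 finally show ?thesis unfolding avgh_def using K by (simp only: ennreal_mult' mult.assoc)
qed

lemma nn_integral_real_reflect:
 fixes f :: "real => ennreal"
 assumes "f \<in> bmb"
 shows "(NNI t. f (-t)) = (NNI t. f t)"
 using nn_integral_lborel_scale[OF assms, of "-1" 0] by simp

text \<open>The mean slope of \<open>v\<close> over the chords of \<open>U\<close> through
  \<open>y\<close>, with a slack \<open>wo\<close> for the replacement of the mollification by
  \<open>v\<close> at the two ends.\<close>

definition slopeQ :: "'a::euclidean_space set => ('a => real) => real => 'a => ennreal" where
 "slopeQ U v wo y = (NNI th. ennreal ((\<bar>v (hit U y th) - v (hit U y (-th))\<bar> + wo) / (exit_time U y th + exit_time U y (-th))) * iann th)"

lemma slope_integrand_measurable:
 fixes v :: "'a::euclidean_space => real"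
 assumes U: "open U" and v: "v \<in> bmb"
  and f: "f \<in> borel_measurable M" and g: "g \<in> borel_measurable M"
 shows "(%z. ennreal ((\<bar>v (hit U (f z) (g z)) - v (hit U (f z) (- g z))\<bar> + wo) / (exit_time U (f z) (g z) + exit_time U (f z) (- g z)))) \<in> borel_measurable M"
proof -
 have g': "(%z. - g z) \<in> borel_measurable M" using g by measurable
 have [measurable]: "(%z. v (hit U (f z) (g z))) \<in> borel_measurable M" "(%z. v (hit U (f z) (- g z))) \<in> borel_measurable M"
  by (rule measurable_compose[OF exit_time_measurable(3)[OF U f g] v], rule measurable_compose[OF exit_time_measurable(3)[OF U f g'] v])
 have [measurable]: "(%z. exit_time U (f z) (g z)) \<in> borel_measurable M" "(%z. exit_time U (f z) (- g z)) \<in> borel_measurable M"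
  by (rule exit_time_measurable(1)[OF U f g], rule exit_time_measurable(1)[OF U f g'])
 show ?thesis by measurable
qed

lemma slopeQ_measurable:
 fixes v :: "'a::euclidean_space => real"
 assumes U: "open U" and v: "v \<in> bmb"
 shows "slopeQ U v wo \<in> bmb"
proof -
 have "(%p. ennreal ((\<bar>v (hit U (fst p) (snd p)) - v (hit U (fst p) (- snd p))\<bar> + wo) / (exit_time U (fst p) (snd p) + exit_time U (fst p) (- snd p)))) \<in> borel_measurable (borel \<Otimes>\<^sub>M lborel)"
  by (rule slope_integrand_measurable[OF U v]) measurable
 moreover have "(%p. iann (snd p :: 'a) :: ennreal) \<in> borel_measurable ((borel :: 'a measure) \<Otimes>\<^sub>M lborel)"
  by measurable
 ultimately have "(%p. ennreal ((\<bar>v (hit U (fst p) (snd p)) - v (hit U (fst p) (- snd p))\<bar> + wo) / (exit_time U (fst p) (snd p) + exit_time U (fst p) (- snd p))) * iann (snd p)) \<in> borel_measurable (borel \<Otimes>\<^sub>M lborel)"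
  by (rule borel_measurable_times_ennreal)
 then show ?thesis unfolding slopeQ_def[abs_def]
  by (intro lborel.borel_measurable_nn_integral) (simp add: case_prod_beta')
qed

text \<open>\<open>slope_line_estimate\<close> on the chord in direction \<open>th\<close>, averaged
  over the annulus. A chord consists of two opposite rays, whose means agree by reflection; hence
  the factor 2 in front of the potential.\<close>

lemma gradient_bound:
 fixes Om :: "'a::euclidean_space set"
 assumes Om: "open Om" and mo: "mollified Om u h K de w D H" and K: "0 <= K"
  and de: "0 < de" "de < 1 / real (Suc m)"
  and h [measurable]: "h \<in> bmb" and v: "v \<in> bmb"
  and close: "!!p. 1 / real (Suc m) <= infdist p (- Om) ==> \<bar>w p - v p\<bar> <= wo"
  and y: "y \<in> inner_part Om m"
 shows "ennreal (norm (D y) * (unit_ball_vol DIM('a) / (2 * 4 ^ DIM('a)))) <=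
  slopeQ (inner_part Om m) v (2*wo) y + ennreal (2 * K * avg_const DIM('a) (real DIM('a) - 1)) * pot (real DIM('a) - 1) h y"
proof -
 let ?U = "inner_part Om m"
 let ?b = "real DIM('a) - 1"
 have U: "open ?U" by (rule inner_part_open[OF Om])
 have wD: "!!x th t. ((%t. w (x + t *\<^sub>R th)) has_real_derivative D (x + t *\<^sub>R th) \<bullet> th) (at t)"
  and DH: "!!x th t. ((%t. D (x + t *\<^sub>R th) \<bullet> th) has_real_derivative H th (x + t *\<^sub>R th)) (at t)"
  and cH: "!!th. continuous_on UNIV (H th)" and cD: "continuous_on UNIV D"
  using mo unfolding mollified_def by blast+
 let ?S = "%th. ennreal ((\<bar>v (hit ?U y th) - v (hit ?U y (-th))\<bar> + 2*wo) / (exit_time ?U y th + exit_time ?U y (-th)))"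
 let ?P = "%th. \<integral>\<^sup>+t. avgh de h (y + t *\<^sub>R th) * ennreal (t powr 0) * indicator {0<..} t \<partial>lborel"
 have line: "ennreal \<bar>D y \<bullet> th\<bar> <= ?S th + ennreal K * (?P th + ?P (-th))" if th: "th \<in> annulus" for th
 proof -
  let ?a = "exit_time ?U y (-th)" and ?e = "exit_time ?U y th"
  have mth: "-th \<in> annulus" using th by (simp add: annulus_uminus)
  have ab: "0 < ?a" "0 < ?e" using exit_time_pos[OF U y inner_part_exits] th mth by blast+
  have seg: "1 / real (Suc m) <= infdist (y + t *\<^sub>R th) (- Om)" if "t \<in> {-?a..?e}" for t
  proof (cases "0 <= t")
   case True then show ?thesis using that by (intro inner_part_segment[OF Om y th]) auto
  next
   case False
   then have "1 / real (Suc m) <= infdist (y + (-t) *\<^sub>R (-th)) (- Om)" using that by (intro inner_part_segment[OF Om y mth]) auto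
   then show ?thesis by simp
  qed
  have "ennreal \<bar>D (y + 0 *\<^sub>R th) \<bullet> th\<bar> <= ennreal (\<bar>w (y + ?e *\<^sub>R th) - w (y + (-?a) *\<^sub>R th)\<bar> / (?a + ?e))
    + (NNI t. ennreal \<bar>H th (y + t *\<^sub>R th)\<bar> * indicator {-?a..?e} t)"
   by (rule slope_line_estimate[OF wD DH _ ab]) (intro continuous_on_compose2[OF cH] continuous_intros, auto)
  moreover have "ennreal (\<bar>w (y + ?e *\<^sub>R th) - w (y + (-?a) *\<^sub>R th)\<bar> / (?a + ?e)) <= ?S th"
  proof (rule ennreal_leI)
   have tri: "\<bar>a - b\<bar> <= \<bar>c - d\<bar> + 2*wo" if "\<bar>a - c\<bar> <= wo" "\<bar>b - d\<bar> <= wo" for a b c d :: real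
    using that by linarith
   have in_seg: "?e \<in> {-?a..?e}" "-?a \<in> {-?a..?e}" using ab by simp_all
   have hits: "hit ?U y th = y + ?e *\<^sub>R th" "hit ?U y (-th) = y + (-?a) *\<^sub>R th" by (simp_all add: hit_def)
   have "\<bar>w (y + ?e *\<^sub>R th) - w (y + (-?a) *\<^sub>R th)\<bar> <= \<bar>v (hit ?U y th) - v (hit ?U y (-th))\<bar> + 2*wo"
    unfolding hits by (rule tri[OF close[OF seg[OF in_seg(1)]] close[OF seg[OF in_seg(2)]]])
   then show "\<bar>w (y + ?e *\<^sub>R th) - w (y + (-?a) *\<^sub>R th)\<bar> / (?a + ?e) <= (\<bar>v (hit ?U y th) - v (hit ?U y (-th))\<bar> + 2*wo) / (?e + ?a)"
    using ab by (simp add: divide_right_mono add.commute)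
  qed
  moreover have "(NNI t. ennreal \<bar>H th (y + t *\<^sub>R th)\<bar> * indicator {-?a..?e} t) <= ennreal K * (?P th + ?P (-th))"
  proof -
   have "(NNI t. ennreal \<bar>H th (y + t *\<^sub>R th)\<bar> * indicator {-?a..?e} t) <=
    (NNI t. ennreal K * (avgh de h (y + t *\<^sub>R th) * indicator {0<..} t + avgh de h (y + t *\<^sub>R th) * indicator {..<0} t))"
   proof (rule nn_integral_mono_AE)
    have "AE t in lborel. t ~= (0::real)" by (rule AE_lborel_singleton)
    then show "AE t in lborel. ennreal \<bar>H th (y + t *\<^sub>R th)\<bar> * indicator {-?a..?e} t <= ennreal K * (avgh de h (y + t *\<^sub>R th) * indicator {0<..} t + avgh de h (y + t *\<^sub>R th) * indicator {..<0} t)"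
    proof (rule eventually_mono)
     fix t :: real assume t0: "t ~= 0"
     show "ennreal \<bar>H th (y + t *\<^sub>R th)\<bar> * indicator {-?a..?e} t <= ennreal K * (avgh de h (y + t *\<^sub>R th) * indicator {0<..} t + avgh de h (y + t *\<^sub>R th) * indicator {..<0} t)"
     proof (cases "t \<in> {-?a..?e}")
      case True
      have "ennreal \<bar>H th (y + t *\<^sub>R th)\<bar> <= ennreal K * avgh de h (y + t *\<^sub>R th)"
       using th by (intro mollified_second_derivative[OF mo K de(1)] cball_subset_infdist[OF seg[OF True] de(2)]) (simp add: annulus_def)
      then show ?thesis using t0 True by (cases "0 < t") auto
     qed simp
    qed
   qed
   also have "... = ennreal K * ((NNI t. avgh de h (y + t *\<^sub>R th) * indicator {0<..} t) + (NNI t. avgh de h (y + t *\<^sub>R th) * indicator {..<0} t))"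
    by (subst nn_integral_cmult) (measurable, subst nn_integral_add, measurable)
   also have "(NNI t. avgh de h (y + t *\<^sub>R th) * indicator {..<0} t) = (NNI t. avgh de h (y + (-t) *\<^sub>R th) * indicator {..<0} (-t))"
    by (rule nn_integral_real_reflect[symmetric]) measurable
   also have "... = ?P (-th)" by (intro nn_integral_cong) (auto simp: indicator_def)
   also have "(NNI t. avgh de h (y + t *\<^sub>R th) * indicator {0<..} t) = ?P th"
    by (intro nn_integral_cong) (auto simp: indicator_def)
   finally show ?thesis .
  qed
  ultimately show ?thesis
   by (simp only: scaleR_zero_left add_0_right) (meson add_mono order.trans)
 qed
 have mP: "?P \<in> bmb" by measurable
 have mP': "(%th. ?P (-th)) \<in> bmb" by (rule measurable_compose[OF _ mP]) measurable
 have mS: "?S \<in> bmb" by (rule slope_integrand_measurable[OF U v]) measurable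
 have P: "(NNI th. ?P th * iann th) <= ennreal (avg_const DIM('a) ?b) * pot ?b h y"
  by (rule order.trans[OF polar_annulus]) (use pot_avgh[of h ?b de y] de in simp_all)
 have "ennreal (norm (D y) * (unit_ball_vol DIM('a) / (2 * 4 ^ DIM('a)))) <= (NNI th. ennreal \<bar>D y \<bullet> th\<bar> * iann th)"
  by (rule norm_le_annulus_integral)
 also have "... <= (NNI th. ?S th * iann th + ennreal K * (?P th * iann th + ?P (-th) * iann th))"
 proof (rule nn_integral_mono)
  fix th :: 'a
  show "ennreal \<bar>D y \<bullet> th\<bar> * iann th <= ?S th * iann th + ennreal K * (?P th * iann th + ?P (-th) * iann th)"
   using line[of th] by (cases "th \<in> annulus") simp_all
 qed
 also have "... = slopeQ ?U v (2*wo) y + ennreal K * ((NNI th. ?P th * iann th) + (NNI th. ?P (-th) * iann th))"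
  unfolding slopeQ_def using mP mP' mS
  by (subst nn_integral_add) (simp_all add: nn_integral_cmult nn_integral_add)
 also have "(NNI th. ?P (-th) * iann th) = (NNI th. ?P th * iann th)"
  by (rule nn_integral_annulus_uminus[OF mP])
 also have "ennreal K * ((NNI th. ?P th * iann th) + (NNI th. ?P th * iann th))
  <= ennreal K * (ennreal (avg_const DIM('a) ?b) * pot ?b h y + ennreal (avg_const DIM('a) ?b) * pot ?b h y)"
  by (intro mult_left_mono add_mono P) auto
 also have "... = ennreal (2 * K * avg_const DIM('a) ?b) * pot ?b h y"
 proof -
  have "ennreal (2 * K * avg_const DIM('a) ?b) = ennreal K * ennreal (avg_const DIM('a) ?b) * ennreal 2"
   using K avg_const_nonneg[of ?b "DIM('a)"] by (simp add: ennreal_mult'[symmetric] mult_ac del: ennreal_numeral)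
  then show ?thesis by (simp add: mult_ac mult_2[symmetric])
 qed
 finally show ?thesis by (simp add: add_left_mono)
qed

lemma ennreal_le_add: "a <= b + c ==> 0 <= b ==> 0 <= c ==> ennreal a <= ennreal b + ennreal c"
 by (metis ennreal_leI ennreal_plus)

text \<open>The closure may be unbounded, but \<open>u\<close> vanishes outside a ball. If that ball
  is enlarged by 1 and \<open>d <= 1\<close>, two close points lie both in a compact set or both
  where \<open>u\<close> is 0.\<close>

lemma Cb_closure_uniform:
 assumes u: "Cb_closure Om u" and e: "0 < e"
 shows "EX d>0. ALL x:closure Om. ALL y:closure Om. dist x y < d --> \<bar>u x - u y\<bar> <= e"
proof -
 obtain B where B: "!!x. x \<in> closure Om ==> u x ~= 0 ==> norm x <= B"
  using u unfolding Cb_closure_def bounded_iff by auto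
 let ?K = "closure Om \<inter> cball 0 (B + 1)"
 have "compact ?K" by (intro closed_Int_compact) auto
 then have "uniformly_continuous_on ?K u"
  using u unfolding Cb_closure_def by (intro compact_uniformly_continuous) (auto intro: continuous_on_subset)
 then obtain d where d: "0 < d" "!!x y. x \<in> ?K ==> y \<in> ?K ==> dist y x < d ==> dist (u y) (u x) < e"
  using e unfolding uniformly_continuous_on_def by metis
 show ?thesis
 proof (intro exI[of _ "min d 1"] conjI ballI impI)
  fix x y assume xy: "x \<in> closure Om" "y \<in> closure Om" "dist x y < min d 1"
  show "\<bar>u x - u y\<bar> <= e"
  proof (cases "x \<in> ?K & y \<in> ?K")
   case True
   then show ?thesis using d(2)[of x y] xy by (simp add: dist_real_def dist_commute abs_minus_commute)
  next
   case False
   have "norm x <= norm y + dist x y" "norm y <= norm x + dist x y"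
    by (metis dist_norm norm_triangle_sub) (metis dist_norm norm_minus_commute norm_triangle_sub)
   then have "B < norm x & B < norm y" using False xy by auto
   then have "u x = 0" "u y = 0" using B xy by force+
   then show ?thesis using e by simp
  qed
 qed (use d in auto)
qed

text \<open>The gradient term of \<open>value_line_estimate\<close> averaged over directions. It is
  at most a potential of order one by \<open>ring_le_potential\<close>, but on L^n it satisfies the
  uniform bound \<open>ring_normalised\<close>.\<close>

definition ring :: "'a::euclidean_space set => ('a => ennreal) => 'a => ennreal" where
 "ring U f x = (NNI th. (NNI t. (if in_shell U x th t then f (x + t *\<^sub>R th) else 0)) * iann th)"

lemma exit_time_measurable_1:
 assumes "open (U :: 'a::euclidean_space set)"
 shows "(%th. exit_time U x th) \<in> bmb"
 by (rule exit_time_measurable(1)[OF assms]) measurable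

lemma ring_integrand_measurable:
 fixes f :: "'a::euclidean_space => ennreal"
 assumes U: "open U" and f [measurable]: "f \<in> bmb"
 shows "(%t. if in_shell U x th t then f (x + t *\<^sub>R th) else 0) \<in> borel_measurable lborel"
  "(%th. \<integral>\<^sup>+t. (if in_shell U x th t then f (x + t *\<^sub>R th) else 0) \<partial>lborel) \<in> borel_measurable lborel"
proof -
 show "(%t. if in_shell U x th t then f (x + t *\<^sub>R th) else 0) \<in> borel_measurable lborel"
  by measurable
 note exit_time_measurable_1[OF U, measurable]
 show "(%th. \<integral>\<^sup>+t. (if in_shell U x th t then f (x + t *\<^sub>R th) else 0) \<partial>lborel) \<in> borel_measurable lborel"
  by measurable
qed

lemma ring_mono:
 assumes fg: "!!y. y \<in> U ==> f y <= g y" and ex: "!!th. th \<in> annulus ==> exits U x th"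
 shows "ring U f x <= ring U g x"
 unfolding ring_def
proof (rule nn_integral_mono)
 fix th
 show "(NNI t. (if in_shell U x th t then f (x + t *\<^sub>R th) else 0)) * iann th
  <= (NNI t. (if in_shell U x th t then g (x + t *\<^sub>R th) else 0)) * iann th"
 proof (cases "th \<in> annulus")
  case True
  have "0 <= exit_time U x th" by (rule exit_time_nonneg[OF ex[OF True]])
  then have "(NNI t. (if in_shell U x th t then f (x + t *\<^sub>R th) else 0))
   <= (NNI t. (if in_shell U x th t then g (x + t *\<^sub>R th) else 0))"
   by (intro nn_integral_mono) (auto intro!: fg exit_time_inside)
  then show ?thesis by (rule mult_right_mono) simp
 qed simp
qed

lemma ring_add:
 assumes U: "open U" and f: "f \<in> bmb" and g: "g \<in> bmb"
 shows "ring U (%y. f y + g y) x = ring U f x + ring U g x"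
proof -
 have i: "(NNI t. (if in_shell U x th t then f (x + t *\<^sub>R th) + g (x + t *\<^sub>R th) else 0)) = (NNI t. (if in_shell U x th t then f (x + t *\<^sub>R th) else 0)) + (NNI t. (if in_shell U x th t then g (x + t *\<^sub>R th) else 0))" for th
 proof -
  have "(NNI t. (if in_shell U x th t then f (x + t *\<^sub>R th) + g (x + t *\<^sub>R th) else 0)) = (NNI t. (if in_shell U x th t then f (x + t *\<^sub>R th) else 0) + (if in_shell U x th t then g (x + t *\<^sub>R th) else 0))"
   by (intro nn_integral_cong) simp
  also have "... = (NNI t. (if in_shell U x th t then f (x + t *\<^sub>R th) else 0)) + (NNI t. (if in_shell U x th t then g (x + t *\<^sub>R th) else 0))"
   by (rule nn_integral_add[OF ring_integrand_measurable(1)[OF U f] ring_integrand_measurable(1)[OF U g]])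
  finally show ?thesis .
 qed
 have m: "(%th. (NNI t. (if in_shell U x th t then k (x + t *\<^sub>R th) else 0)) * iann th) \<in> borel_measurable lborel"
  if "k \<in> bmb" for k :: "'a => ennreal"
  by (intro borel_measurable_times_ennreal ring_integrand_measurable(2)[OF U that]) auto
 show ?thesis unfolding ring_def i distrib_right by (rule nn_integral_add[OF m[OF f] m[OF g]])
qed

lemma ring_cmult:
 assumes U: "open U" and f: "f \<in> bmb"
 shows "ring U (%y. c * f y) x = c * ring U f x"
proof -
 have i: "(NNI t. (if in_shell U x th t then c * f (x + t *\<^sub>R th) else 0)) = c * (NNI t. (if in_shell U x th t then f (x + t *\<^sub>R th) else 0))" for th
 proof -
  have "(NNI t. (if in_shell U x th t then c * f (x + t *\<^sub>R th) else 0)) = (NNI t. c * (if in_shell U x th t then f (x + t *\<^sub>R th) else 0))"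
   by (intro nn_integral_cong) simp
  also have "... = c * (NNI t. (if in_shell U x th t then f (x + t *\<^sub>R th) else 0))"
   by (rule nn_integral_cmult[OF ring_integrand_measurable(1)[OF U f]])
  finally show ?thesis .
 qed
 have m: "(%th. (NNI t. (if in_shell U x th t then f (x + t *\<^sub>R th) else 0)) * iann th) \<in> borel_measurable lborel"
  by (intro borel_measurable_times_ennreal ring_integrand_measurable(2)[OF U f]) auto
 show ?thesis unfolding ring_def i mult.assoc by (rule nn_integral_cmult[OF m])
qed

lemma ring_const_le:
 fixes x :: "'a::euclidean_space"
 assumes R: "!!th. th \<in> annulus ==> exit_time U x th <= R" and R0: "0 <= R" and c: "0 <= c"
 shows "ring U (%_. ennreal c) x <= ennreal (c * R * unit_ball_vol DIM('a))"
proof -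
 have "ring U (%_. ennreal c) x <= (NNI th. ennreal (c * R) * indicator (annulus :: 'a set) th)"
  unfolding ring_def
 proof (rule nn_integral_mono)
  fix th :: 'a
  show "(NNI t. (if in_shell U x th t then ennreal c else 0)) * iann th <= ennreal (c * R) * iann th"
  proof (cases "th \<in> annulus")
   case True
   have "(NNI t. (if in_shell U x th t then ennreal c else 0)) <= (NNI t. ennreal c * indicator {0..R} t)"
    using R[OF True] by (intro nn_integral_mono) (auto simp: indicator_def)
   also have "... = ennreal (c * R)" using c R0 by (simp add: nn_integral_cmult_indicator ennreal_mult')
   finally show ?thesis by (rule mult_right_mono) simp
  qed simp
 qed
 also have "... = ennreal (c * R) * emeasure lborel (annulus :: 'a set)" by (rule nn_integral_cmult_indicator) simp
 also have "... <= ennreal (c * R) * ennreal (unit_ball_vol DIM('a))" by (intro mult_left_mono emeasure_annulus) simp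
 finally show ?thesis using c R0 by (simp add: ennreal_mult'[symmetric])
qed

lemma ring_le_potential:
 fixes f :: "'a::euclidean_space => ennreal"
 assumes U: "open U" and f: "f \<in> bmb" and ex: "!!th. th \<in> annulus ==> exits U x th"
 shows "ring U f x <= (NNI y. f y * rker (real DIM('a) - 1) x y)"
proof -
 have "ring U f x <= (NNI th. (NNI t. f (x + t *\<^sub>R th) * ennreal (t powr 0) * indicator {0<..} t) * iann th)"
  unfolding ring_def
 proof (rule nn_integral_mono)
  fix th :: 'a
  show "(NNI t. (if in_shell U x th t then f (x + t *\<^sub>R th) else 0)) * iann th
   <= (NNI t. f (x + t *\<^sub>R th) * ennreal (t powr 0) * indicator {0<..} t) * iann th"
  proof (cases "th \<in> annulus")
   case True
   have "0 <= exit_time U x th" by (rule exit_time_nonneg[OF ex[OF True]])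
   then show ?thesis by (intro mult_right_mono nn_integral_mono) (auto simp: indicator_def)
  qed simp
 qed
 also have "... <= (NNI y. f y * rker (real DIM('a) - 1 - 0) x y)"
  by (rule polar_annulus[OF f]) simp
 finally show ?thesis by simp
qed

text \<open>\<open>value_line_estimate\<close> on each ray from \<open>x\<close> to its exit point.
  The gradient \<open>D\<close> stays on the right side because it is estimated with respect to a
  different, larger subdomain.\<close>

lemma value_bound:
 fixes Om :: "'a::euclidean_space set"
 assumes n: "2 <= DIM('a)" and Om: "open Om" and mo: "mollified Om u h K de w D H" and K: "0 <= K"
  and de: "0 < de" "de < 1 / real (Suc m)"
  and h [measurable]: "h \<in> bmb" and v: "v \<in> bmb"
  and close: "!!p. 1 / real (Suc m) <= infdist p (- Om) ==> \<bar>w p - v p\<bar> <= wo" and wo: "0 <= wo"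
  and x: "x \<in> inner_part Om m"
 shows "emeasure lborel (annulus :: 'a set) * ennreal \<bar>v x\<bar> <=
  (NNI th. ennreal \<bar>v (hit (inner_part Om m) x th)\<bar> * iann th)
  + ennreal (2 * wo * unit_ball_vol DIM('a)) + 3 * ring (inner_part Om m) (%y. ennreal (norm (D y))) x
  + ennreal (K * avg_const DIM('a) (real DIM('a) - 2)) * pot (real DIM('a) - 2) h x"
proof -
 let ?U = "inner_part Om m"
 let ?b = "real DIM('a) - 2"
 have U: "open ?U" by (rule inner_part_open[OF Om])
 have wD: "!!x th t. ((%t. w (x + t *\<^sub>R th)) has_real_derivative D (x + t *\<^sub>R th) \<bullet> th) (at t)"
  and DH: "!!x th t. ((%t. D (x + t *\<^sub>R th) \<bullet> th) has_real_derivative H th (x + t *\<^sub>R th)) (at t)"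
  and cH: "!!th. continuous_on UNIV (H th)" and cD: "continuous_on UNIV D"
  using mo unfolding mollified_def by blast+
 have Dm: "(%y. ennreal (norm (D y))) \<in> bmb"
  using borel_measurable_continuous_onI[OF cD] by measurable
 let ?V = "%th. ennreal \<bar>v (hit ?U x th)\<bar>"
 let ?G = "%th. \<integral>\<^sup>+t. (if exit_time ?U x th / 2 < t & t < exit_time ?U x th then ennreal (norm (D (x + t *\<^sub>R th))) else 0) \<partial>lborel"
 let ?P = "%th. \<integral>\<^sup>+t. avgh de h (x + t *\<^sub>R th) * ennreal (t powr 1) * indicator {0<..} t \<partial>lborel"
 have line: "ennreal \<bar>v x\<bar> <= ?V th + ennreal (2*wo) + 3 * ?G th + ennreal K * ?P th" if th: "th \<in> annulus" for th
 proof -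
  let ?r = "exit_time ?U x th"
  have nth: "norm th <= 1" using th by (simp add: annulus_def)
  have r: "0 < ?r" using exit_time_pos[OF U x inner_part_exits[OF th]] .
  have seg: "1 / real (Suc m) <= infdist (x + t *\<^sub>R th) (- Om)" if "t \<in> {0..?r}" for t
   using that by (intro inner_part_segment[OF Om x th]) auto
  have "ennreal \<bar>w (x + 0 *\<^sub>R th)\<bar> <= ennreal \<bar>w (x + ?r *\<^sub>R th)\<bar> + 3 * (NNI t. ennreal \<bar>D (x + t *\<^sub>R th) \<bullet> th\<bar> * indicator {?r/2..?r} t)
    + (NNI t. ennreal (t * \<bar>H th (x + t *\<^sub>R th)\<bar>) * indicator {0..?r} t)"
   by (rule value_line_estimate[OF wD DH _ r]) (intro continuous_on_compose2[OF cH] continuous_intros, auto)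
  also have "... <= (?V th + ennreal wo) + 3 * ?G th + ennreal K * ?P th"
  proof (intro add_mono mult_left_mono)
   have "?r \<in> {0..?r}" using r by simp
   then have "\<bar>w (x + ?r *\<^sub>R th) - v (x + ?r *\<^sub>R th)\<bar> <= wo" by (intro close seg)
   then have "\<bar>w (x + ?r *\<^sub>R th)\<bar> <= \<bar>v (hit ?U x th)\<bar> + wo" unfolding hit_def by linarith
   then show "ennreal \<bar>w (x + ?r *\<^sub>R th)\<bar> <= ?V th + ennreal wo"
    using wo by (intro ennreal_le_add) auto
   show "(NNI t. ennreal \<bar>D (x + t *\<^sub>R th) \<bullet> th\<bar> * indicator {?r/2..?r} t) <= ?G th"
   proof (rule nn_integral_mono_AE)
    have "AE t in lborel. t ~= ?r/2 & t ~= ?r" using AE_lborel_singleton[of "?r/2"] AE_lborel_singleton[of ?r] by eventually_elim simp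
    then show "AE t in lborel. ennreal \<bar>D (x + t *\<^sub>R th) \<bullet> th\<bar> * indicator {?r/2..?r} t <= (if ?r / 2 < t & t < ?r then ennreal (norm (D (x + t *\<^sub>R th))) else 0)"
    proof (rule eventually_mono)
     fix t assume t: "t ~= ?r/2 & t ~= ?r"
     have "\<bar>D (x + t *\<^sub>R th) \<bullet> th\<bar> <= norm (D (x + t *\<^sub>R th)) * norm th" by (rule Cauchy_Schwarz_ineq2)
     also have "... <= norm (D (x + t *\<^sub>R th))" using nth by (simp add: mult_left_le)
     finally show "ennreal \<bar>D (x + t *\<^sub>R th) \<bullet> th\<bar> * indicator {?r/2..?r} t <= (if ?r / 2 < t & t < ?r then ennreal (norm (D (x + t *\<^sub>R th))) else 0)"
      using t by (auto simp: indicator_def intro!: ennreal_leI)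
    qed
   qed
   have "(NNI t. ennreal (t * \<bar>H th (x + t *\<^sub>R th)\<bar>) * indicator {0..?r} t) <= (NNI t. ennreal K * (avgh de h (x + t *\<^sub>R th) * ennreal (t powr 1) * indicator {0<..} t))"
   proof (rule nn_integral_mono)
    fix t
    show "ennreal (t * \<bar>H th (x + t *\<^sub>R th)\<bar>) * indicator {0..?r} t <= ennreal K * (avgh de h (x + t *\<^sub>R th) * ennreal (t powr 1) * indicator {0<..} t)"
    proof (cases "t \<in> {0<..?r}")
     case True
     then have t: "t \<in> {0..?r}" "0 < t" by auto
     have "ennreal (t * \<bar>H th (x + t *\<^sub>R th)\<bar>) = ennreal t * ennreal \<bar>H th (x + t *\<^sub>R th)\<bar>" using t by (simp add: ennreal_mult')
     also have "... <= ennreal t * (ennreal K * avgh de h (x + t *\<^sub>R th))"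
      by (intro mult_left_mono mollified_second_derivative[OF mo K de(1) cball_subset_infdist[OF seg[OF t(1)] de(2)] nth]) simp
     finally show ?thesis using t by (simp add: mult_ac)
    qed (auto simp: indicator_def)
   qed
   also have "... = ennreal K * ?P th" by (rule nn_integral_cmult) measurable
   finally show "(NNI t. ennreal (t * \<bar>H th (x + t *\<^sub>R th)\<bar>) * indicator {0..?r} t) <= ennreal K * ?P th" .
  qed simp
  finally have 1: "ennreal \<bar>w x\<bar> <= (?V th + ennreal wo) + 3 * ?G th + ennreal K * ?P th" by simp
  have "0 \<in> {0..?r}" using r by simp
  from close[OF seg[OF this]] have "\<bar>w x - v x\<bar> <= wo" by simp
  then have "\<bar>v x\<bar> <= \<bar>w x\<bar> + wo" by linarith
  then have "ennreal \<bar>v x\<bar> <= ennreal \<bar>w x\<bar> + ennreal wo"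
   using wo by (intro ennreal_le_add) auto
  also have "... <= ((?V th + ennreal wo) + 3 * ?G th + ennreal K * ?P th) + ennreal wo" by (intro add_right_mono 1)
  also have "... = ?V th + (ennreal wo + ennreal wo) + 3 * ?G th + ennreal K * ?P th" by (simp only: ac_simps)
  also have "ennreal wo + ennreal wo = ennreal (2*wo)" using wo by (simp add: ennreal_plus[symmetric] del: ennreal_plus)
  finally show ?thesis .
 qed
 have idm: "(%th::'a. th) \<in> borel_measurable lborel" by measurable
 have mV: "?V \<in> borel_measurable lborel"
  using measurable_compose[OF exit_time_measurable(3)[OF U borel_measurable_const idm] v] by measurable
 have mG: "?G \<in> borel_measurable lborel" by (rule ring_integrand_measurable(2)[OF U Dm])
 have mP: "?P \<in> borel_measurable lborel" by measurable
 have P: "(NNI th. ?P th * iann th) <= ennreal (avg_const DIM('a) ?b) * pot ?b h x"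
 proof -
  have e: "real DIM('a) - 1 - 1 = ?b" by simp
  have "(NNI th. ?P th * iann th) <= (NNI y. avgh de h y * rker (real DIM('a) - 1 - 1) x y)"
   by (rule polar_annulus) (use n in simp_all)
  also have "... <= ennreal (avg_const DIM('a) ?b) * pot ?b h x" unfolding e using n de by (intro pot_avgh) simp_all
  finally show ?thesis .
 qed
 have "emeasure lborel (annulus :: 'a set) * ennreal \<bar>v x\<bar> = (NNI th. ennreal \<bar>v x\<bar> * indicator (annulus :: 'a set) th)"
  by (subst nn_integral_cmult_indicator) (simp_all add: mult.commute)
 also have "... <= (NNI th. ?V th * iann th + ennreal (2*wo) * iann th + 3 * (?G th * iann th) + ennreal K * (?P th * iann th))"
 proof (rule nn_integral_mono)
  fix th :: 'a
  show "ennreal \<bar>v x\<bar> * iann th <= ?V th * iann th + ennreal (2*wo) * iann th + 3 * (?G th * iann th) + ennreal K * (?P th * iann th)"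
   using line[of th] by (cases "th \<in> annulus") simp_all
 qed
 also have "... = (NNI th. ?V th * iann th) + ennreal (2*wo) * emeasure lborel (annulus :: 'a set)
   + 3 * ring ?U (%y. ennreal (norm (D y))) x + ennreal K * (NNI th. ?P th * iann th)"
  unfolding ring_def using mV mG mP
  by (simp add: nn_integral_add nn_integral_cmult nn_integral_cmult_indicator)
 also have "... <= (NNI th. ?V th * iann th) + ennreal (2*wo) * ennreal (unit_ball_vol DIM('a))
   + 3 * ring ?U (%y. ennreal (norm (D y))) x + ennreal K * (ennreal (avg_const DIM('a) ?b) * pot ?b h x)"
  by (intro add_mono mult_left_mono emeasure_annulus P) auto
 also have "ennreal (2*wo) * ennreal (unit_ball_vol DIM('a)) = ennreal (2 * wo * unit_ball_vol DIM('a))"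
  using wo by (simp add: ennreal_mult')
 also have "ennreal K * (ennreal (avg_const DIM('a) ?b) * pot ?b h x) = ennreal (K * avg_const DIM('a) ?b) * pot ?b h x"
  using K by (simp add: ennreal_mult' mult.assoc)
 finally show ?thesis .
qed

definition slope_const :: "nat => real" where
 "slope_const n = unit_ball_vol n / (2 * 4 ^ n)"

definition stage_const :: "nat => real => real" where
 "stage_const n K = 3 / slope_const n * (2 * K * avg_const n (real n - 1)) * comp_const n + K * avg_const n (real n - 2)"

lemma slope_const_pos: "0 < slope_const n"
 by (simp add: slope_const_def)

lemma stage_const_nonneg: "3 <= n ==> 0 <= K ==> 0 <= stage_const n K"
 unfolding stage_const_def using slope_const_pos[of n]
 by (intro add_nonneg_nonneg mult_nonneg_nonneg avg_const_nonneg comp_const_nonneg) auto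

definition gap :: "nat => real" where
 "gap m = 1 / real (Suc m) - 1 / real (Suc (Suc m))"

lemma gap_pos: "0 < gap m"
proof -
 have "1 / real (Suc (Suc m)) < 1 / real (Suc m)" by (intro divide_strict_left_mono) auto
 then show ?thesis by (simp add: gap_def)
qed

lemma exit_sum_gap:
 assumes "open Om" "y \<in> inner_part Om m" "Suc m <= k" "th \<in> annulus"
 shows "2 * gap m <= exit_time (inner_part Om k) y th + exit_time (inner_part Om k) y (-th)"
 using exit_time_gap[OF assms] exit_time_gap[OF assms(1,2,3), of "-th"] assms(4) by (simp add: gap_def annulus_uminus)

text \<open>The parameter length of each chord is at least \<open>2 * gap m\<close>, so the slack
  costs only a multiple of \<open>wo\<close> that does not depend on \<open>k\<close>.\<close>

lemma slopeQ_perturb: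
 fixes Om :: "'a::euclidean_space set"
 assumes Om: "open Om" and y: "y \<in> inner_part Om m" and k: "Suc m <= k" and wo: "0 <= wo" and v: "v \<in> bmb"
 shows "slopeQ (inner_part Om k) v (2*wo) y <= slopeQ (inner_part Om k) v 0 y + ennreal (wo / gap m * unit_ball_vol DIM('a))"
proof -
 let ?U = "inner_part Om k"
 let ?s = "%th. \<bar>v (hit ?U y th) - v (hit ?U y (-th))\<bar>" and ?e = "%th. exit_time ?U y th + exit_time ?U y (-th)"
 have g: "0 < gap m" by (rule gap_pos)
 have "slopeQ ?U v (2*wo) y <= (NNI th. ennreal ((?s th + 0) / ?e th) * iann th + ennreal (wo / gap m) * iann th)"
  unfolding slopeQ_def
 proof (rule nn_integral_mono)
  fix th :: 'a
  show "ennreal ((?s th + 2*wo) / ?e th) * iann th <= ennreal ((?s th + 0) / ?e th) * iann th + ennreal (wo / gap m) * iann th"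
  proof (cases "th \<in> annulus")
   case True
   have e: "2 * gap m <= ?e th" by (rule exit_sum_gap[OF Om y k True])
   then have e0: "0 < ?e th" using g by linarith
   have "2*wo / ?e th <= 2*wo / (2 * gap m)" using e g wo by (intro divide_left_mono mult_pos_pos e0) auto
   then have "(?s th + 2*wo) / ?e th <= (?s th + 0) / ?e th + wo / gap m" by (simp add: add_divide_distrib)
   then have "ennreal ((?s th + 2*wo) / ?e th) <= ennreal ((?s th + 0) / ?e th) + ennreal (wo / gap m)"
    using e0 g wo by (intro ennreal_le_add) auto
   then show ?thesis using True by simp
  qed simp
 qed
 also have "... = slopeQ ?U v 0 y + ennreal (wo / gap m) * emeasure lborel (annulus :: 'a set)"
 proof -
  have "(%th. ennreal ((?s th + 0) / ?e th)) \<in> borel_measurable lborel"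
   by (rule slope_integrand_measurable[OF inner_part_open[OF Om] v]) measurable
  then have "(%th. ennreal ((?s th + 0) / ?e th) * iann th) \<in> borel_measurable lborel"
   by (intro borel_measurable_times_ennreal) auto
  then show ?thesis unfolding slopeQ_def by (subst nn_integral_add) (auto simp: nn_integral_cmult_indicator)
 qed
 also have "... <= slopeQ ?U v 0 y + ennreal (wo / gap m) * ennreal (unit_ball_vol DIM('a))"
  by (intro add_left_mono mult_left_mono emeasure_annulus) auto
 finally show ?thesis using wo g by (simp only: ennreal_mult' divide_nonneg_pos)
qed

text \<open>Values are bounded along rays of subdomain \<open>m\<close>, gradients along chords of
  the strictly larger subdomain \<open>k\<close>. With one subdomain in both roles, points near its
  frontier would have arbitrarily short chords, and the closeness error divided by their lengths
  would be out of control. Here the error is at most \<open>ep\<close> once the scale is chosen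
  after \<open>m\<close> and \<open>k\<close>.\<close>

lemma stage_bound:
 fixes Om :: "'a::euclidean_space set"
 assumes n: "3 <= DIM('a)" and Om: "open Om" and u: "Cb_closure Om u"
  and mo: "!!de. 0 < de ==> EX w D H. mollified Om u h K de w D H" and K: "0 <= K"
  and h [measurable]: "h \<in> bmb" and v [measurable]: "v \<in> bmb"
  and vu: "!!y. y \<in> closure Om ==> v y = u y"
  and x: "x \<in> inner_part Om m" and k: "Suc m <= k"
 shows "emeasure lborel (annulus :: 'a set) * ennreal \<bar>v x\<bar> <=
  (NNI th. ennreal \<bar>v (hit (inner_part Om m) x th)\<bar> * iann th)
  + ennreal (3 / slope_const DIM('a)) * ring (inner_part Om m) (slopeQ (inner_part Om k) v 0) x
  + ennreal (stage_const DIM('a) K) * pot (real DIM('a) - 2) h x" (is "?L <= ?R")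
proof (rule ennreal_le_epsilon)
 fix ep :: real assume ep: "0 < ep"
 let ?U = "inner_part Om m" and ?W = "inner_part Om k"
 let ?V = "unit_ball_vol DIM('a)" and ?b1 = "real DIM('a) - 1" and ?b2 = "real DIM('a) - 2"
 define c where "c = slope_const DIM('a)"
 have c: "0 < c" by (simp add: c_def slope_const_pos)
 define A1 where "A1 = 2 * K * avg_const DIM('a) ?b1"
 have A1: "0 <= A1" unfolding A1_def using K by (intro mult_nonneg_nonneg avg_const_nonneg) auto
 have A2: "0 <= K * avg_const DIM('a) ?b2" using K by (intro mult_nonneg_nonneg avg_const_nonneg) auto
 \<comment> \<open>The total weight of the closeness error \<open>wo\<close>: the first summand
   stems from the values at the two ends of each ray, the second from the slack in the slopes,
   accumulated on rays of parameter length at most \<open>4 * real (Suc m)\<close>.\<close>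
 define M where "M = 2 * ?V + 3 / c * (1 / gap m * ?V * (4 * real (Suc m)) * ?V)"
 have M: "0 <= M" unfolding M_def using c gap_pos[of m] by simp
 define wo where "wo = ep / (M + 1)"
 have wo: "0 < wo" using ep M by (simp add: wo_def)
 have woM: "wo * M <= ep" using ep M by (simp add: wo_def mult_le_cancel_left_pos pos_divide_le_eq)
 obtain d where d: "0 < d" "!!x y. x \<in> closure Om ==> y \<in> closure Om ==> dist x y < d ==> \<bar>u x - u y\<bar> <= wo"
  using Cb_closure_uniform[OF u wo] by blast
 \<comment> \<open>The scale must resolve the oscillation of \<open>u\<close> and keep balls about
   the closure of the larger subdomain inside the domain.\<close>
 define de where "de = min d (1 / (2 * real (Suc k)))"
 have de: "0 < de" "de <= d" using d by (auto simp: de_def)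
 have "1 / (2 * real (Suc k)) < 1 / real (Suc k)" by (intro divide_strict_left_mono) auto
 then have dek: "de < 1 / real (Suc k)" unfolding de_def by linarith
 have km: "1 / real (Suc k) <= 1 / real (Suc m)" using k by (intro divide_left_mono) auto
 then have dem: "de < 1 / real (Suc m)" using dek by linarith
 obtain w D H where w: "mollified Om u h K de w D H" using mo[OF de(1)] by blast
 have close: "\<bar>w p - v p\<bar> <= wo" if "1 / real (Suc k) <= infdist p (- Om)" for p
 proof -
  have sub: "cball p de \<subseteq> Om" by (rule cball_subset_infdist[OF that dek])
  have "p \<in> cball p de" using de(1) by simp
  then have p: "p \<in> closure Om" by (rule subsetD[OF closure_subset subsetD[OF sub]])
  have "ALL z:ball p de. \<bar>u z - u p\<bar> <= wo"
  proof
   fix z assume z: "z \<in> ball p de"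
   then have "z \<in> Om" using sub by (meson ball_subset_cball subsetD)
   then have "z \<in> closure Om" by (rule subsetD[OF closure_subset])
   then show "\<bar>u z - u p\<bar> <= wo" using z de(2) by (intro d(2) p) (auto simp: dist_commute)
  qed
  then have "\<bar>w p - u p\<bar> <= wo" using w sub unfolding mollified_def by blast
  then show ?thesis using vu[OF p] by simp
 qed
 have closem: "\<bar>w p - v p\<bar> <= wo" if "1 / real (Suc m) <= infdist p (- Om)" for p
  by (rule close) (use that km in linarith)
 have cD: "continuous_on UNIV D" using w unfolding mollified_def by blast
 have UW: "?U \<subseteq> ?W" using k by (intro inner_part_mono) simp
 have ex: "!!th. th \<in> annulus ==> exits ?U x th" by (rule inner_part_exits)
 have Uo: "open ?U" by (rule inner_part_open[OF Om])
 have mQ: "slopeQ ?W v 0 \<in> bmb" by (rule slopeQ_measurable[OF inner_part_open[OF Om] v])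
 have mp: "pot ?b1 h \<in> bmb" by measurable
 have "ring ?U (%y. ennreal (norm (D y))) x <= ring ?U (%y. ennreal (1/c) * (slopeQ ?W v 0 y + (ennreal (wo / gap m * ?V) + ennreal A1 * pot ?b1 h y))) x"
 proof (rule ring_mono[OF _ ex])
  fix y assume y: "y \<in> ?U"
  have "ennreal (norm (D y)) = ennreal (1/c) * ennreal (norm (D y) * c)"
   using c by (simp add: ennreal_mult'[symmetric])
  also have "... <= ennreal (1/c) * (slopeQ ?W v (2*wo) y + ennreal A1 * pot ?b1 h y)"
   unfolding c_def slope_const_def A1_def using y UW
   by (intro mult_left_mono gradient_bound[OF Om w K de(1) dek h v close]) auto
  also have "... <= ennreal (1/c) * ((slopeQ ?W v 0 y + ennreal (wo / gap m * ?V)) + ennreal A1 * pot ?b1 h y)"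
   using wo by (intro mult_left_mono add_right_mono slopeQ_perturb[OF Om y k _ v]) auto
  finally show "ennreal (norm (D y)) <= ennreal (1/c) * (slopeQ ?W v 0 y + (ennreal (wo / gap m * ?V) + ennreal A1 * pot ?b1 h y))"
   by (simp only: add.assoc)
 qed
 also have "... = ennreal (1/c) * (ring ?U (slopeQ ?W v 0) x + (ring ?U (%_. ennreal (wo / gap m * ?V)) x + ennreal A1 * ring ?U (pot ?b1 h) x))"
  using mQ mp by (subst ring_cmult[OF Uo], measurable, subst ring_add[OF Uo], measurable, subst ring_add[OF Uo], measurable, subst ring_cmult[OF Uo], measurable)
 also have "... <= ennreal (1/c) * (ring ?U (slopeQ ?W v 0) x + (ennreal (wo / gap m * ?V * (4 * real (Suc m)) * ?V) + ennreal A1 * (ennreal (comp_const DIM('a)) * pot ?b2 h x)))"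
 proof (intro mult_left_mono add_mono order.refl)
  show "ring ?U (%_. ennreal (wo / gap m * ?V)) x <= ennreal (wo / gap m * ?V * (4 * real (Suc m)) * ?V)"
   using wo gap_pos[of m] by (intro ring_const_le exit_time_inner_le[OF _ x Om]) auto
  have "ring ?U (pot ?b1 h) x <= (NNI y. pot ?b1 h y * rker ?b1 x y)" by (rule ring_le_potential[OF Uo mp ex])
  also have "... <= ennreal (comp_const DIM('a)) * pot ?b2 h x" by (rule pot_pot[OF n h])
  finally show "ring ?U (pot ?b1 h) x <= ennreal (comp_const DIM('a)) * pot ?b2 h x" .
 qed auto
 finally have R: "ring ?U (%y. ennreal (norm (D y))) x <= ennreal (1/c) * (ring ?U (slopeQ ?W v 0) x + (ennreal (wo / gap m * ?V * (4 * real (Suc m)) * ?V) + ennreal A1 * (ennreal (comp_const DIM('a)) * pot ?b2 h x)))" .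
 let ?I = "\<integral>\<^sup>+th. ennreal \<bar>v (hit ?U x th)\<bar> * iann th \<partial>lborel"
 let ?X = "ring ?U (slopeQ ?W v 0) x" and ?P = "pot ?b2 h x"
 have "?L <= ?I + ennreal (2 * wo * ?V) + 3 * ring ?U (%y. ennreal (norm (D y))) x + ennreal (K * avg_const DIM('a) ?b2) * ?P"
  using n wo by (intro value_bound[OF _ Om w K de(1) dem h v closem _ x]) auto
 also have "... <= ?I + ennreal (2 * wo * ?V) + 3 * (ennreal (1/c) * (?X + (ennreal (wo / gap m * ?V * (4 * real (Suc m)) * ?V) + ennreal A1 * (ennreal (comp_const DIM('a)) * ?P)))) + ennreal (K * avg_const DIM('a) ?b2) * ?P"
  by (intro add_mono mult_left_mono R order.refl) auto
 also have "... = ?I + (3 * ennreal (1/c)) * ?X + ((3 * ennreal (1/c)) * (ennreal A1 * ennreal (comp_const DIM('a))) + ennreal (K * avg_const DIM('a) ?b2)) * ?P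
   + (ennreal (2 * wo * ?V) + (3 * ennreal (1/c)) * ennreal (wo / gap m * ?V * (4 * real (Suc m)) * ?V))"
  by (simp only: distrib_left distrib_right ac_simps)
 also have "3 * ennreal (1/c) = ennreal (3/c)"
 proof -
  have "ennreal 3 * ennreal (1/c) = ennreal (3 * (1/c))" using c by (intro ennreal_mult'[symmetric]) simp
  then show ?thesis by simp
 qed
 also have "ennreal (3/c) * (ennreal A1 * ennreal (comp_const DIM('a))) + ennreal (K * avg_const DIM('a) ?b2) = ennreal (stage_const DIM('a) K)"
  using A1 A2 c comp_const_nonneg[OF n] unfolding stage_const_def c_def[symmetric] A1_def[symmetric]
  by (simp add: ennreal_mult'[symmetric] ennreal_plus[symmetric] mult.assoc del: ennreal_plus)
 also have "ennreal (2 * wo * ?V) + ennreal (3/c) * ennreal (wo / gap m * ?V * (4 * real (Suc m)) * ?V) = ennreal (wo * M)"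
 proof -
  have "wo * M = 2 * wo * ?V + 3/c * (wo / gap m * ?V * (4 * real (Suc m)) * ?V)" unfolding M_def by (simp add: distrib_left)
  moreover have "0 <= 3/c * (wo / gap m * ?V * (4 * real (Suc m)) * ?V)" "0 <= 3/c" "0 <= 2 * wo * ?V"
   using wo c gap_pos[of m] by simp_all
  ultimately show ?thesis by (simp only: ennreal_plus ennreal_mult')
 qed
 also have "ennreal (wo * M) <= ennreal ep" by (rule ennreal_leI[OF woM])
 finally show "?L <= ?R + ennreal ep" by (simp add: c_def add_left_mono)
qed

section \<open>Passage to the full domain\<close>

lemma AE_lborel_uminus:
 assumes "AE th in (lborel :: 'a::euclidean_space measure). P th"
 shows "AE th in (lborel :: 'a measure). P (-th)"
proof -
 obtain N where N: "{th. \<not> P th} \<subseteq> N" "N \<in> sets borel" "emeasure lborel N = 0"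
  using assms by (elim AE_E) auto
 have "(NNI th. indicator N th) = ennreal (\<bar>-1\<bar> ^ DIM('a)) * (NNI th. indicator N (0 + (-1) *\<^sub>R th))"
  using N by (intro nn_integral_lborel_scale) auto
 then have "(NNI th. indicator N (-th)) = 0" using N by simp
 then have "AE th in lborel. indicator N (-th) = (0::ennreal)" using N by (subst (asm) nn_integral_0_iff_AE) auto
 then show ?thesis by (rule eventually_mono) (use N(1) in \<open>auto simp: indicator_def split: if_splits\<close>)
qed

text \<open>Dominated convergence twice, first along each ray and then over directions; the bound
  \<open>R\<close> on exit times makes the constant \<open>c\<close> integrable along the
  rays.\<close>

lemma ring_tendsto:
 fixes x :: "'a::euclidean_space" and f :: "nat => 'a => ennreal"
 assumes U: "open U" and f: "!!i. f i \<in> bmb" and f': "f' \<in> bmb"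
  and ex: "!!th. th \<in> annulus ==> exits U x th" and R: "!!th. th \<in> annulus ==> exit_time U x th <= R"
  and lim: "!!y. y \<in> U ==> (%i. f i y) \<longlonglongrightarrow> f' y"
  and bd: "!!i y. y \<in> U ==> f i y <= ennreal c"
 shows "(%i. ring U (f i) x) \<longlonglongrightarrow> ring U f' x"
proof -
 let ?I = "%f th t. if in_shell U x th t then f (x + t *\<^sub>R th) else 0"
 have inU: "x + t *\<^sub>R th \<in> U" if "th \<in> annulus" "in_shell U x th t" for th t
  using exit_time_nonneg[OF ex[OF that(1)]] that(2) by (intro exit_time_inside) auto
 have Ile: "?I (f i) th t <= ennreal c * indicator {0..R} t" if "th \<in> annulus" for i th t
  using exit_time_nonneg[OF ex[OF that]] R[OF that] bd[OF inU[OF that]] by (auto simp: indicator_def)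
 have fin: "(NNI t. ennreal c * indicator {0..R} t) < \<infinity>"
  by (subst nn_integral_cmult_indicator) (auto simp: ennreal_mult_less_top emeasure_lborel_Icc_eq)
 have inner: "(%i. \<integral>\<^sup>+t. ?I (f i) th t \<partial>lborel) \<longlonglongrightarrow> (NNI t. ?I f' th t)" if th: "th \<in> annulus" for th
 proof (rule nn_integral_dominated_convergence[where w = "%t. ennreal c * indicator {0..R} t"])
  show "AE t in lborel. (%i. ?I (f i) th t) \<longlonglongrightarrow> ?I f' th t"
   using lim[OF inU[OF th]] by (intro AE_I2) auto
  show "AE t in lborel. ?I (f i) th t <= ennreal c * indicator {0..R} t" for i
   by (intro AE_I2 Ile[OF th])
  show "(%t. ?I (f i) th t) \<in> borel_measurable lborel" for i by (rule ring_integrand_measurable(1)[OF U f])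
  show "(%t. ?I f' th t) \<in> borel_measurable lborel" by (rule ring_integrand_measurable(1)[OF U f'])
  show "(NNI t. ennreal c * indicator {0..R} t) < \<infinity>" by (rule fin)
 qed simp
 define C where "C = (NNI t. ennreal c * indicator {0..R} t)"
 show ?thesis unfolding ring_def
 proof (rule nn_integral_dominated_convergence[where w = "%th. C * iann th"])
  show "(%th. (NNI t. ?I (f i) th t) * iann th) \<in> borel_measurable lborel" for i
   by (intro borel_measurable_times_ennreal ring_integrand_measurable(2)[OF U f]) auto
  show "(%th. (NNI t. ?I f' th t) * iann th) \<in> borel_measurable lborel"
   by (intro borel_measurable_times_ennreal ring_integrand_measurable(2)[OF U f']) auto
  show "(\<integral>\<^sup>+th. C * iann th \<partial>(lborel :: 'a measure)) < \<infinity>"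
   using fin emeasure_annulus[where 'a='a]
   by (subst nn_integral_cmult_indicator) (auto simp: C_def ennreal_mult_less_top intro: le_less_trans)
  show "AE th in lborel. (NNI t. ?I (f i) th t) * iann th <= C * iann th" for i
  proof (intro AE_I2)
   fix th :: 'a
   show "(NNI t. ?I (f i) th t) * iann th <= C * iann th"
   proof (cases "th \<in> annulus")
    case True
    then show ?thesis unfolding C_def by (intro mult_right_mono nn_integral_mono Ile) auto
   qed simp
  qed
  show "AE th in lborel. (%i. (NNI t. ?I (f i) th t) * iann th) \<longlonglongrightarrow> (NNI t. ?I f' th t) * iann th"
  proof (intro AE_I2)
   fix th :: 'a
   show "(%i. (NNI t. ?I (f i) th t) * iann th) \<longlonglongrightarrow> (NNI t. ?I f' th t) * iann th"
    using inner[of th] by (cases "th \<in> annulus") simp_all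
  qed
 qed simp
qed

lemma hit_inner_closure:
 assumes "open Om" "x \<in> inner_part Om m" "th \<in> annulus"
 shows "hit (inner_part Om m) x th \<in> closure Om"
 using hit_frontier[OF inner_part_open[OF assms(1)] assms(2) inner_part_exits[OF assms(3)]]
  closure_mono[OF inner_part_subset[of Om m]] by (auto simp: frontier_def)

lemma hit_inner_tendsto:
 fixes v :: "'a::euclidean_space => real"
 assumes Om: "open Om" "Om ~= UNIV" and x: "x \<in> inner_part Om m" and th: "th \<in> annulus" "exits Om x th"
  and cv: "continuous_on (closure Om) v"
 shows "(%i. v (hit (inner_part Om (i + m)) x th)) \<longlonglongrightarrow> v (hit Om x th)"
proof -
 have xOm: "x \<in> Om" using x inner_part_subset by blast
 have e: "(%i. exit_time (inner_part Om (i + m)) x th) \<longlonglongrightarrow> exit_time Om x th"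
  by (rule LIMSEQ_ignore_initial_segment[OF exit_time_inner_tendsto[OF Om xOm th(2)]])
 have "(%i. hit (inner_part Om (i + m)) x th) \<longlonglongrightarrow> hit Om x th"
  unfolding hit_def by (intro tendsto_intros e)
 then show ?thesis
 proof (rule continuous_on_tendsto_compose[OF cv])
  show "hit Om x th \<in> closure Om" using hit_frontier[OF Om(1) xOm th(2)] by (simp add: frontier_def)
  show "\<forall>\<^sub>F i in sequentially. hit (inner_part Om (i + m)) x th \<in> closure Om"
  proof (rule always_eventually, rule allI)
   fix i
   have "x \<in> inner_part Om (i + m)" using x inner_part_mono[of m "i + m" Om] by auto
   then show "hit (inner_part Om (i + m)) x th \<in> closure Om" by (rule hit_inner_closure[OF Om(1) _ th(1)])
  qed
 qed
qed

lemma slopeQ_inner_le: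
 fixes v :: "'a::euclidean_space => real"
 assumes Om: "open Om" and y: "y \<in> inner_part Om m" and k: "Suc m <= k"
  and B: "!!z. z \<in> closure Om ==> \<bar>v z\<bar> <= B" and th: "th \<in> annulus"
 shows "ennreal ((\<bar>v (hit (inner_part Om k) y th) - v (hit (inner_part Om k) y (-th))\<bar> + 0) / (exit_time (inner_part Om k) y th + exit_time (inner_part Om k) y (-th)))
   <= ennreal (2 * B / (2 * gap m))"
proof (rule ennreal_leI)
 let ?U = "inner_part Om k"
 have y': "y \<in> ?U" using y k inner_part_mono[of m k Om] by auto
 have "\<bar>v (hit ?U y th)\<bar> <= B" "\<bar>v (hit ?U y (-th))\<bar> <= B"
  using th by (auto intro!: B hit_inner_closure[OF Om y'] simp: annulus_uminus)
 then have "\<bar>v (hit ?U y th) - v (hit ?U y (-th))\<bar> <= 2 * B" "0 <= B" by linarith+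
 then show "(\<bar>v (hit ?U y th) - v (hit ?U y (-th))\<bar> + 0) / (exit_time ?U y th + exit_time ?U y (-th)) <= 2 * B / (2 * gap m)"
  using exit_sum_gap[OF Om y k th] gap_pos[of m] by (intro frac_le) auto
qed

text \<open>The dominating constant consists of the bound \<open>B\<close> on the closure and the
  chord gap, both independent of the larger subdomain. Convergence holds in every direction for
  which both opposite rays exit the domain, that is, in almost every direction.\<close>

lemma slopeQ_tendsto:
 fixes v :: "'a::euclidean_space => real"
 assumes Om: "open Om" "emeasure lborel Om < \<infinity>" and y: "y \<in> inner_part Om m"
  and v: "v \<in> bmb" and cv: "continuous_on (closure Om) v" and B: "!!z. z \<in> closure Om ==> \<bar>v z\<bar> <= B"
 shows "(%i. slopeQ (inner_part Om (i + Suc m)) v 0 y) \<longlonglongrightarrow> slopeQ Om v 0 y"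
  "slopeQ (inner_part Om (i + Suc m)) v 0 y <= ennreal (2 * B / (2 * gap m) * unit_ball_vol DIM('a))"
proof -
 have ne: "Om ~= UNIV" using Om(2) by auto
 have yOm: "y \<in> Om" using y inner_part_subset by blast
 have y1: "y \<in> inner_part Om (Suc m)" using y inner_part_mono[of m "Suc m" Om] by auto
 let ?s = "%(U :: 'a set) (th :: 'a). ennreal ((\<bar>v (hit U y th) - v (hit U y (-th))\<bar> + 0) / (exit_time U y th + exit_time U y (-th)))"
 have B0: "0 <= B" using B[of y] yOm closure_subset[of Om] by fastforce
 have g: "0 < gap m" by (rule gap_pos)
 have ms: "(%th. ?s U th * iann th) \<in> borel_measurable lborel" if "open U" for U
  by (intro borel_measurable_times_ennreal slope_integrand_measurable[OF that v]) auto
 have bd: "?s (inner_part Om (i + Suc m)) th * iann th <= ennreal (2 * B / (2 * gap m)) * iann th" for i and th :: 'a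
  using slopeQ_inner_le[OF Om(1) y _ B, where k = "i + Suc m" and th = th] by (cases "th \<in> annulus") auto
 have tot: "(\<integral>\<^sup>+th. ennreal (2 * B / (2 * gap m)) * iann th \<partial>(lborel :: 'a measure)) <= ennreal (2 * B / (2 * gap m) * unit_ball_vol DIM('a))"
 proof -
  have "(\<integral>\<^sup>+th. ennreal (2 * B / (2 * gap m)) * iann th \<partial>(lborel :: 'a measure)) = ennreal (2 * B / (2 * gap m)) * emeasure lborel (annulus :: 'a set)"
   by (rule nn_integral_cmult_indicator) simp
  also have "... <= ennreal (2 * B / (2 * gap m)) * ennreal (unit_ball_vol DIM('a))" by (intro mult_left_mono emeasure_annulus) auto
  also have "... = ennreal (2 * B / (2 * gap m) * unit_ball_vol DIM('a))" using B0 g by (intro ennreal_mult'[symmetric]) auto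
  finally show ?thesis .
 qed
 show "slopeQ (inner_part Om (i + Suc m)) v 0 y <= ennreal (2 * B / (2 * gap m) * unit_ball_vol DIM('a))"
  unfolding slopeQ_def by (rule order.trans[OF nn_integral_mono[OF bd] tot])
 show "(%i. slopeQ (inner_part Om (i + Suc m)) v 0 y) \<longlonglongrightarrow> slopeQ Om v 0 y"
  unfolding slopeQ_def
 proof (rule nn_integral_dominated_convergence[where w = "%th. ennreal (2 * B / (2 * gap m)) * iann th"])
  show "(%th. ?s (inner_part Om (i + Suc m)) th * iann th) \<in> borel_measurable lborel" for i
   by (rule ms[OF inner_part_open[OF Om(1)]])
  show "(%th. ?s Om th * iann th) \<in> borel_measurable lborel" by (rule ms[OF Om(1)])
  show "AE th in lborel. ?s (inner_part Om (i + Suc m)) th * iann th <= ennreal (2 * B / (2 * gap m)) * iann th" for i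
   by (intro AE_I2 bd)
  show "(\<integral>\<^sup>+th. ennreal (2 * B / (2 * gap m)) * iann th \<partial>(lborel :: 'a measure)) < \<infinity>"
   by (rule le_less_trans[OF tot]) simp
  have "AE th in lborel. th \<in> annulus --> exits Om y th" by (rule AE_exits[OF Om])
  moreover have "AE th in lborel. -th \<in> annulus --> exits Om y (-th)"
   by (rule AE_lborel_uminus[OF AE_exits[OF Om]])
  ultimately show "AE th in lborel. (%i. ?s (inner_part Om (i + Suc m)) th * iann th) \<longlonglongrightarrow> ?s Om th * iann th"
  proof eventually_elim
   case (elim th)
   show ?case
   proof (cases "th \<in> annulus")
    case True
    then have t: "th \<in> annulus" "exits Om y th" "-th \<in> annulus" "exits Om y (-th)" using elim by (auto simp: annulus_uminus)
    have e: "(%i. exit_time (inner_part Om (i + Suc m)) y th) \<longlonglongrightarrow> exit_time Om y th" if "exits Om y th" for th :: 'a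
     by (rule LIMSEQ_ignore_initial_segment[OF exit_time_inner_tendsto[OF Om(1) ne yOm that]])
    have pos: "exit_time Om y th + exit_time Om y (-th) ~= 0"
     using exit_time_pos[OF Om(1) yOm t(2)] exit_time_pos[OF Om(1) yOm t(4)] by simp
    have "(%i. ?s (inner_part Om (i + Suc m)) th) \<longlonglongrightarrow> ?s Om th"
     by (intro tendsto_ennrealI tendsto_divide tendsto_add tendsto_rabs tendsto_diff tendsto_const e t pos
       hit_inner_tendsto[OF Om(1) ne y1 _ _ cv])
    then show ?thesis using True by simp
   qed simp
  qed
 qed simp
qed

text \<open>The ends of a chord have distance at most the sum of the two exit times, because
  \<open>norm th <= 1\<close> in the annulus. The upper gradient inequality then bounds the slope by
  the sum of \<open>g\<close> at both ends, and reflection of directions gives both ends the same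
  mean.\<close>

lemma slopeQ_le_hitT:
 fixes v :: "'a::euclidean_space => real"
 assumes n: "2 <= DIM('a)" and Om: "open Om" "emeasure lborel Om < \<infinity>" and y: "y \<in> Om"
  and g [measurable]: "g \<in> bmb" and g0: "!!z. 0 <= g z"
  and N: "N \<in> null_sets (bdm Om)"
  and hj: "!!x z. x \<in> frontier Om - N ==> z \<in> frontier Om - N ==> \<bar>v x - v z\<bar> <= dist x z * (g x + g z)"
 shows "slopeQ Om v 0 y <= 2 * hitT Om (%z. ennreal (g z)) y"
proof -
 let ?G = "%th. if exits Om y th then ennreal (g (hit Om y th)) else 0"
 have mG: "?G \<in> bmb"
  by (rule hit_integrand_measurable[OF Om(1)]) measurable
 have mG': "(%th. ?G (-th)) \<in> bmb" by (rule measurable_compose[OF _ mG]) measurable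
 have "slopeQ Om v 0 y <= (NNI th. ?G th * iann th + ?G (-th) * iann th)"
  unfolding slopeQ_def
 proof (rule nn_integral_mono_AE)
  have "AE th in lborel. th \<in> annulus --> exits Om y th" by (rule AE_exits[OF Om])
  moreover have "AE th in lborel. -th \<in> annulus --> exits Om y (-th)" by (rule AE_lborel_uminus[OF AE_exits[OF Om]])
  moreover have "AE th in lborel. th \<in> annulus --> exits Om y th --> hit Om y th \<notin> N" by (rule hit_null_AE[OF n Om(1) y N])
  moreover have "AE th in lborel. -th \<in> annulus --> exits Om y (-th) --> hit Om y (-th) \<notin> N"
   by (rule AE_lborel_uminus[OF hit_null_AE[OF n Om(1) y N]])
  ultimately show "AE th in lborel. ennreal ((\<bar>v (hit Om y th) - v (hit Om y (-th))\<bar> + 0) / (exit_time Om y th + exit_time Om y (-th))) * iann th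
    <= ?G th * iann th + ?G (-th) * iann th"
  proof eventually_elim
   case (elim th)
   show ?case
   proof (cases "th \<in> annulus")
    case True
    then have t: "exits Om y th" "exits Om y (-th)" "hit Om y th \<notin> N" "hit Om y (-th) \<notin> N" using elim by (auto simp: annulus_uminus)
    let ?b = "exit_time Om y th" and ?a = "exit_time Om y (-th)"
    have ab: "0 < ?b" "0 < ?a" using exit_time_pos[OF Om(1) y] t by blast+
    have "hit Om y th - hit Om y (-th) = (?b + ?a) *\<^sub>R th" by (simp add: hit_def scaleR_add_left)
    then have "dist (hit Om y th) (hit Om y (-th)) = (?b + ?a) * norm th" using ab by (simp add: dist_norm)
    also have "... <= ?b + ?a" using True ab by (simp add: annulus_def mult_left_le)
    finally have d: "dist (hit Om y th) (hit Om y (-th)) <= ?b + ?a" .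
    let ?g = "g (hit Om y th) + g (hit Om y (-th))"
    have "\<bar>v (hit Om y th) - v (hit Om y (-th))\<bar> <= dist (hit Om y th) (hit Om y (-th)) * ?g"
     using hit_frontier[OF Om(1) y] t by (intro hj) auto
    also have "... <= (?b + ?a) * ?g" using d g0 by (intro mult_right_mono) auto
    finally have "(\<bar>v (hit Om y th) - v (hit Om y (-th))\<bar> + 0) / (?b + ?a) <= ?g"
     using ab by (simp add: pos_divide_le_eq mult.commute)
    then have "ennreal ((\<bar>v (hit Om y th) - v (hit Om y (-th))\<bar> + 0) / (?b + ?a)) <= ennreal (g (hit Om y th)) + ennreal (g (hit Om y (-th)))"
     using g0 by (intro ennreal_le_add) auto
    then show ?thesis using True t by simp
   qed simp
  qed
 qed
 also have "... = hitT Om (%z. ennreal (g z)) y + (NNI th. ?G (-th) * iann th)"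
  unfolding hitT_def using mG mG' by (intro nn_integral_add) simp_all
 also have "(NNI th. ?G (-th) * iann th) = hitT Om (%z. ennreal (g z)) y"
  unfolding hitT_def by (rule nn_integral_annulus_uminus[OF mG])
 finally show ?thesis by (simp add: mult_2)
qed

text \<open>The larger subdomain grows first with \<open>m\<close> fixed, then \<open>m\<close>
  grows. The bound \<open>J\<close> for the gradient term is left open because it is supplied in two
  ways: as a potential of order one in (i), and as a constant in (ii) and (iii).\<close>

lemma pointwise_bound:
 fixes Om :: "'a::euclidean_space set"
 assumes n: "3 <= DIM('a)" and Om: "open Om" "emeasure lborel Om < \<infinity>" and u: "Cb_closure Om u"
  and mo: "!!de. 0 < de ==> EX w D H. mollified Om u h K de w D H" and K: "0 <= K"
  and h [measurable]: "h \<in> bmb" and v [measurable]: "v \<in> bmb"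
  and vu: "!!y. y \<in> closure Om ==> v y = u y"
  and g [measurable]: "g \<in> bmb" and g0: "!!z. 0 <= g z"
  and N: "N \<in> null_sets (bdm Om)"
  and hj: "!!x z. x \<in> frontier Om - N ==> z \<in> frontier Om - N ==> \<bar>v x - v z\<bar> <= dist x z * (g x + g z)"
  and x: "x \<in> Om"
  and J: "!!m. x \<in> inner_part Om m ==> ring (inner_part Om m) (hitT Om (%z. ennreal (g z))) x <= J"
 shows "emeasure lborel (annulus :: 'a set) * ennreal \<bar>v x\<bar> <=
  hitT Om (%z. ennreal \<bar>v z\<bar>) x + ennreal (3 / slope_const DIM('a)) * (2 * J)
  + ennreal (stage_const DIM('a) K) * pot (real DIM('a) - 2) h x"
proof -
 have ne: "Om ~= UNIV" using Om(2) by auto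
 have cv: "continuous_on (closure Om) v"
  using u vu unfolding Cb_closure_def by (metis (no_types, lifting) continuous_on_cong)
 obtain B where B: "0 < B" "!!z. z \<in> closure Om ==> \<bar>v z\<bar> <= B" using Cb_closure_bounded[OF u] vu by metis
 have mT: "hitT Om (%z. ennreal (g z)) \<in> bmb" by (rule hitT_measurable[OF Om(1)]) measurable
 let ?I = "%m. \<integral>\<^sup>+th. ennreal \<bar>v (hit (inner_part Om m) x th)\<bar> * iann th \<partial>lborel"
 let ?c = "ennreal (3 / slope_const DIM('a))" and ?P = "ennreal (stage_const DIM('a) K) * pot (real DIM('a) - 2) h x"
 have stage: "emeasure lborel (annulus :: 'a set) * ennreal \<bar>v x\<bar> <= ?I m + ?c * (2 * J) + ?P" if xm: "x \<in> inner_part Om m" for m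
 proof -
  let ?U = "inner_part Om m"
  have Uo: "open ?U" by (rule inner_part_open[OF Om(1)])
  have "(%i. ring ?U (slopeQ (inner_part Om (i + Suc m)) v 0) x) \<longlonglongrightarrow> ring ?U (slopeQ Om v 0) x"
   by (rule ring_tendsto[OF Uo slopeQ_measurable[OF inner_part_open[OF Om(1)] v] slopeQ_measurable[OF Om(1) v] inner_part_exits
     exit_time_inner_le[OF _ xm Om(1)] slopeQ_tendsto(1)[OF Om _ v cv B(2)] slopeQ_tendsto(2)[OF Om _ v cv B(2)]])
  then have "(%i. ?I m + ?c * ring ?U (slopeQ (inner_part Om (i + Suc m)) v 0) x + ?P) \<longlonglongrightarrow> ?I m + ?c * ring ?U (slopeQ Om v 0) x + ?P"
   by (intro tendsto_add tendsto_const ennreal_tendsto_cmult) simp_all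
  moreover have "emeasure lborel (annulus :: 'a set) * ennreal \<bar>v x\<bar> <= ?I m + ?c * ring ?U (slopeQ (inner_part Om (i + Suc m)) v 0) x + ?P" for i
   by (rule stage_bound[OF n Om(1) u mo K h v vu xm]) auto
  ultimately have "emeasure lborel (annulus :: 'a set) * ennreal \<bar>v x\<bar> <= ?I m + ?c * ring ?U (slopeQ Om v 0) x + ?P"
   by (intro LIMSEQ_le_const) auto
  also have "ring ?U (slopeQ Om v 0) x <= ring ?U (%y. 2 * hitT Om (%z. ennreal (g z)) y) x"
   using n inner_part_subset[of Om m] by (intro ring_mono slopeQ_le_hitT[OF _ Om _ g g0 N hj] inner_part_exits) auto
  also have "... = 2 * ring ?U (hitT Om (%z. ennreal (g z))) x" by (rule ring_cmult[OF Uo mT])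
  also have "... <= 2 * J" by (intro mult_left_mono J xm) auto
  finally show ?thesis by (simp add: add_left_mono add_right_mono mult_left_mono)
 qed
 obtain m where m: "x \<in> inner_part Om m" using inner_part_compact[OF Om(1) ne, of "{x}"] x by auto
 have xi: "x \<in> inner_part Om (i + m)" for i using m inner_part_mono[of m "i + m" Om] by auto
 have "(%i. ?I (i + m)) \<longlonglongrightarrow> hitT Om (%z. ennreal \<bar>v z\<bar>) x"
  unfolding hitT_def
 proof (rule nn_integral_dominated_convergence[where w = "%th. ennreal B * iann th"])
  have idm: "(%th::'a. th) \<in> borel_measurable lborel" by measurable
  show "(%th. ennreal \<bar>v (hit (inner_part Om (i + m)) x th)\<bar> * iann th) \<in> borel_measurable lborel" for i
   using measurable_compose[OF exit_time_measurable(3)[OF inner_part_open[OF Om(1)] borel_measurable_const idm] v] by measurable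
  show "(%th. (if exits Om x th then ennreal \<bar>v (hit Om x th)\<bar> else 0) * iann th) \<in> borel_measurable lborel"
   by (intro borel_measurable_times_ennreal hit_integrand_measurable[OF Om(1), where f = "%z. ennreal \<bar>v z\<bar>"]) auto
  show "AE th in lborel. ennreal \<bar>v (hit (inner_part Om (i + m)) x th)\<bar> * iann th <= ennreal B * iann th" for i
  proof (intro AE_I2)
   fix th :: 'a
   show "ennreal \<bar>v (hit (inner_part Om (i + m)) x th)\<bar> * iann th <= ennreal B * iann th"
    using B(2)[OF hit_inner_closure[OF Om(1) xi]] by (cases "th \<in> annulus") (auto intro: ennreal_leI)
  qed
  show "(\<integral>\<^sup>+th. ennreal B * iann th \<partial>(lborel :: 'a measure)) < \<infinity>"
   using emeasure_annulus[where 'a='a]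
   by (subst nn_integral_cmult_indicator) (auto simp: ennreal_mult_less_top intro: le_less_trans)
  have "AE th in lborel. th \<in> annulus --> exits Om x th" by (rule AE_exits[OF Om])
  then show "AE th in lborel. (%i. ennreal \<bar>v (hit (inner_part Om (i + m)) x th)\<bar> * iann th) \<longlonglongrightarrow> (if exits Om x th then ennreal \<bar>v (hit Om x th)\<bar> else 0) * iann th"
  proof eventually_elim
   case (elim th)
   show ?case
   proof (cases "th \<in> annulus")
    case True
    then have "(%i. ennreal \<bar>v (hit (inner_part Om (i + m)) x th)\<bar>) \<longlonglongrightarrow> ennreal \<bar>v (hit Om x th)\<bar>"
     using elim by (intro tendsto_ennrealI tendsto_rabs hit_inner_tendsto[OF Om(1) ne m _ _ cv]) auto
    then show ?thesis using True elim by simp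
   qed simp
  qed
 qed simp
 then have "(%i. ?I (i + m) + ?c * (2 * J) + ?P) \<longlonglongrightarrow> hitT Om (%z. ennreal \<bar>v z\<bar>) x + ?c * (2 * J) + ?P"
  by (intro tendsto_add tendsto_const)
 then show ?thesis using stage[OF xi] by (intro LIMSEQ_le_const) auto
qed

section \<open>Lebesgue norms and mapping properties of the operators\<close>

definition lp_le :: "'b measure => real => ('b => real) => real => bool" where
 "lp_le M p f N \<longleftrightarrow> (\<integral>\<^sup>+x. ennreal (f x powr p) \<partial>M) <= ennreal (N powr p)"

lemma lp_norm_less_imp:
 assumes "lp_norm M p f < ennreal N" "0 < p"
 shows "0 < N" "lp_le M p (%x. \<bar>f x\<bar>) N"
proof -
 let ?I = "\<integral>\<^sup>+x. ennreal (\<bar>f x\<bar> powr p) \<partial>M"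
 show N: "0 < N" using assms(1) by (cases "0 < N") (auto simp: ennreal_neg)
 have fin: "?I ~= \<infinity>" using assms(1) by (auto simp: lp_norm_def Let_def split: if_splits)
 then have "enn2real ?I powr (1/p) < N"
  using assms(1) N by (simp add: lp_norm_def Let_def ennreal_less_iff)
 then have "(enn2real ?I powr (1/p)) powr p <= N powr p" using assms(2) by (intro powr_mono2) auto
 then have "enn2real ?I <= N powr p" using assms(2) by (simp add: powr_powr)
 then show "lp_le M p (%x. \<bar>f x\<bar>) N" unfolding lp_le_def using fin
  by (metis ennreal_enn2real ennreal_leI infinity_ennreal_def less_top)
qed

lemma lp_norm_le:
 assumes "lp_le M p (%x. \<bar>f x\<bar>) N" "0 < p" "0 <= N"
 shows "lp_norm M p f <= ennreal N"
proof -
 let ?I = "\<integral>\<^sup>+x. ennreal (\<bar>f x\<bar> powr p) \<partial>M"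
 have I: "?I <= ennreal (N powr p)" using assms(1) by (simp add: lp_le_def)
 then have fin: "?I ~= \<infinity>" by (auto simp: top_unique)
 have "enn2real ?I <= N powr p" by (rule enn2real_leI[OF _ I]) simp
 then have "enn2real ?I powr (1/p) <= (N powr p) powr (1/p)" using assms(2) by (intro powr_mono2) auto
 then have "enn2real ?I powr (1/p) <= N" using assms by (simp add: powr_powr)
 then show ?thesis using fin by (simp add: lp_norm_def Let_def ennreal_leI)
qed

lemma lp_le_cmult:
 assumes "lp_le M p f N" "f \<in> borel_measurable M" "0 <= c"
 shows "lp_le M p (%x. c * f x) (c * N)"
proof -
 have "(\<integral>\<^sup>+x. ennreal ((c * f x) powr p) \<partial>M) = (\<integral>\<^sup>+x. ennreal (c powr p) * ennreal (f x powr p) \<partial>M)"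
  by (intro nn_integral_cong) (simp add: powr_mult ennreal_mult')
 also have "... = ennreal (c powr p) * (\<integral>\<^sup>+x. ennreal (f x powr p) \<partial>M)"
  using assms(2) by (intro nn_integral_cmult) measurable
 also have "... <= ennreal (c powr p) * ennreal (N powr p)"
  using assms(1) by (intro mult_left_mono) (auto simp: lp_le_def)
 also have "... = ennreal ((c * N) powr p)" by (simp add: powr_mult ennreal_mult')
 finally show ?thesis by (simp add: lp_le_def)
qed

lemma lp_le_mono:
 assumes "lp_le M p f N" "AE x in M. 0 <= g x & g x <= f x" "0 <= N" "N <= N'" "0 <= p"
 shows "lp_le M p g N'"
proof -
 have "AE x in M. ennreal (g x powr p) <= ennreal (f x powr p)"
  using assms(2) by eventually_elim (use assms(5) in \<open>auto intro!: ennreal_leI powr_mono2\<close>)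
 then have "(\<integral>\<^sup>+x. ennreal (g x powr p) \<partial>M) <= (\<integral>\<^sup>+x. ennreal (f x powr p) \<partial>M)"
  by (rule nn_integral_mono_AE)
 also have "... <= ennreal (N powr p)" using assms(1) by (simp add: lp_le_def)
 also have "... <= ennreal (N' powr p)" using assms(3-5) by (intro ennreal_leI powr_mono2) auto
 finally show ?thesis by (simp add: lp_le_def)
qed

lemma lp_le_normalise:
 assumes "lp_le M p f N" "f \<in> borel_measurable M" "0 < N"
 shows "(\<integral>\<^sup>+x. ennreal ((f x / N) powr p) \<partial>M) <= 1"
 using lp_le_cmult[OF assms(1,2), of "1/N"] assms(3) by (simp add: lp_le_def)

lemma lp_le_denormalise:
 assumes "(\<integral>\<^sup>+x. ennreal (v x powr q) \<partial>M) <= ennreal K" "v \<in> borel_measurable M" "0 < q" "0 < K" "0 < N"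
 shows "lp_le M q (%x. N * v x) (K powr (1/q) * N)"
proof -
 have "lp_le M q v (K powr (1/q))" using assms by (simp add: lp_le_def powr_powr)
 from lp_le_cmult[OF this assms(2), of N] assms(5) show ?thesis by (simp add: mult.commute)
qed

text \<open>The height \<open>A\<close> is the one at which both parts of the splitting contribute
  \<open>A powr q * m\<close>. This includes the case \<open>q = p\<close>, and the factor
  \<open>2 powr (1/q)\<close> is free of \<open>p\<close>; the latter keeps the constant in (ii)
  free of \<open>s\<close>.\<close>

lemma lp_le_finite_measure:
 assumes f: "lp_le M p f N" "f \<in> borel_measurable M" "!!x. 0 <= f x" and M: "finite_measure M"
  and q: "0 < q" "q <= p" and N: "0 < N"
 shows "lp_le M q f (2 powr (1/q) * (N * measure M (space M) powr (1/q - 1/p)))"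
proof (cases "measure M (space M) = 0")
 case True
 interpret finite_measure M by (rule M)
 have e0: "emeasure M (space M) = 0" using True by (simp add: emeasure_eq_measure)
 have "AE x in M. False" by (rule AE_I[of _ _ "space M"]) (use e0 in auto)
 then have "AE x in M. ennreal (f x powr q) = 0" by (rule eventually_mono) simp
 then have "(\<integral>\<^sup>+x. ennreal (f x powr q) \<partial>M) = 0"
  using nn_integral_cong_AE[where M = M and u = "%x. ennreal (f x powr q)" and v = "%_. 0"] by simp
 then show ?thesis by (simp add: lp_le_def)
next
 case False
 interpret finite_measure M by (rule M)
 define m where "m = measure M (space M)"
 have m: "0 < m" using False by (simp add: m_def zero_less_measure_iff)
 define A where "A = N * m powr (-1/p)"
 have p: "0 < p" using q by simp
 have A: "0 < A" using N m by (simp add: A_def)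
 have pt: "f x powr q <= A powr q + A powr (q-p) * f x powr p" for x
 proof (cases "f x <= A")
  case True
  then have "f x powr q <= A powr q" using f(3) q by (intro powr_mono2) auto
  then show ?thesis using A by (simp add: add_increasing2)
 next
  case False
  then have fp: "0 < f x" "A <= f x" using A by auto
  have "f x powr (q-p) <= A powr (q-p)" using fp A q by (intro powr_mono2') auto
  then have "f x powr (q-p) * f x powr p <= A powr (q-p) * f x powr p" by (rule mult_right_mono) simp
  moreover have "f x powr (q-p) * f x powr p = f x powr q" using fp by (simp add: powr_add[symmetric])
  moreover have "0 <= A powr q" by simp
  ultimately show ?thesis by linarith
 qed
 have "(\<integral>\<^sup>+x. ennreal (f x powr q) \<partial>M) <= (\<integral>\<^sup>+x. ennreal (A powr q) + ennreal (A powr (q-p)) * ennreal (f x powr p) \<partial>M)"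
 proof (intro nn_integral_mono)
  fix x
  have "ennreal (f x powr q) <= ennreal (A powr q + A powr (q-p) * f x powr p)" by (rule ennreal_leI[OF pt])
  then show "ennreal (f x powr q) <= ennreal (A powr q) + ennreal (A powr (q-p)) * ennreal (f x powr p)"
   by (simp add: ennreal_mult')
 qed
 also have "... = ennreal (A powr q) * emeasure M (space M) + ennreal (A powr (q-p)) * (\<integral>\<^sup>+x. ennreal (f x powr p) \<partial>M)"
  using f(2) by (subst nn_integral_add) (auto simp: nn_integral_cmult)
 also have "... <= ennreal (A powr q) * ennreal m + ennreal (A powr (q-p)) * ennreal (N powr p)"
  using f(1) by (intro add_mono mult_left_mono) (auto simp: lp_le_def emeasure_eq_measure m_def)
 also have "... = ennreal (A powr q * m + A powr (q-p) * N powr p)"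
  using m by (simp add: ennreal_mult'[symmetric])
 also have "A powr (q-p) * N powr p = A powr q * m"
 proof -
  have "A powr p = N powr p / m" unfolding A_def powr_mult powr_powr using p m by (simp add: powr_minus divide_inverse)
  then have "A powr (q-p) * N powr p = A powr q * (N powr p / (N powr p / m))" by (simp add: powr_diff)
  then show ?thesis using N m by simp
 qed
 also have "A powr q * m + A powr q * m = (2 powr (1/q) * (N * m powr (1/q - 1/p))) powr q"
 proof -
  have "(-1/p) * q + 1 = (1/q-1/p)*q" using q by (simp add: left_diff_distrib)
  then have "m powr ((-1/p)*q) * m powr 1 = m powr ((1/q-1/p)*q)" by (simp only: powr_add[symmetric])
  then have "A powr q * m = N powr q * m powr ((1/q-1/p)*q)" using m by (simp add: A_def powr_mult powr_powr)
  then show ?thesis using q by (simp only: powr_mult powr_powr) simp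
 qed
 finally show ?thesis unfolding lp_le_def m_def .
qed

lemma lp_le_integrable:
 assumes f: "lp_le M p f N" "f \<in> borel_measurable M" "!!x. 0 <= f x" and p: "1 <= p"
  and Om: "Om \<in> sets M" "emeasure M Om < \<infinity>" and off: "!!x. x \<in> space M ==> x \<notin> Om ==> f x = 0"
 shows "(\<integral>\<^sup>+x. ennreal (f x) \<partial>M) <= emeasure M Om + ennreal (N powr p)" "(\<integral>\<^sup>+x. ennreal (f x) \<partial>M) < \<infinity>"
proof -
 have "(\<integral>\<^sup>+x. ennreal (f x) \<partial>M) <= (\<integral>\<^sup>+x. indicator Om x + ennreal (f x powr p) \<partial>M)"
 proof (intro nn_integral_mono)
  fix x assume x: "x \<in> space M"
  have "f x <= indicator Om x + f x powr p"
  proof (cases "1 <= f x")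
   case True
   then have "f x powr 1 <= f x powr p" using p by (intro powr_mono) auto
   then show ?thesis using True by (simp add: add_increasing)
  next
   case False
   then show ?thesis using off[OF x] f(3)[of x] by (cases "x \<in> Om") (auto simp: add_increasing2)
  qed
  then have "ennreal (f x) <= ennreal (indicator Om x + f x powr p)" by (rule ennreal_leI)
  then show "ennreal (f x) <= indicator Om x + ennreal (f x powr p)" by (simp add: ennreal_indicator)
 qed
 also have "... = emeasure M Om + (\<integral>\<^sup>+x. ennreal (f x powr p) \<partial>M)"
  using f(2) Om by (subst nn_integral_add) auto
 also have "... <= emeasure M Om + ennreal (N powr p)" using f(1) by (simp add: lp_le_def add_left_mono)
 finally show le: "(\<integral>\<^sup>+x. ennreal (f x) \<partial>M) <= emeasure M Om + ennreal (N powr p)" .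
 show "(\<integral>\<^sup>+x. ennreal (f x) \<partial>M) < \<infinity>" by (rule le_less_trans[OF le]) (use Om in auto)
qed

lemma ennreal_enn2real_le: "ennreal (enn2real x) <= x"
 by (cases x) auto

lemma pot_cmult:
 assumes [measurable]: "g \<in> bmb" and c: "0 <= c"
 shows "pot b (%y. c * g y) x = ennreal c * pot b g x"
proof -
 have "pot b (%y. c * g y) x = (NNI z. ennreal c * (rker b x z * ennreal (g z)))"
  unfolding pot_def using c by (intro nn_integral_cong) (simp add: ennreal_mult' mult_ac)
 then show ?thesis unfolding pot_def by (simp add: nn_integral_cmult)
qed

lemma hitT_cmult:
 fixes f :: "'a::euclidean_space => ennreal"
 assumes Om: "open Om" and f: "f \<in> bmb"
 shows "hitT Om (%z. c * f z) x = c * hitT Om f x"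
proof -
 have "hitT Om (%z. c * f z) x = (NNI th. c * ((if exits Om x th then f (hit Om x th) else 0) * iann th))"
  unfolding hitT_def by (intro nn_integral_cong) (simp add: mult_ac)
 also have "... = c * hitT Om f x" unfolding hitT_def
  by (intro nn_integral_cmult borel_measurable_times_ennreal hit_integrand_measurable[OF Om] f) auto
 finally show ?thesis .
qed

text \<open>Stated with \<open>enn2real\<close>, which turns an infinite value into 0. Where the
  bound is applied, \<open>pot_finite_AE\<close> shows that infinite values form a null set.\<close>

definition riesz_const :: "'a::euclidean_space itself => real => real => real => real => real => bool" where
 "riesz_const (T :: 'a itself) (k :: real) (p :: real) (al :: real) (C :: real) K \<longleftrightarrow> (ALL (M :: 'a measure) g N. ahlfors M al C --> finite_measure M -->
   g \<in> bmb --> (ALL y. 0 <= g y) --> 0 < N --> lp_le lborel p g N -->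
   lp_le M (p * al / (real DIM('a) - k * p)) (%x. enn2real (pot (real DIM('a) - k) g x)) (K * N))"

lemma riesz_lp:
 fixes k p al C :: real
 assumes kp: "0 < k" "k < DIM('a::euclidean_space)" "1 < p" "k * p < DIM('a)"
  and al: "DIM('a) - k < al" and C: "0 < C"
 shows "EX K>0. riesz_const TYPE('a) k p al C K"
proof -
 let ?q = "p * al / (DIM('a) - k * p)" and ?b = "real DIM('a) - k"
 obtain K where K: "0 < K" and R: "!!(M :: 'a measure) g v. ahlfors M al C ==> finite_measure M ==>
   g \<in> bmb ==> (ALL y. 0 <= g y) ==> (NNI y. ennreal (g y powr p)) <= 1 ==>
   v \<in> borel_measurable M ==> (ALL x. 0 <= v x) ==>
   (ALL x. ennreal (v x) <= (NNI y. rker ?b x y * ennreal (g y))) ==>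
   (\<integral>\<^sup>+x. ennreal (v x powr ?q) \<partial>M) <= ennreal K"
  using riesz_strong[OF kp al C] by blast
 have q: "0 < ?q" using kp al by simp
 show ?thesis unfolding riesz_const_def
 proof (intro exI[of _ "K powr (1/?q)"] conjI allI impI)
  show "0 < K powr (1/?q)" using K by simp
  fix M :: "'a measure" and g :: "'a => real" and N :: real
  assume M: "ahlfors M al C" "finite_measure M" and g: "g \<in> bmb" "ALL y. 0 <= g y"
   and N: "0 < N" and gN: "lp_le lborel p g N"
  let ?v = "%x. 1/N * enn2real (pot ?b g x)"
  have v: "?v \<in> borel_measurable M" using g(1) by (intro ahlfors_measurable[OF M(1)]) measurable
  have "(\<integral>\<^sup>+x. ennreal (?v x powr ?q) \<partial>M) <= ennreal K"
  proof (rule R[OF M _ _ _ v, where g = "%y. 1/N * g y"])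
   show "(NNI y. ennreal ((1/N * g y) powr p)) <= 1"
    using lp_le_normalise[OF gN _ N] g(1) by simp
   show "ALL x. ennreal (?v x) <= (NNI y. rker ?b x y * ennreal (1/N * g y))"
   proof
    fix x
    have "ennreal (?v x) = ennreal (1/N) * ennreal (enn2real (pot ?b g x))" using N by (intro ennreal_mult) auto
    also have "... <= ennreal (1/N) * pot ?b g x" by (intro mult_left_mono ennreal_enn2real_le) auto
    also have "... = pot ?b (%y. 1/N * g y) x" using g(1) N by (subst pot_cmult) auto
    finally show "ennreal (?v x) <= (NNI y. rker ?b x y * ennreal (1/N * g y))" by (simp only: pot_def)
   qed
  qed (use g N in auto)
  from lp_le_denormalise[OF this v q K N] show "lp_le M ?q (%x. enn2real (pot ?b g x)) (K powr (1/?q) * N)"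
   using N by simp
 qed
qed

text \<open>The hypothesis \<open>weak\<close> of \<open>interpolation\<close> for means over exit
  points, by way of \<open>hitT_le\<close>. The condition that \<open>al\<close> exceeds the
  dimension minus 1 is what makes the kernel of \<open>hitT_le\<close> integrable against
  \<open>M\<close>.\<close>

lemma hitT_swap:
 fixes M :: "'a::euclidean_space measure"
 assumes n: "2 <= DIM('a)" and M: "ahlfors M al C" "finite_measure M" and al: "real DIM('a) - 1 < al"
  and Om: "open Om" and fin: "finite_measure (bdm Om)"
  and E: "E \<in> sets M" and f [measurable]: "f \<in> bmb"
 shows "(\<integral>\<^sup>+x. (if x \<in> Om then hitT Om f x else 0) * indicator E x \<partial>M) <=
  ennreal (proj_const DIM('a) * set_const al (real DIM('a) - 1) C * measure M E powr (1 - (real DIM('a) - 1)/al))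
   * (\<integral>\<^sup>+y. f y \<partial>bdm Om)"
proof -
 let ?b = "real DIM('a) - 1" and ?H = "bdm Om"
 interpret H: finite_measure ?H by (rule fin)
 note [measurable_cong] = ahlforsD(1)[OF M(1)]
 have sH: "sigma_finite_measure ?H" by unfold_locales
 interpret H2: sigma_finite_measure ?H by (rule sH)
 have [measurable]: "E \<in> sets borel" using E ahlforsD(1)[OF M(1)] by simp
 have "(\<integral>\<^sup>+x. (if x \<in> Om then hitT Om f x else 0) * indicator E x \<partial>M)
  <= (\<integral>\<^sup>+x. ennreal (proj_const DIM('a)) * ((\<integral>\<^sup>+z. rker ?b x z * f z \<partial>?H) * indicator E x) \<partial>M)"
 proof (intro nn_integral_mono)
  fix x
  show "(if x \<in> Om then hitT Om f x else 0) * indicator E x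
    <= ennreal (proj_const DIM('a)) * ((\<integral>\<^sup>+z. rker ?b x z * f z \<partial>?H) * indicator E x)"
   using hitT_le[OF n Om, of x f] f by (auto simp: indicator_def)
 qed
 also have "... = ennreal (proj_const DIM('a)) * (\<integral>\<^sup>+x. (\<integral>\<^sup>+z. rker ?b x z * f z \<partial>?H) * indicator E x \<partial>M)"
  by (intro nn_integral_cmult) measurable
 also have "... <= ennreal (proj_const DIM('a)) * (ennreal (set_const al ?b C * measure M E powr (1-?b/al)) * (\<integral>\<^sup>+y. f y \<partial>?H))"
  using n al by (intro mult_left_mono nn_integral_rker_swap M sH E f) auto
 also have "... = ennreal (proj_const DIM('a) * set_const al ?b C * measure M E powr (1 - ?b/al)) * (\<integral>\<^sup>+y. f y \<partial>?H)"
  using proj_const_pos[of "DIM('a)"] n by (simp add: ennreal_mult' mult.assoc)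
 finally show ?thesis .
qed

lemma hitT_finite_AE:
 fixes M :: "'a::euclidean_space measure"
 assumes n: "2 <= DIM('a)" and M: "ahlfors M al C" "finite_measure M" and al: "real DIM('a) - 1 < al"
  and Om: "open Om" and fin: "finite_measure (bdm Om)"
  and f: "f \<in> bmb" "(\<integral>\<^sup>+y. f y \<partial>bdm Om) < \<infinity>"
 shows "AE x in M. x \<in> Om --> hitT Om f x < \<infinity>"
proof -
 note [measurable_cong] = ahlforsD(1)[OF M(1)]
 have [measurable]: "hitT Om f \<in> bmb" by (rule hitT_measurable[OF Om f(1)])
 have [measurable]: "Om \<in> sets borel" using Om by simp
 have m: "(%x. (if x \<in> Om then hitT Om f x else 0) * indicator UNIV x) \<in> borel_measurable M" by measurable
 have "(\<integral>\<^sup>+x. (if x \<in> Om then hitT Om f x else 0) * indicator UNIV x \<partial>M) < \<infinity>"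
  by (rule le_less_trans[OF hitT_swap[OF n M al Om fin _ f(1)]])
   (use f(2) ahlforsD(1)[OF M(1)] in \<open>auto simp: ennreal_mult_less_top\<close>)
 then have "AE x in M. (if x \<in> Om then hitT Om f x else 0) * indicator UNIV x ~= \<infinity>"
  by (intro nn_integral_noteq_infinite m) auto
 then show ?thesis by (rule eventually_mono) (auto simp: less_top split: if_splits)
qed

lemma pot_finite_AE:
 fixes M :: "'a::euclidean_space measure"
 assumes M: "ahlfors M al C" "finite_measure M" and b: "0 <= b" "b < al"
  and h: "h \<in> bmb" "(NNI y. ennreal (h y)) < \<infinity>"
 shows "AE x in M. pot b h x < \<infinity>"
proof -
 note [measurable_cong] = ahlforsD(1)[OF M(1)]
 note h(1) [measurable]
 have m: "(%x. pot b h x * indicator UNIV x) \<in> borel_measurable M" by measurable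
 have "(\<integral>\<^sup>+x. pot b h x * indicator UNIV x \<partial>M) < \<infinity>" unfolding pot_def
  by (rule le_less_trans[OF nn_integral_rker_swap[OF M _ _ b]])
   (use h(2) ahlforsD(1)[OF M(1)] in \<open>auto simp: ennreal_mult_less_top lborel.sigma_finite_measure_axioms\<close>)
 then have "AE x in M. pot b h x * indicator UNIV x ~= \<infinity>"
  by (intro nn_integral_noteq_infinite m) auto
 then show ?thesis by (rule eventually_mono) (auto simp: less_top)
qed

definition hitR :: "'a::euclidean_space set => ('a => real) => 'a => real" where
 "hitR Om g x = (if x \<in> Om then enn2real (hitT Om (%z. ennreal (g z)) x) else 0)"

definition hit_const :: "'a::euclidean_space itself => real => real => real => real => bool" where
 "hit_const (T :: 'a itself) (r :: real) (al :: real) (C :: real) K \<longleftrightarrow> (ALL (M :: 'a measure) Om f N. ahlfors M al C --> finite_measure M --> open Om -->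
   finite_measure (bdm Om) -->
   f \<in> bmb --> (ALL y. 0 <= f y) --> 0 < N --> lp_le (bdm Om) r f N -->
   lp_le M (r * al / (real DIM('a) - 1)) (hitR Om f) (K * N))"

text \<open>Means of bounded functions are bounded because the annulus has finite volume, so small
  values cost \<open>V * l\<close>, the case \<open>th = 1\<close> of \<open>interpolation\<close>.
  Large values are handled by \<open>hitT_swap\<close>.\<close>

lemma hit_lp:
 fixes r al C :: real
 assumes n: "2 <= DIM('a::euclidean_space)" and r: "1 < r" and al: "real DIM('a) - 1 < al" and C: "0 < C"
 shows "EX K>0. hit_const TYPE('a) r al C K"
proof -
 let ?b = "real DIM('a) - 1"
 let ?q = "r * al / ?b"
 define V where "V = unit_ball_vol (real DIM('a))"
 define A where "A = proj_const DIM('a) * set_const al ?b C"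
 define K where "K = 1 + interp_const (al/?b) r 1 V A"
 have V: "0 < V" by (simp add: V_def)
 have b: "1 <= ?b" using n by simp
 have A: "0 < A" using proj_const_pos[of "DIM('a)"] n set_const_pos[OF al C] by (simp add: A_def)
 have q: "0 < ?q" using r al b by simp
 have K: "0 < K" unfolding K_def interp_const_def using b al r V A by (intro add_pos_nonneg) auto
 show ?thesis unfolding hit_const_def hitR_def[abs_def]
 proof (intro exI[of _ "K powr (1/?q)"] conjI allI impI)
  show "0 < K powr (1/?q)" using K by simp
  fix M :: "'a measure" and Om and f :: "'a => real" and N :: real
  assume M: "ahlfors M al C" "finite_measure M" and Om: "open Om" and fin: "finite_measure (hmeas ?b (frontier Om))"
   and f: "f \<in> bmb" "ALL y. 0 <= f y" and N: "0 < N" and fN: "lp_le (hmeas ?b (frontier Om)) r f N"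
  let ?H = "hmeas ?b (frontier Om)"
  note [measurable_cong] = ahlforsD(1)[OF M(1)]
  note f(1) [measurable]
  interpret H: finite_measure ?H by (rule fin)
  let ?g = "%y. f y / N"
  have mh: "hitT Om (%z. ennreal (f z)) \<in> bmb" by (rule hitT_measurable[OF Om]) measurable
  have mO [measurable]: "Om \<in> sets borel" using Om by simp
  let ?v = "%x. if x \<in> Om then 1/N * enn2real (hitT Om (%z. ennreal (f z)) x) else 0"
  let ?R = "%l x. if x \<in> Om then hitT Om (%y. ennreal (?g y) * indicator {y. l < ?g y} y) x else 0"
  have v: "?v \<in> borel_measurable M" using mh mO by (intro ahlfors_measurable[OF M(1)] measurable_If borel_measurable_times borel_measurable_const) auto
  have hg: "hitT Om (%z. ennreal (?g z)) x = ennreal (1/N) * hitT Om (%z. ennreal (f z)) x" for x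
  proof -
   have "(%z. ennreal (?g z)) = (%z. ennreal (1/N) * ennreal (f z))" using N by (simp add: ennreal_mult'[symmetric])
   then show ?thesis using hitT_cmult[OF Om, of "%z. ennreal (f z)"] by simp
  qed
  have mi: "(%y. ennreal (?g y) * indicator {y. l < ?g y} y) \<in> bmb" for l
   by measurable
  have "(\<integral>\<^sup>+x. ennreal (?v x powr (al/?b*(1+r-1)/1)) \<partial>M) <= ennreal (interp_const (al/?b) r 1 V A)"
  proof (rule interpolation[where N = ?H and g = ?g and R = ?R])
   show "sigma_finite_measure ?H" by unfold_locales
   show "(\<integral>\<^sup>+y. ennreal (?g y powr r) \<partial>?H) <= 1" by (rule lp_le_normalise[OF fN _ N]) simp
   show "?R l \<in> borel_measurable M" for l
   proof -
    have [measurable]: "hitT Om (%y. ennreal (?g y) * indicator {y. l < ?g y} y) \<in> bmb"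
     by (rule hitT_measurable[OF Om mi])
    show ?thesis by measurable
   qed
   fix l :: real assume l: "0 < l"
   show "ennreal (?v x) <= ennreal (V * l powr 1) + ?R l x" for x
   proof (cases "x \<in> Om")
    case True
    have "ennreal (?v x) = ennreal (1/N) * ennreal (enn2real (hitT Om (%z. ennreal (f z)) x))"
     using N True by (simp add: ennreal_mult'[symmetric])
    also have "... <= ennreal (1/N) * hitT Om (%z. ennreal (f z)) x" by (intro mult_left_mono ennreal_enn2real_le) auto
    also have "... = hitT Om (%z. ennreal (?g z)) x" by (rule hg[symmetric])
    also have "... <= hitT Om (%z. ennreal l + ennreal (?g z) * indicator {y. l < ?g y} z) x"
     by (rule hitT_mono) (auto simp: indicator_def ennreal_leI)
    also have "... = hitT Om (%z. ennreal l) x + ?R l x" using True by (subst hitT_add[OF Om _ mi]) auto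
    also have "... <= ennreal (V * l) + ?R l x" unfolding V_def using l by (intro add_right_mono hitT_bounded) auto
    finally show ?thesis using l by simp
   qed simp
   fix E assume E: "E \<in> sets M"
   have "1 / (al/?b) = ?b/al" by simp
   then show "(\<integral>\<^sup>+x. ?R l x * indicator E x \<partial>M) <= ennreal (A * measure M E powr (1 - 1/(al/?b))) *
      (\<integral>\<^sup>+y. ennreal (?g y) * indicator {y. l < ?g y} y \<partial>?H)"
    using hitT_swap[OF n M al Om fin E mi[of l]] by (simp only: A_def)
  qed (use M f N v b r V A al in auto)
  also have "... <= ennreal K" unfolding K_def by (intro ennreal_leI) simp
  finally have "(\<integral>\<^sup>+x. ennreal (?v x powr ?q) \<partial>M) <= ennreal K" by (simp add: mult.commute)
  from lp_le_denormalise[OF this v q K N]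
  show "lp_le M ?q (%x. if x \<in> Om then enn2real (hitT Om (%z. ennreal (f z)) x) else 0) (K powr (1/?q) * N)"
  proof (rule lp_le_mono)
   show "AE x in M. 0 <= (if x \<in> Om then enn2real (hitT Om (%z. ennreal (f z)) x) else 0) &
     (if x \<in> Om then enn2real (hitT Om (%z. ennreal (f z)) x) else 0) <= N * ?v x"
    using N by (intro AE_I2) auto
  qed (use q N in auto)
 qed
qed

text \<open>\<open>interpolation\<close> requires a finite measure. Volume restricted to the domain
  is one, of full dimension, so the same operator bound also yields Lebesgue norms inside the
  domain.\<close>

lemma ahlfors_restricted:
 fixes Om :: "'a::euclidean_space set"
 assumes "open Om" "emeasure lborel Om < \<infinity>"
 shows "ahlfors (density lborel (indicator Om)) (real DIM('a)) (unit_ball_vol DIM('a))" (is "ahlfors ?M _ _")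
  and "finite_measure (density lborel (indicator Om))"
proof -
 have O: "Om \<in> sets lborel" using assms(1) by simp
 have e: "emeasure ?M A = emeasure lborel (Om \<inter> A)" if "A \<in> sets borel" for A
  using that O by (subst emeasure_density) (auto simp: indicator_inter_arith[symmetric])
 show "ahlfors ?M (real DIM('a)) (unit_ball_vol DIM('a))"
  unfolding ahlfors_def
 proof (intro conjI allI impI)
  fix x :: 'a and r :: real assume "0 < r"
  have "emeasure ?M (ball x r) <= emeasure lborel (ball x r)" by (subst e) (auto intro: emeasure_mono)
  also have "... <= ennreal (unit_ball_vol DIM('a) * r powr real DIM('a))" using ahlforsD(5)[OF ahlfors_lborel \<open>0 < r\<close>] .
  finally show "emeasure ?M (ball x r) <= ennreal (unit_ball_vol DIM('a) * r powr real DIM('a))" .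
 qed auto
 show "finite_measure ?M"
  by (rule finite_measureI) (use assms e[of UNIV] in auto)
qed

lemma lp_le_restricted:
 fixes Om :: "'a::euclidean_space set"
 assumes "open Om" "lp_le (density lborel (indicator Om)) p f N" "f \<in> bmb" "!!x. x \<notin> Om ==> f x = 0"
 shows "lp_le lborel p f N"
proof -
 have "Om \<in> sets borel" using assms(1) by simp
 then have "(\<integral>\<^sup>+x. ennreal (f x powr p) \<partial>density lborel (indicator Om)) = (NNI x. indicator Om x * ennreal (f x powr p))"
  using assms(3) by (intro nn_integral_density) auto
 also have "... = (NNI x. ennreal (f x powr p))"
  using assms(4) by (intro nn_integral_cong) (auto simp: indicator_def)
 finally show ?thesis using assms(2) by (simp add: lp_le_def)
qed

text \<open>A ring integrates along individual rays, but over all directions together it is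
  dominated by a potential, and this does not see the null set where \<open>F\<close> is
  infinite.\<close>

lemma ring_enn2real:
 fixes x :: "'a::euclidean_space" and F :: "'a => ennreal"
 assumes U: "open U" and F [measurable]: "F \<in> bmb"
  and ex: "!!th. th \<in> annulus ==> exits U x th" and fin: "AE y in lborel. F y < \<infinity>"
 shows "ring U F x <= ring U (%y. ennreal (enn2real (F y))) x"
proof -
 let ?I = "%y. if F y < \<infinity> then 0 else (\<infinity> :: ennreal)"
 have mI: "?I \<in> bmb" by measurable
 have mR: "(%y. ennreal (enn2real (F y))) \<in> bmb" by measurable
 have "ring U F x <= ring U (%y. ennreal (enn2real (F y)) + ?I y) x"
  using ex by (intro ring_mono) (auto simp: less_top[symmetric])
 also have "... = ring U (%y. ennreal (enn2real (F y))) x + ring U ?I x" by (rule ring_add[OF U mR mI])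
 also have "ring U ?I x <= (NNI y. ?I y * rker (real DIM('a) - 1) x y)" by (rule ring_le_potential[OF U mI ex])
 also have "... = (\<integral>\<^sup>+y. 0 \<partial>(lborel :: 'a measure))"
  by (rule nn_integral_cong_AE) (use fin in eventually_elim, simp)
 finally show ?thesis by (simp add: add_left_mono)
qed

section \<open>Uniform bounds for the gradient and Hessian terms\<close>

lemma hitR_measurable:
 assumes "open Om" "g \<in> bmb"
 shows "hitR Om g \<in> bmb"
proof -
 have "hitT Om (%z. ennreal (g z)) \<in> bmb"
  by (rule hitT_measurable[OF assms(1)]) (use assms(2) in measurable)
 moreover have "Om \<in> sets borel" using assms(1) by simp
 ultimately show ?thesis unfolding hitR_def[abs_def] by measurable
qed

lemma ring_hitT_le:
 fixes Om :: "'a::euclidean_space set"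
 assumes n: "2 <= DIM('a)" and Om: "open Om" "emeasure lborel Om < \<infinity>"
  and fin: "finite_measure (bdm Om)"
  and g [measurable]: "g \<in> bmb"
  and gi: "(\<integral>\<^sup>+y. ennreal (g y) \<partial>bdm Om) < \<infinity>"
 shows "ring (inner_part Om m) (hitT Om (%z. ennreal (g z))) x <= ring (inner_part Om m) (%y. ennreal (hitR Om g y)) x"
proof -
 let ?T = "hitT Om (%z. ennreal (g z))" and ?U = "inner_part Om m"
 have mT [measurable]: "?T \<in> bmb" by (rule hitT_measurable[OF Om(1)]) measurable
 have mO [measurable]: "Om \<in> sets borel" using Om(1) by simp
 let ?F = "%y. if y \<in> Om then ?T y else 0"
 have Uo: "open ?U" by (rule inner_part_open[OF Om(1)])
 have "AE y in density lborel (indicator Om). y \<in> Om --> ?T y < \<infinity>"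
  by (rule hitT_finite_AE[OF n ahlfors_restricted[OF Om] _ Om(1) fin _ gi]) auto
 then have "AE y in lborel. 0 < (indicator Om y :: ennreal) --> y \<in> Om --> ?T y < \<infinity>"
  by (subst (asm) AE_density) auto
 then have AE: "AE y in lborel. ?F y < \<infinity>" by eventually_elim (auto simp: indicator_def)
 have "ring ?U ?T x <= ring ?U ?F x"
  using inner_part_subset[of Om m] by (intro ring_mono inner_part_exits) auto
 also have "... <= ring ?U (%y. ennreal (enn2real (?F y))) x"
  by (rule ring_enn2real[OF Uo _ inner_part_exits AE]) measurable
 also have "(%y. ennreal (enn2real (?F y))) = (%y. ennreal (hitR Om g y))" by (auto simp: hitR_def)
 finally show ?thesis .
qed

text \<open>The endpoint estimate. On the last half of a ray with exit time \<open>e\<close>, either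
  \<open>q <= 2/e\<close>, which integrates to at most 1 there, or \<open>q * t >= 1\<close>, and
  then \<open>q <= q^n * t^(n-1)\<close>. By polar coordinates the latter is bounded by the integral
  of \<open>q^n\<close>, since the weight \<open>t^(n-1)\<close> cancels the kernel.\<close>

lemma ring_normalised:
 fixes q :: "'a::euclidean_space => real"
 assumes U: "open U" and ex: "!!th. th \<in> annulus ==> exits U x th"
  and q [measurable]: "q \<in> bmb" and q0: "!!y. 0 <= q y"
  and q1: "(NNI y. ennreal (q y powr real DIM('a))) <= 1"
 shows "ring U (%y. ennreal (q y)) x <= ennreal (1 + unit_ball_vol DIM('a))"
proof -
 let ?n = "real DIM('a)"
 let ?A = "%th. \<integral>\<^sup>+t. ennreal (q (x + t *\<^sub>R th) powr ?n) * ennreal (t powr (?n - 1)) * indicator {0<..} t \<partial>lborel"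
 have "ring U (%y. ennreal (q y)) x <= (NNI th. ?A th * iann th + iann th)"
  unfolding ring_def
 proof (rule nn_integral_mono)
  fix th :: 'a
  show "(NNI t. (if in_shell U x th t then ennreal (q (x + t *\<^sub>R th)) else 0)) * iann th
    <= ?A th * iann th + iann th"
  proof (cases "th \<in> annulus")
   case True
   define e where "e = exit_time U x th"
   have e0: "0 <= e" using exit_time_nonneg[OF ex[OF True]] by (simp add: e_def)
   have "(NNI t. (if e / 2 < t & t < e then ennreal (q (x + t *\<^sub>R th)) else 0))
    <= (NNI t. ennreal (q (x + t *\<^sub>R th) powr ?n) * ennreal (t powr (?n - 1)) * indicator {0<..} t + ennreal (2/e) * indicator {e/2..e} t)"
   proof (rule nn_integral_mono)
    fix t :: real
    let ?q = "q (x + t *\<^sub>R th)"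
    show "(if e / 2 < t & t < e then ennreal ?q else 0)
     <= ennreal (?q powr ?n) * ennreal (t powr (?n - 1)) * indicator {0<..} t + ennreal (2/e) * indicator {e/2..e} t"
    proof (cases "e / 2 < t & t < e")
     case T: True
     then have t: "0 < t" "0 < e" using e0 by auto
     have "?q <= ?q powr ?n * t powr (?n - 1) + 2/e"
     proof (cases "?q <= 2/e")
      case True
      then show ?thesis by (simp add: add_increasing)
     next
      case False
      have "1/t <= 2/e" using T t by (simp add: field_simps)
      then have "1/t <= ?q" using False by linarith
      then have "1 <= ?q * t" using t by (simp add: pos_divide_le_eq)
      then have "1 <= (?q * t) powr (?n - 1)" by (intro ge_one_powr_ge_zero) auto
      then have "?q * 1 <= ?q * (?q * t) powr (?n - 1)" by (intro mult_left_mono q0)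
      also have "... = (?q powr 1 * ?q powr (?n - 1)) * t powr (?n - 1)" using q0 by (simp add: powr_mult)
      also have "... = ?q powr ?n * t powr (?n - 1)" by (simp only: powr_add[symmetric]) simp
      finally show ?thesis using t by (simp add: add_increasing2)
     qed
     then have "ennreal ?q <= ennreal (?q powr ?n * t powr (?n - 1) + 2/e)" by (rule ennreal_leI)
     also have "... = ennreal (?q powr ?n) * ennreal (t powr (?n - 1)) + ennreal (2/e)"
      using t by (simp add: ennreal_mult')
     finally show ?thesis using T t by simp
    next
     case False
     then show ?thesis by (simp only: if_False zero_le)
    qed
   qed
   also have "... = ?A th + ennreal (2/e) * emeasure lborel {e/2..e}"
    by (subst nn_integral_add) (auto simp: nn_integral_cmult_indicator)
   also have "ennreal (2/e) * emeasure lborel {e/2..e} <= 1"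
    using e0 by (cases "e = 0") (auto simp: ennreal_mult'[symmetric])
   finally show ?thesis using True by (simp add: e_def add_left_mono)
  qed simp
 qed
 also have "... = (NNI th. ?A th * iann th) + emeasure lborel (annulus :: 'a set)"
  by (subst nn_integral_add) (auto intro!: borel_measurable_times_ennreal)
 also have "... <= (NNI y. ennreal (q y powr ?n) * rker (?n - 1 - (?n - 1)) x y) + ennreal (unit_ball_vol DIM('a))"
  by (intro add_mono emeasure_annulus polar_annulus) auto
 also have "(NNI y. ennreal (q y powr ?n) * rker (?n - 1 - (?n - 1)) x y) <= (NNI y. ennreal (q y powr ?n) * 1)"
  by (intro nn_integral_mono mult_left_mono) (auto simp: rker_def)
 also have "... <= 1" using q1 by simp
 also have "1 + ennreal (unit_ball_vol DIM('a)) = ennreal (1 + unit_ball_vol DIM('a))" by simp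
 finally show ?thesis by (simp add: add_right_mono)
qed

lemma ring_lp:
 fixes q :: "'a::euclidean_space => real"
 assumes U: "open U" and ex: "!!th. th \<in> annulus ==> exits U x th"
  and q [measurable]: "q \<in> bmb" and q0: "!!y. 0 <= q y"
  and A: "0 < A" "lp_le lborel (real DIM('a)) q A"
 shows "ring U (%y. ennreal (q y)) x <= ennreal ((1 + unit_ball_vol DIM('a)) * A)"
proof -
 have "ring U (%y. ennreal (q y)) x = ring U (%y. ennreal A * ennreal (q y / A)) x"
  using A by (simp add: ennreal_mult'[symmetric])
 also have "... = ennreal A * ring U (%y. ennreal (q y / A)) x"
  by (rule ring_cmult[OF U]) measurable
 also have "... <= ennreal A * ennreal (1 + unit_ball_vol DIM('a))"
  using A q0 lp_le_normalise[OF A(2) _ A(1)] by (intro mult_left_mono ring_normalised U ex) auto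
 also have "... = ennreal ((1 + unit_ball_vol DIM('a)) * A)" using A by (subst ennreal_mult'[symmetric]) (auto simp: mult.commute)
 finally show ?thesis .
qed

lemma ring_hitT_pot:
 fixes Om :: "'a::euclidean_space set"
 assumes n: "2 <= DIM('a)" and Om: "open Om" "emeasure lborel Om < \<infinity>"
  and fin: "finite_measure (bdm Om)"
  and g [measurable]: "g \<in> bmb"
  and gi: "(\<integral>\<^sup>+y. ennreal (g y) \<partial>bdm Om) < \<infinity>"
 shows "ring (inner_part Om m) (hitT Om (%z. ennreal (g z))) x <= pot (real DIM('a) - 1) (hitR Om g) x"
proof -
 have mG [measurable]: "hitR Om g \<in> bmb" by (rule hitR_measurable[OF Om(1) g])
 have a: "ring (inner_part Om m) (%y. ennreal (hitR Om g y)) x <= (NNI y. ennreal (hitR Om g y) * rker (real DIM('a) - 1) x y)"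
  by (rule ring_le_potential[OF inner_part_open[OF Om(1)] _ inner_part_exits]) measurable
 from order.trans[OF ring_hitT_le[OF n Om fin g gi] a] show ?thesis by (simp add: pot_def mult.commute)
qed

definition ring_const :: "'a::euclidean_space itself => real => bool" where
 "ring_const (T :: 'a itself)  K \<longleftrightarrow> (ALL (Om :: 'a set) s g N m x. open Om --> emeasure lborel Om < \<infinity> -->
   finite_measure (bdm Om) --> real DIM('a) - 1 < s -->
   g \<in> bmb --> (ALL y. 0 <= g y) --> 0 < N --> lp_le (bdm Om) s g N -->
   ring (inner_part Om m) (hitT Om (%z. ennreal (g z))) x <=
    ennreal (K * (measure (bdm Om) UNIV powr (1/(real DIM('a) - 1) - 1/s) * N)))"

text \<open>The exponent \<open>s\<close> is first lowered to \<open>n-1\<close>, which produces the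
  power of the boundary measure. Then \<open>hit_lp\<close> leads from L^(n-1) of the boundary to
  L^n of the domain, and \<open>ring_lp\<close> from there to a uniform bound. As \<open>s\<close>
  enters through the embedding only, \<open>K\<close> is independent of \<open>s\<close>. For
  \<open>hit_lp\<close> the exponent \<open>n-1\<close> must exceed 1, which holds in dimension at
  least 3.\<close>

lemma ring_hitT_bound:
 assumes n: "3 <= DIM('a::euclidean_space)"
 shows "EX K>0. ring_const TYPE('a)  K"
proof -
 let ?d = "real DIM('a) - 1" and ?V = "unit_ball_vol (real DIM('a))"
 have d: "2 <= ?d" using n by linarith
 have nn: "2 <= DIM('a)" "1 < ?d" "?d < real DIM('a)" "0 < ?V" using n by auto
 obtain K where K: "0 < K" and H: "hit_const TYPE('a) ?d (real DIM('a)) ?V K"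
  using hit_lp[OF nn] by blast
 define K' where "K' = (1 + ?V) * (K * 2 powr (1/?d))"
 show ?thesis unfolding ring_const_def
 proof (intro exI[of _ K'] conjI allI impI)
  show "0 < K'" using K by (simp add: K'_def add_pos_pos)
  fix Om :: "'a set" and s N :: real and g :: "'a => real" and m x
  assume Om: "open Om" "emeasure lborel Om < \<infinity>" and fin: "finite_measure (hmeas ?d (frontier Om))"
   and s: "?d < s" and g: "g \<in> bmb" "ALL y. 0 <= g y" and N: "0 < N" and gN: "lp_le (hmeas ?d (frontier Om)) s g N"
  let ?H = "hmeas ?d (frontier Om)"
  interpret H: finite_measure ?H by (rule fin)
  define A where "A = measure ?H UNIV powr (1/?d - 1/s) * N"
  note g(1) [measurable]
  have n2: "2 <= DIM('a)" using n by simp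
  have Hf: "emeasure ?H UNIV < \<infinity>" using H.emeasure_finite[of UNIV] by (simp add: less_top[symmetric])
  have gi: "(\<integral>\<^sup>+y. ennreal (g y) \<partial>?H) < \<infinity>"
   by (rule lp_le_integrable(2)[OF gN _ _ _ _ Hf]) (use g d s in auto)
  show "ring (inner_part Om m) (hitT Om (%z. ennreal (g z))) x <= ennreal (K' * (measure ?H UNIV powr (1/?d - 1/s) * N))"
  \<comment> \<open>If the boundary has measure 0, the right side is 0 because \<open>0 powr\<close>
    is 0, so the ring has to vanish exactly.\<close>
  proof (cases "measure ?H UNIV = 0")
   case True
   then have "emeasure ?H UNIV = 0" by (simp add: H.emeasure_eq_measure)
   then have AEf: "AE z in ?H. False" by (intro AE_I[of _ _ UNIV]) auto
   have T0: "hitT Om (%z. ennreal (g z)) y <= 0" if "y \<in> Om" for y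
   proof -
    have "(\<integral>\<^sup>+z. rker ?d y z * ennreal (g z) \<partial>?H) = (\<integral>\<^sup>+z. 0 \<partial>?H)"
     by (rule nn_integral_cong_AE) (use AEf in eventually_elim, simp)
    then show ?thesis using hitT_le[OF n2 Om(1) that, of "%z. ennreal (g z)"] by simp
   qed
   have "ring (inner_part Om m) (hitT Om (%z. ennreal (g z))) x <= ring (inner_part Om m) (%_. 0 * 0) x"
    using inner_part_subset[of Om m] T0 by (intro ring_mono inner_part_exits) auto
   also have "... = 0 * ring (inner_part Om m) (%_. 0) x" by (rule ring_cmult[OF inner_part_open[OF Om(1)]]) simp
   finally show ?thesis by simp
  next
   case False
   then have Hp: "0 < measure ?H UNIV" by (simp add: zero_less_measure_iff)
   then have A: "0 < A" using N by (simp add: A_def)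
   have "lp_le ?H ?d g (2 powr (1/?d) * (N * measure ?H (space ?H) powr (1/?d - 1/s)))"
    by (rule lp_le_finite_measure[OF gN _ _ fin]) (use g d s N in auto)
   then have "lp_le ?H ?d g (2 powr (1/?d) * A)" by (simp add: A_def mult.commute)
   from H[unfolded hit_const_def, rule_format, OF ahlfors_restricted[OF Om] Om(1) fin g(1) g(2)[rule_format] _ this] A
   have "lp_le (density lborel (indicator Om)) (?d * real DIM('a) / ?d) (hitR Om g) (K * (2 powr (1/?d) * A))"
    by simp
   moreover have "?d * real DIM('a) / ?d = real DIM('a)" using d by simp
   ultimately have "lp_le (density lborel (indicator Om)) (real DIM('a)) (hitR Om g) (K * (2 powr (1/?d) * A))" by simp
   then have L: "lp_le lborel (real DIM('a)) (hitR Om g) (K * (2 powr (1/?d) * A))"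
    by (rule lp_le_restricted[OF Om(1)]) (auto intro: hitR_measurable[OF Om(1) g(1)] simp: hitR_def)
   have "ring (inner_part Om m) (%y. ennreal (hitR Om g y)) x <= ennreal ((1 + ?V) * (K * (2 powr (1/?d) * A)))"
    by (rule ring_lp[OF inner_part_open[OF Om(1)] inner_part_exits hitR_measurable[OF Om(1) g(1)] _ _ L])
     (use K A in \<open>auto simp: hitR_def\<close>)
   then show ?thesis
    by (intro order.trans[OF ring_hitT_le[OF n2 Om fin g(1) gi]]) (simp add: K'_def A_def mult_ac)
  qed
 qed
qed

definition pot_const :: "'a::euclidean_space itself => real => real => bool" where
 "pot_const (T :: 'a itself) (p :: real) K \<longleftrightarrow> (ALL (Om :: 'a set) h N x. open Om --> Om ~= {} --> emeasure lborel Om < \<infinity> -->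
   h \<in> bmb --> (ALL y. 0 <= h y) --> (ALL y. y \<notin> Om --> h y = 0) --> 0 < N --> lp_le lborel p h N -->
   pot (real DIM('a) - 2) h x <= ennreal (K * (measure lborel Om powr (2/real DIM('a) - 1/p) * N)))"

text \<open>The condition \<open>p > n/2\<close> means \<open>(n-2) * p' < n\<close> for the dual
  exponent, so Hoelder's inequality applies over a set of finite volume. The power of the volume
  comes from \<open>rker_set\<close>.\<close>

lemma pot_bound:
 assumes n: "3 <= DIM('a::euclidean_space)" and p: "real DIM('a) / 2 < p"
 shows "EX K>0. pot_const TYPE('a) p K"
proof -
 define n where "n = real DIM('a)"
 define V where "V = unit_ball_vol (real DIM('a))"
 define p' where "p' = p/(p-1)"
 define b where "b = (n-2)*p'"
 have n3: "3 <= n" using n by (simp add: n_def)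
 have p1: "1 < p" using p n3 by (simp add: n_def)
 have p': "0 < p'" using p1 by (simp add: p'_def)
 have b: "0 <= b" "b < n"
 proof -
  have "(n-2)*p < n*(p-1)" using p by (simp add: n_def algebra_simps)
  then show "b < n" using p1 by (simp add: b_def p'_def pos_divide_less_eq)
  show "0 <= b" using n3 p' by (simp add: b_def)
 qed
 define c where "c = set_const n b V"
 have c: "0 < c" unfolding c_def by (rule set_const_pos[OF b(2)]) (simp add: V_def)
 show ?thesis unfolding pot_const_def
 proof (intro exI[of _ "2 * c powr (1/p')"] conjI allI impI)
  show "0 < 2 * c powr (1/p')" using c by simp
  fix Om :: "'a set" and h :: "'a => real" and N :: real and x :: 'a
  assume Om: "open Om" "Om ~= {}" "emeasure lborel Om < \<infinity>" and h [measurable]: "h \<in> bmb"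
   and h0: "ALL y. 0 <= h y" "ALL y. y \<notin> Om --> h y = 0" and N: "0 < N" and hN: "lp_le lborel p h N"
  have mO [measurable]: "Om \<in> sets borel" using Om(1) by simp
  define L where "L = measure lborel Om"
  have eL: "emeasure lborel Om = ennreal L" using Om(3) by (simp add: L_def emeasure_eq_ennreal_measure less_top)
  have L: "0 < L"
   using open_not_negligible[OF Om(1,2)] eL by (auto simp: L_def zero_less_measure_iff negligible_iff_null_sets null_sets_def)
  let ?k = "%y. if y \<in> Om then dist y x powr (-(n-2)) else 0"
  have "pot (n-2) h x = (NNI y. ennreal N * ennreal (?k y * (h y / N)))"
   unfolding pot_def
  proof (intro nn_integral_cong)
   fix y
   have "N * (dist y x powr (-(n-2)) * (h y / N)) = dist y x powr (-(n-2)) * h y" using N by simp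
   then have "ennreal N * ennreal (dist y x powr (-(n-2)) * (h y / N)) = ennreal (dist y x powr (-(n-2))) * ennreal (h y)"
    using N by (metis ennreal_mult' less_imp_le powr_ge_zero)
   then show "rker (n-2) x y * ennreal (h y) = ennreal N * ennreal (?k y * (h y / N))"
    using h0(2) by (auto simp: rker_def dist_commute)
  qed
  also have "... = ennreal N * (NNI y. ennreal (?k y * (h y / N)))"
   by (rule nn_integral_cmult) measurable
  also have "(NNI y. ennreal (?k y * (h y / N))) <= ennreal (2 * (c * L powr (1-b/n)) powr (1/p'))"
  proof (rule nn_holder_le[OF p1 p'_def])
   have "(NNI y. ennreal (?k y powr p')) = (NNI y. rker b y x * indicator Om y)"
   proof (intro nn_integral_cong)
    fix y
    have "(dist y x powr (-(n-2))) powr p' = dist y x powr (-b)" by (simp only: powr_powr mult_minus_left b_def)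
    then show "ennreal (?k y powr p') = rker b y x * indicator Om y" by (auto simp: rker_def)
   qed
   also have "... <= ennreal (set_const n b V * measure lborel Om powr (1-b/n))"
    unfolding n_def V_def by (rule rker_set[OF ahlfors_lborel]) (use b Om mO in \<open>auto simp: n_def\<close>)
   finally show "(NNI y. ennreal (?k y powr p')) <= ennreal (c * L powr (1-b/n))" by (simp only: c_def L_def)
   show "(NNI y. ennreal ((h y / N) powr p)) <= 1" by (rule lp_le_normalise[OF hN _ N]) simp
   show "0 < c * L powr (1-b/n)" using c L by simp
  qed (use h0 N in auto)
  also have "(c * L powr (1-b/n)) powr (1/p') = c powr (1/p') * L powr (2/n-1/p)"
  proof -
   have "1/p' = 1 - 1/p" using p1 by (simp add: p'_def diff_divide_distrib)
   moreover have "b/n*(1/p') = (n-2)/n" unfolding b_def using p' by simp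
   then have "(1-b/n)*(1/p') = 1/p' - (n-2)/n" by (simp only: left_diff_distrib mult_1_left)
   moreover have "(n-2)/n = 1-2/n" using n3 by (simp add: diff_divide_distrib)
   ultimately have "(1-b/n)*(1/p') = 2/n-1/p" by linarith
   then show ?thesis by (simp only: powr_mult powr_powr)
  qed
  also have "ennreal N * ennreal (2 * (c powr (1/p') * L powr (2/n-1/p))) = ennreal (2 * c powr (1/p') * (L powr (2/n-1/p) * N))"
   using N by (simp add: ennreal_mult'[symmetric] mult_ac)
  finally show "pot (real DIM('a) - 2) h x <= ennreal (2 * c powr (1/p') * (measure lborel Om powr (2/real DIM('a) - 1/p) * N))"
   by (simp add: n_def L_def mult_left_mono)
 qed
qed

lemma emeasure_annulus_pos: "EX a>0. emeasure lborel (annulus :: 'a::euclidean_space set) = ennreal a"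
proof -
 obtain e :: 'a where e: "e \<in> Basis" using nonempty_Basis by blast
 let ?c = "(3/4) *\<^sub>R e"
 have sub: "ball ?c (1/4) \<subseteq> annulus"
 proof
  fix y assume "y \<in> ball ?c (1/4)"
  then have "norm (?c - y) < 1/4" by (simp add: dist_norm)
  moreover have "norm ?c = 3/4" using e by simp
  ultimately show "y \<in> annulus" using norm_triangle_ineq2[of ?c y] norm_triangle_ineq3[of ?c y] by (auto simp: annulus_def)
 qed
 have "0 < emeasure lborel (ball ?c (1/4))" by (subst emeasure_ball) (auto simp: ennreal_zero_less_mult_iff)
 also have "... <= emeasure lborel (annulus :: 'a set)" using sub by (intro emeasure_mono) auto
 finally have p: "0 < emeasure lborel (annulus :: 'a set)" .
 have fin: "emeasure lborel (annulus :: 'a set) < \<infinity>" by (rule le_less_trans[OF emeasure_annulus]) simp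
 show ?thesis using p fin by (cases "emeasure lborel (annulus :: 'a set)") auto
qed

section \<open>Borel representatives and the interior estimate\<close>

lemma hess_norm_measurable:
 fixes Om :: "'a::euclidean_space set"
 assumes Om: "open Om" and w: "weak_hessian Om u Hs"
 shows "(%x. if x \<in> Om then hess_norm Hs x else 0) \<in> borel_measurable lebesgue"
proof -
 \<comment> \<open>Local integrability gives measurability of the entries on compact subsets of the
   domain; a compact exhaustion extends it to the whole domain.\<close>
 obtain C :: "nat => 'a set" where C: "!!n. compact (C n)" "!!n. C n \<subseteq> Om" "!!n. C n \<subseteq> interior (C (Suc n))" "\<Union>(range C) = Om"
  using open_Union_compact_subsets[OF Om] by metis
 have loc: "loc_int Om (Hs i j)" if "i \<in> Basis" "j \<in> Basis" for i j
  using w that by (auto simp: weak_hessian_def weak_deriv_def)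
 have CS: "C n \<in> sets lebesgue" for n using C(1) by (simp add: lmeasurable_compact fmeasurableD)
 have m1: "(%x. if x \<in> Om then Hs i j x else 0) \<in> borel_measurable lebesgue" if ij: "i \<in> Basis" "j \<in> Basis" for i j
 proof (rule borel_measurable_LIMSEQ_real)
  show "(%x. if x \<in> C n then Hs i j x else 0) \<in> borel_measurable lebesgue" for n
  proof (rule borel_measurable_if_I[OF _ CS])
   have "Hs i j absolutely_integrable_on C n" using loc[OF ij] C(1,2) by (auto simp: loc_int_def)
   then show "Hs i j \<in> borel_measurable (lebesgue_on (C n))" by (rule absolutely_integrable_measurable[THEN iffD1, THEN conjunct1, rotated]) (rule CS)
  qed
  fix x
  show "(%n. if x \<in> C n then Hs i j x else 0) \<longlonglongrightarrow> (if x \<in> Om then Hs i j x else 0)"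
  proof (cases "x \<in> Om")
   case True
   then obtain N where N: "x \<in> C N" using C(4) by auto
   have mono: "C n \<subseteq> C (Suc n)" for n using C(3)[of n] interior_subset by blast
   have "x \<in> C n" if "N <= n" for n using N lift_Suc_mono_le[of C, OF mono that] by blast
   then have "\<forall>\<^sub>F n in sequentially. (if x \<in> C n then Hs i j x else 0) = (if x \<in> Om then Hs i j x else 0)"
    using True by (auto simp: eventually_sequentially)
   then show ?thesis by (rule tendsto_eventually)
  next
   case False
   then have "x \<notin> C n" for n using C(2) by blast
   then show ?thesis using False by simp
  qed
 qed
 have "(%x. sqrt (\<Sum>i\<in>Basis. \<Sum>j\<in>Basis. (if x \<in> Om then Hs i j x else 0)\<^sup>2)) \<in> borel_measurable lebesgue"
  by (intro measurable_compose[OF _ borel_measurable_sqrt] borel_measurable_sum borel_measurable_power m1)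
 also have "(%x. sqrt (\<Sum>i\<in>Basis. \<Sum>j\<in>Basis. (if x \<in> Om then Hs i j x else 0)\<^sup>2)) = (%x. if x \<in> Om then hess_norm Hs x else 0)"
  by (auto simp: hess_norm_def)
 finally show ?thesis .
qed

lemma hess_norm_nonneg: "0 <= hess_norm Hs x"
 by (simp add: hess_norm_def sum_nonneg)

text \<open>Weak derivatives live in the completion, while Fubini and polar coordinates are applied
  to Borel functions. A Borel version that agrees almost everywhere inherits the norm
  bounds.\<close>

lemma hess_norm_version:
 fixes Om :: "'a::euclidean_space set"
 assumes Om: "open Om" and w: "weak_hessian Om u Hs"
 shows "EX h. h \<in> bmb & (ALL x. 0 <= h x) & (ALL x. x \<notin> Om --> h x = 0) &
  (AE z in lebesgue. z \<in> Om --> hess_norm Hs z <= h z) &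
  (ALL p N. lp_le (lebesgue_on Om) p (%x. \<bar>hess_norm Hs x\<bar>) N --> lp_le lborel p h N)"
proof -
 let ?f = "%x. if x \<in> Om then hess_norm Hs x else 0"
 obtain f' where f': "f' \<in> borel_measurable lborel" "AE x in lborel. ?f x = f' x"
  using completion_ex_borel_measurable_real[OF hess_norm_measurable[OF Om w]] by auto
 define h where "h x = (if x \<in> Om then max 0 (f' x) else 0)" for x
 have mO: "Om \<in> sets borel" using Om by simp
 have mh: "h \<in> bmb" unfolding h_def using f'(1) mO by measurable
 have ae: "AE x in lborel. h x = ?f x"
  using f'(2)
 proof eventually_elim
  case (elim x)
  then show ?case using hess_norm_nonneg[of Hs x] by (auto simp: h_def max_def split: if_splits)
 qed
 have "AE z in lborel. z \<in> Om --> hess_norm Hs z <= h z" using ae by eventually_elim auto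
 then have a: "AE z in lebesgue. z \<in> Om --> hess_norm Hs z <= h z" by (rule AE_completion)
 have l: "lp_le lborel p h N" if "lp_le (lebesgue_on Om) p (%x. \<bar>hess_norm Hs x\<bar>) N" for p N
 proof -
  have "(NNI x. ennreal (h x powr p)) = (NNI x. ennreal (\<bar>hess_norm Hs x\<bar> powr p) * indicator Om x)"
   by (rule nn_integral_cong_AE) (use ae in eventually_elim, auto simp: hess_norm_nonneg)
  also have "... = (\<integral>\<^sup>+x. ennreal (\<bar>hess_norm Hs x\<bar> powr p) * indicator Om x \<partial>lebesgue)"
   by (rule nn_integral_completion[symmetric])
  also have "... = (\<integral>\<^sup>+x. ennreal (\<bar>hess_norm Hs x\<bar> powr p) \<partial>lebesgue_on Om)"
   using mO by (subst nn_integral_restrict_space) auto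
  finally show ?thesis using that by (simp add: lp_le_def)
 qed
 show ?thesis by (rule exI[of _ h]) (use mh a l in \<open>auto simp: h_def\<close>)
qed

lemma emeasure_hmeas_bdry:
 fixes X :: "'a::euclidean_space set"
 assumes "X \<in> sets borel" "A \<in> sets borel" "A \<subseteq> X"
 shows "emeasure (hmeas d X) A = emeasure (hausdorff_measure d X) A" "emeasure (hmeas d X) UNIV = emeasure (hausdorff_measure d X) X"
 using assms by (auto simp: emeasure_hmeas emeasure_hausdorff_measure Int_absorb2)

lemma nn_integral_hmeas_eq:
 assumes "f \<in> bmb" "!!x. x \<in> X ==> f x = f' x"
 shows "(\<integral>\<^sup>+x. f x \<partial>hmeas d X) = (\<integral>\<^sup>+x. f' x \<partial>hausdorff_measure d X)"
 unfolding nn_integral_hmeas[OF assms(1)] by (intro nn_integral_cong) (simp add: assms(2))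

text \<open>An upper gradient is given on the boundary only and may be negative somewhere. Its
  absolute value satisfies the same inequality and has the same norm, and extending it by 0 makes it
  Borel on the whole space.\<close>

lemma hajlasz_version:
 fixes Om :: "'a::euclidean_space set"
 assumes "hajlasz_ug (hausdorff_measure d F) u g" and F: "closed F"
 obtains ga N where "ga \<in> bmb" "!!z. 0 <= ga z" "!!z. z \<in> F ==> ga z = \<bar>g z\<bar>" "N \<in> null_sets (hmeas d F)"
  "!!x z. x \<in> F - N ==> z \<in> F - N ==> \<bar>u x - u z\<bar> <= dist x z * (ga x + ga z)"
proof -
 let ?B = "hausdorff_measure d F"
 have FB: "F \<in> sets borel" using F by simp
 obtain N where N: "N \<in> null_sets ?B" and hj: "!!x y. x \<in> F - N ==> y \<in> F - N ==> \<bar>u x - u y\<bar> <= dist x y * (g x + g y)"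
  and g: "g \<in> borel_measurable ?B"
  using assms(1) by (auto simp: hajlasz_ug_def)
 have "g \<in> borel_measurable (restrict_space borel F)" using g measurable_cong_sets[OF sets_hausdorff_measure refl] by blast
 then have m: "(%x. indicator F x *\<^sub>R g x) \<in> bmb"
  using FB by (subst (asm) borel_measurable_restrict_space_iff) auto
 define ga where "ga z = \<bar>indicator F z *\<^sub>R g z\<bar>" for z
 have mga: "ga \<in> bmb" unfolding ga_def[abs_def] by (rule borel_measurable_abs[OF m])
 have eq: "ga z = \<bar>g z\<bar>" if "z \<in> F" for z using that by (simp add: ga_def)
 have "N \<in> sets (restrict_space borel F)" using N by auto
 then have NB: "N \<in> sets borel" "N \<subseteq> F" using FB by (auto simp: sets_restrict_space_iff)
 have N': "N \<in> null_sets (hmeas d F)" using N NB emeasure_hmeas_bdry(1)[OF FB NB, of d] by (auto simp: null_sets_def)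
 have hj': "\<bar>u x - u z\<bar> <= dist x z * (ga x + ga z)" if "x \<in> F - N" "z \<in> F - N" for x z
 proof -
  have "dist x z * (g x + g z) <= dist x z * (ga x + ga z)" using that by (intro mult_left_mono add_mono) (auto simp: eq)
  then show ?thesis using hj[OF that] by linarith
 qed
 show ?thesis by (rule that[OF mga _ eq N' hj']) (auto simp: ga_def)
qed

text \<open>One constant, fixed by the dimension, absorbs the volume of the annulus and all
  geometric factors. \<open>v\<close>, \<open>h\<close> and \<open>ga\<close> are the Borel
  representatives of the function, of the Hessian norm and of the upper gradient.\<close>

lemma interior_estimate:
 assumes n: "3 <= DIM('a::euclidean_space)"
 shows "EX c>0. ALL (Om :: 'a set) u Hs g. admissible_domain Om --> Cb_closure Om u --> weak_hessian Om u Hs -->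
   hajlasz_ug (bdry_meas Om) u g -->
   (EX v h ga. v \<in> bmb & (EX B. ALL x. \<bar>v x\<bar> <= B) & (ALL y:closure Om. v y = u y) &
    h \<in> bmb & (ALL x. 0 <= h x) & (ALL x. x \<notin> Om --> h x = 0) &
    (ALL p N. lp_le (lebesgue_on Om) p (%x. \<bar>hess_norm Hs x\<bar>) N --> lp_le lborel p h N) &
    ga \<in> bmb & (ALL z. 0 <= ga z) & (ALL z:frontier Om. ga z = \<bar>g z\<bar>) &
    (ALL x J. x \<in> Om --> (ALL m. x \<in> inner_part Om m --> ring (inner_part Om m) (hitT Om (%z. ennreal (ga z))) x <= J) -->
     ennreal \<bar>v x\<bar> <= ennreal c * (hitT Om (%z. ennreal \<bar>v z\<bar>) x + J + pot (real DIM('a) - 2) h x)))"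
proof -
 obtain K where K: "0 < K" and mo: "!!(Om :: 'a set) u Hs h de. open Om ==> emeasure lborel Om < \<infinity> ==> Cb_closure Om u ==>
   weak_hessian Om u Hs ==> h \<in> bmb ==> (ALL z. 0 <= h z) ==>
   (AE z in lebesgue. z \<in> Om --> hess_norm Hs z <= h z) ==> 0 < de ==> (EX w D H. mollified Om u h K de w D H)"
  using mollification[where 'a='a] by blast
 obtain a where a: "0 < a" "emeasure lborel (annulus :: 'a set) = ennreal a" using emeasure_annulus_pos by blast
 define c1 where "c1 = 2 * \<bar>3 / slope_const DIM('a)\<bar>"
 define c2 where "c2 = stage_const DIM('a) K"
 have c: "0 <= c1" "0 <= c2" using stage_const_nonneg[of "DIM('a)" K] n K by (auto simp: c1_def c2_def)
 define c0 where "c0 = 1 + c1 + c2"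
 show ?thesis
 proof (intro exI[of _ "c0 / a"] conjI allI impI)
  show "0 < c0 / a" using a c by (simp add: c0_def)
  fix Om :: "'a set" and u :: "'a => real" and Hs g
  assume ad: "admissible_domain Om" and u: "Cb_closure Om u" and w: "weak_hessian Om u Hs" and g: "hajlasz_ug (bdry_meas Om) u g"
  have Om: "open Om" "emeasure lborel Om < \<infinity>" using ad by (auto simp: admissible_domain_def)
  obtain h where h: "h \<in> bmb" "ALL x. 0 <= h x" "ALL x. x \<notin> Om --> h x = 0"
   "AE z in lebesgue. z \<in> Om --> hess_norm Hs z <= h z"
   "ALL p N. lp_le (lebesgue_on Om) p (%x. \<bar>hess_norm Hs x\<bar>) N --> lp_le lborel p h N"
   using hess_norm_version[OF Om(1) w] by (elim exE conjE)
  obtain ga N where ga: "ga \<in> bmb" "!!z. 0 <= ga z" "!!z. z \<in> frontier Om ==> ga z = \<bar>g z\<bar>"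
   and N: "N \<in> null_sets (bdm Om)"
   and hj: "!!x z. x \<in> frontier Om - N ==> z \<in> frontier Om - N ==> \<bar>u x - u z\<bar> <= dist x z * (ga x + ga z)"
   using hajlasz_version[OF g frontier_closed] by metis
  define v where "v x = indicator (closure Om) x *\<^sub>R u x" for x
  have mv: "v \<in> bmb" unfolding v_def[abs_def]
   by (rule borel_measurable_continuous_on_indicator) (use u in \<open>auto simp: Cb_closure_def\<close>)
  have vu: "v y = u y" if "y \<in> closure Om" for y using that by (simp add: v_def)
  obtain B where B: "0 < B" "!!z. z \<in> closure Om ==> \<bar>u z\<bar> <= B" using Cb_closure_bounded[OF u] by metis
  have vB: "\<bar>v x\<bar> <= B" for x using B by (auto simp: v_def indicator_def)
  have fc: "frontier Om \<subseteq> closure Om" by (auto simp: frontier_def)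
  have hjv: "\<bar>v x - v z\<bar> <= dist x z * (ga x + ga z)" if "x \<in> frontier Om - N" "z \<in> frontier Om - N" for x z
   using hj[OF that] that fc by (simp add: vu subset_iff)
  have est: "ennreal \<bar>v x\<bar> <= ennreal (c0 / a) * (hitT Om (%z. ennreal \<bar>v z\<bar>) x + J + pot (real DIM('a) - 2) h x)"
   if x: "x \<in> Om" and J: "ALL m. x \<in> inner_part Om m --> ring (inner_part Om m) (hitT Om (%z. ennreal (ga z))) x <= J" for x J
  proof -
   let ?T = "hitT Om (%z. ennreal \<bar>v z\<bar>) x" and ?P = "pot (real DIM('a) - 2) h x"
   have "ennreal a * ennreal \<bar>v x\<bar> <= ?T + ennreal (3 / slope_const DIM('a)) * (2 * J) + ennreal c2 * ?P"
    unfolding a(2)[symmetric] c2_def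
    by (rule pointwise_bound[OF n Om u mo[OF Om u w h(1) _ h(4)] _ h(1) mv vu ga(1,2) N hjv x]) (use h K J in auto)
   also have "... <= ennreal c0 * ?T + ennreal c0 * J + ennreal c0 * ?P"
   proof (intro add_mono)
    show "?T <= ennreal c0 * ?T" using mult_right_mono[of 1 "ennreal c0" ?T] c by (simp add: c0_def)
    have "ennreal (3 / slope_const DIM('a)) * (2 * J) = ennreal (3 / slope_const DIM('a)) * ennreal 2 * J" by (simp add: mult.assoc)
    also have "... <= ennreal \<bar>3 / slope_const DIM('a)\<bar> * ennreal 2 * J" by (intro mult_right_mono ennreal_leI abs_ge_self) auto
    also have "ennreal \<bar>3 / slope_const DIM('a)\<bar> * ennreal 2 = ennreal c1"
     unfolding c1_def by (subst ennreal_mult'[symmetric]) (auto simp: mult.commute)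
    also have "ennreal c1 * J <= ennreal c0 * J" using c by (intro mult_right_mono ennreal_leI) (auto simp: c0_def)
    finally show "ennreal (3 / slope_const DIM('a)) * (2 * J) <= ennreal c0 * J" .
    show "ennreal c2 * ?P <= ennreal c0 * ?P" using c by (intro mult_right_mono ennreal_leI) (auto simp: c0_def)
   qed
   also have "... = ennreal c0 * (?T + J + ?P)" by (simp add: distrib_left)
   finally have "ennreal (1/a) * (ennreal a * ennreal \<bar>v x\<bar>) <= ennreal (1/a) * (ennreal c0 * (?T + J + ?P))" by (rule mult_left_mono) simp
   moreover have "ennreal (1/a) * (ennreal a * ennreal \<bar>v x\<bar>) = ennreal \<bar>v x\<bar>" using a by (simp add: ennreal_mult'[symmetric])
   moreover have "ennreal (1/a) * (ennreal c0 * (?T + J + ?P)) = ennreal (c0/a) * (?T + J + ?P)"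
   proof -
    have "ennreal (1/a) * ennreal c0 = ennreal (c0/a)" using a by (simp add: ennreal_mult'[symmetric])
    then show ?thesis by (metis mult.assoc)
   qed
   ultimately show ?thesis by simp
  qed
  show "EX v h ga. v \<in> bmb & (EX B. ALL x. \<bar>v x\<bar> <= B) & (ALL y:closure Om. v y = u y) &
    h \<in> bmb & (ALL x. 0 <= h x) & (ALL x. x \<notin> Om --> h x = 0) &
    (ALL p N. lp_le (lebesgue_on Om) p (%x. \<bar>hess_norm Hs x\<bar>) N --> lp_le lborel p h N) &
    ga \<in> bmb & (ALL z. 0 <= ga z) & (ALL z:frontier Om. ga z = \<bar>g z\<bar>) &
    (ALL x J. x \<in> Om --> (ALL m. x \<in> inner_part Om m --> ring (inner_part Om m) (hitT Om (%z. ennreal (ga z))) x <= J) -->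
     ennreal \<bar>v x\<bar> <= ennreal (c0 / a) * (hitT Om (%z. ennreal \<bar>v z\<bar>) x + J + pot (real DIM('a) - 2) h x))"
   by (rule exI[of _ v], rule exI[of _ h], rule exI[of _ ga]) (use mv vB vu h ga est in blast)
 qed
qed

text \<open>Growth is assumed at centres in the domain only. A ball that meets the domain lies in a
  ball of twice the radius about one of its points, which costs \<open>2 powr al\<close>; a ball
  that misses it has measure 0.\<close>

lemma upper_ahlfors_distr:
 fixes Om :: "'a::euclidean_space set"
 assumes Om: "open Om" and mu: "upper_ahlfors Om mu al C" and al: "0 < al" and C: "0 < C"
 shows "ahlfors (distr mu borel (%x. x)) al (C * 2 powr al)" "finite_measure (distr mu borel (%x. x))"
  "measure (distr mu borel (%x. x)) UNIV = measure mu Om" "AE x in distr mu borel (%x. x). x \<in> Om"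
  "!!(f :: 'a => ennreal) f'. f \<in> bmb ==> (!!x. x \<in> Om ==> f x = f' x) ==>
    (\<integral>\<^sup>+x. f x \<partial>distr mu borel (%x. x)) = (\<integral>\<^sup>+x. f' x \<partial>mu)"
proof -
 let ?M = "distr mu borel (%x. x)"
 have O: "Om \<in> sets borel" using Om by simp
 have s: "sets mu = sets (restrict_space borel Om)" using mu by (simp add: upper_ahlfors_def)
 have sp: "space mu = Om" using sets_eq_imp_space_eq[OF s] by (simp add: space_restrict_space)
 have m: "(%x. x) \<in> measurable mu borel"
  by (subst measurable_cong_sets[OF s refl]) (rule measurable_restrict_space1, simp)
 have e: "emeasure ?M A = emeasure mu (A \<inter> Om)" if "A \<in> sets borel" for A
  using that m by (subst emeasure_distr) (auto simp: sp)
 show "ahlfors ?M al (C * 2 powr al)"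
  unfolding ahlfors_def
 proof (intro conjI allI impI)
  fix y :: 'a and r :: real assume r: "0 < r"
  show "emeasure ?M (ball y r) <= ennreal (C * 2 powr al * r powr al)"
  proof (cases "ball y r \<inter> Om = {}")
   case True
   then show ?thesis by (simp add: e)
  next
   case False
   then obtain x where x: "x \<in> Om" "dist y x < r" by auto
   have "emeasure ?M (ball y r) <= emeasure mu (ball x (2*r) \<inter> Om)"
   proof (subst e)
    have "ball y r \<subseteq> ball x (2*r)"
    proof
     fix z assume "z \<in> ball y r"
     then show "z \<in> ball x (2*r)" using x(2) dist_triangle[of x z y] by (auto simp: dist_commute)
    qed
    moreover have "ball x (2*r) \<inter> Om \<in> sets mu" unfolding s sets_restrict_space by (auto simp: image_iff)
    ultimately show "emeasure mu (ball y r \<inter> Om) <= emeasure mu (ball x (2*r) \<inter> Om)"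
     by (intro emeasure_mono) auto
   qed simp
   also have "... <= ennreal (C * (2*r) powr al)" using mu x r by (auto simp: upper_ahlfors_def)
   finally show ?thesis by (simp add: powr_mult mult.assoc)
  qed
 qed (use al C in auto)
 have eU: "emeasure ?M UNIV = emeasure mu Om" by (simp add: e)
 show "finite_measure ?M" by (rule finite_measureI) (use eU mu in \<open>auto simp: upper_ahlfors_def\<close>)
 show "measure ?M UNIV = measure mu Om" using eU by (simp add: measure_def)
 show "AE x in ?M. x \<in> Om" using O m by (subst AE_distr_iff) (auto simp: sp)
 fix f f' :: "'a => ennreal" assume f: "f \<in> bmb" "!!x. x \<in> Om ==> f x = f' x"
 have "(\<integral>\<^sup>+x. f x \<partial>?M) = (\<integral>\<^sup>+x. f x \<partial>mu)" by (rule nn_integral_distr[OF m]) (use f(1) in simp)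
 also have "... = (\<integral>\<^sup>+x. f' x \<partial>mu)" by (intro nn_integral_cong) (simp add: sp f(2))
 finally show "(\<integral>\<^sup>+x. f x \<partial>?M) = (\<integral>\<^sup>+x. f' x \<partial>mu)" .
qed

text \<open>The function is at most \<open>c\<close> plus a function that is infinite on a null set
  of the boundary, and by \<open>hitT_le\<close> the mean of the latter is 0.\<close>

lemma hitT_ess_bounded:
 fixes Om :: "'a::euclidean_space set"
 assumes n: "2 <= DIM('a)" and Om: "open Om" "x \<in> Om" and f [measurable]: "f \<in> bmb"
  and AE: "AE z in bdm Om. f z <= ennreal c" and c: "0 <= c"
 shows "hitT Om f x <= ennreal (unit_ball_vol DIM('a) * c)"
proof -
 let ?I = "%z. if f z <= ennreal c then 0 else (\<infinity> :: ennreal)"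
 have mI: "?I \<in> bmb" by measurable
 have "hitT Om f x <= hitT Om (%z. ennreal c + ?I z) x" by (rule hitT_mono) auto
 also have "... = hitT Om (%z. ennreal c) x + hitT Om ?I x" by (rule hitT_add[OF Om(1) _ mI]) simp
 also have "hitT Om ?I x <= 0"
 proof -
  have "(\<integral>\<^sup>+z. rker (real DIM('a) - 1) x z * ?I z \<partial>bdm Om) = (\<integral>\<^sup>+z. 0 \<partial>bdm Om)"
   by (rule nn_integral_cong_AE) (use AE in eventually_elim, simp)
  then show ?thesis using hitT_le[OF n Om mI] by simp
 qed
 also have "hitT Om (%z. ennreal c) x <= ennreal (unit_ball_vol DIM('a) * c)" by (rule hitT_bounded) (use c in auto)
 finally show ?thesis by (simp add: add_left_mono add_right_mono)
qed

lemma admissible_facts: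
 fixes Om :: "'a::euclidean_space set"
 assumes "admissible_domain Om"
 shows "open Om" "emeasure lborel Om < \<infinity>" "finite_measure (bdm Om)"
  "measure (bdm Om) UNIV = measure (bdry_meas Om) (frontier Om)"
  "measure lborel Om = measure lebesgue Om"
proof -
 show o: "open Om" and "emeasure lborel Om < \<infinity>" using assms by (auto simp: admissible_domain_def)
 have F: "frontier Om \<in> sets borel" by simp
 have e: "emeasure (bdm Om) UNIV = emeasure (bdry_meas Om) (frontier Om)"
  by (rule emeasure_hmeas_bdry(2)[OF F F subset_refl])
 show "finite_measure (bdm Om)"
  by (rule finite_measureI) (use e assms in \<open>auto simp: admissible_domain_def\<close>)
 show "measure (bdm Om) UNIV = measure (bdry_meas Om) (frontier Om)"
  using e by (simp add: measure_def)
 show "measure lborel Om = measure lebesgue Om" using o by (simp add: measure_def)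
qed

lemma lp_le_bdry:
 fixes v :: "'a::euclidean_space => real"
 assumes "lp_norm (hausdorff_measure d X) p u < ennreal N" "0 < p" "v \<in> bmb"
  and "!!x. x \<in> X ==> \<bar>v x\<bar> = \<bar>u x\<bar>"
 shows "lp_le (hmeas d X) p (%x. \<bar>v x\<bar>) N"
proof -
 have "(\<integral>\<^sup>+x. ennreal (\<bar>v x\<bar> powr p) \<partial>hmeas d X) = (\<integral>\<^sup>+x. ennreal (\<bar>u x\<bar> powr p) \<partial>hausdorff_measure d X)"
  using assms(3,4) by (intro nn_integral_hmeas_eq) auto
 then show ?thesis using lp_norm_less_imp(2)[OF assms(1,2)] by (simp add: lp_le_def)
qed

definition represents :: "real => 'a::euclidean_space set => ('a => real) => real => real => real => real => ('a => real) => ('a => real) => ('a => real) => bool" where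
 "represents c Om u p s N1 N2 v h ga \<longleftrightarrow> v \<in> bmb & (EX B. ALL x. \<bar>v x\<bar> <= B) & (ALL y:closure Om. v y = u y) &
    h \<in> bmb & (ALL x. 0 <= h x) & (ALL x. x \<notin> Om --> h x = 0) & lp_le lborel p h N1 &
    ga \<in> bmb & (ALL z. 0 <= ga z) & lp_le (bdm Om) s ga N2 & 0 < N1 & 0 < N2 &
    (ALL x J. x \<in> Om --> (ALL m. x \<in> inner_part Om m --> ring (inner_part Om m) (hitT Om (%z. ennreal (ga z))) x <= J) -->
     ennreal \<bar>v x\<bar> <= ennreal c * (hitT Om (%z. ennreal \<bar>v z\<bar>) x + J + pot (real DIM('a) - 2) h x))"

lemma representsD:
 assumes "represents c Om (u :: 'a::euclidean_space => real) p s N1 N2 v h ga"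
 shows "v \<in> bmb" "EX B. ALL x. \<bar>v x\<bar> <= B" "ALL y:closure Om. v y = u y"
  "h \<in> bmb" "0 <= h x" "x \<notin> Om ==> h x = 0" "lp_le lborel p h N1"
  "ga \<in> bmb" "0 <= ga x" "lp_le (bdm Om) s ga N2" "0 < N1" "0 < N2"
  "x \<in> Om ==> (!!m. x \<in> inner_part Om m ==> ring (inner_part Om m) (hitT Om (%z. ennreal (ga z))) x <= J) ==>
   ennreal \<bar>v x\<bar> <= ennreal c * (hitT Om (%z. ennreal \<bar>v z\<bar>) x + J + pot (real DIM('a) - 2) h x)"
 using assms unfolding represents_def by blast+

text \<open>Strict upper bounds stand in for the norms: the infimum in \<open>V1_norm\<close> need
  not be attained, whereas a strict bound provides an actual upper gradient. Strictness also makes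
  \<open>N1\<close> and \<open>N2\<close> positive, so that densities can be normalised by division.
  \<open>norm_limit\<close> removes the slack.\<close>

definition rep_const :: "'a::euclidean_space itself => real => bool" where
 "rep_const (T :: 'a itself) c \<longleftrightarrow> (ALL (Om :: 'a set) u Hs p s N1 N2. admissible_domain Om --> Cb_closure Om u --> weak_hessian Om u Hs -->
   0 < p --> 0 < s --> lp_norm (lebesgue_on Om) p (hess_norm Hs) < ennreal N1 -->
   V1_norm (bdry_meas Om) (lp_norm (bdry_meas Om) s) u < ennreal N2 --> (EX v h ga. represents c Om u p s N1 N2 v h ga))"

lemma representation:
 assumes n: "3 <= DIM('a::euclidean_space)"
 shows "EX c>0. rep_const TYPE('a) c"
proof -
 obtain c where c: "0 < c" and I: "ALL (Om :: 'a set) u Hs g. admissible_domain Om --> Cb_closure Om u --> weak_hessian Om u Hs -->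
   hajlasz_ug (bdry_meas Om) u g -->
   (EX v h ga. v \<in> bmb & (EX B. ALL x. \<bar>v x\<bar> <= B) & (ALL y:closure Om. v y = u y) &
    h \<in> bmb & (ALL x. 0 <= h x) & (ALL x. x \<notin> Om --> h x = 0) &
    (ALL p N. lp_le (lebesgue_on Om) p (%x. \<bar>hess_norm Hs x\<bar>) N --> lp_le lborel p h N) &
    ga \<in> bmb & (ALL z. 0 <= ga z) & (ALL z:frontier Om. ga z = \<bar>g z\<bar>) &
    (ALL x J. x \<in> Om --> (ALL m. x \<in> inner_part Om m --> ring (inner_part Om m) (hitT Om (%z. ennreal (ga z))) x <= J) -->
     ennreal \<bar>v x\<bar> <= ennreal c * (hitT Om (%z. ennreal \<bar>v z\<bar>) x + J + pot (real DIM('a) - 2) h x)))"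
  using interior_estimate[OF n] by (elim exE conjE)
 show ?thesis unfolding rep_const_def
 proof (intro exI[of _ c] conjI c allI impI)
  fix Om :: "'a set" and u :: "'a => real" and Hs and p s N1 N2 :: real
  assume ad: "admissible_domain Om" and u: "Cb_closure Om u" and w: "weak_hessian Om u Hs" and ps: "0 < p" "0 < s"
   and N1: "lp_norm (lebesgue_on Om) p (hess_norm Hs) < ennreal N1"
   and N2: "V1_norm (bdry_meas Om) (lp_norm (bdry_meas Om) s) u < ennreal N2"
  obtain g where g: "hajlasz_ug (bdry_meas Om) u g" "lp_norm (bdry_meas Om) s g < ennreal N2"
   using N2 by (auto simp: V1_norm_def INF_less_iff)
  obtain v h ga B where v: "v \<in> bmb" "ALL x. \<bar>v x\<bar> <= B" "ALL y:closure Om. v y = u y"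
   and h: "h \<in> bmb" "ALL x. 0 <= h x" "ALL x. x \<notin> Om --> h x = 0"
    "ALL p N. lp_le (lebesgue_on Om) p (%x. \<bar>hess_norm Hs x\<bar>) N --> lp_le lborel p h N"
   and ga: "ga \<in> bmb" "ALL z. 0 <= ga z" "ALL z:frontier Om. ga z = \<bar>g z\<bar>"
   and E: "ALL x J. x \<in> Om --> (ALL m. x \<in> inner_part Om m --> ring (inner_part Om m) (hitT Om (%z. ennreal (ga z))) x <= J) -->
     ennreal \<bar>v x\<bar> <= ennreal c * (hitT Om (%z. ennreal \<bar>v z\<bar>) x + J + pot (real DIM('a) - 2) h x)"
   using I[rule_format, OF ad u w g(1)] by (elim exE conjE)
  have vB: "EX B. ALL x. \<bar>v x\<bar> <= B" using v(2) by (rule exI)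
  have hN: "lp_le lborel p h N1" by (rule h(4)[rule_format, OF lp_norm_less_imp(2)[OF N1 ps(1)]])
  have "lp_le (bdm Om) s (%x. \<bar>ga x\<bar>) N2"
   by (rule lp_le_bdry[OF g(2) ps(2) ga(1)]) (use ga in auto)
  then have gN: "lp_le (bdm Om) s ga N2" using ga(2) by simp
  have pos: "0 < N1" "0 < N2" using lp_norm_less_imp(1)[OF N1 ps(1)] lp_norm_less_imp(1)[OF g(2) ps(2)] by auto
  show "EX v h ga. represents c Om u p s N1 N2 v h ga" unfolding represents_def
   by (rule exI[of _ v], rule exI[of _ h], rule exI[of _ ga], (rule conjI, fact)+, fact)
 qed
qed

section \<open>The uniform estimate (iii)\<close>

definition sup_const :: "'a::euclidean_space itself => real => real => real => bool" where
 "sup_const (T :: 'a itself) (p :: real) (s :: real) C \<longleftrightarrow> (ALL (Om :: 'a set) u Hs N1 N2 N3. admissible_domain Om --> Cb_closure Om u --> weak_hessian Om u Hs -->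
   lp_norm (lebesgue_on Om) p (hess_norm Hs) < ennreal N1 -->
   V1_norm (bdry_meas Om) (lp_norm (bdry_meas Om) s) u < ennreal N2 --> linf_norm (bdry_meas Om) u < ennreal N3 -->
   linf_norm (lebesgue_on Om) u <= ennreal (C * (measure lebesgue Om powr (2 / real DIM('a) - 1 / p) * N1
    + measure (bdry_meas Om) (frontier Om) powr (1 / (real DIM('a) - 1) - 1 / s) * N2 + 1 * N3)))"

text \<open>The three summands of the pointwise estimate are bounded separately, at every point of
  the domain, by \<open>hitT_ess_bounded\<close>, \<open>ring_hitT_bound\<close> and
  \<open>pot_bound\<close>.\<close>

lemma part_sup:
 assumes n: "3 <= DIM('a::euclidean_space)" and p: "real DIM('a) / 2 < p" and s: "real DIM('a) - 1 < s"
 shows "EX C>0. sup_const TYPE('a) p s C"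
proof -
 let ?n = "real DIM('a)" and ?V = "unit_ball_vol (real DIM('a))"
 obtain c where c: "0 < c" and R: "rep_const TYPE('a) c" using representation[OF n] by blast
 obtain K1 where K1: "0 < K1" and P: "pot_const TYPE('a) p K1" using pot_bound[OF n p] by blast
 obtain K2 where K2: "0 < K2" and J: "ring_const TYPE('a) K2" using ring_hitT_bound[OF n] by blast
 have V: "0 < ?V" by simp
 define C where "C = c * (?V + K1 + K2)"
 show ?thesis unfolding sup_const_def
 proof (intro exI[of _ C] conjI allI impI)
  show "0 < C" using c V K1 K2 unfolding C_def by (intro mult_pos_pos add_pos_pos)
  fix Om :: "'a set" and u :: "'a => real" and Hs and N1 N2 N3 :: real
  assume ad: "admissible_domain Om" and u: "Cb_closure Om u" and w: "weak_hessian Om u Hs"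
   and N1: "lp_norm (lebesgue_on Om) p (hess_norm Hs) < ennreal N1"
   and N2: "V1_norm (bdry_meas Om) (lp_norm (bdry_meas Om) s) u < ennreal N2"
   and N3: "linf_norm (bdry_meas Om) u < ennreal N3"
  note af = admissible_facts[OF ad]
  have ps: "0 < p" "0 < s" using p s n by auto
  obtain v h ga where rp: "represents c Om u p s N1 N2 v h ga"
   using R[unfolded rep_const_def, rule_format, OF ad u w ps N1 N2] by blast
  note v = representsD(1,3)[OF rp] and h = representsD(4-7)[OF rp] and ga = representsD(8-10)[OF rp]
   and pos = representsD(11,12)[OF rp]
  have N3p: "0 < N3" using N3 by (cases "0 < N3") (auto simp: ennreal_neg)
  note v(1) [measurable]
  have "AE z in bdry_meas Om. ennreal \<bar>u z\<bar> <= ennreal N3"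
  proof -
   obtain e where e: "AE z in bdry_meas Om. ennreal \<bar>u z\<bar> <= e" "e < ennreal N3"
    using N3 by (auto simp: linf_norm_def Inf_less_iff)
   from e(1) show ?thesis by eventually_elim (use e(2) in auto)
  qed
  then have "AE z in bdry_meas Om. ennreal \<bar>v z\<bar> <= ennreal N3"
   by (rule AE_mp[OF _ AE_I2]) (use v(2) in \<open>auto simp: frontier_def\<close>)
  moreover have ms: "{z \<in> space borel. ennreal \<bar>v z\<bar> <= ennreal N3} \<in> sets borel" by measurable
  ultimately have "AE z in hmeas (?n - 1) (frontier Om). ennreal \<bar>v z\<bar> <= ennreal N3"
   unfolding hmeas_def by (subst AE_distr_iff[OF measurable_id_hausdorff ms])
  then have T: "hitT Om (%z. ennreal \<bar>v z\<bar>) x <= ennreal (?V * N3)" if "x \<in> Om" for x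
   using n N3p by (intro hitT_ess_bounded af(1) that) auto
  let ?L = "measure lebesgue Om powr (2 / ?n - 1 / p)" and ?H = "measure (bdry_meas Om) (frontier Om) powr (1 / (?n - 1) - 1 / s)"
  have pt: "ennreal \<bar>u x\<bar> <= ennreal (C * (?L * N1 + ?H * N2 + 1 * N3))" if x: "x \<in> Om" for x
  proof -
   have "ennreal \<bar>v x\<bar> <= ennreal c * (hitT Om (%z. ennreal \<bar>v z\<bar>) x + ennreal (K2 * (?H * N2)) + pot (?n - 2) h x)"
    unfolding af(4)[symmetric]
    by (intro representsD(13)[OF rp x] J[unfolded ring_const_def, rule_format, OF af(1-3) s ga(1,2) pos(2) ga(3)])
   also have "... <= ennreal c * (ennreal (?V * N3) + ennreal (K2 * (?H * N2)) + ennreal (K1 * (?L * N1)))"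
    using x P[unfolded pot_const_def, rule_format, OF af(1) _ af(2) h(1-3) pos(1) h(4), where x = x] unfolding af(5)
    by (intro mult_left_mono add_mono T) auto
   also have "... = ennreal (c * (?V * N3 + K2 * (?H * N2) + K1 * (?L * N1)))"
    using c V N3p K1 K2 pos by (simp add: ennreal_mult')
   also have "... <= ennreal (C * (?L * N1 + ?H * N2 + 1 * N3))"
   proof (rule ennreal_leI)
    have le: "?V * N3 <= (?V + K1 + K2) * N3" "K2 * (?H * N2) <= (?V + K1 + K2) * (?H * N2)" "K1 * (?L * N1) <= (?V + K1 + K2) * (?L * N1)"
     using V K1 K2 N3p pos by (auto intro!: mult_right_mono simp: less_imp_le)
    have "?V * N3 + K2 * (?H * N2) + K1 * (?L * N1) <= (?V + K1 + K2) * (?L * N1 + ?H * N2 + 1 * N3)"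
     using le by (simp only: distrib_left mult_1_left)
    then show "c * (?V * N3 + K2 * (?H * N2) + K1 * (?L * N1)) <= C * (?L * N1 + ?H * N2 + 1 * N3)"
     unfolding C_def mult.assoc using c by (intro mult_left_mono) auto
   qed
   finally show ?thesis using v(2) x closure_subset[of Om] by auto
  qed
  show "linf_norm (lebesgue_on Om) u <= ennreal (C * (?L * N1 + ?H * N2 + 1 * N3))"
   unfolding linf_norm_def
  proof (rule Inf_lower, rule CollectI, rule AE_I2)
   fix x assume "x \<in> space (lebesgue_on Om)"
   then have "x \<in> Om" by simp
   then show "ennreal \<bar>u x\<bar> <= ennreal (C * (?L * N1 + ?H * N2 + 1 * N3))" by (rule pt)
  qed
 qed
qed

section \<open>The Lebesgue estimate (i)\<close>

lemma powr_add3_le: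
 fixes a b c q :: real
 assumes "0 <= a" "0 <= b" "0 <= c" "0 < q"
 shows "(a + b + c) powr q <= 3 powr q * (a powr q + b powr q + c powr q)"
proof -
 define m where "m = max a (max b c)"
 have m: "0 <= m" "a + b + c <= 3 * m" using assms by (auto simp: m_def)
 have "(a + b + c) powr q <= (3 * m) powr q" using assms m by (intro powr_mono2) auto
 also have "... = 3 powr q * m powr q" by (simp add: powr_mult)
 also have "m powr q <= a powr q + b powr q + c powr q" by (auto simp: m_def max_def)
 finally show ?thesis by (simp add: mult_left_mono)
qed

lemma lp_le_add3:
 assumes "lp_le M q f a" "lp_le M q g b" "lp_le M q h c" "0 < q"
  and [measurable]: "f \<in> borel_measurable M" "g \<in> borel_measurable M" "h \<in> borel_measurable M"
  and pos: "!!x. 0 <= f x" "!!x. 0 <= g x" "!!x. 0 <= h x" "0 <= a" "0 <= b" "0 <= c"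
 shows "lp_le M q (%x. f x + g x + h x) (3 * 3 powr (1/q) * (a + b + c))"
proof -
 have t: "ennreal X + ennreal X + ennreal X = ennreal (3 * X)" if "0 <= X" for X :: real
  using that by (simp add: ennreal_plus[symmetric] del: ennreal_plus)
 have "(\<integral>\<^sup>+x. ennreal ((f x + g x + h x) powr q) \<partial>M)
   <= (\<integral>\<^sup>+x. ennreal (3 powr q) * (ennreal (f x powr q) + ennreal (g x powr q) + ennreal (h x powr q)) \<partial>M)"
 proof (intro nn_integral_mono)
  fix x
  have "ennreal ((f x + g x + h x) powr q) <= ennreal (3 powr q * (f x powr q + g x powr q + h x powr q))"
   using assms(4) pos by (intro ennreal_leI powr_add3_le)
  then show "ennreal ((f x + g x + h x) powr q) <= ennreal (3 powr q) * (ennreal (f x powr q) + ennreal (g x powr q) + ennreal (h x powr q))"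
   by (simp add: ennreal_mult')
 qed
 also have "... = ennreal (3 powr q) * ((\<integral>\<^sup>+x. ennreal (f x powr q) \<partial>M) + (\<integral>\<^sup>+x. ennreal (g x powr q) \<partial>M) + (\<integral>\<^sup>+x. ennreal (h x powr q) \<partial>M))"
  by (subst nn_integral_cmult) (auto simp: nn_integral_add)
 also have "... <= ennreal (3 powr q) * (ennreal ((a+b+c) powr q) + ennreal ((a+b+c) powr q) + ennreal ((a+b+c) powr q))"
 proof (intro mult_left_mono add_mono)
  have "a powr q <= (a+b+c) powr q" "b powr q <= (a+b+c) powr q" "c powr q <= (a+b+c) powr q"
   using pos assms(4) by (auto intro!: powr_mono2)
  then show "(\<integral>\<^sup>+x. ennreal (f x powr q) \<partial>M) <= ennreal ((a+b+c) powr q)" "(\<integral>\<^sup>+x. ennreal (g x powr q) \<partial>M) <= ennreal ((a+b+c) powr q)"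
   "(\<integral>\<^sup>+x. ennreal (h x powr q) \<partial>M) <= ennreal ((a+b+c) powr q)"
   using assms(1-3) by (auto simp: lp_le_def intro: order.trans ennreal_leI)
 qed simp
 also have "... = ennreal (3 powr q * (3 * (a+b+c) powr q))"
  by (subst t) (simp_all add: ennreal_mult')
 also have "3 powr q * (3 * (a+b+c) powr q) = (3 * 3 powr (1/q) * (a + b + c)) powr q"
  using assms(4) by (simp add: powr_mult powr_powr)
 finally show ?thesis unfolding lp_le_def .
qed

definition lp_const :: "'a::euclidean_space itself => real => real => real => real => real => real => real => bool" where
 "lp_const (T :: 'a itself) (al :: real) (Cmu :: real) (p :: real) (s :: real) (r :: real) (q :: real) C \<longleftrightarrow> (ALL (Om :: 'a set) mu u Hs N1 N2 N3. admissible_domain Om --> upper_ahlfors Om mu al Cmu --> Cb_closure Om u --> weak_hessian Om u Hs -->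
   lp_norm (lebesgue_on Om) p (hess_norm Hs) < ennreal N1 -->
   V1_norm (bdry_meas Om) (lp_norm (bdry_meas Om) s) u < ennreal N2 --> lp_norm (bdry_meas Om) r u < ennreal N3 -->
   lp_norm mu q u <= ennreal (C * (measure mu Om powr (1/q - 1/(p * al / (real DIM('a) - 2 * p))) * N1
    + measure mu Om powr (1/q - 1/(s * al / (real DIM('a) - 1 - s))) * N2 + measure mu Om powr (1/q - 1/(r * al / (real DIM('a) - 1))) * N3)))"

text \<open>Each summand has its own target exponent \<open>q1\<close>, \<open>q2\<close> or
  \<open>q3\<close>; finiteness of \<open>mu\<close> lowers them to a common \<open>q\<close> at the
  cost of powers of the total mass. The upper gradient passes through \<open>sg = s*n/(n-1)\<close>:
  means over exit points lead from L^s of the boundary to L^sg of the domain, and the potential of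
  order one, for which \<open>s < n-1\<close> gives \<open>sg < n\<close>, leads to L^q2 of
  \<open>mu\<close>.\<close>

lemma part_lp:
 fixes al Cmu p s r :: real
 assumes n: "3 <= DIM('a::euclidean_space)" and al: "real DIM('a) - 1 < al" and Cmu: "0 < Cmu"
  and p: "1 < p" "p < real DIM('a) / 2" and s: "1 < s" "s < real DIM('a) - 1" and r: "1 < r"
  and q: "0 < q" "q <= p * al / (real DIM('a) - 2 * p)" "q <= s * al / (real DIM('a) - 1 - s)" "q <= r * al / (real DIM('a) - 1)"
 shows "EX C>0. lp_const TYPE('a) al Cmu p s r q C"
proof -
 let ?n = "real DIM('a)"
 define q1 where "q1 = p * al / (?n - 2 * p)"
 define q2 where "q2 = s * al / (?n - 1 - s)"
 define q3 where "q3 = r * al / (?n - 1)"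
 define sg where "sg = s * ?n / (?n - 1)"
 define CM where "CM = Cmu * 2 powr al"
 have n3: "3 <= ?n" using n by simp
 have n2: "2 <= DIM('a)" using n by simp
 have CM: "0 < CM" using Cmu by (simp add: CM_def)
 have sg: "1 < sg" "1 * sg < ?n" "sg * al / (?n - 1 * sg) = q2"
 proof -
  have "1 * (?n - 1) < s * ?n" using s n3 by (intro mult_strict_mono) auto
  then show "1 < sg" using n3 by (simp add: sg_def pos_less_divide_eq)
  have "s * ?n < (?n - 1) * ?n" using s n3 by (intro mult_strict_right_mono) auto
  then show "1 * sg < ?n" using n3 by (simp add: sg_def pos_divide_less_eq mult.commute)
  have a: "sg * (?n - 1) = s * ?n" unfolding sg_def using n3 by simp
  have "(?n - sg) * (?n - 1) = ?n * (?n - 1 - s)"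
   by (simp only: left_diff_distrib[of ?n] a) (simp add: algebra_simps)
  with a have "(sg * (?n - 1)) * al / ((?n - sg) * (?n - 1)) = (s * ?n) * al / (?n * (?n - 1 - s))" by simp
  then show "sg * al / (?n - 1 * sg) = q2" using n3 by (simp add: q2_def mult.commute mult.left_commute)
 qed
 obtain c where c: "0 < c" and R: "rep_const TYPE('a) c" using representation[OF n] by blast
 have k2: "0 < (2::real)" "2 < ?n" "2 * p < ?n" "?n - 2 < al" and k1: "0 < (1::real)" "1 < ?n" using n3 p al by auto
 have k4: "?n - 1 < ?n" "0 < unit_ball_vol ?n" by simp_all
 obtain K1 where K1: "0 < K1" and P1: "riesz_const TYPE('a) 2 p al CM K1"
  using riesz_lp[OF k2(1,2) p(1) k2(3,4) CM] by blast
 obtain K2 where K2: "0 < K2" and P2: "riesz_const TYPE('a) 1 sg al CM K2" using riesz_lp[OF k1 sg(1,2) al CM] by blast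
 obtain K3 where K3: "0 < K3" and H3: "hit_const TYPE('a) r al CM K3" using hit_lp[OF n2 r al CM] by blast
 obtain K4 where K4: "0 < K4" and H4: "hit_const TYPE('a) s ?n (unit_ball_vol ?n) K4" using hit_lp[OF n2 s(1) k4] by blast
 define K where "K = K1 + K2 * K4 + K3"
 define D where "D = c * (3 * 3 powr (1/q) * (2 powr (1/q) * K))"
 show ?thesis unfolding lp_const_def
 proof (intro exI[of _ D] conjI allI impI)
  have K: "0 < K" using K1 K2 K3 K4 by (simp add: K_def add_pos_pos)
  then show "0 < D" using c by (simp add: D_def)
  fix Om :: "'a set" and mu and u :: "'a => real" and Hs and N1 N2 N3 :: real
  assume ad: "admissible_domain Om" and mu: "upper_ahlfors Om mu al Cmu" and u: "Cb_closure Om u" and w: "weak_hessian Om u Hs"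
   and N1: "lp_norm (lebesgue_on Om) p (hess_norm Hs) < ennreal N1"
   and N2: "V1_norm (bdry_meas Om) (lp_norm (bdry_meas Om) s) u < ennreal N2"
   and N3: "lp_norm (bdry_meas Om) r u < ennreal N3"
  note af = admissible_facts[OF ad]
  have ps: "0 < p" "0 < s" "0 < r" "0 < al" using p s r al n3 by auto
  obtain v h ga where rp: "represents c Om u p s N1 N2 v h ga"
   using R[unfolded rep_const_def, rule_format, OF ad u w ps(1,2) N1 N2] by blast
  note v = representsD(1-3)[OF rp] and h = representsD(4-7)[OF rp] and ga = representsD(8-10)[OF rp]
   and pos = representsD(11,12)[OF rp]
  have N3p: "0 < N3" by (rule lp_norm_less_imp(1)[OF N3 ps(3)])
  define M where "M = distr mu borel (%x. x)"
  note M = upper_ahlfors_distr[OF af(1) mu ps(4) Cmu, folded M_def CM_def]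
  interpret M: finite_measure M by (rule M(2))
  note ahl = ahlfors_measurable[OF M(1)]
  let ?H = "hmeas (?n - 1) (frontier Om)"
  interpret H: finite_measure ?H by (rule af(3))
  have Hf: "emeasure ?H UNIV < \<infinity>" using H.emeasure_finite[of UNIV] by (simp add: less_top[symmetric])
  let ?av = "%z. \<bar>v z\<bar>"
  have mav: "?av \<in> bmb" using v(1) by measurable
  define A where "A = hitR Om ?av"
  define G where "G = hitR Om ga"
  define PJ where "PJ x = enn2real (pot (?n - 1) G x)" for x
  define PH where "PH x = enn2real (pot (?n - 2) h x)" for x
  have mA: "A \<in> bmb" unfolding A_def by (rule hitR_measurable[OF af(1) mav])
  have mG: "G \<in> bmb" unfolding G_def by (rule hitR_measurable[OF af(1) ga(1)])
  have mPJ: "PJ \<in> bmb" unfolding PJ_def[abs_def] using mG by measurable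
  have mPH: "PH \<in> bmb" unfolding PH_def[abs_def] using h(1) by measurable
  have G0: "ALL y. 0 <= G y" by (simp add: G_def hitR_def)
  have LA: "lp_le M q3 A (K3 * N3)" unfolding A_def q3_def
  proof (rule H3[unfolded hit_const_def, rule_format, OF M(1,2) af(1,3) mav _ N3p])
   show "lp_le ?H r ?av N3" by (rule lp_le_bdry[OF N3 ps(3) v(1)]) (use v(3) in \<open>auto simp: frontier_def\<close>)
  qed simp
  have "lp_le (density lborel (indicator Om)) sg G (K4 * N2)" unfolding G_def sg_def
   by (rule H4[unfolded hit_const_def, rule_format, OF ahlfors_restricted[OF af(1,2)] af(1,3) ga(1) _ pos(2) ga(3)]) (use ga(2) in simp)
  then have LG: "lp_le lborel sg G (K4 * N2)" by (rule lp_le_restricted[OF af(1) _ mG]) (simp add: G_def hitR_def)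
  have LJ: "lp_le M q2 PJ (K2 * (K4 * N2))" unfolding PJ_def[abs_def] sg(3)[symmetric]
   by (rule P2[unfolded riesz_const_def, rule_format, OF M(1,2) mG _ _ LG]) (use K4 pos G0 in auto)
  have LH: "lp_le M q1 PH (K1 * N1)" unfolding PH_def[abs_def] q1_def
   by (rule P1[unfolded riesz_const_def, rule_format, OF M(1,2) h(1) _ pos(1) h(4)]) (use h(2) in simp)
  define m where "m = measure mu Om"
  have Mm: "measure M (space M) = m" using M(3) ahlforsD(2)[OF M(1)] by (simp add: m_def)
  have FA: "lp_le M q A (2 powr (1/q) * (K3 * N3 * m powr (1/q - 1/q3)))" unfolding Mm[symmetric]
   by (rule lp_le_finite_measure[OF LA ahl[OF mA] _ M(2) q(1)]) (use q(4) K3 N3p in \<open>auto simp: q3_def A_def hitR_def\<close>)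
  have FJ: "lp_le M q PJ (2 powr (1/q) * (K2 * (K4 * N2) * m powr (1/q - 1/q2)))" unfolding Mm[symmetric]
   by (rule lp_le_finite_measure[OF LJ ahl[OF mPJ] _ M(2) q(1)]) (use q(3) K2 K4 pos in \<open>auto simp: q2_def PJ_def\<close>)
  have FH: "lp_le M q PH (2 powr (1/q) * (K1 * N1 * m powr (1/q - 1/q1)))" unfolding Mm[symmetric]
   by (rule lp_le_finite_measure[OF LH ahl[OF mPH] _ M(2) q(1)]) (use q(2) K1 pos in \<open>auto simp: q1_def PH_def\<close>)
  let ?a = "2 powr (1/q) * (K3 * N3 * m powr (1/q - 1/q3))" and ?b = "2 powr (1/q) * (K2 * (K4 * N2) * m powr (1/q - 1/q2))"
   and ?d = "2 powr (1/q) * (K1 * N1 * m powr (1/q - 1/q1))"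
  have abd: "0 <= ?a" "0 <= ?b" "0 <= ?d" using K1 K2 K3 K4 pos N3p by auto
  have S: "lp_le M q (%x. c * (A x + PJ x + PH x)) (c * (3 * 3 powr (1/q) * (?a + ?b + ?d)))"
  proof (rule lp_le_cmult)
   show "lp_le M q (%x. A x + PJ x + PH x) (3 * 3 powr (1/q) * (?a + ?b + ?d))"
    by (rule lp_le_add3[OF FA FJ FH q(1) ahl[OF mA] ahl[OF mPJ] ahl[OF mPH] _ _ _ abd])
     (auto simp: A_def hitR_def PJ_def PH_def)
   show "(%x. A x + PJ x + PH x) \<in> borel_measurable M" by (rule ahl) (use mA mPJ mPH in measurable)
  qed (use c in simp)
  obtain B where B: "!!x. \<bar>v x\<bar> <= B" using v(2) by blast
  have gi: "(\<integral>\<^sup>+y. ennreal (ga y) \<partial>?H) < \<infinity>"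
   by (rule lp_le_integrable(2)[OF ga(3) _ _ _ _ Hf]) (use ga s in auto)
  have Gi: "(NNI y. ennreal (G y)) < \<infinity>"
   by (rule lp_le_integrable(2)[OF LG _ _ _ _ af(2)]) (use mG G0 sg af(1) in \<open>auto simp: G_def hitR_def\<close>)
  have hi: "(NNI y. ennreal (h y)) < \<infinity>"
   by (rule lp_le_integrable(2)[OF h(4) _ _ _ _ af(2)]) (use h p af(1) in auto)
  \<comment> \<open>The norm bounds concern \<open>enn2real\<close> of the potentials. They speak
    about the potentials themselves only where these are finite, which is almost everywhere for
    \<open>M\<close>.\<close>
  have aJ: "AE x in M. pot (?n - 1) G x < \<infinity>" by (rule pot_finite_AE[OF M(1,2) _ al mG Gi]) (use n3 in simp)
  have aH: "AE x in M. pot (?n - 2) h x < \<infinity>" by (rule pot_finite_AE[OF M(1,2) _ _ h(1) hi]) (use n3 al in auto)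
  have "AE x in M. 0 <= \<bar>v x\<bar> & \<bar>v x\<bar> <= c * (A x + PJ x + PH x)"
   using M(4) aJ aH
  proof eventually_elim
   case (elim x)
   have "hitT Om (%z. ennreal \<bar>v z\<bar>) x <= ennreal (unit_ball_vol ?n * B)"
   proof (rule hitT_bounded)
    show "0 <= B" using B[of x] abs_ge_zero[of "v x"] by linarith
   qed (intro ennreal_leI B)
   then have f1: "hitT Om (%z. ennreal \<bar>v z\<bar>) x < \<infinity>" by (rule le_less_trans) simp
   have "ennreal \<bar>v x\<bar> <= ennreal c * (hitT Om (%z. ennreal \<bar>v z\<bar>) x + pot (?n - 1) G x + pot (?n - 2) h x)"
    unfolding G_def by (rule representsD(13)[OF rp elim(1)]) (rule ring_hitT_pot[OF n2 af(1,2,3) ga(1) gi])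
   also have "... = ennreal c * (ennreal (A x) + ennreal (PJ x) + ennreal (PH x))"
    using f1 elim by (simp add: A_def hitR_def PJ_def PH_def less_top[symmetric])
   also have "... = ennreal (c * (A x + PJ x + PH x))"
    using c by (simp add: ennreal_mult' A_def hitR_def PJ_def PH_def)
   finally have "\<bar>v x\<bar> <= c * (A x + PJ x + PH x)"
    using c by (subst (asm) ennreal_le_iff) (auto simp: A_def hitR_def PJ_def PH_def)
   then show ?case by simp
  qed
  then have ae: "AE x in M. 0 <= \<bar>v x\<bar> & \<bar>v x\<bar> <= c * (A x + PJ x + PH x)" .
  have le: "c * (3 * 3 powr (1/q) * (?a + ?b + ?d)) <= D * (m powr (1/q - 1/q1) * N1 + m powr (1/q - 1/q2) * N2 + m powr (1/q - 1/q3) * N3)"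
  proof -
   let ?x = "m powr (1/q - 1/q1) * N1" and ?y = "m powr (1/q - 1/q2) * N2" and ?z = "m powr (1/q - 1/q3) * N3"
   have xyz: "0 <= ?x" "0 <= ?y" "0 <= ?z" using pos N3p by auto
   have "0 < K2 * K4" using K2 K4 by simp
   then have "K1 <= K" "K2 * K4 <= K" "K3 <= K" using K1 K3 unfolding K_def by linarith+
   note kk = mult_right_mono[OF this(1) xyz(1)] mult_right_mono[OF this(2) xyz(2)] mult_right_mono[OF this(3) xyz(3)]
   then have "K3 * ?z + (K2 * K4) * ?y + K1 * ?x <= K * (?x + ?y + ?z)" using kk unfolding distrib_left by linarith
   then have "2 powr (1/q) * (K3 * ?z + (K2 * K4) * ?y + K1 * ?x) <= 2 powr (1/q) * (K * (?x + ?y + ?z))" by (rule mult_left_mono) simp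
   moreover have "t * (K3 * N3 * z) + t * (K2 * (K4 * N2) * y) + t * (K1 * N1 * x) = t * (K3 * (z * N3) + (K2 * K4) * (y * N2) + K1 * (x * N1))"
    for t x y z by (simp add: algebra_simps)
   ultimately have "?a + ?b + ?d <= 2 powr (1/q) * (K * (?x + ?y + ?z))" by (simp only:)
   then have "c * (3 * 3 powr (1/q) * (?a + ?b + ?d)) <= c * (3 * 3 powr (1/q) * (2 powr (1/q) * (K * (?x + ?y + ?z))))"
    using c by (intro mult_left_mono) auto
   then show ?thesis unfolding D_def by (simp only: mult.assoc)
  qed
  have S0: "0 <= c * (3 * 3 powr (1/q) * (?a + ?b + ?d))" using c K1 K2 K3 K4 pos N3p by (intro mult_nonneg_nonneg add_nonneg_nonneg) auto
  have "lp_le M q ?av (D * (m powr (1/q - 1/q1) * N1 + m powr (1/q - 1/q2) * N2 + m powr (1/q - 1/q3) * N3))"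
   by (rule lp_le_mono[OF S ae S0 le less_imp_le[OF q(1)]])
  moreover have "(\<integral>\<^sup>+x. ennreal (?av x powr q) \<partial>M) = (\<integral>\<^sup>+x. ennreal (\<bar>u x\<bar> powr q) \<partial>mu)"
   by (rule M(5)) (use v(1,3) closure_subset[of Om] in auto)
  ultimately have "lp_le mu q (%x. \<bar>u x\<bar>) (D * (m powr (1/q - 1/q1) * N1 + m powr (1/q - 1/q2) * N2 + m powr (1/q - 1/q3) * N3))"
   by (simp add: lp_le_def)
  from lp_norm_le[OF this q(1) order.trans[OF S0 le]] show "lp_norm mu q u <= ennreal (D * (measure mu Om powr (1/q - 1/(p * al / (?n - 2 * p))) * N1
    + measure mu Om powr (1/q - 1/(s * al / (?n - 1 - s))) * N2 + measure mu Om powr (1/q - 1/(r * al / (?n - 1))) * N3))"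
   unfolding q1_def q2_def q3_def m_def .
 qed
qed

section \<open>The exponential estimate (ii)\<close>

lemma young_shift_nonneg: "0 <= young_shift g"
 by (simp add: young_shift_def)

lemma exp_powr_le_young:
 assumes "0 <= t" "0 < g"
 shows "exp (t powr g) <= young_exp g t + exp (young_shift g powr g)"
 using assms young_shift_nonneg[of g] by (simp add: young_exp_def powr_mono2)

lemma powr_add_le_add:
 fixes a b g :: real
 assumes "0 <= a" "0 <= b" "0 < g" "g <= 1"
 shows "(a + b) powr g <= a powr g + b powr g"
proof (cases "a + b = 0")
 case False
 then have ab: "0 < a + b" using assms by simp
 have le: "x <= x powr g" if "0 <= x" "x <= 1" for x :: real
 proof (cases "x = 0")
  case False
  then have "x powr 1 <= x powr g" using that assms by (intro powr_mono') auto
  then show ?thesis using that False by simp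
 qed simp
 have "1 = a / (a + b) + b / (a + b)" using ab by (simp add: add_divide_distrib[symmetric])
 also have "... <= (a / (a + b)) powr g + (b / (a + b)) powr g"
  using assms ab by (intro add_mono le) auto
 also have "... = (a powr g + b powr g) / (a + b) powr g"
  using assms ab by (simp add: powr_divide add_divide_distrib)
 finally show ?thesis using ab by (simp add: pos_le_divide_eq)
qed (use assms in auto)

text \<open>For \<open>g < 1\<close> subadditivity of \<open>powr g\<close> turns the shift of the
  argument into a constant factor. For \<open>g >= 1\<close> the shift is 0 and equality
  holds.\<close>

lemma young_exp_le:
 assumes "0 <= t" "0 < g"
 shows "young_exp g t <= exp (young_shift g powr g) * (exp (t powr g) - 1)"
proof (cases "g < 1")
 case True
 have "(t + young_shift g) powr g <= t powr g + young_shift g powr g"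
  using assms True young_shift_nonneg by (intro powr_add_le_add) auto
 then have "exp ((t + young_shift g) powr g) <= exp (t powr g) * exp (young_shift g powr g)"
  by (simp add: exp_add[symmetric])
 then show ?thesis by (simp add: young_exp_def algebra_simps)
next
 case False
 then show ?thesis using assms by (simp add: young_exp_def young_shift_def)
qed

text \<open>Linearity in \<open>e\<close> on the right is the point: given a bound on the integral
  of \<open>exp (y/4)\<close>, the integral of the Young function becomes as small as desired when
  the divisor grows. One half of the exponent 1/4 dominates \<open>exp (e*y)\<close>, the other half
  absorbs the factor \<open>y\<close> with constant 8.\<close>

lemma exp_minus_one_le:
 fixes y e :: real
 assumes "0 <= y" "0 <= e" "e <= 1/8"
 shows "exp (e * y) - 1 <= 8 * e * exp (y / 4)"
proof -
 have "1 - e * y <= exp (- (e * y))" using exp_ge_add_one_self[of "- (e * y)"] by simp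
 then have "(1 - e * y) * exp (e * y) <= exp (- (e * y)) * exp (e * y)" by (rule mult_right_mono) simp
 then have "exp (e * y) - 1 <= e * y * exp (e * y)" by (simp add: exp_minus algebra_simps)
 also have "... <= e * y * exp (y / 8)"
 proof -
  have "e * y <= 1/8 * y" using assms by (intro mult_right_mono) auto
  then show ?thesis using assms by (intro mult_left_mono) auto
 qed
 also have "y <= 8 * exp (y / 8)" using exp_ge_add_one_self[of "y / 8"] by linarith
 then have "e * y * exp (y / 8) <= e * (8 * exp (y / 8)) * exp (y / 8)"
  using assms by (intro mult_right_mono mult_left_mono) auto
 also have "... = 8 * e * exp (y / 4)" by (simp add: exp_add[symmetric])
 finally show ?thesis .
qed

definition exp_const :: "'a itself => real => real => real => real => real => bool" where
 "exp_const (T :: 'a itself) (ga :: real) B D m La \<longleftrightarrow> (ALL (M :: 'a measure) w. finite_measure M --> measure M (space M) = m --> w \<in> borel_measurable M --> (ALL x. 0 <= w x) -->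
   (ALL k>=1. emeasure M {x \<in> space M. B * real k powr (1/ga) < w x} <= ennreal (D * (1/2)^k)) -->
   (\<integral>\<^sup>+x. ennreal (young_exp ga (w x / La)) \<partial>M) <= 1)"

text \<open>For \<open>y = (w/B) powr ga\<close> the hypothesis says that \<open>y > k\<close> has
  measure at most \<open>D * (1/2)^k\<close>. Since \<open>exp (1/4) < 2\<close>, the integral of
  \<open>exp (y/4)\<close> is at most a finite \<open>E\<close>. Dividing \<open>w\<close> by
  \<open>La\<close> multiplies \<open>y\<close> by \<open>et\<close>, which is chosen so that
  \<open>c0 * (8 * et) * E <= 1\<close>.\<close>

lemma exp_tail_integrable:
 fixes ga B D m :: real
 assumes par: "0 < ga" "0 < B" "0 <= D" "0 <= m"
 shows "EX La>0. exp_const TYPE('b) ga B D m La"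
proof -
 define c0 where "c0 = exp (young_shift ga powr ga)"
 define r :: real where "r = exp (1/4) / 2"
 define E where "E = exp (1/4) * m + D * exp (1/4) / (1 - r)"
 define et where "et = 1 / (8 * (1 + c0 * E))"
 define La where "La = B * et powr (-1/ga)"
 have r: "0 < r" "r < 1"
 proof -
  have "exp (1/4 :: real) <= 1 + 1/4 + (1/4)^2" by (rule exp_bound) auto
  then show "r < 1" by (simp add: r_def power2_eq_square)
  show "0 < r" by (simp add: r_def)
 qed
 have E: "0 <= E" using par r by (simp add: E_def)
 have c0: "0 < c0" by (simp add: c0_def)
 have c0E: "0 <= c0 * E" using c0 E by simp
 have et: "0 < et" "et <= 1/8" using c0E by (auto simp: et_def divide_simps)
 have La: "0 < La" using par et by (simp add: La_def)
 show ?thesis unfolding exp_const_def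
 proof (intro exI[of _ La] conjI La allI impI)
  fix M :: "'b measure" and w
  assume fin: "finite_measure M" and m: "measure M (space M) = m" and w [measurable]: "w \<in> borel_measurable M"
   and w0: "ALL x. 0 <= w x"
   and tail: "ALL k>=1. emeasure M {x \<in> space M. B * real k powr (1/ga) < w x} <= ennreal (D * (1/2)^k)"
  interpret finite_measure M by (rule fin)
  define y where "y x = (w x / B) powr ga" for x
  define S where "S k = {x \<in> space M. B * real (Suc k) powr (1/ga) < w x}" for k
  have S [measurable]: "S k \<in> sets M" for k unfolding S_def by measurable
  have y0: "0 <= y x" for x by (simp add: y_def)
  have big: "ennreal (exp (y x / 4)) <= ennreal (exp (1/4)) + (\<Sum>k. ennreal (exp (real (k + 2) / 4)) * indicator (S k) x)" if x: "x \<in> space M" for x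
  proof (cases "y x <= 1")
   case True
   then have "ennreal (exp (y x / 4)) <= ennreal (exp (1/4))" by (intro ennreal_leI) simp
   then show ?thesis by (simp add: add_increasing2)
  next
   case False
   \<comment> \<open>Shifted so that \<open>k+1 < y <= k+2\<close>: the level sets \<open>S\<close>
     are indexed by \<open>k+1\<close>, because the tail hypothesis starts at 1.\<close>
   define k where "k = nat (\<lceil>y x\<rceil> - 2)"
   have c2: "2 <= \<lceil>y x\<rceil>" using False by (simp add: le_ceiling_iff)
   have k: "real (Suc k) < y x" "y x <= real (k + 2)"
    using c2 unfolding k_def by linarith+
   have wp: "0 <= w x / B" using w0 par by simp
   have "B * real (Suc k) powr (1/ga) < B * (y x) powr (1/ga)"
    using k par by (intro mult_strict_left_mono powr_less_mono2) auto
   also have "(y x) powr (1/ga) = w x / B" using par wp w0 by (simp add: y_def powr_powr)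
   finally have xS: "x \<in> S k" using x par by (simp add: S_def)
   have "ennreal (exp (y x / 4)) <= ennreal (exp (real (k + 2) / 4))" using k by (intro ennreal_leI) simp
   also have "... = ennreal (exp (real (k + 2) / 4)) * indicator (S k) x" using xS by simp
   also have "... <= (\<Sum>k. ennreal (exp (real (k + 2) / 4)) * indicator (S k) x)" by (rule ennreal_le_suminf)
   finally show ?thesis by (simp add: add_increasing)
  qed
  have "(\<integral>\<^sup>+x. ennreal (exp (y x / 4)) \<partial>M) <= (\<integral>\<^sup>+x. ennreal (exp (1/4)) + (\<Sum>k. ennreal (exp (real (k + 2) / 4)) * indicator (S k) x) \<partial>M)"
   by (rule nn_integral_mono) (rule big)
  also have "... = ennreal (exp (1/4)) * emeasure M (space M) + (\<Sum>k. ennreal (exp (real (k + 2) / 4)) * emeasure M (S k))"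
   by (subst nn_integral_add) (auto simp: nn_integral_suminf nn_integral_cmult_indicator)
  also have "... <= ennreal (exp (1/4) * m) + (\<Sum>k. ennreal (D * exp (1/4) * r ^ k))"
  proof (intro add_mono suminf_le)
   show "ennreal (exp (1/4)) * emeasure M (space M) <= ennreal (exp (1/4) * m)"
    using m by (simp add: emeasure_eq_measure ennreal_mult')
   fix k
   have "emeasure M (S k) <= ennreal (D * (1/2)^Suc k)" using tail[rule_format, of "Suc k"] by (simp add: S_def)
   then have "ennreal (exp (real (k + 2) / 4)) * emeasure M (S k) <= ennreal (exp (real (k + 2) / 4)) * ennreal (D * (1/2)^Suc k)"
    by (rule mult_left_mono) simp
   also have "... = ennreal (exp (real (k + 2) / 4) * (D * (1/2)^Suc k))" using par by (intro ennreal_mult[symmetric]) auto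
   also have "... <= ennreal (D * exp (1/4) * r ^ k)"
   proof (rule ennreal_leI)
    have "exp (real (k + 2) / 4) = exp (real k * (1/4)) * (exp (1/4) * exp (1/4 :: real))"
     by (simp add: exp_add[symmetric] add_divide_distrib)
    then have e: "exp (real (k + 2) / 4) = exp (1/4) ^ k * (exp (1/4) * exp (1/4 :: real))" by (simp only: exp_of_nat_mult)
    have "exp (real (k + 2) / 4) * (D * (1/2)^Suc k) = D * exp (1/4) * r ^ k * r"
     unfolding e r_def by (simp add: power_divide mult_ac)
    also have "... <= D * exp (1/4) * r ^ k * 1" using r par by (intro mult_left_mono) auto
    finally show "exp (real (k + 2) / 4) * (D * (1/2)^Suc k) <= D * exp (1/4) * r ^ k" by simp
   qed
   finally show "ennreal (exp (real (k + 2) / 4)) * emeasure M (S k) <= ennreal (D * exp (1/4) * r ^ k)" .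
  qed auto
  also have "(\<Sum>k. ennreal (D * exp (1/4) * r ^ k)) = ennreal (D * exp (1/4) * (1 / (1 - r)))"
  proof (rule suminf_ennreal_eq)
   have "norm r < 1" using r by simp
   then show "(%k. D * exp (1/4) * r ^ k) sums (D * exp (1/4) * (1 / (1 - r)))" by (intro sums_mult geometric_sums)
   show "0 <= D * exp (1/4) * r ^ k" for k using r par by simp
  qed
  also have "ennreal (exp (1/4) * m) + ennreal (D * exp (1/4) * (1 / (1 - r))) = ennreal E"
  proof -
   have "0 <= D * exp (1/4) * (1 / (1 - r))" "0 <= exp (1/4) * m" using r par by auto
   then show ?thesis by (simp only: E_def ennreal_plus times_divide_eq_right mult_1_right)
  qed
  finally have Eb: "(\<integral>\<^sup>+x. ennreal (exp (y x / 4)) \<partial>M) <= ennreal E" .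
  have "(\<integral>\<^sup>+x. ennreal (young_exp ga (w x / La)) \<partial>M) <= (\<integral>\<^sup>+x. ennreal (c0 * (8 * et)) * ennreal (exp (y x / 4)) \<partial>M)"
  proof (intro nn_integral_mono)
   fix x
   have "et powr (-1/ga) = inverse (et powr (1/ga))" using powr_minus[of et "1/ga"] by simp
   then have "w x / La = (w x / B) * et powr (1/ga)" by (simp only: La_def divide_inverse inverse_mult_distrib inverse_inverse_eq mult.assoc)
   then have "(w x / La) powr ga = (w x / B) powr ga * (et powr (1/ga)) powr ga" by (simp only: powr_mult)
   also have "(et powr (1/ga)) powr ga = et" using par et by (simp add: powr_powr)
   finally have wl: "(w x / La) powr ga = et * y x" by (simp only: y_def mult.commute)
   have "young_exp ga (w x / La) <= c0 * (exp (et * y x) - 1)"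
    using young_exp_le[of "w x / La" ga] w0 La par by (simp add: c0_def wl)
   also have "... <= c0 * (8 * et * exp (y x / 4))" using c0 et y0 by (intro mult_left_mono exp_minus_one_le) auto
   finally have "ennreal (young_exp ga (w x / La)) <= ennreal ((c0 * (8 * et)) * exp (y x / 4))"
    by (intro ennreal_leI) (simp only: mult.assoc)
   then show "ennreal (young_exp ga (w x / La)) <= ennreal (c0 * (8 * et)) * ennreal (exp (y x / 4))"
    using c0 et by (simp add: ennreal_mult')
  qed
  also have "... = ennreal (c0 * (8 * et)) * (\<integral>\<^sup>+x. ennreal (exp (y x / 4)) \<partial>M)"
   unfolding y_def by (intro nn_integral_cmult) measurable
  also have "... <= ennreal (c0 * (8 * et)) * ennreal E" by (rule mult_left_mono[OF Eb]) simp
  also have "... = ennreal (c0 * (8 * et) * E)" using E by (intro ennreal_mult''[symmetric])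
  also have "... <= ennreal 1"
  proof (rule ennreal_leI)
   have "8 * (1 / (8 * X)) = 1 / X" for X :: real by simp
   then have "8 * et = 1 / (1 + c0 * E)" unfolding et_def .
   then have "c0 * (8 * et) * E = c0 * E / (1 + c0 * E)" by simp
   also have "... <= 1" using c0E by (simp add: divide_simps)
   finally show "c0 * (8 * et) * E <= 1" .
  qed
  finally show "(\<integral>\<^sup>+x. ennreal (young_exp ga (w x / La)) \<partial>M) <= 1" by simp
 qed
qed

text \<open>The inequality \<open>ln z <= z - 1\<close> at \<open>z = t powr be * be / 2\<close>.
  Only half of the exponent is spent, so that the other half can supply decay in
  \<open>hit_tail\<close>.\<close>

lemma le_exp_powr:
 fixes t be :: real
 assumes "0 <= t" "0 < be"
 shows "t <= exp (1/be * ln (2/be)) * exp (t powr be / 2)"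
proof (cases "t = 0")
 case False
 then have t: "0 < t" using assms by simp
 let ?x = "t powr be"
 have "ln (?x * be / 2) <= ?x * be / 2 - 1" using t assms by (intro ln_le_minus_one) auto
 moreover have "ln (?x * be / 2) = be * ln t - ln (2/be)" using t assms by (simp add: ln_mult ln_div ln_powr)
 ultimately have "be * ln t <= be * (?x / 2) + ln (2/be)" by (simp add: mult.commute)
 then have "1/be * (be * ln t) <= 1/be * (be * (?x / 2) + ln (2/be))" using assms by (intro mult_left_mono) auto
 then have "ln t <= 1/be * ln (2/be) + ?x / 2" using assms by (simp add: distrib_left)
 then have "exp (ln t) <= exp (1/be * ln (2/be) + ?x / 2)" by (simp only: exp_le_cancel_iff)
 then show ?thesis using t by (simp add: exp_add)
qed simp

definition hit_tail_const :: "'a::euclidean_space itself => real => real => real => real => real => real => real => bool" where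
 "hit_tail_const (T :: 'a itself) (be :: real) (al :: real) (C :: real) (H :: real) (m :: real) B D \<longleftrightarrow> (ALL (M :: 'a measure) Om f l. ahlfors M al C --> finite_measure M --> open Om -->
   finite_measure (bdm Om) --> measure (bdm Om) UNIV = H --> measure M UNIV = m -->
   f \<in> bmb --> (ALL y. 0 <= f y) --> 0 < l -->
   (\<integral>\<^sup>+z. ennreal (young_exp be (f z / l)) \<partial>bdm Om) <= 1 -->
   (ALL k>=1. emeasure M {x. x \<in> Om & ennreal (B * real k powr (1/be) * l) < hitT Om (%z. ennreal (f z)) x} <= ennreal (D * (1/2)^k)))"

text \<open>Values of \<open>f/l\<close> up to \<open>t = (2k)^(1/be)\<close> have mean at most
  \<open>V * t\<close>, which is of the order of the level. For larger values half of the exponent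
  is at least \<open>k\<close> and is traded for the factor \<open>exp (-k)\<close>, so their
  boundary integral is at most a multiple of \<open>2^(-k)\<close>; \<open>hitT_swap\<close> and
  Markov's inequality turn this into the tail bound.\<close>

lemma hit_tail:
 fixes be al C H m :: real
 assumes n: "2 <= DIM('a::euclidean_space)" and be: "0 < be" and al: "real DIM('a) - 1 < al" and C: "0 < C" and H: "0 <= H"
 shows "EX B>0. EX D>0. hit_tail_const TYPE('a) be al C H m B D"
proof -
 let ?d = "real DIM('a) - 1" and ?V = "unit_ball_vol (real DIM('a))"
 define c where "c = exp (1/be * ln (2/be))"
 define e0 where "e0 = exp (young_shift be powr be)"
 define A where "A = proj_const DIM('a) * set_const al ?d C * m powr (1 - ?d/al)"
 \<comment> \<open>The summand 1 absorbs the mean of the large values, which is below 1 off the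
   exceptional set, because \<open>real k powr (1/be) >= 1\<close>.\<close>
 define B where "B = ?V * 2 powr (1/be) + 1"
 define D where "D = 1 + A * (c * (1 + e0 * H))"
 have c: "0 < c" "0 < e0" by (simp_all add: c_def e0_def)
 have A: "0 <= A" using proj_const_pos[of "DIM('a)"] n set_const_pos[OF al C] by (simp add: A_def)
 show ?thesis unfolding hit_tail_const_def
 proof (rule exI[of _ B], rule conjI, goal_cases)
  case 1
  show ?case by (simp add: B_def add_nonneg_pos)
 next
  case 2
  show ?case
  proof (intro exI[of _ D] conjI allI impI)
   show "0 < D" using c A H by (simp add: D_def add_pos_nonneg)
   fix M :: "'a measure" and Om and f :: "'a => real" and l :: real and k :: nat
   assume M: "ahlfors M al C" "finite_measure M" and Om: "open Om" and fin: "finite_measure (hmeas ?d (frontier Om))"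
    and Hm: "measure (hmeas ?d (frontier Om)) UNIV = H" and m: "measure M UNIV = m"
    and f [measurable]: "f \<in> bmb" and f0: "ALL y. 0 <= f y" and l: "0 < l"
    and y: "(\<integral>\<^sup>+z. ennreal (young_exp be (f z / l)) \<partial>hmeas ?d (frontier Om)) <= 1" and k: "1 <= k"
   let ?H = "hmeas ?d (frontier Om)"
   interpret H: finite_measure ?H by (rule fin)
   note [measurable_cong] = ahlforsD(1)[OF M(1)]
   define t where "t = (2 * real k) powr (1/be)"
   have t0: "0 <= t" by (simp add: t_def)
   have tb: "t powr be = 2 * real k" using be k by (simp add: t_def powr_powr)
   let ?F = "%z. f z / l"
   let ?G = "%z. if t < ?F z then ennreal (?F z) else 0"
   have mG: "?G \<in> bmb" by measurable
   have G: "(\<integral>\<^sup>+z. ?G z \<partial>?H) <= ennreal (c * exp (- real k) * (1 + e0 * H))"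
   proof -
    have "(\<integral>\<^sup>+z. ?G z \<partial>?H) <= (\<integral>\<^sup>+z. ennreal (c * exp (- real k)) * (ennreal (young_exp be (?F z)) + ennreal e0) \<partial>?H)"
    proof (intro nn_integral_mono)
     fix z
     show "?G z <= ennreal (c * exp (- real k)) * (ennreal (young_exp be (?F z)) + ennreal e0)"
     proof (cases "t < ?F z")
      case True
      have F0: "0 <= ?F z" using f0 l by simp
      have "t powr be <= ?F z powr be" using True t0 be by (intro powr_mono2) auto
      then have kk: "?F z powr be / 2 <= ?F z powr be - real k" unfolding tb by simp
      have "?F z <= c * exp (?F z powr be / 2)" unfolding c_def by (rule le_exp_powr[OF F0 be])
      also have "... <= c * exp (?F z powr be - real k)" using kk c by (intro mult_left_mono) auto
      also have "... = c * exp (- real k) * exp (?F z powr be)" by (simp add: exp_diff exp_minus divide_inverse)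
      also have "... <= c * exp (- real k) * (young_exp be (?F z) + e0)"
       using exp_powr_le_young[OF F0 be] c by (intro mult_left_mono) (auto simp: e0_def)
      finally have "ennreal (?F z) <= ennreal (c * exp (- real k) * (young_exp be (?F z) + e0))" by (rule ennreal_leI)
      also have "... = ennreal (c * exp (- real k)) * ennreal (young_exp be (?F z) + e0)" using c by (intro ennreal_mult') auto
      also have "... <= ennreal (c * exp (- real k)) * (ennreal (young_exp be (?F z)) + ennreal e0)"
       using c by (intro mult_left_mono) (auto simp: ennreal_plus_if)
      finally show ?thesis using True by simp
     qed (simp only: if_False zero_le)
    qed
    also have "... = ennreal (c * exp (- real k)) * ((\<integral>\<^sup>+z. ennreal (young_exp be (?F z)) \<partial>?H) + ennreal e0 * emeasure ?H UNIV)"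
    proof -
     have "(%z. ennreal (young_exp be (?F z))) \<in> borel_measurable ?H" unfolding young_exp_def by measurable
     then show ?thesis by (subst nn_integral_cmult) (auto simp: nn_integral_add)
    qed
    also have "... <= ennreal (c * exp (- real k)) * (1 + ennreal e0 * ennreal H)"
     using y Hm by (intro mult_left_mono add_mono) (auto simp: H.emeasure_eq_measure)
    also have "1 + ennreal e0 * ennreal H = ennreal (1 + e0 * H)" using c H by (simp add: ennreal_mult')
    also have "ennreal (c * exp (- real k)) * ennreal (1 + e0 * H) = ennreal (c * exp (- real k) * (1 + e0 * H))"
     using c H by (intro ennreal_mult[symmetric]) auto
    finally show ?thesis .
   qed
   define R where "R x = (if x \<in> Om then hitT Om ?G x else 0)" for x
   have mO: "Om \<in> sets borel" using Om by simp
   have mR: "R \<in> borel_measurable M" unfolding R_def[abs_def]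
    using hitT_measurable[OF Om mG] mO by (intro ahlfors_measurable[OF M(1)] measurable_If borel_measurable_const) auto
   have US: "UNIV \<in> sets M" using ahlforsD(1)[OF M(1)] by simp
   have "(\<integral>\<^sup>+x. R x * indicator UNIV x \<partial>M) <= ennreal A * (\<integral>\<^sup>+z. ?G z \<partial>?H)"
    using hitT_swap[OF n M al Om fin US mG] unfolding m A_def R_def .
   also have "... <= ennreal A * ennreal (c * exp (- real k) * (1 + e0 * H))" by (rule mult_left_mono[OF G]) simp
   also have "... = ennreal (A * (c * exp (- real k) * (1 + e0 * H)))" using A by (simp add: ennreal_mult'[symmetric])
   also have "... <= ennreal (D * (1/2)^k)"
   proof (rule ennreal_leI)
    have "exp (- real k) <= (1/2)^k"
    proof -
     have "(2::real) ^ k <= exp 1 ^ k" using exp_ge_add_one_self[of 1] by (intro power_mono) auto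
     then have "2 ^ k <= exp (real k)" by (simp add: exp_of_nat_mult[symmetric])
     then have "inverse (exp (real k)) <= inverse (2 ^ k)" by (intro le_imp_inverse_le) auto
     then show ?thesis by (simp add: exp_minus power_divide inverse_eq_divide)
    qed
    then have "A * (c * (1 + e0 * H)) * exp (- real k) <= D * (1/2)^k"
     using A c H by (intro mult_mono) (auto simp: D_def)
    then show "A * (c * exp (- real k) * (1 + e0 * H)) <= D * (1/2)^k" by (simp only: mult_ac)
   qed
   finally have RI: "(\<integral>\<^sup>+x. R x * indicator UNIV x \<partial>M) <= ennreal (D * (1/2)^k)" .
   have "emeasure M {x. x \<in> Om & ennreal (B * real k powr (1/be) * l) < hitT Om (%z. ennreal (f z)) x} <= emeasure M {x \<in> UNIV. 1 <= 1 * R x}"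
   proof (rule emeasure_mono)
    show "{x. x \<in> Om & ennreal (B * real k powr (1/be) * l) < hitT Om (%z. ennreal (f z)) x} \<subseteq> {x \<in> UNIV. 1 <= 1 * R x}"
    proof (rule subsetI, elim CollectE conjE)
     fix x assume x: "x \<in> Om" and big: "ennreal (B * real k powr (1/be) * l) < hitT Om (%z. ennreal (f z)) x"
     have "1 <= 1 * R x"
     proof (rule ccontr)
      assume "\<not> 1 <= 1 * R x"
      then have R1: "hitT Om ?G x <= 1" using x by (simp add: R_def)
      have "hitT Om (%z. ennreal (f z)) x <= hitT Om (%z. ennreal l * (ennreal t + ?G z)) x"
      proof (rule hitT_mono)
       fix z
       have "ennreal (f z) = ennreal l * ennreal (?F z)" using l by (simp add: ennreal_mult'[symmetric])
       also have "ennreal (?F z) <= ennreal t + ?G z"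
       proof (cases "t < ?F z")
        case True
        then have "?G z = ennreal (?F z)" by simp
        then show ?thesis by (simp only: add_increasing zero_le order_refl)
       next
        case False
        then have "ennreal (?F z) <= ennreal t" by (intro ennreal_leI) simp
        then show ?thesis by (rule add_increasing2[rotated]) (rule zero_le)
       qed
       then have "ennreal l * ennreal (?F z) <= ennreal l * (ennreal t + ?G z)" by (rule mult_left_mono) simp
       finally show "ennreal (f z) <= ennreal l * (ennreal t + ?G z)" .
      qed
      also have "... = ennreal l * hitT Om (%z. ennreal t + ?G z) x" by (rule hitT_cmult[OF Om]) (use mG in measurable)
      also have "hitT Om (%z. ennreal t + ?G z) x = hitT Om (%z. ennreal t) x + hitT Om ?G x" by (rule hitT_add[OF Om _ mG]) simp
      also have "... <= ennreal (?V * t) + ennreal 1" using t0 R1 by (intro add_mono hitT_bounded) auto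
      also have "... = ennreal (?V * t + 1)" using t0 by (intro ennreal_plus[symmetric]) auto
      also have "?V * t + 1 <= B * real k powr (1/be)"
      proof -
       have "1 <= real k powr (1/be)" using k be by (intro ge_one_powr_ge_zero) auto
       moreover have "t = 2 powr (1/be) * real k powr (1/be)" by (simp add: t_def powr_mult)
       ultimately show ?thesis by (simp add: B_def distrib_right mult.assoc)
      qed
      then have "ennreal l * ennreal (?V * t + 1) <= ennreal l * ennreal (B * real k powr (1/be))" by (intro mult_left_mono ennreal_leI) auto
      also have "ennreal l * ennreal (B * real k powr (1/be)) = ennreal (B * real k powr (1/be) * l)"
       using l by (simp add: ennreal_mult'[symmetric] mult.commute)
      finally show False using big by (simp add: mult_left_mono)
     qed
     then show "x \<in> {x \<in> UNIV. 1 <= 1 * R x}" by simp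
    qed
    show "{x \<in> UNIV. 1 <= 1 * R x} \<in> sets M" using mR ahlforsD(2)[OF M(1)] by measurable
   qed
   also have "... <= 1 * (\<integral>\<^sup>+x. R x * indicator UNIV x \<partial>M)"
    by (rule nn_integral_Markov_inequality) (use mR US in auto)
   finally show "emeasure M {x. x \<in> Om & ennreal (B * real k powr (1/be) * l) < hitT Om (%z. ennreal (f z)) x} <= ennreal (D * (1/2)^k)"
    using RI by simp
  qed
 qed
qed

text \<open>As the kernel exponent approaches the dimension, the constant degenerates only linearly.\<close>

lemma near_const_critical_le:
 fixes k :: nat
 assumes "1 <= k"
 shows "near_const n (n - 1 / real k) <= 2 powr n * (2 * real k)"
proof -
 have k: "0 < real k" using assms by simp
 let ?x = "1 - 1 / (2 * real k)"
 have x: "0 < ?x" using assms by (simp add: field_simps)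
 have "1 + real k * (- (1 / (2 * real k))) <= (1 + (- (1 / (2 * real k)))) ^ k"
  using assms by (intro Bernoulli_inequality) (simp add: field_simps)
 then have "1/2 <= ?x ^ k" using k by simp
 then have "(1/2) powr (1 / real k) <= (?x ^ k) powr (1 / real k)" by (intro powr_mono2) auto
 also have "... = (?x powr real k) powr (1 / real k)" using x by (simp only: powr_realpow)
 also have "... = ?x" using x k by (simp add: powr_powr)
 finally have h: "1 / (2 * real k) <= 1 - (1/2) powr (1 / real k)" by simp
 have "near_const n (n - 1 / real k) = 2 powr (n - 1 / real k) / (1 - (1/2) powr (1 / real k))"
  by (simp add: near_const_def)
 also have "... <= 2 powr n / (1 / (2 * real k))"
  using h k by (intro frac_le powr_mono) auto
 finally show ?thesis by simp
qed

definition pot_tail_const :: "'a::euclidean_space itself => real => real => real => real => real => bool" where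
 "pot_tail_const (T :: 'a itself) (al :: real) (C :: real) (L :: real) B D \<longleftrightarrow> (ALL (M :: 'a measure) Om h N. ahlfors M al C --> finite_measure M --> open Om -->
   emeasure lborel Om < \<infinity> --> measure lborel Om = L -->
   h \<in> bmb --> (ALL y. 0 <= h y) --> (ALL y. y \<notin> Om --> h y = 0) --> 0 < N --> lp_le lborel (real DIM('a) / 2) h N -->
   (ALL k>=1. emeasure M {x. ennreal (B * real k powr ((real DIM('a) - 2) / real DIM('a)) * N) < pot (real DIM('a) - 2) h x} <= ennreal (D * (1/2)^k)))"

text \<open>At \<open>p = n/2\<close> the dual power of the kernel has exponent exactly
  \<open>n\<close> and fails to be integrable at the singularity, so the kernel is cut at radius
  \<open>rh = 2^(-k)\<close>. The near part has an integral of order \<open>2^(-k)\<close> against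
  \<open>M\<close>, because \<open>al - (n-2) > 1\<close>, and Markov's inequality applies. In the
  far part the exponent \<open>n\<close> is lowered to \<open>n - 1/k\<close> at the cost of
  \<open>rh powr (-1/k) = 2\<close>. The constant for that exponent is linear in \<open>k\<close>,
  and the root \<open>1/p'\<close> turns it into \<open>k^((n-2)/n)\<close>.\<close>

lemma pot_tail:
 fixes al C L :: real
 assumes n: "3 <= DIM('a::euclidean_space)" and al: "real DIM('a) - 1 < al" and C: "0 < C" and L: "0 <= L"
 shows "EX B>0. EX D>0. pot_tail_const TYPE('a) al C L B D"
proof -
 define n where "n = real DIM('a)"
 define V where "V = unit_ball_vol (real DIM('a))"
 define p where "p = n / 2"
 define p' where "p' = p / (p - 1)"
 define cc where "cc = 2 * ((V * (2 powr n * 2) + 1) * max 1 L)"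
 define B where "B = 2 * cc powr (1/p') + 1"
 define D where "D = 1 + C * near_const al (n - 2) * (L + 1)"
 have n3: "3 <= n" using n by (simp add: n_def)
 have V: "0 < V" by (simp add: V_def)
 have p: "1 < p" using n3 by (simp add: p_def)
 have p': "0 < p'" "p' * (n - 2) = n" "1 / p' = (n - 2) / n" using n3 by (auto simp: p'_def p_def field_simps)
 have cc: "0 < cc" using V by (simp add: cc_def add_pos_pos)
 have nc: "0 < near_const al (n - 2)" using al by (intro near_const_pos) (simp add: n_def)
 show ?thesis unfolding pot_tail_const_def
 proof (rule exI[of _ B], rule conjI, goal_cases)
  case 1
  show ?case by (simp add: B_def add_nonneg_pos)
 next
  case 2
  show ?case
  proof (intro exI[of _ D] conjI allI impI)
   show "0 < D" using C nc L by (simp add: D_def add_pos_nonneg)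
   fix M :: "'a measure" and Om and h :: "'a => real" and N :: real and k :: nat
   assume M: "ahlfors M al C" "finite_measure M" and Om: "open Om" "emeasure lborel Om < \<infinity>" "measure lborel Om = L"
    and h [measurable]: "h \<in> bmb" and h0: "ALL y. 0 <= h y" "ALL y. y \<notin> Om --> h y = 0"
    and N: "0 < N" and hN: "lp_le lborel (real DIM('a) / 2) h N" and k: "1 <= k"
   interpret finite_measure M by (rule M(2))
   interpret P: pair_sigma_finite M lborel ..
   note [measurable_cong] = ahlforsD(1)[OF M(1)]
   have mO [measurable]: "Om \<in> sets borel" using Om(1) by simp
   have eL: "emeasure lborel Om = ennreal L" using Om(2,3) by (auto simp: emeasure_eq_ennreal_measure less_top)
   let ?g = "%y. h y / N"
   have g1: "(NNI y. ennreal (?g y powr p)) <= 1"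
    unfolding p_def n_def by (rule lp_le_normalise[OF hN _ N]) simp
   have gi: "(NNI y. ennreal (?g y)) <= ennreal (L + 1)"
   proof -
    have "lp_le lborel p ?g 1" using g1 by (simp add: lp_le_def)
    then have "(NNI y. ennreal (?g y)) <= emeasure lborel Om + ennreal (1 powr p)"
     by (rule lp_le_integrable(1)) (use h0 N p mO Om(2) in auto)
    then show ?thesis using L by (simp add: eL)
   qed
   define rh :: real where "rh = (1/2)^k"
   have rh: "0 < rh" "rh <= 1" by (auto simp: rh_def power_le_one)
   let ?w = "%x y. if dist x y < rh then rker (n - 2) x y else 0"
   define R where "R x = (NNI y. ennreal (?g y) * ?w x y)" for x
   have mR: "R \<in> borel_measurable M" unfolding R_def[abs_def] by measurable
   have US: "UNIV \<in> sets M" using ahlforsD(1)[OF M(1)] by simp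
   have "(\<integral>\<^sup>+x. R x \<partial>M) = (NNI y. \<integral>\<^sup>+x. ennreal (?g y) * ?w x y \<partial>M)"
    unfolding R_def by (rule P.Fubini'[symmetric]) measurable
   also have "... = (NNI y. ennreal (?g y) * (\<integral>\<^sup>+x. ?w x y \<partial>M))"
    by (intro nn_integral_cong nn_integral_cmult) measurable
   also have "... <= (NNI y. ennreal (?g y) * ennreal (C * near_const al (n - 2) * rh))"
   proof (intro nn_integral_mono mult_left_mono)
    fix y
    have "(\<integral>\<^sup>+x. ?w x y \<partial>M) = (\<integral>\<^sup>+x. rker (n - 2) x y * indicator (ball y rh) x \<partial>M)"
     by (intro nn_integral_cong) (auto simp: dist_commute indicator_def)
    also have "... <= ennreal (C * near_const al (n - 2) * rh powr (al - (n - 2)))"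
     by (rule rker_near[OF M(1)]) (use n3 al rh in \<open>auto simp: n_def\<close>)
    also have "... <= ennreal (C * near_const al (n - 2) * rh)"
    proof (intro ennreal_leI mult_left_mono)
     have "rh powr (al - (n - 2)) <= rh powr 1" using rh al by (intro powr_mono') (auto simp: n_def)
     then show "rh powr (al - (n - 2)) <= rh" using rh by simp
    qed (use C nc in auto)
    finally show "(\<integral>\<^sup>+x. ?w x y \<partial>M) <= ennreal (C * near_const al (n - 2) * rh)" .
   qed simp
   also have "... = (NNI y. ennreal (?g y)) * ennreal (C * near_const al (n - 2) * rh)"
    by (rule nn_integral_multc) measurable
   also have "... <= ennreal (L + 1) * ennreal (C * near_const al (n - 2) * rh)" by (rule mult_right_mono[OF gi]) simp
   also have "... = ennreal ((L + 1) * (C * near_const al (n - 2) * rh))" using L by (simp add: ennreal_mult')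
   also have "... <= ennreal (D * (1/2)^k)"
   proof (rule ennreal_leI)
    have "(L + 1) * (C * near_const al (n - 2) * rh) = (C * near_const al (n - 2) * (L + 1)) * rh" by (simp only: mult_ac)
    also have "... <= D * rh" using rh by (intro mult_right_mono) (auto simp: D_def)
    finally show "(L + 1) * (C * near_const al (n - 2) * rh) <= D * (1/2)^k" by (simp add: rh_def)
   qed
   finally have RI: "(\<integral>\<^sup>+x. R x \<partial>M) <= ennreal (D * (1/2)^k)" .
   have far: "pot (n - 2) ?g x <= ennreal (2 * (cc * real k) powr (1/p')) + R x" for x
   proof -
    let ?k = "%y. if y \<in> Om & rh <= dist y x then dist y x powr (-(n - 2)) else 0"
    have "pot (n - 2) ?g x <= (NNI y. ennreal (?k y * ?g y) + ennreal (?g y) * ?w x y)"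
     unfolding pot_def
    proof (intro nn_integral_mono)
     fix y
     show "rker (n - 2) x y * ennreal (?g y) <= ennreal (?k y * ?g y) + ennreal (?g y) * ?w x y"
     proof (cases "dist x y < rh")
      case True
      then show ?thesis by (simp add: mult.commute add_increasing)
     next
      case False
      then have "rker (n - 2) x y * ennreal (?g y) = ennreal (?k y * ?g y)"
       using h0(2) by (auto simp: rker_def dist_commute ennreal_mult'[symmetric])
      then show ?thesis by (simp add: add_increasing2)
     qed
    qed
    also have "... = (NNI y. ennreal (?k y * ?g y)) + R x"
     unfolding R_def by (intro nn_integral_add) measurable
    also have "(NNI y. ennreal (?k y * ?g y)) <= ennreal (2 * (cc * real k) powr (1/p'))"
    proof (rule nn_holder_le[OF p p'_def])
     let ?b = "n - 1 / real k"
     have k1: "1 / real k <= 1" "0 < 1 / real k" using k by auto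
     have b: "0 <= ?b" "?b < n" using n3 k1 by linarith+
     have "(NNI y. ennreal (?k y powr p')) <= (NNI y. ennreal 2 * (rker ?b y x * indicator Om y))"
     proof (intro nn_integral_mono)
      fix y
      show "ennreal (?k y powr p') <= ennreal 2 * (rker ?b y x * indicator Om y)"
      proof (cases "y \<in> Om & rh <= dist y x")
       case True
       let ?t = "dist y x"
       have "-(n - 2) * p' = -?b + (-(1 / real k))" using p'(2) by (simp add: algebra_simps)
       moreover have "?k y = ?t powr (-(n - 2))" using True by simp
       ultimately have "?k y powr p' = ?t powr (-?b) * ?t powr (-(1 / real k))"
        by (simp only: powr_powr powr_add)
       also have "... <= ?t powr (-?b) * rh powr (-(1 / real k))"
        using True rh k1 by (intro mult_left_mono powr_mono2') auto
       also have "rh powr (-(1 / real k)) = 2"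
       proof -
        have a: "rh = (1/2) powr real k" by (simp add: rh_def powr_realpow)
        have b: "real k * (-(1 / real k)) = -1" using k by simp
        show ?thesis unfolding a powr_powr b by (simp add: powr_minus)
       qed
       finally have "ennreal (?k y powr p') <= ennreal (2 * ?t powr (-?b))" by (intro ennreal_leI) (simp add: mult.commute)
       also have "... = ennreal 2 * rker ?b y x" unfolding rker_def by (rule ennreal_mult) auto
       finally show ?thesis using True by simp
      next
       case False
       then have "?k y = 0" by (simp only: if_False)
       then show ?thesis by simp
      qed
     qed
     also have "... = ennreal 2 * (NNI y. rker ?b y x * indicator Om y)"
      by (rule nn_integral_cmult) measurable
     also have "... <= ennreal 2 * ennreal (set_const n ?b V * measure lborel Om powr (1 - ?b/n))"
      unfolding n_def V_def by (intro mult_left_mono rker_set[OF ahlfors_lborel]) (use b mO Om in \<open>auto simp: n_def\<close>)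
     also have "... = ennreal (2 * (set_const n ?b V * L powr (1 - ?b/n)))"
      using Om(3) by (simp add: ennreal_mult')
     also have "... <= ennreal (cc * real k)"
     proof (rule ennreal_leI)
      have e: "0 <= 1 - ?b/n" "1 - ?b/n <= 1" using b n3 by auto
      have "L powr (1 - ?b/n) <= max 1 L powr (1 - ?b/n)" using e L by (intro powr_mono2) auto
      also have "... <= max 1 L powr 1" using e by (intro powr_mono) auto
      finally have l: "L powr (1 - ?b/n) <= max 1 L" by simp
      have "set_const n ?b V = V * near_const n ?b + 1" by (simp add: set_const_def)
      also have "... <= V * (2 powr n * (2 * real k)) + 1 * real k"
       using near_const_critical_le[OF k, of n] V k by (intro add_mono mult_left_mono) auto
      also have "... = (V * (2 powr n * 2) + 1) * real k" by (simp add: algebra_simps)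
      finally have s: "set_const n ?b V <= (V * (2 powr n * 2) + 1) * real k" .
      have "set_const n ?b V * L powr (1 - ?b/n) <= ((V * (2 powr n * 2) + 1) * real k) * max 1 L"
       using V by (intro mult_mono s l) auto
      then show "2 * (set_const n ?b V * L powr (1 - ?b/n)) <= cc * real k" by (simp add: cc_def mult_ac)
     qed
     finally show "(NNI y. ennreal (?k y powr p')) <= ennreal (cc * real k)" .
     show "0 < cc * real k" using cc k by simp
    qed (use h0 N g1 in auto)
    finally show ?thesis by (simp add: add_right_mono)
   qed
   let ?S = "{x. ennreal (B * real k powr ((n - 2) / n) * N) < pot (n - 2) h x}"
   have "emeasure M ?S <= emeasure M {x \<in> UNIV. 1 <= 1 * R x}"
   proof (rule emeasure_mono)
    show "?S \<subseteq> {x \<in> UNIV. 1 <= 1 * R x}"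
    proof (rule subsetI)
     fix x assume "x \<in> ?S"
     then have big: "ennreal (B * real k powr ((n - 2) / n) * N) < pot (n - 2) h x" by (rule CollectD)
     have "1 <= 1 * R x"
     proof (rule ccontr)
      assume "\<not> 1 <= 1 * R x"
      then have R1: "R x <= ennreal 1" by simp
      have "pot (n - 2) h x = pot (n - 2) (%y. N * ?g y) x" using N by simp
      also have "... = ennreal N * pot (n - 2) ?g x" using N by (intro pot_cmult) auto
      also have "... <= ennreal N * (ennreal (2 * (cc * real k) powr (1/p')) + ennreal 1)"
       by (intro mult_left_mono order.trans[OF far] add_left_mono R1) auto
      also have "... = ennreal (N * (2 * (cc * real k) powr (1/p') + 1))" using N by (simp add: ennreal_mult')
      also have "... <= ennreal (B * real k powr ((n - 2) / n) * N)"
      proof (rule ennreal_leI)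
       have "1 <= real k powr (1/p')" using k p'(1) by (intro ge_one_powr_ge_zero) auto
       then have "2 * (cc * real k) powr (1/p') + 1 <= B * real k powr (1/p')" by (simp add: B_def distrib_right powr_mult)
       then have "N * (2 * (cc * real k) powr (1/p') + 1) <= N * (B * real k powr (1/p'))" using N by (intro mult_left_mono) auto
       then show "N * (2 * (cc * real k) powr (1/p') + 1) <= B * real k powr ((n - 2) / n) * N" unfolding p'(3) by (simp only: mult_ac)
      qed
      finally show False using big by (simp add: not_less[symmetric])
     qed
     then show "x \<in> {x \<in> UNIV. 1 <= 1 * R x}" by simp
    qed
    show "{x \<in> UNIV. 1 <= 1 * R x} \<in> sets M" using mR ahlforsD(2)[OF M(1)] by measurable
   qed
   also have "... <= 1 * (\<integral>\<^sup>+x. R x * indicator UNIV x \<partial>M)"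
    by (rule nn_integral_Markov_inequality) (use mR US in auto)
   finally show "emeasure M {x. ennreal (B * real k powr ((real DIM('a) - 2) / real DIM('a)) * N) < pot (real DIM('a) - 2) h x} <= ennreal (D * (1/2)^k)"
    using RI by (simp add: n_def)
  qed
 qed
qed

definition exp_norm_const :: "'a::euclidean_space itself => real => real => real => real => real => real => real => bool" where
 "exp_norm_const (T :: 'a itself) (al :: real) Cmu (be :: real) L Hb m C \<longleftrightarrow> (ALL s (Om :: 'a set) mu u Hs N1 N2 N3. real DIM('a) - 1 < s --> admissible_domain Om --> upper_ahlfors Om mu al Cmu -->
   measure lebesgue Om = L --> measure (bdry_meas Om) (frontier Om) = Hb --> measure mu Om = m -->
   Cb_closure Om u --> weak_hessian Om u Hs -->
   lp_norm (lebesgue_on Om) (real DIM('a) / 2) (hess_norm Hs) < ennreal N1 -->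
   V1_norm (bdry_meas Om) (lp_norm (bdry_meas Om) s) u < ennreal N2 --> expL_norm (bdry_meas Om) be u < ennreal N3 -->
   expL_norm mu (min (real DIM('a) / (real DIM('a) - 2)) be) u <= ennreal (C * (1 * N1 + 1 * N2 + 1 * N3)))"

text \<open>After division by \<open>S\<close>, the function exceeds \<open>B * k^(1/ga)\<close>
  only on the two exceptional sets, for the mean over exit points and for the potential of the
  Hessian, and on a null set. The exponents \<open>1/be\<close> and \<open>(n-2)/n\<close> are both
  at most \<open>1/ga\<close>, as \<open>ga\<close> is a minimum, and the gradient term is bounded,
  hence absorbed since \<open>k >= 1\<close>.\<close>

lemma part_exp:
 fixes al Cmu be L Hb m :: real
 assumes n: "3 <= DIM('a::euclidean_space)" and al: "real DIM('a) - 1 < al" and Cmu: "0 < Cmu" and be: "0 < be"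
 shows "EX C>0. exp_norm_const TYPE('a) al Cmu be L Hb m C"
proof -
 define ga where "ga = min (real DIM('a) / (real DIM('a) - 2)) be"
 show "?thesis"
proof (cases "0 <= L & 0 <= Hb & 0 <= m")
 \<comment> \<open>Measures are nonnegative, so a negative prescribed value contradicts the
   hypotheses and any constant serves.\<close>
 case False
 have no: "\<not> (measure lebesgue Om = L & measure (bdry_meas Om) (frontier Om) = Hb & measure mu Om = m)" for Om :: "'a set" and mu :: "'a measure"
  using False by (auto simp: not_le)
 show ?thesis unfolding exp_norm_const_def ga_def[symmetric]
 proof (rule exI[of _ 1], intro conjI allI impI)
  fix Om :: "'a set" and mu :: "'a measure" and u :: "'a => real" and N1 N2 N3 :: real
  assume "measure lebesgue Om = L" "measure (bdry_meas Om) (frontier Om) = Hb" "measure mu Om = m"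
  then show "expL_norm mu ga u <= ennreal (1 * (1 * N1 + 1 * N2 + 1 * N3))" using no[of Om mu] by simp
 qed simp
next
 case True
 then have L: "0 <= L" and Hb: "0 <= Hb" and m0: "0 <= m" by auto
 let ?n = "real DIM('a)"
 have n3: "3 <= ?n" using n by simp
 have n2: "2 <= DIM('a)" using n by simp
 define CM where "CM = Cmu * 2 powr al"
 have CM: "0 < CM" using Cmu by (simp add: CM_def)
 have ga: "0 < ga" "ga <= be" "ga <= ?n / (?n - 2)" using n3 be by (auto simp: ga_def)
 have ex: "1/be <= 1/ga" "(?n - 2) / ?n <= 1/ga"
 proof -
  show "1/be <= 1/ga" using ga by (simp add: frac_le)
  have "1 / (?n / (?n - 2)) <= 1/ga" using ga by (intro frac_le) auto
  then show "(?n - 2) / ?n <= 1/ga" by simp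
 qed
 obtain c where c: "0 < c" and R: "rep_const TYPE('a) c" using representation[OF n] by blast
 obtain K2 where K2: "0 < K2" and J: "ring_const TYPE('a) K2" using ring_hitT_bound[OF n] by blast
 obtain B1 D1 where B1: "0 < B1" "0 < D1" and T1: "hit_tail_const TYPE('a) be al CM Hb m B1 D1"
  using hit_tail[OF n2 be al CM Hb] by blast
 obtain B2 D2 where B2: "0 < B2" "0 < D2" and T2: "pot_tail_const TYPE('a) al CM L B2 D2" using pot_tail[OF n al CM L] by blast
 \<comment> \<open>A bound for the gradient term valid for all \<open>s > n-1\<close> at once: the
   exponent \<open>1/(n-1) - 1/s\<close> of the boundary measure lies between 0 and
   \<open>1/(n-1)\<close>.\<close>
 define KJ where "KJ = K2 * max 1 Hb powr (1/(?n - 1))"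
 have KJ: "0 < KJ" using K2 by (simp add: KJ_def)
 define B where "B = c * (B1 + KJ + B2)"
 have B: "0 < B" using c B1 B2 KJ by (simp add: B_def)
 have D: "0 <= D1 + D2" using B1 B2 by simp
 obtain La where La: "0 < La" and X: "exp_const TYPE('a) ga B (D1 + D2) m La"
  using exp_tail_integrable[OF ga(1) B D m0, where 'b='a] by blast
 show ?thesis unfolding exp_norm_const_def ga_def[symmetric]
 proof (intro exI[of _ La] conjI La allI impI)
  fix s and Om :: "'a set" and mu and u :: "'a => real" and Hs and N1 N2 N3 :: real
  assume s: "?n - 1 < s" and ad: "admissible_domain Om" and mu: "upper_ahlfors Om mu al Cmu"
   and eq: "measure lebesgue Om = L" "measure (bdry_meas Om) (frontier Om) = Hb" "measure mu Om = m"
   and u: "Cb_closure Om u" and w: "weak_hessian Om u Hs"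
   and N1: "lp_norm (lebesgue_on Om) (?n / 2) (hess_norm Hs) < ennreal N1"
   and N2: "V1_norm (bdry_meas Om) (lp_norm (bdry_meas Om) s) u < ennreal N2"
   and N3: "expL_norm (bdry_meas Om) be u < ennreal N3"
  note af = admissible_facts[OF ad]
  have ps: "0 < ?n / 2" "0 < s" "0 < al" using s n3 al by auto
  obtain v h g where rp: "represents c Om u (?n / 2) s N1 N2 v h g"
   using R[unfolded rep_const_def, rule_format, OF ad u w ps(1,2) N1 N2] by blast
  note v = representsD(1-3)[OF rp] and h = representsD(4-7)[OF rp] and g = representsD(8-10)[OF rp]
   and pos = representsD(11,12)[OF rp]
  note v(1) [measurable]
  let ?av = "%z. \<bar>v z\<bar>"
  let ?H = "hmeas (?n - 1) (frontier Om)"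
  obtain l where l: "0 < l" "(\<integral>\<^sup>+z. ennreal (young_exp be (\<bar>u z\<bar> / l)) \<partial>bdry_meas Om) <= 1" "ennreal l < ennreal N3"
   using N3 by (auto simp: expL_norm_def orlicz_norm_def INF_less_iff)
  have lN: "l < N3" using l by (simp add: ennreal_less_iff)
  have "(\<integral>\<^sup>+z. ennreal (young_exp be (\<bar>v z\<bar> / l)) \<partial>?H) = (\<integral>\<^sup>+z. ennreal (young_exp be (\<bar>u z\<bar> / l)) \<partial>bdry_meas Om)"
  proof (rule nn_integral_hmeas_eq)
   show "(%z. ennreal (young_exp be (\<bar>v z\<bar> / l))) \<in> bmb" unfolding young_exp_def by measurable
  qed (use v(3) in \<open>auto simp: frontier_def\<close>)
  then have y: "(\<integral>\<^sup>+z. ennreal (young_exp be (\<bar>v z\<bar> / l)) \<partial>?H) <= 1" using l(2) by simp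
  define M where "M = distr mu borel (%x. x)"
  note M = upper_ahlfors_distr[OF af(1) mu ps(3) Cmu, folded M_def CM_def]
  define S where "S = 1 * N1 + 1 * N2 + 1 * N3"
  have S: "0 < S" "l <= S" "N1 <= S" "N2 <= S" using pos l lN by (auto simp: S_def)
  have Mm: "measure M UNIV = m" using M(3) eq(3) by simp
  have mav: "?av \<in> bmb" by measurable
  have mT: "hitT Om (%z. ennreal \<bar>v z\<bar>) \<in> bmb" by (rule hitT_measurable[OF af(1)]) measurable
  have mP: "pot (?n - 2) h \<in> bmb" by (rule pot_measurable[OF h(1)])
  have mO: "Om \<in> sets borel" using af(1) by simp
  have sM: "sets M = sets borel" "space M = UNIV" using ahlforsD(1,2)[OF M(1)] by auto
  have "(\<integral>\<^sup>+x. ennreal (young_exp ga (?av x / S / La)) \<partial>M) <= 1"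
  proof (rule X[unfolded exp_const_def, rule_format, where w = "%x. ?av x / S"])
   show "finite_measure M" by (rule M(2))
   show "measure M (space M) = m" using Mm sM by simp
   show "(%x. ?av x / S) \<in> borel_measurable M" by (rule ahlfors_measurable[OF M(1)]) measurable
   show "0 <= ?av x / S" for x using S by simp
   fix k :: nat assume k: "1 <= k"
   let ?A1 = "{x. x \<in> Om & ennreal (B1 * real k powr (1/be) * l) < hitT Om (%z. ennreal \<bar>v z\<bar>) x}"
   let ?A2 = "{x. ennreal (B2 * real k powr ((?n - 2) / ?n) * N1) < pot (?n - 2) h x}"
   have A1: "emeasure M ?A1 <= ennreal (D1 * (1/2)^k)"
    by (rule T1[unfolded hit_tail_const_def, rule_format, OF M(1,2) af(1,3) _ Mm mav _ l(1) y k]) (use af(4) eq in auto)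
   have A2: "emeasure M ?A2 <= ennreal (D2 * (1/2)^k)"
    by (rule T2[unfolded pot_tail_const_def, rule_format, OF M(1,2) af(1,2) _ h(1) _ _ pos(1) h(4) k]) (use af(5) eq h in auto)
   have "{x \<in> space borel. ennreal (B1 * real k powr (1/be) * l) < hitT Om (%z. ennreal \<bar>v z\<bar>) x} \<in> sets borel" using mT by measurable
   then have "Om \<inter> {x. ennreal (B1 * real k powr (1/be) * l) < hitT Om (%z. ennreal \<bar>v z\<bar>) x} \<in> sets borel"
    unfolding space_borel by (intro sets.Int mO) (simp only: UNIV_I simp_thms)
   moreover have "?A1 = Om \<inter> {x. ennreal (B1 * real k powr (1/be) * l) < hitT Om (%z. ennreal \<bar>v z\<bar>) x}"
    by (rule set_eqI) (simp only: mem_Collect_eq Int_iff)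
   ultimately have s1: "?A1 \<in> sets M" by (simp only: sM)
   have "{x \<in> space borel. ennreal (B2 * real k powr ((?n - 2) / ?n) * N1) < pot (?n - 2) h x} \<in> sets borel" using mP by measurable
   then have s2: "?A2 \<in> sets M" by (simp only: sM space_borel UNIV_I simp_thms)
   have s3: "- Om \<in> sets M" using borel_open[OF af(1)] unfolding sM by (rule borel_comp)
   have k1: "1 <= real k" using k by simp
   have bound: "?av x / S <= B * real k powr (1/ga)" if x: "x \<in> Om" "x \<notin> ?A1" "x \<notin> ?A2" for x
   proof -
    let ?k = "real k powr (1/ga)"
    have kk: "1 <= ?k" "real k powr (1/be) <= ?k" "real k powr ((?n - 2) / ?n) <= ?k"
    proof -
     have "0 <= 1/ga" using ga(1) by simp
     then show "1 <= ?k" using k1 by (intro ge_one_powr_ge_zero)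
    qed (rule powr_mono[OF ex(1) k1], rule powr_mono[OF ex(2) k1])
    have t: "hitT Om (%z. ennreal \<bar>v z\<bar>) x <= ennreal (B1 * real k powr (1/be) * l)" "pot (?n - 2) h x <= ennreal (B2 * real k powr ((?n - 2) / ?n) * N1)"
    proof -
     show "hitT Om (%z. ennreal \<bar>v z\<bar>) x <= ennreal (B1 * real k powr (1/be) * l)"
      using x(1,2) unfolding mem_Collect_eq not_less[symmetric] by blast
     show "pot (?n - 2) h x <= ennreal (B2 * real k powr ((?n - 2) / ?n) * N1)"
      using x(3) unfolding mem_Collect_eq not_less .
    qed
    have j: "ring (inner_part Om i) (hitT Om (%z. ennreal (g z))) x <= ennreal (KJ * N2)" for i
    proof -
     have "ring (inner_part Om i) (hitT Om (%z. ennreal (g z))) x <= ennreal (K2 * (measure ?H UNIV powr (1/(?n - 1) - 1/s) * N2))"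
      by (rule J[unfolded ring_const_def, rule_format, OF af(1,2,3) s g(1) _ pos(2) g(3)]) (use g in auto)
     also have "... <= ennreal (KJ * N2)"
     proof (rule ennreal_leI)
      have e: "0 <= 1/(?n - 1) - 1/s" "1/(?n - 1) - 1/s <= 1/(?n - 1)"
       using frac_le[of 1 1 "?n - 1" s] s n3 by auto
      have "Hb powr (1/(?n - 1) - 1/s) <= max 1 Hb powr (1/(?n - 1) - 1/s)" using e Hb by (intro powr_mono2) auto
      also have "... <= max 1 Hb powr (1/(?n - 1))" using e by (intro powr_mono) auto
      finally have "K2 * (Hb powr (1/(?n - 1) - 1/s) * N2) <= K2 * (max 1 Hb powr (1/(?n - 1)) * N2)"
       using K2 pos by (intro mult_left_mono mult_right_mono) auto
      then show "K2 * (measure ?H UNIV powr (1/(?n - 1) - 1/s) * N2) <= KJ * N2" using af(4) eq by (simp add: KJ_def mult.assoc)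
     qed
     finally show ?thesis .
    qed
    have "ennreal \<bar>v x\<bar> <= ennreal c * (hitT Om (%z. ennreal \<bar>v z\<bar>) x + ennreal (KJ * N2) + pot (?n - 2) h x)"
     by (rule representsD(13)[OF rp x(1)]) (rule j)
    also have "... <= ennreal c * (ennreal (B1 * real k powr (1/be) * l) + ennreal (KJ * N2) + ennreal (B2 * real k powr ((?n - 2) / ?n) * N1))"
     by (intro mult_left_mono add_mono t order_refl) simp
    also have "... = ennreal (c * (B1 * real k powr (1/be) * l + KJ * N2 + B2 * real k powr ((?n - 2) / ?n) * N1))"
     using c B1 B2 KJ pos l by (simp add: ennreal_mult')
    finally have "\<bar>v x\<bar> <= c * (B1 * real k powr (1/be) * l + KJ * N2 + B2 * real k powr ((?n - 2) / ?n) * N1)"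
     using c B1 B2 KJ pos l by (subst (asm) ennreal_le_iff) auto
    also have "... <= c * (B1 * ?k * S + KJ * ?k * S + B2 * ?k * S)"
    proof (intro mult_left_mono add_mono)
     show "B1 * real k powr (1/be) * l <= B1 * ?k * S" using B1 kk S l by (intro mult_mono) auto
     have "1 * N2 <= ?k * S" using kk S pos by (intro mult_mono) auto
     then have "KJ * (1 * N2) <= KJ * (?k * S)" using KJ by (intro mult_left_mono) auto
     then show "KJ * N2 <= KJ * ?k * S" by (simp add: mult.assoc)
     show "B2 * real k powr ((?n - 2) / ?n) * N1 <= B2 * ?k * S" using B2 kk S pos by (intro mult_mono) auto
    qed (use c in simp)
    also have "... = (B * ?k) * S" by (simp add: B_def algebra_simps)
    finally show ?thesis using S by (simp add: pos_divide_le_eq)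
   qed
   have null: "emeasure M (- Om) = 0"
    by (rule AE_iff_measurable[THEN iffD1, OF s3 _ M(4)]) (use sM(2) in blast)
   have "{x \<in> space M. B * real k powr (1/ga) < ?av x / S} \<subseteq> ?A1 \<union> ?A2 \<union> - Om"
   proof (rule subsetI)
    fix x assume "x \<in> {x \<in> space M. B * real k powr (1/ga) < ?av x / S}"
    then have "\<not> ?av x / S <= B * real k powr (1/ga)" unfolding not_le by blast
    then show "x \<in> ?A1 \<union> ?A2 \<union> - Om" using bound[of x] by blast
   qed
   then have "emeasure M {x \<in> space M. B * real k powr (1/ga) < ?av x / S} <= emeasure M (?A1 \<union> ?A2 \<union> - Om)"
    by (intro emeasure_mono sets.Un s1 s2 s3)
   also have "... <= emeasure M (?A1 \<union> ?A2) + emeasure M (- Om)"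
    by (intro emeasure_subadditive sets.Un s1 s2 s3)
   also have "... <= emeasure M ?A1 + emeasure M ?A2" unfolding null add_0_right by (rule emeasure_subadditive[OF s1 s2])
   also have "... <= ennreal (D1 * (1/2)^k) + ennreal (D2 * (1/2)^k)" by (intro add_mono A1 A2)
   also have "... = ennreal ((D1 + D2) * (1/2)^k)" using B1 B2 by (simp add: distrib_right)
   finally show "emeasure M {x \<in> space M. B * real k powr (1/ga) < ?av x / S} <= ennreal ((D1 + D2) * (1/2)^k)" .
  qed
  moreover have "(\<integral>\<^sup>+x. ennreal (young_exp ga (?av x / S / La)) \<partial>M) = (\<integral>\<^sup>+x. ennreal (young_exp ga (\<bar>u x\<bar> / (La * S))) \<partial>mu)"
  proof (rule M(5))
   show "(%x. ennreal (young_exp ga (?av x / S / La))) \<in> bmb" unfolding young_exp_def by measurable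
   fix x assume "x \<in> Om"
   then have "v x = u x" using v(3) closure_subset[of Om] by auto
   then show "ennreal (young_exp ga (?av x / S / La)) = ennreal (young_exp ga (\<bar>u x\<bar> / (La * S)))" by (simp add: mult.commute)
  qed
  ultimately have "La * S \<in> {l. 0 < l & (\<integral>\<^sup>+x. ennreal (young_exp ga (\<bar>u x\<bar> / l)) \<partial>mu) <= 1}"
   using La S by simp
  then show "expL_norm mu ga u <= ennreal (La * (1 * N1 + 1 * N2 + 1 * N3))"
   unfolding expL_norm_def orlicz_norm_def S_def by (rule INF_lower)
 qed
qed
qed

section \<open>From strict bounds to the norms of the statement\<close>

lemma norm_limit:
 fixes X n1 n2 n3 :: ennreal and C a b d :: real
 assumes le: "!!N1 N2 N3. n1 < ennreal N1 ==> n2 < ennreal N2 ==> n3 < ennreal N3 ==> X <= ennreal (C * (a * N1 + b * N2 + d * N3))"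
  and fin: "n1 < \<infinity>" "n2 < \<infinity>" "n3 < \<infinity> \<or> 0 < d" and pos: "0 <= a" "0 <= b" "0 <= d" "0 < C"
 shows "X <= ennreal C * (ennreal a * n1 + ennreal b * n2 + ennreal d * n3)"
proof (cases "n3 < \<infinity>")
 case True
 obtain r1 r2 r3 where r: "n1 = ennreal r1" "n2 = ennreal r2" "n3 = ennreal r3" "0 <= r1" "0 <= r2" "0 <= r3"
  using fin(1,2) True by (cases n1; cases n2; cases n3) auto
 let ?e = "%k. 1 / real (Suc k)"
 have "(%k. ennreal (C * (a * (r1 + ?e k) + b * (r2 + ?e k) + d * (r3 + ?e k)))) \<longlonglongrightarrow> ennreal (C * (a * (r1 + 0) + b * (r2 + 0) + d * (r3 + 0)))"
  by (intro tendsto_ennrealI tendsto_mult tendsto_add tendsto_const LIMSEQ_Suc[OF lim_1_over_n])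
 moreover have "X <= ennreal (C * (a * (r1 + ?e k) + b * (r2 + ?e k) + d * (r3 + ?e k)))" for k
  unfolding r by (rule le) (use r in \<open>auto simp: ennreal_less_iff\<close>)
 ultimately have "X <= ennreal (C * (a * (r1 + 0) + b * (r2 + 0) + d * (r3 + 0)))"
  by (intro LIMSEQ_le_const) auto
 also have "... = ennreal C * (ennreal a * n1 + ennreal b * n2 + ennreal d * n3)"
  using r pos by (simp add: ennreal_mult')
 finally show ?thesis .
next
 \<comment> \<open>When the third norm is infinite its weight is positive, and the right side is
   infinite as well.\<close>
 case False
 then have "n3 = \<infinity>" by (simp add: less_top[symmetric])
 moreover have "0 < d" using False fin(3) by blast
 ultimately have "ennreal C * (ennreal a * n1 + ennreal b * n2 + ennreal d * n3) = \<infinity>"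
  using pos by (simp add: ennreal_mult_top)
 then show ?thesis by simp
qed

text \<open>The origin of the maxima in (i): the estimate proved in \<open>part_lp\<close> carries
  powers of the total mass alone, and a nonnegative exponent permits the passage to the
  maximum.\<close>

lemma powr_le_max_powr:
 fixes m t L e e' :: real
 assumes "0 <= e'" "t * e' = e"
 shows "m powr e <= max (m powr t) L powr e'"
proof -
 have "m powr e = (m powr t) powr e'" by (simp add: powr_powr assms(2))
 also have "... <= max (m powr t) L powr e'" using assms(1) by (intro powr_mono2) auto
 finally show ?thesis .
qed

text \<open>In (i) the weight of this norm is 0 when \<open>mu\<close> has total mass 0, so
  \<open>norm_limit\<close> requires the norm to be finite. It is, because \<open>u\<close> is
  bounded and the boundary has finite measure.\<close>

lemma lp_norm_bdry_finite:
 fixes Om :: "'a::euclidean_space set"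
 assumes ad: "admissible_domain Om" and u: "Cb_closure Om u" and r: "0 < r"
 shows "lp_norm (bdry_meas Om) r u < \<infinity>"
proof -
 obtain B where B: "0 < B" "!!z. z \<in> closure Om ==> \<bar>u z\<bar> <= B" using Cb_closure_bounded[OF u] by metis
 have "(\<integral>\<^sup>+x. ennreal (\<bar>u x\<bar> powr r) \<partial>bdry_meas Om) <= (\<integral>\<^sup>+x. ennreal (B powr r) \<partial>bdry_meas Om)"
 proof (intro nn_integral_mono ennreal_leI powr_mono2)
  fix x assume "x \<in> space (bdry_meas Om)"
  then have "x \<in> closure Om" by (simp add: frontier_def)
  then show "\<bar>u x\<bar> <= B" by (rule B(2))
 qed (use r in auto)
 also have "... = ennreal (B powr r) * emeasure (bdry_meas Om) (frontier Om)" by simp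
 also have "... < \<infinity>" using ad by (auto simp: admissible_domain_def ennreal_mult_less_top)
 finally show ?thesis by (auto simp: lp_norm_def Let_def)
qed

text \<open>The exponents in (i) are \<open>a/d\<close> times the differences
  \<open>1/q - 1/t\<close> to the target exponents \<open>t\<close> of the summands, and are
  nonnegative because \<open>q <= t\<close>.\<close>

lemma exponent_gap:
 fixes a d q t x :: real
 assumes "0 < a" "0 < d" "0 < q" "q <= t" and x: "x = a / (t * d)"
 shows "0 <= a / (q * d) - x" "d / a * (a / (q * d) - x) = 1/q - 1/t"
proof -
 have "1/t <= 1/q" using assms by (intro frac_le) auto
 then have "a / d * (1/t) <= a / d * (1/q)" using assms by (intro mult_left_mono) auto
 then show "0 <= a / (q * d) - x" unfolding x by (simp add: mult.commute)
 show "d / a * (a / (q * d) - x) = 1/q - 1/t" unfolding x right_diff_distrib using assms by simp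
qed

theorem theorem4p1:
  assumes dim: "DIM('a::euclidean_space) \<ge> 3"
  shows
  "(\<forall>\<alpha> C\<mu>. real DIM('a) - 1 < \<alpha> \<and> \<alpha> \<le> real DIM('a) \<and> C\<mu> > 0 \<longrightarrow>
     \<comment> \<open>(i)\<close>
     (\<forall>p s r. 1 < p \<and> p < real DIM('a) / 2 \<and> 1 < s \<and> s < real DIM('a) - 1 \<and> 1 < r \<longrightarrow>
        (let n = real DIM('a);
             q = min (min (p * \<alpha> / (n - 2 * p)) (s * \<alpha> / (n - 1 - s))) (r * \<alpha> / (n - 1))
         in \<exists>C. \<forall>(\<Omega>::'a set) \<mu> u Hs.
           admissible_domain \<Omega> \<and> upper_ahlfors \<Omega> \<mu> \<alpha> C\<mu> \<and>
           weak_hessian \<Omega> u Hs \<and> lp_norm (lebesgue_on \<Omega>) p (hess_norm Hs) < \<infinity> \<and>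
           V1_norm (bdry_meas \<Omega>) (lp_norm (bdry_meas \<Omega>) s) u < \<infinity> \<and>
           Cb_closure \<Omega> u \<longrightarrow>
           lp_norm \<mu> q u \<le>
             ennreal C *
             (ennreal (max (measure \<mu> \<Omega> powr (n / \<alpha>)) (measure lebesgue \<Omega>)
                  powr (\<alpha> / (q * n) - (n - 2 * p) / (p * n)))
                * lp_norm (lebesgue_on \<Omega>) p (hess_norm Hs)
              + ennreal (max (measure \<mu> \<Omega> powr ((n - 1) / \<alpha>)) (measure (bdry_meas \<Omega>) (frontier \<Omega>))
                  powr (\<alpha> / (q * (n - 1)) - (n - 1 - s) / (s * (n - 1))))
                * V1_norm (bdry_meas \<Omega>) (lp_norm (bdry_meas \<Omega>) s) u
              + ennreal (max (measure \<mu> \<Omega> powr ((n - 1) / \<alpha>)) (measure (bdry_meas \<Omega>) (frontier \<Omega>))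
                  powr (\<alpha> / (q * (n - 1)) - 1 / r))
                * lp_norm (bdry_meas \<Omega>) r u))) \<and>
     \<comment> \<open>(ii)\<close>
     (\<forall>\<beta> L Hb m. \<beta> > 0 \<longrightarrow>
        (let n = real DIM('a); \<gamma> = min (n / (n - 2)) \<beta>
         in \<exists>C. \<forall>s (\<Omega>::'a set) \<mu> u Hs.
           s > n - 1 \<and>
           admissible_domain \<Omega> \<and> upper_ahlfors \<Omega> \<mu> \<alpha> C\<mu> \<and>
           measure lebesgue \<Omega> = L \<and> measure (bdry_meas \<Omega>) (frontier \<Omega>) = Hb \<and> measure \<mu> \<Omega> = m \<and>
           weak_hessian \<Omega> u Hs \<and> lp_norm (lebesgue_on \<Omega>) (n / 2) (hess_norm Hs) < \<infinity> \<and>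
           V1_norm (bdry_meas \<Omega>) (lp_norm (bdry_meas \<Omega>) s) u < \<infinity> \<and>
           Cb_closure \<Omega> u \<longrightarrow>
           expL_norm \<mu> \<gamma> u \<le>
             ennreal C *
             (lp_norm (lebesgue_on \<Omega>) (n / 2) (hess_norm Hs)
              + V1_norm (bdry_meas \<Omega>) (lp_norm (bdry_meas \<Omega>) s) u
              + expL_norm (bdry_meas \<Omega>) \<beta> u))))
   \<and>
   \<comment> \<open>(iii)\<close>
   (\<forall>p s. p > real DIM('a) / 2 \<and> s > real DIM('a) - 1 \<longrightarrow>
      (let n = real DIM('a)
       in \<exists>C. \<forall>(\<Omega>::'a set) u Hs.
         admissible_domain \<Omega> \<and>
         weak_hessian \<Omega> u Hs \<and> lp_norm (lebesgue_on \<Omega>) p (hess_norm Hs) < \<infinity> \<and>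
         V1_norm (bdry_meas \<Omega>) (lp_norm (bdry_meas \<Omega>) s) u < \<infinity> \<and>
         Cb_closure \<Omega> u \<longrightarrow>
         linf_norm (lebesgue_on \<Omega>) u \<le>
           ennreal C *
           (ennreal (measure lebesgue \<Omega> powr (2 / n - 1 / p)) * lp_norm (lebesgue_on \<Omega>) p (hess_norm Hs)
            + ennreal (measure (bdry_meas \<Omega>) (frontier \<Omega>) powr (1 / (n - 1) - 1 / s))
              * V1_norm (bdry_meas \<Omega>) (lp_norm (bdry_meas \<Omega>) s) u
            + linf_norm (bdry_meas \<Omega>) u)))"
proof (intro conjI allI impI, unfold Let_def, goal_cases)
 case (1 al Cmu p s r)
 let ?n = "real DIM('a)"
 define q where "q = min (min (p * al / (?n - 2 * p)) (s * al / (?n - 1 - s))) (r * al / (?n - 1))"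
 have n: "3 <= ?n" using dim by simp
 have h: "?n - 1 < al" "0 < Cmu" "1 < p" "p < ?n / 2" "1 < s" "s < ?n - 1" "1 < r" using 1 by auto
 have a0: "0 < al" using h n by linarith
 have q: "0 < q" "q <= p * al / (?n - 2 * p)" "q <= s * al / (?n - 1 - s)" "q <= r * al / (?n - 1)"
  using h a0 n by (auto simp: q_def)
 obtain C where C: "0 < C" and P: "lp_const TYPE('a) al Cmu p s r q C" using part_lp[OF dim h q] by blast
 have nz: "0 < ?n" "0 < ?n - 1" using n by auto
 \<comment> \<open>Each subtracted exponent equals the leading one with \<open>q\<close> replaced by
   the target exponent of its summand.\<close>
 have "(?n - 2 * p) / (p * ?n) = al / ((p * al / (?n - 2 * p)) * ?n)" "(?n - 1 - s) / (s * (?n - 1)) = al / ((s * al / (?n - 1 - s)) * (?n - 1))"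
  "1 / r = al / ((r * al / (?n - 1)) * (?n - 1))"
  using a0 h nz by simp_all
 note e = exponent_gap[OF a0 nz(1) q(1,2) this(1)] exponent_gap[OF a0 nz(2) q(1,3) this(2)] exponent_gap[OF a0 nz(2) q(1,4) this(3)]
 show ?case unfolding q_def[symmetric]
 proof (rule exI[of _ C], intro allI impI, elim conjE, goal_cases)
  case (1 Om mu u Hs)
  have rf: "lp_norm (bdry_meas Om) r u < \<infinity>" by (rule lp_norm_bdry_finite) (use 1 h in auto)
  have "lp_norm mu q u <= ennreal C * (ennreal (measure mu Om powr (1/q - 1/(p * al / (?n - 2 * p)))) * lp_norm (lebesgue_on Om) p (hess_norm Hs)
   + ennreal (measure mu Om powr (1/q - 1/(s * al / (?n - 1 - s)))) * V1_norm (bdry_meas Om) (lp_norm (bdry_meas Om) s) u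
   + ennreal (measure mu Om powr (1/q - 1/(r * al / (?n - 1)))) * lp_norm (bdry_meas Om) r u)"
  proof (rule norm_limit)
   fix N1 N2 N3
   assume N: "lp_norm (lebesgue_on Om) p (hess_norm Hs) < ennreal N1"
    "V1_norm (bdry_meas Om) (lp_norm (bdry_meas Om) s) u < ennreal N2" "lp_norm (bdry_meas Om) r u < ennreal N3"
   show "lp_norm mu q u <= ennreal (C * (measure mu Om powr (1/q - 1/(p * al / (?n - 2 * p))) * N1
    + measure mu Om powr (1/q - 1/(s * al / (?n - 1 - s))) * N2 + measure mu Om powr (1/q - 1/(r * al / (?n - 1))) * N3))"
    by (rule P[unfolded lp_const_def, rule_format, OF 1(1,2,6,3) N])
  qed (use 1 C rf in simp_all)
  then show ?case
   by (rule order.trans) (intro mult_left_mono add_mono mult_right_mono ennreal_leI powr_le_max_powr e zero_le order_refl)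
 qed
next
 case (2 al Cmu be L Hb m)
 let ?n = "real DIM('a)"
 have h: "?n - 1 < al" "0 < Cmu" "0 < be" using 2 by auto
 obtain C where C: "0 < C" and P: "exp_norm_const TYPE('a) al Cmu be L Hb m C" using part_exp[OF dim h] by blast
 show ?case
 proof (rule exI[of _ C], intro allI impI, elim conjE, goal_cases)
  case (1 s Om mu u Hs)
  have "expL_norm mu (min (?n / (?n - 2)) be) u <= ennreal C * (ennreal 1 * lp_norm (lebesgue_on Om) (?n / 2) (hess_norm Hs)
   + ennreal 1 * V1_norm (bdry_meas Om) (lp_norm (bdry_meas Om) s) u + ennreal 1 * expL_norm (bdry_meas Om) be u)"
  proof (rule norm_limit)
   fix N1 N2 N3
   assume N: "lp_norm (lebesgue_on Om) (?n / 2) (hess_norm Hs) < ennreal N1"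
    "V1_norm (bdry_meas Om) (lp_norm (bdry_meas Om) s) u < ennreal N2" "expL_norm (bdry_meas Om) be u < ennreal N3"
   show "expL_norm mu (min (?n / (?n - 2)) be) u <= ennreal (C * (1 * N1 + 1 * N2 + 1 * N3))"
    by (rule P[unfolded exp_norm_const_def, rule_format, OF 1(1-6) 1(10) 1(7) N])
  qed (use 1 C in simp_all)
  then show ?case by simp
 qed
next
 case (3 p s)
 let ?n = "real DIM('a)"
 have h: "?n / 2 < p" "?n - 1 < s" using 3 by auto
 obtain C where C: "0 < C" and P: "sup_const TYPE('a) p s C" using part_sup[OF dim h] by blast
 show ?case
 proof (rule exI[of _ C], intro allI impI, elim conjE, goal_cases)
  case (1 Om u Hs)
  have "linf_norm (lebesgue_on Om) u <= ennreal C * (ennreal (measure lebesgue Om powr (2 / ?n - 1 / p)) * lp_norm (lebesgue_on Om) p (hess_norm Hs)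
   + ennreal (measure (bdry_meas Om) (frontier Om) powr (1 / (?n - 1) - 1 / s)) * V1_norm (bdry_meas Om) (lp_norm (bdry_meas Om) s) u
   + ennreal 1 * linf_norm (bdry_meas Om) u)"
  proof (rule norm_limit)
   fix N1 N2 N3
   assume N: "lp_norm (lebesgue_on Om) p (hess_norm Hs) < ennreal N1"
    "V1_norm (bdry_meas Om) (lp_norm (bdry_meas Om) s) u < ennreal N2" "linf_norm (bdry_meas Om) u < ennreal N3"
   show "linf_norm (lebesgue_on Om) u <= ennreal (C * (measure lebesgue Om powr (2 / ?n - 1 / p) * N1
    + measure (bdry_meas Om) (frontier Om) powr (1 / (?n - 1) - 1 / s) * N2 + 1 * N3))"
    by (rule P[unfolded sup_const_def, rule_format, OF 1(1) 1(5) 1(2) N])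
  qed (use 1 C in simp_all)
  then show ?case by simp
 qed
qed

end
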